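(* For any fixed $h>0$, the set $$\{f\in\mathcal{C}^\infty(I,I):\ f\text{ admits an SRB measure }\mu\text{ with }h_f(\mu)\ge h\}$$ is closed in $\mathcal{C}^\infty(I,I)$.
   Context: $I$ denotes the interval $[0,1]$ or the circle $\mathbb{S}^1$, and $\mathcal{C}^\infty(I,I)$ is the space of $\mathcal{C}^\infty$ maps $I\to I$ with the $\mathcal{C}^\infty$ topology. For $f\in\mathcal{C}^\infty(I,I)$, $\lambda_f(x):=\limsup_{n\to\infty}\frac1n\sum_{i=0}^{n-1}\log|f'(f^ix)|$; an $f$-invariant Borel probability measure $\nu$ is hyperbolic if $\lambda_f(x)>0$ for $\nu$-a.e. $x$. An SRB measure of $f$ is a hyperbolic $f$-invariant Borel probability measure which is absolutely continuous with respect to Lebesgue measure on $I$. $h_f(\mu)$ denotes metric entropy. *)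

theory Defs
  imports "HOL-Probability.Probability"
begin

(* The two spaces called I, the interval and the circle, are handled together.  Each is a set
   of points with a unit-speed parametrisation defined on the real set pdom.  Calculus on the
   space is calculus on pdom; leb is the Lebesgue measure on the space. *)

record 'a one_dim =
  points :: "'a set"
  pdom :: "real set"
  param :: "real \<Rightarrow> 'a"
  leb :: "'a measure"

definition unit_interval :: "real one_dim" where
  "unit_interval =
     \<lparr>points = {0..1}, pdom = {0..1}, param = (\<lambda>t. t), leb = restrict_space lborel {0..1}\<rparr>"

(* The circle is the unit circle of the complex plane.  It has total length 2 pi; none of the
   notions below depends on this normalisation. *)
definition circle :: "complex one_dim" where
  "circle =
     \<lparr>points = sphere 0 1, pdom = UNIV, param = cis,
      leb = distr (restrict_space lborel {0..<2 * pi}) (restrict_space borel (sphere 0 1)) cis\<rparr>"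

(* The k-th derivative of t |-> f (param t), as a function on pdom; derivatives are taken within
   pdom, hence are one-sided at the end points of the interval. *)
definition nth_deriv ::
    "nat \<Rightarrow> ('a::real_normed_vector) one_dim \<Rightarrow> ('a \<Rightarrow> 'a) \<Rightarrow> real \<Rightarrow> 'a" where
  "nth_deriv k I f =
     ((\<lambda>g t. vector_derivative g (at t within pdom I)) ^^ k) (\<lambda>t. f (param I t))"

(* For the circle this says that f is smooth as a map into the plane, which contains the circle as
   an embedded submanifold.  Maps are extensional, i.e. undefined off the space, so that equality
   of elements is equality of maps on the space. *)
definition smooth_maps :: "('a::real_normed_vector) one_dim \<Rightarrow> ('a \<Rightarrow> 'a) set" where
  "smooth_maps I =
     {f \<in> points I \<rightarrow>\<^sub>E points I.
        \<forall>k. \<forall>t\<in>pdom I. nth_deriv k I f differentiable (at t within pdom I)}"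

definition smooth_nbhd ::
    "('a::real_normed_vector) one_dim \<Rightarrow> nat \<Rightarrow> real \<Rightarrow> ('a \<Rightarrow> 'a) \<Rightarrow> ('a \<Rightarrow> 'a) set" where
  "smooth_nbhd I k e f =
     {g \<in> smooth_maps I. \<forall>j\<le>k. \<forall>t\<in>pdom I. dist (nth_deriv j I f t) (nth_deriv j I g t) < e}"

(* Uniform convergence of all derivatives. *)
definition smooth_topology :: "('a::real_normed_vector) one_dim \<Rightarrow> ('a \<Rightarrow> 'a) topology" where
  "smooth_topology I =
     topology (\<lambda>U. U \<subseteq> smooth_maps I \<and> (\<forall>f\<in>U. \<exists>k. \<exists>e>0. smooth_nbhd I k e f \<subseteq> U))"

lemma smooth_nbhd_mono:
  "k \<le> k' \<Longrightarrow> e' \<le> e \<Longrightarrow> smooth_nbhd I k' e' f \<subseteq> smooth_nbhd I k e f"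
  unfolding smooth_nbhd_def by (auto intro: less_le_trans le_trans)

lemma openin_smooth_topology:
  "openin (smooth_topology I) U \<longleftrightarrow>
     U \<subseteq> smooth_maps I \<and> (\<forall>f\<in>U. \<exists>k. \<exists>e>0. smooth_nbhd I k e f \<subseteq> U)"
proof -
  have "istopology (\<lambda>U. U \<subseteq> smooth_maps I \<and> (\<forall>f\<in>U. \<exists>k. \<exists>e>0. smooth_nbhd I k e f \<subseteq> U))"
    (is "istopology ?op")
    unfolding istopology_def
  proof (intro conjI allI impI)
    fix S T assume S: "?op S" and T: "?op T"
    show "S \<inter> T \<subseteq> smooth_maps I" using S by blast
    show "\<forall>f\<in>S \<inter> T. \<exists>k. \<exists>e>0. smooth_nbhd I k e f \<subseteq> S \<inter> T"
    proof
      fix f assume f: "f \<in> S \<inter> T"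
      obtain k e where 1: "e > 0" "smooth_nbhd I k e f \<subseteq> S" using S f by blast
      obtain l d where 2: "d > 0" "smooth_nbhd I l d f \<subseteq> T" using T f by blast
      have "smooth_nbhd I (max k l) (min e d) f \<subseteq> S \<inter> T"
        using smooth_nbhd_mono[of k "max k l" "min e d" e I f]
          smooth_nbhd_mono[of l "max k l" "min e d" d I f] 1 2 by auto
      moreover have "min e d > 0" using 1 2 by simp
      ultimately show "\<exists>k. \<exists>e>0. smooth_nbhd I k e f \<subseteq> S \<inter> T" by blast
    qed
  next
    fix \<K> assume K: "\<forall>K\<in>\<K>. ?op K"
    show "\<Union> \<K> \<subseteq> smooth_maps I" using K by blast
    show "\<forall>f\<in>\<Union> \<K>. \<exists>k. \<exists>e>0. smooth_nbhd I k e f \<subseteq> \<Union> \<K>"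
      using K by (meson Sup_upper UnionE subset_trans)
  qed
  then show ?thesis
    by (simp add: smooth_topology_def)
qed

lemma topspace_smooth_topology [simp]: "topspace (smooth_topology I) = smooth_maps I"
proof -
  have "openin (smooth_topology I) (smooth_maps I)"
    unfolding openin_smooth_topology by (auto simp: smooth_nbhd_def intro: exI[of _ "1::real"])
  then show ?thesis
    by (metis openin_smooth_topology openin_subset openin_topspace subset_antisym)
qed

(* The modulus of f' at x.  Any t with param t = x may be chosen: the parametrisation of the
   circle is periodic, see abs_deriv_circle. *)
definition abs_deriv :: "('a::real_normed_vector) one_dim \<Rightarrow> ('a \<Rightarrow> 'a) \<Rightarrow> 'a \<Rightarrow> real" where
  "abs_deriv I f x = norm (nth_deriv 1 I f (inv_into (pdom I) (param I) x))"

lemma abs_deriv_unit_interval: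
  "t \<in> {0..1} \<Longrightarrow> abs_deriv unit_interval f t = \<bar>vector_derivative f (at t within {0..1})\<bar>"
  by (simp add: abs_deriv_def nth_deriv_def unit_interval_def inv_into_f_eq)

lemma abs_deriv_circle:
  "abs_deriv circle f (cis t) = norm (vector_derivative (\<lambda>s. f (cis s)) (at t))"
proof -
  define g where "g = (\<lambda>s. f (cis s))"
  define u where "u = inv_into UNIV cis (cis t)"
  have "cis u = cis t"
    unfolding u_def by (rule f_inv_into_f) simp
  then have shift: "g (s + (u - t)) = g s" "g (s + (t - u)) = g s" for s
    by (simp_all add: g_def flip: cis_mult cis_divide)
  have trans: "(g has_vector_derivative D) (at a)"
    if D: "(g has_vector_derivative D) (at (a + c))" and c: "\<And>s. g (s + c) = g s" for a c D
  proof -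
    have "((\<lambda>s. s + c) has_vector_derivative 1) (at a)"
      by (auto intro!: derivative_eq_intros)
    from vector_diff_chain_at[OF this D] have "(g \<circ> (\<lambda>s. s + c) has_vector_derivative D) (at a)"
      by simp
    then show ?thesis by (simp add: comp_def c)
  qed
  have "(g has_vector_derivative D) (at u) \<longleftrightarrow> (g has_vector_derivative D) (at t)" for D
    using trans[where a = t and c = "u - t"] trans[where a = u and c = "t - u"] shift by auto
  then have "vector_derivative g (at u) = vector_derivative g (at t)"
    by (simp add: vector_derivative_def)
  then show ?thesis
    by (simp add: abs_deriv_def nth_deriv_def circle_def g_def u_def)
qed

(* Here log 0 is minus infinity, whereas ln 0 = 0 in the library. *)
definition log_ereal :: "real \<Rightarrow> ereal" where
  "log_ereal r = (if r > 0 then ereal (ln r) else - \<infinity>)"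

definition lyapunov :: "('a::real_normed_vector) one_dim \<Rightarrow> ('a \<Rightarrow> 'a) \<Rightarrow> 'a \<Rightarrow> ereal" where
  "lyapunov I f x =
     limsup (\<lambda>n. ereal (1 / real n) * (\<Sum>i<n. log_ereal (abs_deriv I f ((f ^^ i) x))))"

definition invariant_prob ::
    "('a::real_normed_vector) one_dim \<Rightarrow> ('a \<Rightarrow> 'a) \<Rightarrow> 'a measure \<Rightarrow> bool" where
  "invariant_prob I f \<mu> \<longleftrightarrow>
     prob_space \<mu> \<and> sets \<mu> = sets (restrict_space borel (points I)) \<and>
     f \<in> measurable \<mu> \<mu> \<and> distr \<mu> \<mu> f = \<mu>"

definition hyperbolic ::
    "('a::real_normed_vector) one_dim \<Rightarrow> ('a \<Rightarrow> 'a) \<Rightarrow> 'a measure \<Rightarrow> bool" where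
  "hyperbolic I f \<mu> \<longleftrightarrow> (AE x in \<mu>. lyapunov I f x > 0)"

definition SRB ::
    "('a::real_normed_vector) one_dim \<Rightarrow> ('a \<Rightarrow> 'a) \<Rightarrow> 'a measure \<Rightarrow> bool" where
  "SRB I f \<mu> \<longleftrightarrow>
     invariant_prob I f \<mu> \<and> hyperbolic I f \<mu> \<and> absolutely_continuous (leb I) \<mu>"

definition measurable_partition :: "'a measure \<Rightarrow> 'a set set \<Rightarrow> bool" where
  "measurable_partition M P \<longleftrightarrow> finite P \<and> P \<subseteq> sets M \<and> partition_on (space M) P"

definition partition_entropy :: "'a measure \<Rightarrow> 'a set set \<Rightarrow> real" where
  "partition_entropy M P = - (\<Sum>A\<in>P. measure M A * ln (measure M A))"

(* The common refinement of the preimages of P under f^0, ..., f^(n-1). *)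
definition dyn_refinement :: "'a measure \<Rightarrow> ('a \<Rightarrow> 'a) \<Rightarrow> 'a set set \<Rightarrow> nat \<Rightarrow> 'a set set" where
  "dyn_refinement M f P n =
     (\<lambda>A. {x \<in> space M. \<forall>i<n. (f ^^ i) x \<in> A i}) ` ({..<n} \<rightarrow>\<^sub>E P) - {{}}"

(* Kolmogorov-Sinai entropy. *)
definition metric_entropy :: "'a measure \<Rightarrow> ('a \<Rightarrow> 'a) \<Rightarrow> ereal" where
  "metric_entropy M f =
     (SUP P \<in> {P. measurable_partition M P}.
        lim (\<lambda>n. ereal (partition_entropy M (dyn_refinement M f P n) / real n)))"

end

theory Submission

  imports Defs "HOL-Computational_Algebra.Fundamental_Theorem_Algebra"

begin

text \<open>
  Write \<open>J\<^sub>p = |(f\<^sup>p)'|\<close> and \<open>ln\<^sup>+ = ln \<circ> max 1\<close>. By Ruelle's inequality an invariant measure \<open>\<mu>\<close> of entropy at least \<open>h\<close>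
  satisfies \<open>h p \<le> \<integral> ln\<^sup>+ J\<^sub>p d\<mu> + const\<close>. Following Yomdin, the iterates of a short curve under \<open>g = f\<^sup>p\<close> are cut into
  pieces of bounded distortion; by high smoothness their number is, up to a factor \<open>exp (o(p))\<close> per step, accounted for
  by the derivative, unless the image of the piece is long, and the long images carry Lebesgue measure to a measure of
  bounded density. Hence for \<open>\<mu>\<close> absolutely continuous and \<open>\<kappa>\<close> continuous with values in \<open>[0, 1]\<close>,
  \<open>h p \<le> o(p) + C\<^sub>p \<integral> \<kappa> + \<integral> (1 - \<kappa>) ln\<^sup>+ J\<^sub>p d\<mu>\<close>, with constants that are uniform near \<open>f\<close>. This inequality passes to a weak
  limit \<open>\<mu>\<close> of measures of maps converging to \<open>f\<close>. When \<open>\<kappa>\<close> decreases to the indicator of a maximal Lebesgue null part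
  \<open>Z\<close> of \<open>\<mu>\<close>, it yields \<open>(h - \<delta>) p \<le> \<integral> ln\<^sup>+ J\<^sub>p d\<mu>\<close> over the complement of \<open>Z\<close> for all large \<open>p\<close>. So the restriction of \<open>\<mu>\<close> to the
  points outside \<open>Z\<close> with positive exponent is nonzero; normalised, it is an SRB measure, and its entropy is at least
  the growth rate of \<open>\<integral> ln\<^sup>+ J\<^sub>p\<close>, because the volume growth inside a dynamical ball is small, again by Yomdin's
  argument.
\<close>

section \<open>Derivatives of compositions\<close>

text \<open>A weak limit of absolutely continuous measures may have a singular part, and entropy
  could concentrate there. So the bound on the entropy is first brought into a form that is affine
  in the measure, and \<open>\<kappa>\<close> then localises it. Pieces accumulate at critical
  points and cannot be counted; they are weighed by (length)^(2/n), where n is the order of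
  smoothness in use. At each scale about 2^q of them have slope near 2^(-q n), and the exponent 2/n
  turns this slope into 4^(-q), so the sum over q converges. One step of \<open>g\<close> then costs
  a factor const(n) (sup |g'|)^(2/n). With |f'| \<le> exp \<Lambda> its logarithm is c(n) + (2/n) p
  \<Lambda>, which is small compared with p if n is fixed large before p grows. The constant C_p has
  no useful bound in p. It is removed at fixed p, by letting \<open>\<kappa>\<close> shrink to a
  compact null set; only afterwards does p grow. Logarithms of averages are handled by ln x \<le> x
  - 1, which replaces Jensen's inequality throughout. A lift to the parameter line makes all
  calculus that of real functions, also on the circle.\<close>

definition dseq :: "real set \<Rightarrow> (nat \<Rightarrow> real \<Rightarrow> 'a::real_normed_vector) \<Rightarrow> bool" where
  "dseq S d \<longleftrightarrow> (\<forall>k. \<forall>x\<in>S. (d k has_vector_derivative d (Suc k) x) (at x within S))"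

lemma dseqD: "dseq S d \<Longrightarrow> x \<in> S \<Longrightarrow> (d k has_vector_derivative d (Suc k) x) (at x within S)"
  by (simp add: dseq_def)

lemma dseq_real: "dseq S d \<Longrightarrow> x \<in> S \<Longrightarrow> (d k has_real_derivative d (Suc k) x) (at x within S)"
  by (simp add: dseq_def has_real_derivative_iff_has_vector_derivative)

lemma dseq_continuous: "dseq S d \<Longrightarrow> continuous_on S (d k)"
  by (auto simp: dseq_def intro!: continuous_on_vector_derivative)

lemma dseq_subset: "dseq S d \<Longrightarrow> T \<subseteq> S \<Longrightarrow> dseq T d"
  by (meson dseq_def has_vector_derivative_within_subset subsetD)

lemma dseq_shift: "dseq S d \<Longrightarrow> dseq S (\<lambda>k. d (k + m))"
  by (simp add: dseq_def)

text \<open>Pascal's rule. \<open>p\<close> and \<open>r\<close> are plain sequences, since only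
  values at one point enter the Leibniz formula.\<close>

lemma leibniz_sum:
  fixes p r :: "nat \<Rightarrow> 'a::comm_ring_1"
  shows "(\<Sum>i\<le>k. of_nat (k choose i) * (p (Suc i) * r (k - i) + p i * r (Suc (k - i))))
       = (\<Sum>i\<le>Suc k. of_nat (Suc k choose i) * (p i * r (Suc k - i)))"
proof -
  have "(\<Sum>i\<le>Suc k. of_nat (Suc k choose i) * (p i * r (Suc k - i)))
      = p 0 * r (Suc k) + (\<Sum>i\<le>k. of_nat (Suc k choose Suc i) * (p (Suc i) * r (k - i)))"
    by (subst sum.atMost_Suc_shift) simp
  also have "... = p 0 * r (Suc k) + (\<Sum>i\<le>k. of_nat (k choose Suc i) * (p (Suc i) * r (k - i)))
      + (\<Sum>i\<le>k. of_nat (k choose i) * (p (Suc i) * r (k - i)))"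
    by (simp add: sum.distrib algebra_simps)
  also have "p 0 * r (Suc k) + (\<Sum>i\<le>k. of_nat (k choose Suc i) * (p (Suc i) * r (k - i)))
      = (\<Sum>i\<le>Suc k. of_nat (k choose i) * (p i * r (Suc k - i)))"
    by (subst sum.atMost_Suc_shift) simp
  also have "... = (\<Sum>i\<le>k. of_nat (k choose i) * (p i * r (Suc k - i)))"
    by (simp add: binomial_eq_0)
  also have "... = (\<Sum>i\<le>k. of_nat (k choose i) * (p i * r (Suc (k - i))))"
    by (rule sum.cong) (auto simp: Suc_diff_le)
  finally show ?thesis by (simp add: sum.distrib algebra_simps)
qed

text \<open>The values lie in a normed field because the lift on the circle uses the rule for
  complex functions. Differentiability is asked only up to order k, so that an induction on the
  order can apply it.\<close>

lemma leibniz_deriv: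
  fixes p r :: "nat \<Rightarrow> real \<Rightarrow> 'a::real_normed_field"
  assumes "\<And>i. i \<le> k \<Longrightarrow> (p i has_vector_derivative p (Suc i) x) (at x within S)"
    and "\<And>i. i \<le> k \<Longrightarrow> (r i has_vector_derivative r (Suc i) x) (at x within S)"
  shows "((\<lambda>x. \<Sum>i\<le>k. of_nat (k choose i) * (p i x * r (k - i) x)) has_vector_derivative
     (\<Sum>i\<le>Suc k. of_nat (Suc k choose i) * (p i x * r (Suc k - i) x))) (at x within S)"
proof -
  have "((\<lambda>x. \<Sum>i\<le>k. of_nat (k choose i) * (p i x * r (k - i) x)) has_vector_derivative
     (\<Sum>i\<le>k. of_nat (k choose i) * (p i x * r (Suc (k - i)) x + p (Suc i) x * r (k - i) x))) (at x within S)"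
    by (intro has_vector_derivative_sum has_vector_derivative_mult_right has_vector_derivative_mult assms) auto
  then show ?thesis
    by (simp only: leibniz_sum[of k "\<lambda>i. p i x" "\<lambda>i. r i x", symmetric] add.commute)
qed

text \<open>The successive derivatives of a composition, obtained from \<open>(a \<circ> b)' = (a' \<circ> b) * b'\<close> and the Leibniz rule.\<close>

fun comp_seq :: "(nat \<Rightarrow> real \<Rightarrow> real) \<Rightarrow> (nat \<Rightarrow> real \<Rightarrow> real) \<Rightarrow> nat \<Rightarrow> real \<Rightarrow> real" where
  "comp_seq a b 0 x = a 0 (b 0 x)"
| "comp_seq a b (Suc k) x =
     (\<Sum>i\<le>k. real (k choose i) * (comp_seq (\<lambda>j. a (Suc j)) b i x * b (Suc (k - i)) x))"

lemma dseq_comp: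
  assumes a: "dseq T a" and b: "dseq S b" and ST: "b 0 ` S \<subseteq> T"
  shows "dseq S (comp_seq a b)"
proof -
  have "(comp_seq a b k has_vector_derivative comp_seq a b (Suc k) x) (at x within S)"
    if "x \<in> S" "dseq T a" for k a x
    using that
  proof (induction k arbitrary: a x rule: less_induct)
    case (less k)
    note D = dseqD[OF b less.prems(1)]
    show ?case
    proof (cases k)
      case 0
      have "(a 0 has_real_derivative a 1 (b 0 x)) (at (b 0 x) within b 0 ` S)"
        using dseq_real[OF less.prems(2), of "b 0 x" 0] ST less.prems(1)
        by (auto intro: has_field_derivative_subset)
      moreover have "(b 0 has_real_derivative b 1 x) (at x within S)"
        using dseq_real[OF b less.prems(1), of 0] by simp
      ultimately have "(a 0 \<circ> b 0 has_real_derivative a 1 (b 0 x) * b 1 x) (at x within S)"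
        by (rule DERIV_image_chain)
      then show ?thesis
        by (simp add: 0 comp_def has_real_derivative_iff_has_vector_derivative)
    next
      case (Suc m)
      let ?a = "\<lambda>j. a (Suc j)"
      have a': "dseq T ?a" using dseq_shift[OF less.prems(2), of 1] by simp
      \<comment> \<open>The induction is on the order, for all outer sequences at once, because the
        recursion passes from \<open>a\<close> to its shift.\<close>
      have "(comp_seq ?a b i has_vector_derivative comp_seq ?a b (Suc i) x) (at x within S)" if "i \<le> m" for i
        using less.IH[of i x ?a] that Suc less.prems(1) a' by simp
      from leibniz_deriv[where p = "comp_seq ?a b" and r = "\<lambda>i. b (Suc i)", OF this D]
      have "((\<lambda>x. \<Sum>i\<le>m. real (m choose i) * (comp_seq ?a b i x * b (Suc (m - i)) x)) has_vector_derivative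
        (\<Sum>i\<le>Suc m. real (Suc m choose i) * (comp_seq ?a b i x * b (Suc (Suc m - i)) x))) (at x within S)"
        by simp
      then show ?thesis
        unfolding Suc by (simp del: sum.atMost_Suc binomial_Suc_Suc)
    qed
  qed
  then show ?thesis using a by (simp add: dseq_def)
qed

text \<open>These are the Bell numbers. They count the terms of Faa di Bruno's formula, and in the
  scaling below every term has the same bound.\<close>

fun comp_const :: "nat \<Rightarrow> real" where
  "comp_const 0 = 1"
| "comp_const (Suc k) = (\<Sum>i\<le>k. real (k choose i) * comp_const i)"

lemma comp_const_nonneg: "comp_const k \<ge> 0"
  by (induction k rule: comp_const.induct) (auto intro!: sum_nonneg)

text \<open>On the scale \<open>d\<close>, an inner derivative of order at least 1 has size at most
  \<open>\<eta>\<close>, and \<open>\<eta>\<close> is the scale on which the outer function is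
  measured. Passing to the shift of \<open>a\<close> divides \<open>E\<close> by
  \<open>\<eta>\<close>; the remaining inner derivative gives this factor back.\<close>

lemma comp_seq_bound0:
  assumes "\<And>k. k \<le> r \<Longrightarrow> \<bar>a k (b 0 x)\<bar> * \<eta> ^ k \<le> E"
    and b: "\<And>k. 1 \<le> k \<Longrightarrow> k \<le> r \<Longrightarrow> \<bar>b k x\<bar> * d ^ k \<le> \<eta>"
    and "k \<le> r" and pos: "\<eta> > 0" "d > 0"
  shows "\<bar>comp_seq a b k x\<bar> * d ^ k \<le> comp_const k * E"
  using assms(1,2,3)
proof (induction k arbitrary: a E r rule: less_induct)
  case (less k)
  show ?case
  proof (cases k)
    case 0 then show ?thesis using less.prems(1)[of 0] by simp
  next
    case (Suc m)
    let ?a = "\<lambda>j. a (Suc j)"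
    have IH: "\<bar>comp_seq ?a b i x\<bar> * d ^ i \<le> comp_const i * (E / \<eta>)" if "i \<le> m" for i
    proof (rule less.IH)
      fix k' assume "k' \<le> m"
      then show "\<bar>a (Suc k') (b 0 x)\<bar> * \<eta> ^ k' \<le> E / \<eta>"
        using less.prems(1)[of "Suc k'"] pos Suc less.prems(3) by (simp add: field_simps)
    next
      show "\<bar>b k' x\<bar> * d ^ k' \<le> \<eta>" if "1 \<le> k'" "k' \<le> m" for k'
        using less.prems Suc that by auto
    qed (use Suc that in auto)
    have E: "E \<ge> 0" using less.prems(1)[of 0] by simp
    have "\<bar>comp_seq a b k x\<bar> * d ^ k
      \<le> (\<Sum>i\<le>m. real (m choose i) * (\<bar>comp_seq ?a b i x\<bar> * \<bar>b (Suc (m - i)) x\<bar>)) * d ^ k"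
      unfolding Suc using pos
      by (auto intro!: mult_right_mono order.trans[OF sum_abs] sum_mono simp: abs_mult)
    also have "... = (\<Sum>i\<le>m. real (m choose i) * ((\<bar>comp_seq ?a b i x\<bar> * d ^ i) * (\<bar>b (Suc (m - i)) x\<bar> * d ^ Suc (m - i))))"
      unfolding sum_distrib_right
    proof (rule sum.cong)
      fix i assume "i \<in> {..m}"
      then have "d ^ k = d ^ i * d ^ Suc (m - i)" unfolding Suc by (simp flip: power_add)
      then show "real (m choose i) * (\<bar>comp_seq ?a b i x\<bar> * \<bar>b (Suc (m - i)) x\<bar>) * d ^ k =
         real (m choose i) * ((\<bar>comp_seq ?a b i x\<bar> * d ^ i) * (\<bar>b (Suc (m - i)) x\<bar> * d ^ Suc (m - i)))"
        by simp
    qed simp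
    also have "... \<le> (\<Sum>i\<le>m. real (m choose i) * (comp_const i * (E / \<eta>) * \<eta>))"
      using pos E less.prems Suc
      by (intro sum_mono mult_left_mono mult_mono IH less.prems(2)) (auto simp: comp_const_nonneg)
    also have "... = comp_const k * E"
      unfolding Suc using pos by (simp add: sum_distrib_right mult.assoc)
    finally show ?thesis .
  qed
qed

text \<open>The bound is linear in the size \<open>\<beta>\<close> of the inner function; this is what makes the
  rescaled derivatives of the iterates grow no faster than the first one.\<close>

lemma comp_seq_bound:
  assumes a: "\<And>k. 1 \<le> k \<Longrightarrow> k \<le> r \<Longrightarrow> \<bar>a k (b 0 x)\<bar> * \<eta> ^ (k - 1) \<le> E"
    and b: "\<And>k. 1 \<le> k \<Longrightarrow> k \<le> r \<Longrightarrow> \<bar>b k x\<bar> * d ^ k \<le> \<beta>"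
    and \<beta>: "\<beta> \<le> \<eta>" "\<beta> \<ge> 0" and k: "1 \<le> k" "k \<le> r" and pos: "\<eta> > 0" "d > 0"
  shows "\<bar>comp_seq a b k x\<bar> * d ^ k \<le> comp_const k * E * \<beta>"
proof -
  obtain m where m: "k = Suc m" using k by (cases k) auto
  let ?a = "\<lambda>j. a (Suc j)"
  have E: "E \<ge> 0" using a[of 1] k by simp
  \<comment> \<open>Here the inner derivatives are bounded only by \<open>\<eta>\<close>. The linear
    factor \<open>\<beta>\<close> comes from the single inner derivative which the outermost
    expansion splits off.\<close>
  have IH: "\<bar>comp_seq ?a b i x\<bar> * d ^ i \<le> comp_const i * E" if "i \<le> m" for i
  proof (rule comp_seq_bound0[where r = "r - 1" and \<eta> = \<eta>])
    show "\<bar>a (Suc k') (b 0 x)\<bar> * \<eta> ^ k' \<le> E" if "k' \<le> r - 1" for k'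
      using a[of "Suc k'"] that k by simp
    show "\<bar>b k' x\<bar> * d ^ k' \<le> \<eta>" if "1 \<le> k'" "k' \<le> r - 1" for k'
      using order.trans[OF b[of k'] \<beta>(1)] that by simp
  qed (use that m k pos in auto)
  have "\<bar>comp_seq a b k x\<bar> * d ^ k
    \<le> (\<Sum>i\<le>m. real (m choose i) * (\<bar>comp_seq ?a b i x\<bar> * \<bar>b (Suc (m - i)) x\<bar>)) * d ^ k"
    unfolding m using pos
    by (auto intro!: mult_right_mono order.trans[OF sum_abs] sum_mono simp: abs_mult)
  also have "... = (\<Sum>i\<le>m. real (m choose i) * ((\<bar>comp_seq ?a b i x\<bar> * d ^ i) * (\<bar>b (Suc (m - i)) x\<bar> * d ^ Suc (m - i))))"
    unfolding sum_distrib_right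
  proof (rule sum.cong)
    fix i assume "i \<in> {..m}"
    then have "d ^ k = d ^ i * d ^ Suc (m - i)" unfolding m by (simp flip: power_add)
    then show "real (m choose i) * (\<bar>comp_seq ?a b i x\<bar> * \<bar>b (Suc (m - i)) x\<bar>) * d ^ k =
       real (m choose i) * ((\<bar>comp_seq ?a b i x\<bar> * d ^ i) * (\<bar>b (Suc (m - i)) x\<bar> * d ^ Suc (m - i)))"
      by simp
  qed simp
  also have "... \<le> (\<Sum>i\<le>m. real (m choose i) * ((comp_const i * E) * \<beta>))"
    using pos E k m \<beta>
    by (intro sum_mono mult_left_mono mult_mono IH b) (auto simp: comp_const_nonneg)
  also have "... = comp_const k * E * \<beta>"
    unfolding m by (simp add: sum_distrib_right mult.assoc)
  finally show ?thesis .
qed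


section \<open>Oscillation of smooth functions\<close>

lemma pderiv_iter_linear:
  fixes R :: "complex poly"
  shows "(pderiv ^^ Suc s) ([:- a, 1:] * R) = [:- a, 1:] * (pderiv ^^ Suc s) R + smult (of_nat (Suc s)) ((pderiv ^^ s) R)"
proof (induction s)
  case 0
  show ?case by (simp add: pderiv_diff pderiv_smult pderiv_pCons)
next
  case (Suc s)
  have "(pderiv ^^ Suc (Suc s)) ([:- a, 1:] * R) = pderiv ((pderiv ^^ Suc s) ([:- a, 1:] * R))"
    by simp
  also have "... = [:- a, 1:] * (pderiv ^^ Suc (Suc s)) R + (pderiv ^^ Suc s) R + smult (of_nat (Suc s)) ((pderiv ^^ Suc s) R)"
    unfolding Suc.IH by (simp only: pderiv_add pderiv_smult pderiv_mult) (simp add: pderiv_pCons)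
  also have "... = [:- a, 1:] * (pderiv ^^ Suc (Suc s)) R + smult (of_nat (Suc (Suc s))) ((pderiv ^^ Suc s) R)"
    by (simp only: of_nat_Suc[of "Suc s"] smult_add_left smult_1_left ac_simps)
  finally show ?case .
qed

lemma pow_Suc_ge: "d ^ Suc s + real (Suc s) * d ^ s \<le> (d + 1) ^ Suc s" if "d \<ge> (0::real)"
proof (induction s)
  case (Suc s)
  have "d ^ Suc (Suc s) + real (Suc (Suc s)) * d ^ Suc s \<le> (d + 1) * (d ^ Suc s + real (Suc s) * d ^ s)"
    using that by (simp add: algebra_simps)
  also have "... \<le> (d + 1) * (d + 1) ^ Suc s"
    using Suc that by (intro mult_left_mono) auto
  finally show ?case by simp
qed simp

text \<open>The s-th derivative of the product is the sum, over ordered choices of s distinct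
  factors, of the product of the others. There are at most d^s choices, and every removed factor has
  modulus at least \<open>\<rho>\<close>. The induction on d rests on the first two terms of the
  binomial expansion of (d + 1)^s.\<close>

lemma pderiv_iter_bound:
  fixes z :: complex
  assumes "\<rho> > 0" "\<And>i. i < d \<Longrightarrow> norm (z - rt i) \<ge> \<rho>"
  shows "norm (poly ((pderiv ^^ s) (\<Prod>i<d. [:- rt i, 1:])) z)
    \<le> (real d / \<rho>) ^ s * norm (poly (\<Prod>i<d. [:- rt i, 1:]) z)"
  using assms(2)
proof (induction d arbitrary: s)
  case 0
  show ?case
  proof (cases s)
    case (Suc m)
    have "(pderiv ^^ Suc m) (1::complex poly) = 0" for m by (induction m) (auto simp: pderiv_1)
    then show ?thesis by (simp add: Suc)
  qed simp
next
  case (Suc d)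
  define R where "R = (\<Prod>i<d. [:- rt i, 1:])"
  define N where "N = norm (poly R z)"
  define y where "y = norm (z - rt d)"
  have y: "y \<ge> \<rho>" using Suc.prems[of d] by (simp add: y_def)
  have IH: "norm (poly ((pderiv ^^ s) R) z) \<le> (real d / \<rho>) ^ s * N" for s
    using Suc by (simp add: R_def N_def)
  have prod: "(\<Prod>i<Suc d. [:- rt i, 1:]) = [:- rt d, 1:] * R"
    by (simp add: R_def mult.commute)
  show ?case
  proof (cases s)
    case (Suc m)
    have "norm (poly ((pderiv ^^ s) ([:- rt d, 1:] * R)) z)
      \<le> y * norm (poly ((pderiv ^^ Suc m) R) z) + real (Suc m) * norm (poly ((pderiv ^^ m) R) z)"
      unfolding Suc pderiv_iter_linear poly_add poly_mult poly_smult
      by (rule order.trans[OF norm_triangle_ineq]) (simp add: norm_mult y_def norm_minus_commute del: funpow.simps of_nat_Suc)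
    also have "... \<le> y * ((real d / \<rho>) ^ Suc m * N) + real (Suc m) * ((real d / \<rho>) ^ m * N)"
      using y assms(1) by (intro add_mono mult_left_mono IH) auto
    \<comment> \<open>The second summand lacks a factor \<open>y\<close> / \<open>\<rho>\<close>
      \<ge> 1 compared with the first; inserting it makes both homogeneous.\<close>
    also have "real (Suc m) * ((real d / \<rho>) ^ m * N) \<le> (y / \<rho>) * (real (Suc m) * ((real d / \<rho>) ^ m * N))"
    proof -
      have "1 \<le> y / \<rho>" "0 \<le> real (Suc m) * ((real d / \<rho>) ^ m * N)" using y assms(1) by (simp_all add: N_def)
      then show ?thesis using mult_right_mono by fastforce
    qed
    also have "y * ((real d / \<rho>) ^ Suc m * N) + (y / \<rho>) * (real (Suc m) * ((real d / \<rho>) ^ m * N))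
       = y * N / \<rho> ^ Suc m * (real d ^ Suc m + real (Suc m) * real d ^ m)"
      using assms(1) by (simp add: field_simps power_divide)
    also have "... \<le> y * N / \<rho> ^ Suc m * (real d + 1) ^ Suc m"
      using y assms(1) by (intro mult_left_mono pow_Suc_ge) (auto simp: N_def)
    also have "... = (real (Suc d) / \<rho>) ^ s * norm (poly ([:- rt d, 1:] * R) z)"
    proof -
      have "norm (poly ([:- rt d, 1:] * R) z) = y * N"
        unfolding poly_mult norm_mult by (simp add: y_def N_def norm_minus_commute)
      then show ?thesis by (simp add: Suc power_divide field_simps)
    qed
    finally show ?thesis unfolding prod by simp
  qed simp
qed

text \<open>Complex coefficients let the polynomial split into linear factors. \<open>f i\<close>
  stands for the i-th derivative at the centre, and \<open>m\<close> is the number of terms, so the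
  degree is below \<open>m\<close>.\<close>

definition taylor_poly :: "(nat \<Rightarrow> real) \<Rightarrow> nat \<Rightarrow> complex poly" where
  "taylor_poly f m = (\<Sum>i<m. monom (of_real (f i / fact i)) i)"

lemma pderiv_taylor_poly: "pderiv (taylor_poly f m) = taylor_poly (\<lambda>i. f (Suc i)) (m - 1)"
proof (cases m)
  case (Suc k)
  have "pderiv (taylor_poly f (Suc k)) = (\<Sum>i<Suc k. pderiv (monom (of_real (f i / fact i)) i))"
    unfolding taylor_poly_def using higher_pderiv_sum[of 1 "\<lambda>i. monom (complex_of_real (f i / fact i)) i" "{..<Suc k}"] by simp
  also have "... = (\<Sum>i<k. pderiv (monom (of_real (f (Suc i) / fact (Suc i))) (Suc i)))"
    by (subst sum.lessThan_Suc_shift) (simp add: pderiv_monom)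
  also have "... = taylor_poly (\<lambda>i. f (Suc i)) k"
    unfolding taylor_poly_def by (intro sum.cong) (auto simp: pderiv_monom field_simps simp del: of_nat_Suc)
  finally show ?thesis by (simp add: Suc)
qed (simp add: taylor_poly_def)

lemma pderiv_iter_taylor_poly: "(pderiv ^^ s) (taylor_poly f m) = taylor_poly (\<lambda>i. f (i + s)) (m - s)"
  by (induction s arbitrary: f m) (simp_all add: pderiv_taylor_poly funpow_swap1 add.commute)

text \<open>Only the derivative of order n is bounded, and the factorials of the remainder are
  dropped. Each differentiation costs one power of \<open>len\<close>.\<close>

lemma taylor_poly_error:
  assumes "dseq T v" "convex T" "e \<in> T" "x \<in> T" "\<bar>x - e\<bar> \<le> len" "s \<le> n" "\<And>y. y \<in> T \<Longrightarrow> \<bar>v n y\<bar> \<le> K"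
  shows "norm (of_real (v s x) - poly ((pderiv ^^ s) (taylor_poly (\<lambda>i. v i e) n)) (of_real (x - e))) \<le> K * len ^ (n - s)"
proof -
  have K: "K \<ge> 0" using assms(7)[OF assms(3)] by linarith
  have poly: "poly ((pderiv ^^ s) (taylor_poly (\<lambda>i. v i e) n)) (of_real (x - e)) =
     of_real (\<Sum>i<n - s. v (i + s) e * (x - e) ^ i / fact i)"
    unfolding pderiv_iter_taylor_poly by (simp add: taylor_poly_def poly_sum poly_monom)
  have "\<bar>v s x - (\<Sum>i<n - s. v (i + s) e * (x - e) ^ i / fact i)\<bar> \<le> K * len ^ (n - s)"
  proof (cases "s = n")
    case False
    define N where "N = n - s - 1"
    have N: "n - s = Suc N" "Suc (N + s) = n" using False assms(6) by (auto simp: N_def)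
    have "norm (v (0 + s) x - (\<Sum>i\<le>N. v (i + s) e * (x - e) ^ i / fact i)) \<le> K * norm (x - e) ^ Suc N / fact N"
      using assms N by (intro field_Taylor[OF assms(2), of N "\<lambda>i. v (i + s)"])
        (auto intro!: dseq_real simp: add.commute)
    also have "... \<le> K * norm (x - e) ^ Suc N / 1"
      using K by (intro divide_left_mono) (auto simp: fact_ge_1)
    also have "... \<le> K * len ^ Suc N"
      using K power_mono[OF assms(5), of "Suc N"] by (simp del: power_Suc add: mult_left_mono)
    finally show ?thesis by (simp add: N lessThan_Suc_atMost)
  qed (use assms in auto)
  then show ?thesis unfolding poly of_real_diff[symmetric] norm_of_real .
qed

section \<open>Dyadic intervals on which a function is tame\<close>

definition dyad :: "nat \<Rightarrow> nat \<Rightarrow> real set" where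
  "dyad j k = {real k / 2 ^ j ..< real (Suc k) / 2 ^ j}"

text \<open>After rescaling the interval to unit length, every derivative of order 1 to n at any
  point is dominated by the value at any other point. Later \<open>v\<close> is the derivative of a
  curve, and tameness becomes bounded distortion together with control of the higher
  derivatives.\<close>

definition tame :: "nat \<Rightarrow> (nat \<Rightarrow> real \<Rightarrow> real) \<Rightarrow> nat \<Rightarrow> nat \<Rightarrow> bool" where
  "tame n v j k \<longleftrightarrow> (\<forall>x\<in>dyad j k. v 0 x \<noteq> 0 \<and>
     (\<forall>y\<in>dyad j k. \<forall>s\<in>{1..n}. (1 / 2 ^ j) ^ s * \<bar>v s x\<bar> \<le> \<bar>v 0 y\<bar>))"

lemma dyad_subset_unit: "k < 2 ^ j \<Longrightarrow> dyad j k \<subseteq> {0..<1}"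
proof -
  assume "k < 2 ^ j"
  then have "real (Suc k) \<le> 2 ^ j" by (metis Suc_leI of_nat_le_iff of_nat_numeral of_nat_power)
  then have "real (Suc k) / 2 ^ j \<le> 1" by simp
  moreover have "0 \<le> real k / 2 ^ j" by simp
  ultimately show ?thesis unfolding dyad_def by (intro subsetI, unfold atLeastLessThan_iff) linarith
qed

lemma left_in_dyad: "real k / 2 ^ j \<in> dyad j k"
  by (simp add: dyad_def divide_strict_right_mono)

lemma in_dyad_iff: "x \<in> dyad j k \<longleftrightarrow> \<lfloor>x * 2 ^ j\<rfloor> = int k"
  by (auto simp: dyad_def field_simps floor_eq_iff)

lemma in_dyad_div: "x \<in> dyad (j + i) k \<Longrightarrow> x \<in> dyad j (k div 2 ^ i)"
proof -
  assume "x \<in> dyad (j + i) k"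
  then have "\<lfloor>x * 2 ^ j * 2 ^ i\<rfloor> = int k" by (simp add: in_dyad_iff power_add mult.assoc)
  moreover have "\<lfloor>x * 2 ^ j\<rfloor> = \<lfloor>x * 2 ^ j * 2 ^ i\<rfloor> div 2 ^ i"
    using floor_divide_real_eq_div[of "2 ^ i" "x * 2 ^ j * 2 ^ i"] by simp
  ultimately show ?thesis by (simp add: in_dyad_iff zdiv_int)
qed

lemma dyad_unique: "x \<in> dyad j k \<Longrightarrow> x \<in> dyad j k' \<Longrightarrow> k = k'"
  by (simp add: in_dyad_iff)

lemma card_near_le:
  "finite {k. \<bar>real k - t\<bar> < real R} \<and> card {k. \<bar>real k - t\<bar> < real R} \<le> 2 * R + 1"
proof -
  have "int ` {k. \<bar>real k - t\<bar> < real R} \<subseteq> {\<lfloor>t\<rfloor> - int R .. \<lfloor>t\<rfloor> + int R}"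
    by (auto simp: abs_less_iff) linarith+
  from finite_subset[OF this] card_mono[OF _ this]
  have "finite (int ` {k. \<bar>real k - t\<bar> < real R})" "card (int ` {k. \<bar>real k - t\<bar> < real R}) \<le> card {\<lfloor>t\<rfloor> - int R .. \<lfloor>t\<rfloor> + int R}"
    by simp_all
  then show ?thesis by (auto simp: card_image finite_image_iff nat_add_distrib nat_mult_distrib)
qed

text \<open>At most n roots; near the real part of each at most 2 (4 n + 1) + 1 = 8 n + 3 intervals
  have their left end within 4 n + 1 interval lengths.\<close>

definition cnt :: "nat \<Rightarrow> nat" where "cnt n = n * (8 * n + 3)"

text \<open>Away from the roots of the Taylor polynomial, at scale \<open>2\<^sup>-\<^sup>j\<close>, the function is tame; so the wild
  intervals on which the function is not small are confined to neighbourhoods of at most \<open>n\<close> roots.\<close>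

lemma card_wild_local:
  assumes v: "dseq {0..<1} v" and K: "K > 0" and n: "n \<ge> 1" and iq: "i < 2 ^ q" and jq: "q \<le> j"
    and bd: "\<And>x. x \<in> {0..<1} \<Longrightarrow> \<bar>v n x\<bar> \<le> K"
  defines "W \<equiv> {k. dyad j k \<subseteq> dyad q i \<and> \<not> tame n v j k \<and> (\<exists>x\<in>dyad j k. \<bar>v 0 x\<bar> > 9 * K * (1 / 2 ^ q) ^ n)}"
  shows "finite W \<and> card W \<le> cnt n"
proof (cases "W = {}")
  case False
  define len \<alpha> e where "len = 1 / (2::real) ^ q" and "\<alpha> = 1 / (2::real) ^ j" and "e = real i / 2 ^ q"
  have pos: "len > 0" "\<alpha> > 0" and \<alpha>_len: "\<alpha> \<le> len" using jq by (auto simp: len_def \<alpha>_def field_simps power_increasing)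
  define Q where "Q = taylor_poly (\<lambda>i. v i e) n"
  define P where "P = (\<lambda>s x. poly ((pderiv ^^ s) Q) (of_real (x - e)))"
  have sub: "dyad q i \<subseteq> {0..<1}" by (rule dyad_subset_unit[OF iq])
  have err: "norm (of_real (v s x) - P s x) \<le> K * len ^ (n - s)" if "x \<in> dyad q i" "s \<le> n" for x s
    unfolding P_def Q_def
  proof (rule taylor_poly_error[OF dseq_subset[OF v sub]])
    show "\<bar>x - e\<bar> \<le> len" using that by (auto simp: dyad_def e_def len_def add_divide_distrib)
    show "convex (dyad q i)" by (simp add: dyad_def)
  qed (use that sub bd in \<open>auto simp: e_def left_in_dyad\<close>)
  \<comment> \<open>The budget behind the 9: one unit K \<open>len\<close>^n is lost to the Taylor
    error, and halving the remaining 8 units, when moving to another point of the interval, leaves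
    4.\<close>
  have big: "norm (P 0 x) > 8 * (K * len ^ n)" if "x \<in> dyad q i" "\<bar>v 0 x\<bar> > 9 * K * (1 / 2 ^ q) ^ n" for x
    using err[OF that(1), of 0] that(2) norm_triangle_ineq2[of "complex_of_real (v 0 x)" "P 0 x"]
    by (simp add: len_def)
  have "Q \<noteq> 0"
  proof
    assume "Q = 0"
    obtain k x where "dyad j k \<subseteq> dyad q i" "x \<in> dyad j k" "\<bar>v 0 x\<bar> > 9 * K * (1 / 2 ^ q) ^ n"
      using False by (auto simp: W_def)
    then have "norm (P 0 x) > 8 * (K * len ^ n)" by (intro big) auto
    moreover have "0 \<le> 8 * (K * len ^ n)" using K pos by simp
    ultimately show False using \<open>Q = 0\<close> by (simp add: P_def)
  qed
  obtain rt where rt: "smult (lead_coeff Q) (\<Prod>i<degree Q. [:- rt i, 1:]) = Q"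
    by (rule complex_poly_decompose')
  define m where "m = degree Q"
  have mn: "m \<le> n"
    unfolding m_def Q_def taylor_poly_def
    by (intro degree_sum_le) (auto intro: order.trans[OF degree_monom_le])
  define L where "L = (\<Prod>i<m. [:- rt i, 1:])"
  have Q: "Q = smult (lead_coeff Q) L" using rt by (simp add: L_def m_def)
  have Ps: "norm (P s x) = norm (lead_coeff Q) * norm (poly ((pderiv ^^ s) L) (of_real (x - e)))" for s x
  proof -
    have "(pderiv ^^ s) (smult c L) = smult c ((pderiv ^^ s) L)" for c
      by (induction s) (auto simp: pderiv_smult)
    then show ?thesis unfolding P_def by (subst Q) (simp add: norm_mult)
  qed
  \<comment> \<open>By contraposition: an interval far from the real parts of all roots is tame.
    Real parts suffice, since a real point is at least as far from a root as from its real
    part.\<close>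
  have "W \<subseteq> (\<Union>l<m. {k. \<bar>real k - (e + Re (rt l)) / \<alpha>\<bar> < real (4 * n + 1)})"
  proof
    fix k assume k: "k \<in> W"
    show "k \<in> (\<Union>l<m. {k. \<bar>real k - (e + Re (rt l)) / \<alpha>\<bar> < real (4 * n + 1)})"
    proof (rule ccontr)
      assume "\<not> ?thesis"
      then have far: "\<bar>real k - (e + Re (rt l)) / \<alpha>\<bar> \<ge> real (4 * n) + 1" if "l < m" for l
        using that by (fastforce simp: not_less)
      \<comment> \<open>With this distance from the roots, n \<alpha> / \<rho> = 1/4, so each
        rescaled differentiation of the polynomial gains a factor 1/4.\<close>
      define \<rho> where "\<rho> = real (4 * n) * \<alpha>"
      have \<rho>: "\<rho> > 0" using n pos by (simp add: \<rho>_def)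
      have dsub: "dyad j k \<subseteq> dyad q i" using k by (simp add: W_def)
      have dist: "norm (of_real (x - e) - rt l) \<ge> \<rho>" if "x \<in> dyad j k" "l < m" for x l
      proof -
        have "\<bar>real k * \<alpha> - (e + Re (rt l))\<bar> = \<alpha> * \<bar>real k - (e + Re (rt l)) / \<alpha>\<bar>"
          using pos by (simp add: field_simps flip: abs_mult_pos')
        then have "\<bar>real k * \<alpha> - (e + Re (rt l))\<bar> \<ge> \<alpha> * (real (4 * n) + 1)"
          using far[OF that(2)] pos by simp
        moreover have "\<bar>x - real k * \<alpha>\<bar> \<le> \<alpha>" using that(1) by (auto simp: dyad_def \<alpha>_def add_divide_distrib)
        ultimately have "\<bar>x - e - Re (rt l)\<bar> \<ge> \<rho>" by (simp add: \<rho>_def algebra_simps)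
        also have "\<bar>x - e - Re (rt l)\<bar> = \<bar>Re (of_real (x - e) - rt l)\<bar>" by simp
        also have "... \<le> norm (of_real (x - e) - rt l)" by (rule abs_Re_le_cmod)
        finally show ?thesis .
      qed
      have deriv: "\<alpha> ^ s * norm (P s x) \<le> norm (P 0 x) / 4" if "x \<in> dyad j k" "1 \<le> s" for x s
      proof -
        have "norm (poly ((pderiv ^^ s) L) (of_real (x - e))) \<le> (real m / \<rho>) ^ s * norm (poly L (of_real (x - e)))"
          unfolding L_def by (rule pderiv_iter_bound[OF \<rho> dist[OF that(1)]])
        then have "norm (P s x) \<le> (real m / \<rho>) ^ s * norm (P 0 x)"
          unfolding Ps
            by (simp only: funpow_0) (metis mult.left_commute mult_left_mono norm_ge_zero)
        also have "... \<le> (real n / \<rho>) ^ s * norm (P 0 x)"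
          using mn \<rho> by (intro mult_right_mono power_mono divide_right_mono) auto
        also have "(real n / \<rho>) ^ s = (1 / 4) ^ s / \<alpha> ^ s"
          using n pos by (simp add: \<rho>_def field_simps power_divide)
        finally have "\<alpha> ^ s * norm (P s x) \<le> (1 / 4) ^ s * norm (P 0 x)"
          using pos by (simp add: field_simps)
        also have "... \<le> (1 / 4) ^ 1 * norm (P 0 x)"
          using that by (intro mult_right_mono power_decreasing) auto
        finally show ?thesis by simp
      qed
      \<comment> \<open>Moving inside the interval changes each linear factor by at most 1 + 1 / (4
        n), hence the whole product by at most exp (1/4) < 2.\<close>
      have compare: "norm (P 0 x) \<le> 2 * norm (P 0 y)" if "x \<in> dyad j k" "y \<in> dyad j k" for x y
      proof -
        have "norm (poly L (of_real (x - e))) = (\<Prod>l<m. norm (of_real (x - e) - rt l))"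
          by (simp add: L_def poly_prod prod_norm)
        also have "... \<le> (\<Prod>l<m. (1 + 1 / real (4 * n)) * norm (of_real (y - e) - rt l))"
        proof (intro prod_mono conjI)
          fix l assume "l \<in> {..<m}"
          then have d: "norm (of_real (y - e) - rt l) \<ge> \<rho>" using dist that by simp
          have "\<bar>x - y\<bar> \<le> \<alpha>" using that by (auto simp: dyad_def \<alpha>_def add_divide_distrib)
          have eq: "of_real (x - e) - rt l = (of_real (x - y) :: complex) + (of_real (y - e) - rt l)"
            by simp
          have "norm (of_real (x - e) - rt l) \<le> norm (of_real (x - y) :: complex) + norm (of_real (y - e) - rt l)"
            unfolding eq by (rule norm_triangle_ineq)
          also have "norm (of_real (x - y) :: complex) \<le> \<alpha>" using \<open>\<bar>x - y\<bar> \<le> \<alpha>\<close> by (simp only: norm_of_real)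
          also have "\<alpha> \<le> 1 / real (4 * n) * norm (of_real (y - e) - rt l)"
            using d n by (simp add: \<rho>_def field_simps)
          finally show "norm (of_real (x - e) - rt l) \<le> (1 + 1 / real (4 * n)) * norm (of_real (y - e) - rt l)"
            by (simp add: algebra_simps)
        qed auto
        also have "... = (1 + 1 / real (4 * n)) ^ m * norm (poly L (of_real (y - e)))"
          by (simp add: L_def poly_prod prod_norm prod.distrib)
        also have "... \<le> 2 * norm (poly L (of_real (y - e)))"
        proof (rule mult_right_mono)
          have "(1 + 1 / real (4 * n)) ^ m \<le> (1 + 1 / real (4 * n)) ^ n"
            using mn by (intro power_increasing) auto
          also have "... \<le> exp (1 / real (4 * n)) ^ n"
            by (intro power_mono exp_ge_add_one_self) auto
          also have "... = exp (1 / 4)" using n by (simp flip: exp_of_nat_mult)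
          also have "... \<le> 1 + 1 / 4 + (1 / 4)\<^sup>2" by (rule exp_bound) auto
          also have "... \<le> 2" by (simp add: power2_eq_square)
          finally show "(1 + 1 / real (4 * n)) ^ m \<le> 2" .
        qed auto
        finally show ?thesis unfolding Ps
          by (simp only: funpow_0) (metis mult.left_commute mult_left_mono norm_ge_zero)
      qed
      obtain x0 where x0: "x0 \<in> dyad j k" "\<bar>v 0 x0\<bar> > 9 * K * (1 / 2 ^ q) ^ n"
        using k by (auto simp: W_def)
      have low: "norm (P 0 y) > 4 * (K * len ^ n)" if "y \<in> dyad j k" for y
        using big[OF subsetD[OF dsub x0(1)] x0(2)] compare[OF x0(1) that] by simp
      have low0: "\<bar>v 0 y\<bar> \<ge> norm (P 0 y) - K * len ^ n" if "y \<in> dyad j k" for y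
        using err[OF subsetD[OF dsub that], of 0] norm_triangle_ineq2[of "P 0 y" "complex_of_real (v 0 y)"]
        by (simp add: norm_minus_commute)
      have "tame n v j k"
        unfolding tame_def
      proof (intro ballI conjI)
        fix x assume x: "x \<in> dyad j k"
        have "K * len ^ n > 0" using K pos by simp
        then show "v 0 x \<noteq> 0" using low[OF x] low0[OF x] by auto
        fix y s assume y: "y \<in> dyad j k" and s: "s \<in> {1..n}"
        have "norm (of_real (v s x) - P s x) \<le> K * len ^ (n - s)"
          using err[OF subsetD[OF dsub x], of s] s by simp
        then have "\<bar>v s x\<bar> \<le> norm (P s x) + K * len ^ (n - s)"
          using norm_triangle_ineq2[of "complex_of_real (v s x)" "P s x"] by simp
        then have "\<alpha> ^ s * \<bar>v s x\<bar> \<le> \<alpha> ^ s * norm (P s x) + \<alpha> ^ s * (K * len ^ (n - s))"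
          using pos by (simp flip: distrib_left)
        also have "\<alpha> ^ s * norm (P s x) \<le> norm (P 0 x) / 4" using deriv x s by simp
        also have "\<alpha> ^ s * (K * len ^ (n - s)) \<le> len ^ s * (K * len ^ (n - s))"
          using pos \<alpha>_len K by (intro mult_right_mono power_mono) auto
        also have "... = K * len ^ n" using s by (simp flip: power_add)
        \<comment> \<open>It remains to see that half of |P y| plus one Taylor error is at most |P
          y| minus one Taylor error, which holds since |P y| exceeds four of them.\<close>
        also have "norm (P 0 x) / 4 \<le> norm (P 0 y) / 2" using compare[OF x y] by simp
        finally show "(1 / 2 ^ j) ^ s * \<bar>v s x\<bar> \<le> \<bar>v 0 y\<bar>"
          using low0[OF y] low[OF y] by (simp add: \<alpha>_def)
      qed
      then show False using k by (simp add: W_def)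
    qed
  qed
  moreover have "card (\<Union>l<m. {k. \<bar>real k - (e + Re (rt l)) / \<alpha>\<bar> < real (4 * n + 1)}) \<le> (\<Sum>l<m. 2 * (4 * n + 1) + 1)"
    using card_near_le[of _ "4 * n + 1"] by (intro order.trans[OF card_UN_le] sum_mono) auto
  moreover have "(\<Sum>l<m. 2 * (4 * n + 1) + 1) \<le> cnt n" using mult_right_mono[OF mn, of "8 * n + 3"] by (simp add: cnt_def algebra_simps)
  moreover have "finite (\<Union>l<m. {k. \<bar>real k - (e + Re (rt l)) / \<alpha>\<bar> < real (4 * n + 1)})"
    using card_near_le[of _ "4 * n + 1"] by auto
  ultimately show ?thesis by (meson card_mono finite_subset order.trans)
qed simp


section \<open>Decomposition into maximal tame intervals\<close>

lemma tame_refine: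
  assumes "tame n v j k" "dyad (j + i) k' \<subseteq> dyad j k"
  shows "tame n v (j + i) k'"
  unfolding tame_def
proof (intro ballI conjI)
  fix x assume x: "x \<in> dyad (j + i) k'"
  then show "v 0 x \<noteq> 0" using assms by (auto simp: tame_def)
  fix y s assume y: "y \<in> dyad (j + i) k'" and s: "s \<in> {1..n}"
  have "(1 / 2 ^ (j + i)) ^ s \<le> (1 / (2::real) ^ j) ^ s"
    by (intro power_mono) (auto simp: field_simps power_add)
  then have "(1 / 2 ^ (j + i)) ^ s * \<bar>v s x\<bar> \<le> (1 / 2 ^ j) ^ s * \<bar>v s x\<bar>"
    by (rule mult_right_mono) simp
  also have "... \<le> \<bar>v 0 y\<bar>"
    using assms(1)[unfolded tame_def, rule_format, of x] subsetD[OF assms(2) x] subsetD[OF assms(2) y] s by blast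
  finally show "(1 / 2 ^ (j + i)) ^ s * \<bar>v s x\<bar> \<le> \<bar>v 0 y\<bar>" .
qed

text \<open>A stopping-time decomposition of Whitney type: bisection of the unit interval stops at
  the first tame interval, so the parent is not tame. Subintervals of tame intervals are tame, which
  makes the maximal ones disjoint.\<close>

definition max_tame :: "nat \<Rightarrow> (nat \<Rightarrow> real \<Rightarrow> real) \<Rightarrow> nat \<Rightarrow> nat \<Rightarrow> bool" where
  "max_tame n v j k \<longleftrightarrow> k < 2 ^ j \<and> tame n v j k \<and> (j = 0 \<or> \<not> tame n v (j - 1) (k div 2))"

definition tame_fam :: "nat \<Rightarrow> (nat \<Rightarrow> real \<Rightarrow> real) \<Rightarrow> nat \<Rightarrow> (nat \<times> nat) set" where
  "tame_fam n v R = {(j, k). j \<le> R \<and> max_tame n v j k}"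

lemma finite_tame_fam: "finite (tame_fam n v R)"
proof (rule finite_subset)
  show "tame_fam n v R \<subseteq> (SIGMA j:{..R}. {..<2 ^ j})"
    by (auto simp: tame_fam_def max_tame_def)
qed auto

lemma dyad_sub_parent: "dyad (Suc j) k \<subseteq> dyad j (k div 2)"
  using in_dyad_div[of _ j 1 k] by auto

lemma max_tame_disjoint:
  assumes "max_tame n v j k" "max_tame n v j' k'" "x \<in> dyad j k" "x \<in> dyad j' k'"
  shows "(j, k) = (j', k')"
proof -
  have no: False if "max_tame n v j k" "max_tame n v j' k'" "x \<in> dyad j k" "x \<in> dyad j' k'" "j < j'" for j k j' k'
  proof -
    obtain i where i: "j' = Suc (j + i)" using \<open>j < j'\<close> less_imp_Suc_add by blast
    have x: "x \<in> dyad (j + i) (k' div 2)" using dyad_sub_parent that i by blast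
    have "dyad (j + i) (k' div 2) \<subseteq> dyad j k"
      using in_dyad_div[of _ j i "k' div 2"] x that(3) dyad_unique by (metis subsetI)
    then have "tame n v (j + i) (k' div 2)"
      using that(1) tame_refine unfolding max_tame_def by blast
    then show False using that(2) by (simp add: max_tame_def i)
  qed
  have "j = j'" using no[of j k j' k'] no[of j' k' j k] assms by (metis linorder_neqE_nat)
  then show ?thesis using assms dyad_unique by blast
qed

lemma max_tame_exists:
  assumes "tame n v j k" "k < 2 ^ j" "x \<in> dyad j k"
  shows "\<exists>j' k'. j' \<le> j \<and> max_tame n v j' k' \<and> x \<in> dyad j' k'"
  using assms
proof (induction j arbitrary: k)
  case 0
  then show ?case by (auto simp: max_tame_def)
next
  case (Suc j)
  show ?case
  proof (cases "tame n v j (k div 2)")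
    case True
    then have "\<exists>j' k'. j' \<le> j \<and> max_tame n v j' k' \<and> x \<in> dyad j' k'"
      using Suc dyad_sub_parent[of j k] by (intro Suc.IH) auto
    then show ?thesis using le_Suc_eq by blast
  next
    case False
    then have "max_tame n v (Suc j) k" using Suc.prems by (simp add: max_tame_def)
    then show ?thesis using Suc.prems by blast
  qed
qed

text \<open>On a short interval around x the value stays above half of |v x|, while all rescaled
  derivatives are at most the interval length times K.\<close>

lemma tame_near:
  assumes v: "dseq {0..<1} v" and bd: "\<And>x s. x \<in> {0..<1} \<Longrightarrow> s \<le> n \<Longrightarrow> \<bar>v s x\<bar> \<le> K" and K: "K > 0"
    and x: "x \<in> {0..<1}" "v 0 x \<noteq> 0"
  shows "\<exists>j k. k < 2 ^ j \<and> tame n v j k \<and> x \<in> dyad j k"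
proof -
  define c where "c = \<bar>v 0 x\<bar> / 2"
  have c: "c > 0" using x by (simp add: c_def)
  obtain \<delta> where \<delta>: "\<delta> > 0" "\<And>y. y \<in> {0..<1} \<Longrightarrow> dist y x < \<delta> \<Longrightarrow> dist (v 0 y) (v 0 x) < c"
    using dseq_continuous[OF v, of 0, unfolded continuous_on_iff] x c by blast
  obtain j where j: "(1 / 2) ^ j < min \<delta> (c / K)"
    using real_arch_pow_inv[of "min \<delta> (c / K)" "1/2"] \<delta> c K by auto
  define k where "k = nat \<lfloor>x * 2 ^ j\<rfloor>"
  have fl: "\<lfloor>x * 2 ^ j\<rfloor> \<ge> 0" using x by simp
  then have xk: "x \<in> dyad j k" by (simp add: in_dyad_iff k_def)
  have "\<lfloor>x * 2 ^ j\<rfloor> < 2 ^ j" using x by (simp add: floor_less_iff)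
  then have k: "k < 2 ^ j" using fl by (simp add: k_def nat_less_iff)
  have low: "\<bar>v 0 y\<bar> > c" if "y \<in> dyad j k" for y
  proof -
    have "\<bar>y - x\<bar> \<le> (1/2) ^ j" using that xk by (auto simp: dyad_def add_divide_distrib power_divide)
    then have "dist y x < \<delta>" using j by (simp add: dist_real_def)
    then have "dist (v 0 y) (v 0 x) < c" using \<delta>(2) that dyad_subset_unit[OF k] by blast
    then show ?thesis unfolding dist_real_def c_def by linarith
  qed
  have "tame n v j k"
    unfolding tame_def
  proof (intro ballI conjI)
    fix z assume z: "z \<in> dyad j k"
    then show "v 0 z \<noteq> 0" using low[of z] c by auto
    fix y s assume y: "y \<in> dyad j k" and s: "s \<in> {1..n}"
    have "(1 / 2 ^ j) ^ s \<le> (1 / (2::real) ^ j) ^ 1"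
      using s by (intro power_decreasing) auto
    then have "(1 / 2 ^ j) ^ s * \<bar>v s z\<bar> \<le> (1 / 2 ^ j) * K"
      using bd[of z s] s z dyad_subset_unit[OF k] by (intro mult_mono) auto
    also have "... < c" using j K by (simp add: field_simps power_divide)
    finally show "(1 / 2 ^ j) ^ s * \<bar>v s z\<bar> \<le> \<bar>v 0 y\<bar>" using low[OF y] by simp
  qed
  then show ?thesis using k xk by blast
qed

text \<open>The level q decides which values count as large. For q \<le> j the local count is summed
  over the 2^q intervals of level q; for j < q there are fewer than 2^q intervals of level j
  anyway.\<close>

lemma card_wild:
  assumes v: "dseq {0..<1} v" and K: "K > 0" and n: "n \<ge> 1"
    and bd: "\<And>x. x \<in> {0..<1} \<Longrightarrow> \<bar>v n x\<bar> \<le> K"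
  shows "card {k. k < 2 ^ j \<and> \<not> tame n v j k \<and> (\<exists>x\<in>dyad j k. \<bar>v 0 x\<bar> > 9 * K * (1 / 2 ^ q) ^ n)} \<le> cnt n * 2 ^ q"
    (is "card ?W \<le> _")
proof (cases "q \<le> j")
  case False
  have "card ?W \<le> card {..<2 ^ j :: nat}" by (intro card_mono) auto
  also have "... = 2 ^ j" by simp
  also have "... \<le> (2::nat) ^ q" using False by (intro power_increasing) auto
  also have "... \<le> cnt n * 2 ^ q" using n by (simp add: cnt_def)
  finally show ?thesis .
next
  case True
  let ?L = "\<lambda>i. {k. dyad j k \<subseteq> dyad q i \<and> \<not> tame n v j k \<and> (\<exists>x\<in>dyad j k. \<bar>v 0 x\<bar> > 9 * K * (1 / 2 ^ q) ^ n)}"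
  note loc = card_wild_local[OF v K n _ True bd]
  have "?W \<subseteq> (\<Union>i<2 ^ q. ?L i)"
  proof
    fix k assume k: "k \<in> ?W"
    have "k < 2 ^ q * 2 ^ (j - q)" using k True by (simp flip: power_add)
    then have "k div 2 ^ (j - q) < 2 ^ q" by (simp add: less_mult_imp_div_less)
    moreover have "dyad j k \<subseteq> dyad q (k div 2 ^ (j - q))"
      using in_dyad_div[of _ q "j - q" k] True by auto
    ultimately show "k \<in> (\<Union>i<2 ^ q. ?L i)" using k by blast
  qed
  moreover have "finite (\<Union>i<2 ^ q. ?L i)" using loc by auto
  ultimately have "card ?W \<le> card (\<Union>i<2 ^ q. ?L i)" by (intro card_mono)
  also have "... \<le> (\<Sum>i<2 ^ q. card (?L i))" by (intro card_UN_le) auto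
  also have "... \<le> (\<Sum>i<(2::nat) ^ q. cnt n)" using loc by (intro sum_mono) auto
  finally show ?thesis by (simp add: mult.commute)
qed

text \<open>The parent of a maximal tame interval is wild and contains the point where
  \<open>v\<close> is large, so the interval is one of the two halves of a counted one.\<close>

lemma card_max_tame:
  assumes v: "dseq {0..<1} v" and K: "K > 0" and n: "n \<ge> 1" and j: "j \<ge> 1"
    and bd: "\<And>x. x \<in> {0..<1} \<Longrightarrow> \<bar>v n x\<bar> \<le> K"
  shows "card {k. max_tame n v j k \<and> \<bar>v 0 (real k / 2 ^ j)\<bar> > 9 * K * (1 / 2 ^ q) ^ n} \<le> 2 * cnt n * 2 ^ q"
    (is "card ?M \<le> _")
proof -
  obtain i where i: "j = Suc i" using j by (cases j) auto
  let ?W = "{k. k < 2 ^ i \<and> \<not> tame n v i k \<and> (\<exists>x\<in>dyad i k. \<bar>v 0 x\<bar> > 9 * K * (1 / 2 ^ q) ^ n)}"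
  have "?M \<subseteq> (\<lambda>(w, b). 2 * w + b) ` (?W \<times> {0, 1})"
  proof
    fix k assume k: "k \<in> ?M"
    have "k div 2 \<in> ?W"
      using k left_in_dyad[of k j] dyad_sub_parent[of i k] by (auto simp: i max_tame_def)
    then show "k \<in> (\<lambda>(w, b). 2 * w + b) ` (?W \<times> {0, 1})"
      by (intro image_eqI[of _ _ "(k div 2, k mod 2)"]) auto
  qed
  then have "card ?M \<le> card (?W \<times> {0, 1::nat})"
    by (rule surj_card_le[rotated]) simp
  also have "... = 2 * card ?W" by simp
  also have "... \<le> 2 * (cnt n * 2 ^ q)" using card_wild[OF v K n bd] by simp
  finally show ?thesis by simp
qed

text \<open>The 1 stands for the interval of level 0. In 16 = 2 * 4 * 2 the first 2 counts the
  halves of a parent, 4 = (2^n)^(2/n) is the rounding of a value to the next threshold, and the last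
  2 is the geometric sum over the sizes of the values. The denominator is the geometric sum over the
  levels.\<close>

definition C1 :: "nat \<Rightarrow> real" where
  "C1 n = 1 + 16 * real (cnt n) * 9 powr (2 / real n) / (1 - 2 powr - (2 / real n))"

lemma sum_geometric_le: "0 \<le> x \<Longrightarrow> x < 1 \<Longrightarrow> finite A \<Longrightarrow> (\<Sum>i\<in>A. x ^ i) \<le> 1 / (1 - x :: real)"
  using sum_le_suminf[of "\<lambda>i. x ^ i" A] suminf_geometric[of x] by simp

text \<open>Intervals are grouped by level j and by size of the value, about 2^(-q n). A group has
  at most a constant times 2^q members, and the exponent 2/n turns the value into 4^(-q) and the
  width 2^(-j) into a geometric term. The double series converges, uniformly in the cut-off
  \<open>R\<close>.\<close>

lemma tame_fam_sum:
  assumes v: "dseq {0..<1} v" and K: "K > 0" and n: "n \<ge> 1"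
    and bd: "\<And>x s. x \<in> {0..<1} \<Longrightarrow> s \<le> n \<Longrightarrow> \<bar>v s x\<bar> \<le> K"
  shows "(\<Sum>(j, k)\<in>tame_fam n v R. (\<bar>v 0 (real k / 2 ^ j)\<bar> / 2 ^ j) powr (2 / real n)) \<le> C1 n * K powr (2 / real n)"
proof -
  define \<tau> where "\<tau> = 2 / real n"
  have \<tau>: "\<tau> > 0" using n by (simp add: \<tau>_def)
  define val where "val = (\<lambda>(j, k). \<bar>v 0 (real k / 2 ^ j)\<bar>)"
  define h where "h = (\<lambda>x. (val x / 2 ^ fst x) powr \<tau>)"
  define F where "F = {x \<in> tame_fam n v R. fst x \<ge> 1}"
  have fin: "finite (tame_fam n v R)" "finite F" by (auto simp: finite_tame_fam F_def)
  have mem: "max_tame n v (fst x) (snd x)" "fst x \<le> R" "0 < val x" "val x \<le> K" if "x \<in> tame_fam n v R" for x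
  proof -
    obtain j k where jk: "x = (j, k)" by force
    have m: "j \<le> R" "max_tame n v j k" using that by (auto simp: tame_fam_def jk)
    then have "real k / 2 ^ j \<in> {0..<1}" "v 0 (real k / 2 ^ j) \<noteq> 0"
      using left_in_dyad[of k j] dyad_subset_unit by (auto simp: max_tame_def tame_def)
    then show "max_tame n v (fst x) (snd x)" "fst x \<le> R" "0 < val x" "val x \<le> K"
      using m bd[of "real k / 2 ^ j" 0] by (auto simp: jk val_def)
  qed
  \<comment> \<open>The least threshold below the value. It is never 0, because values are at most K
    < 9 K; so the preceding threshold exists and bounds the value from above.\<close>
  define q where "q = (\<lambda>x. LEAST q. val x > 9 * K * (1 / 2 ^ q) ^ n)"
  have q: "val x > 9 * K * (1 / 2 ^ q x) ^ n" "val x \<le> 9 * K * 2 ^ n * (1 / 2 ^ q x) ^ n" if x0: "x \<in> tame_fam n v R" for x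
  proof -
    have "\<exists>q. val x > 9 * K * (1 / 2 ^ q) ^ n"
    proof -
      obtain m where m: "(1 / 2) ^ m < val x / (9 * K)"
        using real_arch_pow_inv[of "val x / (9 * K)" "1/2"] mem(3)[OF x0] K by auto
      have "(1 / 2 ^ m) ^ n \<le> (1 / 2 ^ m :: real) ^ 1" using n by (intro power_decreasing) auto
      also have "... = (1 / 2) ^ m" by (simp add: power_divide)
      finally have "9 * K * (1 / 2 ^ m) ^ n \<le> 9 * K * (1 / 2) ^ m" using K by simp
      also have "... < val x" using m K by (simp add: field_simps)
      finally show ?thesis by blast
    qed
    then show qq: "val x > 9 * K * (1 / 2 ^ q x) ^ n" unfolding q_def by (rule LeastI_ex)
    have "q x \<noteq> 0"
    proof
      assume "q x = 0"
      then have "val x > 9 * K" using qq by simp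
      then show False using mem(4)[OF x0] K by simp
    qed
    then obtain m where m: "q x = Suc m" by (cases "q x") auto
    have "\<not> val x > 9 * K * (1 / 2 ^ m) ^ n"
      using not_less_Least[of m "\<lambda>q. val x > 9 * K * (1 / 2 ^ q) ^ n"] m by (simp add: q_def)
    then have "val x \<le> 9 * K * (1 / 2 ^ m) ^ n" by simp
    also have "... = 9 * K * 2 ^ n * (1 / 2 ^ q x) ^ n" by (simp add: m power_divide power_mult_distrib)
    finally show "val x \<le> 9 * K * 2 ^ n * (1 / 2 ^ q x) ^ n" .
  qed
  define Q where "Q = Max (insert 0 (q ` F))"
  have qQ: "q x \<le> Q" if "x \<in> F" for x unfolding Q_def using fin that by (intro Max_ge) auto
  define X where "X = 8 * real (cnt n) * (9 * K) powr \<tau>"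
  have pw: "(a ^ n) powr \<tau> = a ^ 2" if "a > 0" for a :: real
  proof -
    have "(a ^ n) powr \<tau> = (a powr real n) powr \<tau>" using that by (simp only: powr_realpow)
    also have "... = a powr 2" using n by (simp add: powr_powr \<tau>_def)
    finally show ?thesis using that by simp
  qed
  \<comment> \<open>For a group, the 2^m members and the bound proportional to 4^(-m) for each
    combine to 2^(-m).\<close>
  have part: "sum h {x \<in> F. (fst x, q x) = (j, m)} \<le> X * (2 powr - \<tau>) ^ j * (1 / 2) ^ m" for j m
  proof (cases "{x \<in> F. (fst x, q x) = (j, m)} = {}")
    case True
    have "0 \<le> X * (2 powr - \<tau>) ^ j * (1 / 2) ^ m" using K by (simp add: X_def)
    then show ?thesis by (simp only: True sum.empty)
  next
    case False
    then have j: "j \<ge> 1" by (auto simp: F_def)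
    let ?b = "(9 * K) powr \<tau> * 4 * (1 / 4) ^ m * (2 powr - \<tau>) ^ j"
    have "h x \<le> ?b" if "x \<in> {x \<in> F. (fst x, q x) = (j, m)}" for x
    proof -
      have x: "x \<in> tame_fam n v R" "fst x = j" "q x = m" using that by (auto simp: F_def)
      have "h x \<le> (9 * K * 2 ^ n * (1 / 2 ^ m) ^ n * (1 / 2 ^ j)) powr \<tau>"
        unfolding h_def using q(2)[OF x(1)] mem(3)[OF x(1)] x \<tau>
        by (intro powr_mono2) (auto simp: divide_right_mono)
      also have "... = (9 * K) powr \<tau> * (2 ^ n) powr \<tau> * ((1 / 2 ^ m) ^ n) powr \<tau> * (1 / 2 ^ j) powr \<tau>"
        using K by (simp only: powr_mult mult_nonneg_nonneg zero_le_numeral less_imp_le zero_le_power zero_le_divide_1_iff)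
      also have "... = (9 * K) powr \<tau> * 4 * (1 / 4) ^ m * (1 / 2 ^ j) powr \<tau>"
        by (subst (1 2) pw) (auto simp: power_divide power2_eq_square simp flip: power_mult_distrib)
      also have "(1 / 2 ^ j) powr \<tau> = (2 powr - \<tau>) ^ j"
      proof -
        have "1 / 2 ^ j = (2::real) powr - real j" by (simp add: powr_minus powr_realpow divide_inverse)
        then have "(1 / 2 ^ j) powr \<tau> = 2 powr (- \<tau> * real j)" by (simp add: powr_powr mult.commute)
        also have "... = (2 powr - \<tau>) powr real j" by (simp only: powr_powr)
        finally show ?thesis by (simp add: powr_realpow)
      qed
      finally show ?thesis .
    qed
    then have "sum h {x \<in> F. (fst x, q x) = (j, m)} \<le> real (card {x \<in> F. (fst x, q x) = (j, m)}) * ?b"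
      by (intro sum_bounded_above) auto
    also have "card {x \<in> F. (fst x, q x) = (j, m)} \<le> card {k. max_tame n v j k \<and> \<bar>v 0 (real k / 2 ^ j)\<bar> > 9 * K * (1 / 2 ^ m) ^ n}"
    proof (rule card_inj_on_le[of snd])
      show "inj_on snd {x \<in> F. (fst x, q x) = (j, m)}" by (auto simp: inj_on_def prod_eq_iff)
      show "snd ` {x \<in> F. (fst x, q x) = (j, m)} \<subseteq> {k. max_tame n v j k \<and> \<bar>v 0 (real k / 2 ^ j)\<bar> > 9 * K * (1 / 2 ^ m) ^ n}"
        using q(1) mem(1) by (fastforce simp: F_def val_def)
      show "finite {k. max_tame n v j k \<and> \<bar>v 0 (real k / 2 ^ j)\<bar> > 9 * K * (1 / 2 ^ m) ^ n}"
        by (rule finite_subset[of _ "{..<2 ^ j}"]) (auto simp: max_tame_def)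
    qed
    also have "... \<le> 2 * cnt n * 2 ^ m" using bd by (intro card_max_tame[OF v K n j]) auto
    also have "real (2 * cnt n * 2 ^ m) * ?b = X * (2 powr - \<tau>) ^ j * (1 / 2) ^ m"
      by (simp add: X_def power_divide field_simps flip: power_mult_distrib)
    finally show ?thesis using K by (simp add: mult_right_mono)
  qed
  have "2 powr - \<tau> < (1::real)" using \<tau> by (simp add: powr_less_one)
  then have t1: "1 - 2 powr - \<tau> > (0::real)" by simp
  have "sum h F = (\<Sum>y\<in>{..R} \<times> {..Q}. sum h {x \<in> F. (fst x, q x) = y})"
    using fin qQ mem(2) by (intro sum.group[symmetric]) (auto simp: F_def)
  also have "... \<le> (\<Sum>(j, m)\<in>{..R} \<times> {..Q}. X * (2 powr - \<tau>) ^ j * (1 / 2) ^ m)"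
    using part by (intro sum_mono) auto
  also have "... = X * ((\<Sum>j\<le>R. (2 powr - \<tau>) ^ j) * (\<Sum>m\<le>Q. (1 / 2) ^ m))"
    by (simp only: sum.cartesian_product[symmetric] sum_product) (simp add: sum_distrib_left mult.assoc)
  also have "... \<le> X * ((1 / (1 - 2 powr - \<tau>)) * (1 / (1 - 1 / 2)))"
    using \<open>2 powr - \<tau> < 1\<close> K by (intro mult_left_mono mult_mono sum_geometric_le sum_nonneg) (auto simp: X_def)
  also have "... = 16 * real (cnt n) * (9 powr \<tau>) / (1 - 2 powr - \<tau>) * K powr \<tau>"
    using K by (simp add: X_def powr_mult)
  finally have FF: "sum h F \<le> 16 * real (cnt n) * (9 powr \<tau>) / (1 - 2 powr - \<tau>) * K powr \<tau>" .
  have "{x \<in> tame_fam n v R. fst x = 0} \<subseteq> {(0, 0)}"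
    by (auto simp: tame_fam_def max_tame_def)
  then have "sum h {x \<in> tame_fam n v R. fst x = 0} \<le> K powr \<tau>"
  proof (cases "{x \<in> tame_fam n v R. fst x = 0} = {}")
    case False
    then have "{x \<in> tame_fam n v R. fst x = 0} = {(0, 0)}" using \<open>_ \<subseteq> {(0,0)}\<close> by auto
    moreover from this have "(0, 0) \<in> tame_fam n v R" by blast
    ultimately show ?thesis
      using mem(3,4)[of "(0,0)"] \<tau> by (simp only: sum.insert sum.empty finite.emptyI empty_iff not_False_eq_True) (simp add: h_def powr_mono2)
  next
    case True
    show ?thesis by (simp only: True sum.empty) simp
  qed
  moreover have "sum h (tame_fam n v R) = sum h F + sum h {x \<in> tame_fam n v R. fst x = 0}"
  proof -
    have "tame_fam n v R = F \<union> {x \<in> tame_fam n v R. fst x = 0}" "F \<inter> {x \<in> tame_fam n v R. fst x = 0} = {}"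
      by (auto simp: F_def)
    then show ?thesis using sum.union_disjoint[of F "{x \<in> tame_fam n v R. fst x = 0}" h] fin by simp
  qed
  ultimately have "sum h (tame_fam n v R) \<le> C1 n * K powr \<tau>"
    using FF by (simp add: C1_def \<tau>_def algebra_simps)
  then show ?thesis by (simp add: h_def val_def \<tau>_def case_prod_beta)
qed

text \<open>Tameness of the derivative of \<open>\<psi>\<close>, on an interval [c, c + a) that need
  not be dyadic. The shift of the orders comes from starting at the first derivative.\<close>

definition bdd_piece :: "nat \<Rightarrow> (nat \<Rightarrow> real \<Rightarrow> real) \<Rightarrow> real \<Rightarrow> real \<Rightarrow> bool" where
  "bdd_piece n \<psi> c a \<longleftrightarrow> a > 0 \<and> (\<forall>x\<in>{c..<c+a}. \<psi> 1 x \<noteq> 0 \<and>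
     (\<forall>y\<in>{c..<c+a}. \<forall>s\<in>{1..n}. a ^ s * \<bar>\<psi> (Suc s) x\<bar> \<le> \<bar>\<psi> 1 y\<bar>))"

lemma affine_dyad: "d > 0 \<Longrightarrow> x \<in> {c + d * (real k / 2 ^ j)..<c + d * (real k / 2 ^ j) + d / 2 ^ j} \<longleftrightarrow> (x - c) / d \<in> dyad j k"
  by (auto simp: dyad_def field_simps)

text \<open>The maximal tame intervals of the rescaled derivative, up to a level R, are the pieces.
  a' |G' c'| is the approximate length of the image of a piece, so the estimate is
  \<open>tame_fam_sum\<close>. Cutting off at R keeps the family finite and leaves a set of small
  measure uncovered.\<close>

lemma subdivide:
  assumes G: "dseq S G" and sub: "{c..<c+d} \<subseteq> S" and d: "d > 0" and n: "n \<ge> 1" and K: "K > 0" and \<kappa>: "\<kappa> > 0"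
    and bd: "\<And>x s. x \<in> {c..<c+d} \<Longrightarrow> 1 \<le> s \<Longrightarrow> s \<le> Suc n \<Longrightarrow> \<bar>G s x\<bar> * d ^ s \<le> K"
  obtains \<B> where "finite \<B>" "\<And>c' a'. (c', a') \<in> \<B> \<Longrightarrow> bdd_piece n G c' a' \<and> {c'..<c'+a'} \<subseteq> {c..<c+d}"
    "disjoint_family_on (\<lambda>(c', a'). {c'..<c'+a'}) \<B>"
    "(\<Sum>(c', a')\<in>\<B>. (a' * \<bar>G 1 c'\<bar>) powr (2 / real n)) \<le> C1 n * K powr (2 / real n)"
    "measure lborel ({x\<in>{c..<c+d}. G 1 x \<noteq> 0} - (\<Union>(c', a')\<in>\<B>. {c'..<c'+a'})) \<le> \<kappa>"
proof -
  \<comment> \<open>The derivatives of order s + 1 of t -> G (c + d t) on the unit interval.\<close>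
  define v where "v = (\<lambda>s t. d ^ Suc s * G (Suc s) (c + d * t))"
  have mem: "c + d * t \<in> {c..<c+d}" if "t \<in> {0..<1}" for t using that d by (auto simp: )
  have v: "dseq {0..<1} v"
    unfolding dseq_def
  proof (intro allI ballI)
    fix k and t :: real assume t: "t \<in> {0..<1}"
    have "(G (Suc k) has_real_derivative G (Suc (Suc k)) (c + d * t)) (at (c + d * t) within (\<lambda>t. c + d * t) ` {0..<1})"
      using mem t sub by (intro has_field_derivative_subset[OF dseq_real[OF G]]) blast+
    moreover have "((\<lambda>t. c + d * t) has_real_derivative d) (at t within {0..<1})"
      by (auto intro!: derivative_eq_intros)
    ultimately have "(G (Suc k) \<circ> (\<lambda>t. c + d * t) has_real_derivative G (Suc (Suc k)) (c + d * t) * d) (at t within {0..<1})"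
      by (rule DERIV_image_chain)
    then have "((\<lambda>t. d ^ Suc k * G (Suc k) (c + d * t)) has_real_derivative d ^ Suc k * (G (Suc (Suc k)) (c + d * t) * d)) (at t within {0..<1})"
      by (intro DERIV_cmult) (simp add: comp_def)
    then show "(v k has_vector_derivative v (Suc k) t) (at t within {0..<1})"
      by (simp add: v_def has_real_derivative_iff_has_vector_derivative mult_ac)
  qed
  have vb: "\<bar>v s t\<bar> \<le> K" if "t \<in> {0..<1}" "s \<le> n" for s t
    using bd[OF mem[OF that(1)], of "Suc s"] that d by (simp add: v_def abs_mult mult.commute)
  define f where "f = (\<lambda>(j::nat, k::nat). (c + d * (real k / 2 ^ j), d / 2 ^ j))"
  define iv where "iv = (\<lambda>(c', a'). {c'..<c'+a'::real})"
  have ivf: "x \<in> iv (f (j, k)) \<longleftrightarrow> (x - c) / d \<in> dyad j k" for x j k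
    using affine_dyad[OF d] by (simp add: iv_def f_def)
  have inj: "inj f"
  proof (rule injI)
    fix x y assume "f x = f y"
    moreover obtain j k j' k' where xy: "x = (j, k)" "y = (j', k')" by (metis surj_pair)
    ultimately have "j = j'" using d by (simp add: f_def)
    then show "x = y" using \<open>f x = f y\<close> d by (simp add: f_def xy)
  qed
  have tame: "bdd_piece n G (fst (f (j, k))) (snd (f (j, k)))" if "tame n v j k" for j k
    unfolding bdd_piece_def
  proof (intro conjI ballI)
    show "0 < snd (f (j, k))" using d by (simp add: f_def)
    fix x assume "x \<in> {fst (f (j, k))..<fst (f (j, k)) + snd (f (j, k))}"
    then have x: "(x - c) / d \<in> dyad j k" using ivf[of x j k] by (simp add: iv_def case_prod_beta)
    then show "G 1 x \<noteq> 0" using that d by (auto simp: tame_def v_def)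
    fix y s assume "y \<in> {fst (f (j, k))..<fst (f (j, k)) + snd (f (j, k))}" and s: "s \<in> {1..n}"
    then have y: "(y - c) / d \<in> dyad j k" using ivf[of y j k] by (simp add: iv_def case_prod_beta)
    have "(1 / 2 ^ j) ^ s * \<bar>v s ((x - c) / d)\<bar> \<le> \<bar>v 0 ((y - c) / d)\<bar>"
      using that x y s unfolding tame_def by blast
    then have "(1 / 2 ^ j) ^ s * (d ^ s * \<bar>G (Suc s) x\<bar>) \<le> \<bar>G 1 y\<bar>"
      using d by (simp add: v_def abs_mult mult_ac)
    then show "snd (f (j, k)) ^ s * \<bar>G (Suc s) x\<bar> \<le> \<bar>G 1 y\<bar>"
      by (simp add: f_def power_divide)
  qed
  define \<B> where "\<B> = (\<lambda>R. f ` tame_fam n v R)"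
  define U where "U = (\<lambda>R. \<Union>(iv ` \<B> R))"
  define X where "X = (\<lambda>R. {x\<in>{c..<c+d}. G 1 x \<noteq> 0} - U R)"
  have "{x\<in>{c..<c+d}. G 1 x \<noteq> 0} \<in> sets borel"
  proof -
    have "continuous_on {c..<c+d} (G 1)" using dseq_continuous[OF dseq_subset[OF G sub]] .
    then have "G 1 \<in> borel_measurable (restrict_space borel {c..<c+d})"
      by (rule borel_measurable_continuous_on_restrict)
    then have "{x\<in>space (restrict_space borel {c..<c+d}). G 1 x \<noteq> 0} \<in> sets (restrict_space borel {c..<c+d})"
      by measurable
    then show ?thesis by (auto simp: space_restrict_space sets_restrict_space_iff)
  qed
  moreover have "U R \<in> sets borel" for R
    unfolding U_def \<B>_def using finite_tame_fam[of n v R] by (auto simp: iv_def case_prod_beta intro!: sets.finite_Union)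
  ultimately have Xm: "X R \<in> sets lborel" for R by (auto simp: X_def)
  have Umono: "U R \<subseteq> U R'" if "R \<le> R'" for R R'
  proof -
    have "tame_fam n v R \<subseteq> tame_fam n v R'" using that by (auto simp: tame_fam_def)
    then show ?thesis unfolding U_def \<B>_def by blast
  qed
  have "(\<lambda>R. measure lborel (X R)) \<longlonglongrightarrow> measure lborel (\<Inter>R. X R)"
  proof (rule Lim_measure_decseq)
    show "range X \<subseteq> sets lborel" using Xm by auto
    show "decseq X" using Umono by (auto simp: decseq_def X_def)
    have "emeasure lborel (X R) \<le> emeasure lborel {c..<c+d}" for R by (intro emeasure_mono) (auto simp: X_def)
    then show "emeasure lborel (X R) \<noteq> \<infinity>" for R using d
      by (metis emeasure_lborel_Ico ennreal_neq_top infinity_ennreal_def less_eq_real_def less_add_same_cancel1 neq_top_trans)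
  qed
  \<comment> \<open>A point where the derivative does not vanish lies in some tame interval, hence
    in a maximal one, and is covered once R reaches the level of that one.\<close>
  moreover have "(\<Inter>R. X R) = {}"
  proof (rule equals0I)
    fix x assume "x \<in> (\<Inter>R. X R)"
    then have x: "x \<in> {c..<c+d}" "G 1 x \<noteq> 0" "\<And>R. x \<notin> U R" by (auto simp: X_def)
    have "(x - c) / d \<in> {0..<1}" "v 0 ((x - c) / d) \<noteq> 0" using x d by (auto simp: v_def)
    from tame_near[OF v _ K this, of n] vb obtain j k where "k < 2 ^ j" "tame n v j k" "(x - c) / d \<in> dyad j k" by auto
    from max_tame_exists[OF this(2,1,3)] obtain j' k' where "max_tame n v j' k'" "(x - c) / d \<in> dyad j' k'" by auto
    then have "x \<in> U j'" unfolding U_def \<B>_def using ivf[of x j' k'] by (force simp: tame_fam_def)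
    then show False using x by auto
  qed
  ultimately have "(\<lambda>R. measure lborel (X R)) \<longlonglongrightarrow> 0" by simp
  then have "\<forall>\<^sub>F R in sequentially. measure lborel (X R) < \<kappa>" using \<kappa> by (rule order_tendstoD)
  then obtain R where R: "measure lborel (X R) < \<kappa>" by (auto dest: eventually_happens)
  show thesis
  proof (rule that[of "\<B> R"])
    show "finite (\<B> R)" by (simp add: \<B>_def finite_tame_fam)
    show "bdd_piece n G c' a' \<and> {c'..<c'+a'} \<subseteq> {c..<c+d}" if mB: "(c', a') \<in> \<B> R" for c' a'
    proof -
      obtain j k where jk: "(c', a') = f (j, k)" "max_tame n v j k" using mB by (auto simp: \<B>_def tame_fam_def)
      have "x \<in> {c..<c+d}" if "x \<in> iv (f (j, k))" for x
        using that[unfolded ivf] dyad_subset_unit[of k j] jk(2) d by (auto simp: max_tame_def field_simps dest!: subsetD)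
      moreover have "fst (f (j, k)) = c'" "snd (f (j, k)) = a'" "iv (f (j, k)) = {c'..<c' + a'}"
        unfolding jk(1)[symmetric] by (simp_all add: iv_def)
      ultimately show ?thesis using tame[of j k] jk(2) unfolding max_tame_def by (metis subsetI)
    qed
    show "disjoint_family_on (\<lambda>(c', a'). {c'..<c'+a'}) (\<B> R)"
      unfolding disjoint_family_on_def
    proof (intro ballI impI, rule equals0I)
      fix p q x assume "p \<in> \<B> R" "q \<in> \<B> R" "p \<noteq> q" "x \<in> (case p of (c', a') \<Rightarrow> {c'..<c'+a'}) \<inter> (case q of (c', a') \<Rightarrow> {c'..<c'+a'})"
      moreover then obtain j k j' k' where "p = f (j, k)" "max_tame n v j k" "q = f (j', k')" "max_tame n v j' k'"
        by (auto simp: \<B>_def tame_fam_def)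
      ultimately show False using max_tame_disjoint[of n v j k j' k' "(x - c) / d"] ivf[of x j k] ivf[of x j' k'] by (auto simp: iv_def)
    qed
    have "(\<Sum>(c', a')\<in>\<B> R. (a' * \<bar>G 1 c'\<bar>) powr (2 / real n))
      = (\<Sum>(j, k)\<in>tame_fam n v R. (\<bar>v 0 (real k / 2 ^ j)\<bar> / 2 ^ j) powr (2 / real n))"
      unfolding \<B>_def using d by (subst sum.reindex[OF inj_on_subset[OF inj]]) (auto simp: f_def v_def abs_mult case_prod_beta)
    then show "(\<Sum>(c', a')\<in>\<B> R. (a' * \<bar>G 1 c'\<bar>) powr (2 / real n)) \<le> C1 n * K powr (2 / real n)"
      using tame_fam_sum[OF v K n vb] by simp
    show "measure lborel ({x\<in>{c..<c+d}. G 1 x \<noteq> 0} - (\<Union>(c', a')\<in>\<B> R. {c'..<c'+a'})) \<le> \<kappa>"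
      using R by (simp add: X_def U_def iv_def)
  qed
qed


section \<open>Pieces of bounded distortion\<close>

lemma borel_restrict_indicator:
  fixes f :: "real \<Rightarrow> real"
  assumes "f \<in> borel_measurable (restrict_space borel A)" "A \<in> sets borel"
  shows "(\<lambda>x. ennreal (f x) * indicator A x) \<in> borel_measurable lborel"
  using measurable_compose[OF assms(1) measurable_ennreal] assms(2)
  by (subst (asm) borel_measurable_restrict_space_iff_ennreal) auto

lemmas borel_continuous_indicator = borel_restrict_indicator[OF borel_measurable_continuous_on_restrict]

lemma bdd_piece_sub:
  assumes "bdd_piece n \<psi> c a" "{c'..<c'+a'} \<subseteq> {c..<c+a}" "a' > 0"
  shows "bdd_piece n \<psi> c' a'"
  unfolding bdd_piece_def
proof (intro conjI ballI)
  have c: "c \<le> c'" "c' + a' \<le> c + a" using assms(2,3) by auto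
  fix x assume x: "x \<in> {c'..<c'+a'}"
  then show "\<psi> 1 x \<noteq> 0" using assms unfolding bdd_piece_def by blast
  fix y s assume y: "y \<in> {c'..<c'+a'}" and s: "s \<in> {1..n}"
  have "a' ^ s * \<bar>\<psi> (Suc s) x\<bar> \<le> a ^ s * \<bar>\<psi> (Suc s) x\<bar>"
    using c assms(3) by (intro mult_right_mono power_mono) auto
  also have "... \<le> \<bar>\<psi> 1 y\<bar>" using assms(1,2) x y s unfolding bdd_piece_def by blast
  finally show "a' ^ s * \<bar>\<psi> (Suc s) x\<bar> \<le> \<bar>\<psi> 1 y\<bar>" .
qed (use assms in auto)

text \<open>The condition for s = 1 bounds the second derivative by |\<psi>' y| / a, so \<psi>'
  varies by at most |\<psi>' y| over an interval of length a.\<close>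

lemma bdd_piece_distortion:
  assumes b: "bdd_piece n \<psi> c a" and \<psi>: "dseq S \<psi>" and J: "{c..<c+a} \<subseteq> S" and n: "n \<ge> 1"
    and x: "x \<in> {c..<c+a}" and y: "y \<in> {c..<c+a}"
  shows "\<bar>\<psi> 1 x\<bar> \<le> 2 * \<bar>\<psi> 1 y\<bar>"
proof -
  have a: "a > 0" using b by (simp add: bdd_piece_def)
  have "norm (\<psi> 1 x - \<psi> 1 y) \<le> (\<bar>\<psi> 1 y\<bar> / a) * norm (x - y)"
  proof (rule field_differentiable_bound[of "{c..<c+a}"])
    fix z assume z: "z \<in> {c..<c+a}"
    show "(\<psi> 1 has_real_derivative \<psi> (Suc 1) z) (at z within {c..<c+a})"
      using dseq_real[OF dseq_subset[OF \<psi> J] z] by simp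
    have "a ^ 1 * \<bar>\<psi> (Suc 1) z\<bar> \<le> \<bar>\<psi> 1 y\<bar>"
      using b z y n unfolding bdd_piece_def by force
    then show "norm (\<psi> (Suc 1) z) \<le> \<bar>\<psi> 1 y\<bar> / a" using a by (simp add: field_simps)
  qed (use x y in auto)
  also have "... \<le> (\<bar>\<psi> 1 y\<bar> / a) * a" using x y a by (intro mult_left_mono) auto
  finally show ?thesis using a by simp
qed

lemma dseq_mvt:
  assumes "dseq S \<psi>" "x < y" "{x..y} \<subseteq> S"
  shows "\<exists>z\<in>{x<..<y}. \<psi> k y - \<psi> k x = \<psi> (Suc k) z * (y - x)"
proof -
  have "(\<psi> k has_derivative (*) (\<psi> (Suc k) z)) (at z within {x..y})" if "x \<le> z" "z \<le> y" for z
    using dseq_real[OF dseq_subset[OF assms(1,3)], of z k] that by (simp add: has_field_derivative_def)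
  from mvt_simple[OF assms(2) this] show ?thesis .
qed

text \<open>Change of variables on a monotone branch: Lebesgue measure is pushed to a measure of
  density at most 1 / b, carried by an interval of length at most B. \<open>Iu\<close> bounds the
  integral of \<open>u\<close> over any such interval.\<close>

lemma push_piece:
  assumes \<psi>: "dseq S \<psi>" and J: "{c..<c+a} \<subseteq> S" and a: "a > 0" and S: "closed S" "convex S" and im: "\<psi> 0 ` S \<subseteq> S"
    and b: "b > 0" "\<And>x. x \<in> {c..<c+a} \<Longrightarrow> b \<le> \<bar>\<psi> 1 x\<bar>" and B: "\<And>x. x \<in> {c..<c+a} \<Longrightarrow> \<bar>\<psi> 1 x\<bar> * a \<le> B"
    and u: "continuous_on S u" "\<And>x. x \<in> S \<Longrightarrow> u x \<ge> (0::real)"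
    and Iu: "\<And>lo hi. lo \<le> hi \<Longrightarrow> {lo..hi} \<subseteq> S \<Longrightarrow> hi - lo \<le> B \<Longrightarrow> integral {lo..hi} u \<le> Iu"
  shows "(\<integral>\<^sup>+x\<in>{c..<c+a}. ennreal (u (\<psi> 0 x)) \<partial>lborel) \<le> ennreal (Iu / b)"
proof -
  let ?J = "{c..<c+a}"
  have der: "(\<psi> 0 has_real_derivative \<psi> 1 x) (at x within ?J)" if "x \<in> ?J" for x
    using dseq_real[OF dseq_subset[OF \<psi> J] that, of 0] by simp
  have mvt: "\<exists>z\<in>?J. \<psi> 0 y - \<psi> 0 x = \<psi> 1 z * (y - x)" if "x < y" "x \<in> ?J" "y \<in> ?J" for x y
  proof -
    have "{x..y} \<subseteq> ?J" using that by auto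
    from dseq_mvt[OF \<psi> that(1) order.trans[OF this J], of 0] show ?thesis using that by force
  qed
  have lip: "\<bar>\<psi> 0 y - \<psi> 0 x\<bar> \<le> B" if xy: "x < y" "x \<in> ?J" "y \<in> ?J" for x y
  proof -
    obtain z where z: "z \<in> ?J" "\<psi> 0 y - \<psi> 0 x = \<psi> 1 z * (y - x)" using mvt[OF xy] by blast
    have "\<bar>\<psi> 1 z\<bar> * (y - x) \<le> \<bar>\<psi> 1 z\<bar> * a" using xy by (intro mult_left_mono) auto
    then show ?thesis using B[OF z(1)] xy by (simp add: z(2) abs_mult)
  qed
  have B0: "B \<ge> 0" using B[of c] a by (auto intro: order.trans[rotated])
  have lip': "\<bar>\<psi> 0 y - \<psi> 0 x\<bar> \<le> B" if "x \<in> ?J" "y \<in> ?J" for x y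
    using lip[of x y] lip[of y x] that B0 by (cases x y rule: linorder_cases) auto
  have inj: "inj_on (\<psi> 0) ?J"
  proof (rule linorder_inj_onI)
    fix x y assume "x < y" "x \<in> ?J" "y \<in> ?J"
    then obtain z where z: "z \<in> ?J" "\<psi> 0 y - \<psi> 0 x = \<psi> 1 z * (y - x)" using mvt by blast
    then show "\<psi> 0 x \<noteq> \<psi> 0 y" using b(1) b(2)[OF z(1)] \<open>x < y\<close> by auto
  qed auto
  let ?I = "\<psi> 0 ` ?J"
  have ne: "?I \<noteq> {}" using a by auto
  have IS: "?I \<subseteq> S" using J im by blast
  have bdI: "bounded ?I"
    unfolding bounded_def using lip'[of c] a by (intro exI[of _ "\<psi> 0 c"] exI[of _ B]) (auto simp: dist_real_def abs_minus_commute)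
  then have bb: "bdd_below ?I" "bdd_above ?I" by (auto simp: bounded_imp_bdd_below bounded_imp_bdd_above)
  \<comment> \<open>The image is an interval that need not be closed. Its closed hull still lies in
    S, since S is closed and convex, and has length at most B.\<close>
  define lo hi where "lo = Inf ?I" and "hi = Sup ?I"
  have sub: "?I \<subseteq> {lo..hi}" using bb by (auto simp: lo_def hi_def intro!: cInf_lower cSup_upper)
  have "lo \<in> closure ?I" "hi \<in> closure ?I"
    unfolding lo_def hi_def using ne bb by (auto intro: closure_contains_Inf closure_contains_Sup)
  then have loS: "lo \<in> S" "hi \<in> S" using closure_minimal[OF IS S(1)] by auto
  have lohi: "lo \<le> hi" using ne sub by force
  have Slohi: "{lo..hi} \<subseteq> S" using loS S(2) by (metis closed_segment_eq_real_ivl1 closed_segment_subset lohi)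
  have "hi - lo \<le> B"
  proof -
    have "y \<le> lo + B" if "y \<in> ?I" for y
    proof -
      have "y - B \<le> Inf ?I"
      proof (rule cInf_greatest[OF ne])
        fix z assume "z \<in> ?I"
        then show "y - B \<le> z" using that lip' by (force simp: abs_le_iff)
      qed
      then show ?thesis by (simp add: lo_def)
    qed
    then have "hi \<le> lo + B" unfolding hi_def by (intro cSup_least[OF ne])
    then show ?thesis by simp
  qed
  then have int: "integral {lo..hi} u \<le> Iu" by (rule Iu[OF lohi Slohi])
  have ai: "u absolutely_integrable_on {lo..hi}"
    by (intro absolutely_integrable_continuous_real continuous_on_subset[OF u(1) Slohi])
  have cont: "continuous_on ?J (\<psi> 0)" by (rule dseq_continuous[OF dseq_subset[OF \<psi> J]])
  have "connected ?J" using is_interval_co is_interval_connected_1 by blast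
  then have "convex ?I"
    using connected_continuous_image[OF cont] by (simp add: is_interval_connected_1[symmetric] is_interval_convex_1)
  then have mI: "?I \<in> sets lebesgue" using measurable_convex bdI by (auto intro: fmeasurableD)
  have aiI: "u absolutely_integrable_on ?I"
    by (rule set_integrable_subset[OF ai mI sub])
  have intI: "integral ?I u \<le> integral {lo..hi} u"
    using u(2) Slohi by (intro integral_subset_le sub set_lebesgue_integral_eq_integral(1)[OF aiI] set_lebesgue_integral_eq_integral(1)[OF ai]) auto
  have "(\<lambda>x. \<bar>\<psi> 1 x\<bar> * u (\<psi> 0 x)) absolutely_integrable_on ?J \<and> integral ?J (\<lambda>x. \<bar>\<psi> 1 x\<bar> * u (\<psi> 0 x)) = integral ?I u"
    using has_absolute_integral_change_of_variables_1'[OF _ der inj, of u "integral ?I u"] aiI by auto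
  then have "((\<lambda>x. \<bar>\<psi> 1 x\<bar> * u (\<psi> 0 x)) has_integral integral ?I u) ?J"
    by (metis has_integral_integral set_lebesgue_integral_eq_integral(1))
  moreover have u0: "u (\<psi> 0 x) \<ge> 0" if "x \<in> ?J" for x using that IS u(2) by blast
  ultimately have "(\<integral>\<^sup>+x\<in>?J. ennreal (\<bar>\<psi> 1 x\<bar> * u (\<psi> 0 x)) \<partial>lborel) = ennreal (integral ?I u)"
    by (intro nn_integral_has_integral_lebesgue') auto
  moreover have "(\<integral>\<^sup>+x\<in>?J. ennreal (u (\<psi> 0 x)) \<partial>lborel) \<le> (\<integral>\<^sup>+x. ennreal (1 / b) * (ennreal (\<bar>\<psi> 1 x\<bar> * u (\<psi> 0 x)) * indicator ?J x) \<partial>lborel)"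
  proof (rule nn_integral_mono)
    fix x
    show "ennreal (u (\<psi> 0 x)) * indicator ?J x \<le> ennreal (1 / b) * (ennreal (\<bar>\<psi> 1 x\<bar> * u (\<psi> 0 x)) * indicator ?J x)"
    proof (cases "x \<in> ?J")
      case True
      have "b * u (\<psi> 0 x) \<le> \<bar>\<psi> 1 x\<bar> * u (\<psi> 0 x)" using b(2)[OF True] u0[OF True] by (rule mult_right_mono)
      then show ?thesis using True b(1) by (simp add: ennreal_mult'[symmetric] field_simps ennreal_leI)
    qed simp
  qed
  moreover have "(\<integral>\<^sup>+x. ennreal (1 / b) * (ennreal (\<bar>\<psi> 1 x\<bar> * u (\<psi> 0 x)) * indicator ?J x) \<partial>lborel)
     = ennreal (1 / b) * (\<integral>\<^sup>+x\<in>?J. ennreal (\<bar>\<psi> 1 x\<bar> * u (\<psi> 0 x)) \<partial>lborel)"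
  proof (rule nn_integral_cmult)
    show "(\<lambda>x. ennreal (\<bar>\<psi> 1 x\<bar> * u (\<psi> 0 x)) * indicator ?J x) \<in> borel_measurable lborel"
      using IS J by (intro borel_continuous_indicator continuous_intros dseq_continuous[OF dseq_subset[OF \<psi> J]]
          continuous_on_compose2[OF u(1) cont]) auto
  qed
  moreover have "ennreal (1 / b) * ennreal (integral ?I u) \<le> ennreal (Iu / b)"
    using b(1) int intI by (simp add: ennreal_mult'[symmetric] ennreal_leI divide_right_mono)
  ultimately show ?thesis by simp
qed

lemma split_piece:
  assumes b: "bdd_piece n \<psi> c a" and \<psi>: "dseq S \<psi>" and J: "{c..<c+a} \<subseteq> S" and n: "n \<ge> 1"
    and eps: "0 < eps" "eps < a * \<bar>\<psi> 1 c\<bar>"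
  obtains \<P> where "finite \<P>"
    "\<And>c' a'. (c', a') \<in> \<P> \<Longrightarrow> bdd_piece n \<psi> c' a' \<and> {c'..<c'+a'} \<subseteq> {c..<c+a} \<and> eps / 6 \<le> a' * \<bar>\<psi> 1 c'\<bar> \<and> a' * \<bar>\<psi> 1 c'\<bar> \<le> eps"
    "disjoint_family_on (\<lambda>(c', a'). {c'..<c'+a'}) \<P>"
    "{c..<c+a} = (\<Union>(c', a')\<in>\<P>. {c'..<c'+a'})"
    "(\<Sum>(c', a')\<in>\<P>. a') = a"
proof -
  have a: "a > 0" using b by (simp add: bdd_piece_def)
  define l where "l = a * \<bar>\<psi> 1 c\<bar>"
  \<comment> \<open>Equal parts. With distortion 2, at least 2 l / \<open>eps\<close> parts bring
    the image lengths below \<open>eps\<close>; and k \<le> 3 l / \<open>eps\<close>, as l >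
    \<open>eps\<close>, keeps them above \<open>eps\<close> / 6.\<close>
  define k where "k = nat \<lceil>2 * l / eps\<rceil>"
  have l: "l > eps" "l > 0" using eps by (auto simp: l_def)
  have k1: "real k \<ge> 2 * l / eps" by (simp add: k_def real_nat_ceiling_ge)
  have "real k \<le> 2 * l / eps + 1"
    using l eps by (simp add: k_def)
  also have "1 \<le> l / eps" using l eps by simp
  finally have k2: "real k \<le> 3 * l / eps" by (simp add: field_simps)
  have k0: "real k > 0" using k1 l eps by (smt (verit) divide_pos_pos)
  define h where "h = a / real k"
  have h: "h > 0" using a k0 by (simp add: h_def)
  have hk: "real k * h = a" using k0 by (simp add: h_def)
  define P where "P = (\<lambda>i. (c + real i * h, h)) ` {..<k}"
  have inj: "inj_on (\<lambda>i. (c + real i * h, h)) {..<k}" using h by (auto simp: inj_on_def)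
  have sub: "{c + real i * h..<c + real i * h + h} \<subseteq> {c..<c+a}" if "i < k" for i
  proof -
    have "(real i + 1) * h \<le> real k * h" using that h by (intro mult_right_mono) auto
    then have "real i * h + h \<le> a" using hk by (simp add: algebra_simps)
    moreover have "0 \<le> real i * h" using h by simp
    ultimately show ?thesis by auto
  qed
  show thesis
  proof (rule that[of P])
    show "finite P" by (simp add: P_def)
    show "bdd_piece n \<psi> c' a' \<and> {c'..<c'+a'} \<subseteq> {c..<c+a} \<and> eps / 6 \<le> a' * \<bar>\<psi> 1 c'\<bar> \<and> a' * \<bar>\<psi> 1 c'\<bar> \<le> eps"
      if mem: "(c', a') \<in> P" for c' a'
    proof -
      obtain i where i: "i < k" "c' = c + real i * h" "a' = h" using mem by (auto simp: P_def)
      have s: "{c'..<c'+a'} \<subseteq> {c..<c+a}" using sub i by simp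
      have c': "c' \<in> {c..<c+a}" "c \<in> {c..<c+a}" using s h i a by auto
      have "h * \<bar>\<psi> 1 c'\<bar> \<le> h * (2 * \<bar>\<psi> 1 c\<bar>)"
        using bdd_piece_distortion[OF b \<psi> J n c'] h by simp
      also have "... = 2 * l / real k" by (simp add: h_def l_def)
      also have "... \<le> eps" using k1 k0 eps by (simp add: field_simps)
      finally have up: "h * \<bar>\<psi> 1 c'\<bar> \<le> eps" .
      have "eps / 6 \<le> l / (2 * real k)" using k2 k0 eps by (simp add: field_simps)
      also have "... = h * \<bar>\<psi> 1 c\<bar> / 2" by (simp add: h_def l_def)
      also have "... \<le> h * \<bar>\<psi> 1 c'\<bar>"
        using bdd_piece_distortion[OF b \<psi> J n c'(2,1)] h by simp
      finally show ?thesis using up s bdd_piece_sub[OF b s] h i by simp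
    qed
    show "disjoint_family_on (\<lambda>(c', a'). {c'..<c'+a'}) P"
      unfolding disjoint_family_on_def
    proof (intro ballI impI)
      fix p q assume pq: "p \<in> P" "q \<in> P" "p \<noteq> q"
      obtain i j where ij: "p = (c + real i * h, h)" "q = (c + real j * h, h)" using pq by (auto simp: P_def)
      have dis: "{c + real i * h..<c + real i * h + h} \<inter> {c + real j * h..<c + real j * h + h} = {}" if "i < j" for i j
      proof -
        have "(real i + 1) * h \<le> real j * h" using that h by (intro mult_right_mono) auto
        then show ?thesis by (auto simp: algebra_simps)
      qed
      have "i \<noteq> j" using pq ij by auto
      then consider "i < j" | "j < i" by linarith
      then show "(case p of (c', a') \<Rightarrow> {c'..<c'+a'}) \<inter> (case q of (c', a') \<Rightarrow> {c'..<c'+a'}) = {}"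
        using dis[of i j] dis[of j i] by cases (auto simp: ij)
    qed
    show "{c..<c+a} = (\<Union>(c', a')\<in>P. {c'..<c'+a'})"
    proof (intro equalityI subsetI)
      fix x assume x: "x \<in> {c..<c+a}"
      define i where "i = nat \<lfloor>(x - c) / h\<rfloor>"
      have "0 \<le> (x - c) / h" using x h by auto
      then have i: "real i \<le> (x - c) / h" "(x - c) / h < real i + 1" unfolding i_def by linarith+
      have "(x - c) / h < real k" using x hk h by (auto simp: field_simps)
      then have "i < k" using i by linarith
      moreover have "x \<in> {c + real i * h..<c + real i * h + h}" using i h by (auto simp: field_simps)
      ultimately show "x \<in> (\<Union>(c', a')\<in>P. {c'..<c'+a'})" by (force simp: P_def)
    next
      fix x assume "x \<in> (\<Union>(c', a')\<in>P. {c'..<c'+a'})"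
      then obtain i where "i < k" "x \<in> {c + real i * h..<c + real i * h + h}" by (auto simp: P_def)
      then show "x \<in> {c..<c+a}" using sub by blast
    qed
    show "(\<Sum>(c', a')\<in>P. a') = a"
      unfolding P_def using hk by (subst sum.reindex[OF inj]) simp
  qed
qed


lemma nn_integral_UN_le:
  assumes "finite I" "\<And>i. i \<in> I \<Longrightarrow> (\<lambda>x. f x * indicator (A i) x) \<in> borel_measurable M"
  shows "(\<integral>\<^sup>+x\<in>(\<Union>i\<in>I. A i). f x \<partial>M) \<le> (\<Sum>i\<in>I. \<integral>\<^sup>+x\<in>A i. f x \<partial>M)"
proof -
  have "(\<integral>\<^sup>+x\<in>(\<Union>i\<in>I. A i). f x \<partial>M) \<le> (\<integral>\<^sup>+x. (\<Sum>i\<in>I. f x * indicator (A i) x) \<partial>M)"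
  proof (rule nn_integral_mono)
    fix x
    show "f x * indicator (\<Union>i\<in>I. A i) x \<le> (\<Sum>i\<in>I. f x * indicator (A i) x)"
    proof (cases "x \<in> (\<Union>i\<in>I. A i)")
      case True
      then obtain i where "i \<in> I" "x \<in> A i" by blast
      then have "f x * indicator (A i) x \<le> (\<Sum>i\<in>I. f x * indicator (A i) x)"
        using assms(1) by (intro member_le_sum) auto
      then show ?thesis using True \<open>x \<in> A i\<close> by simp
    qed simp
  qed
  also have "... = (\<Sum>i\<in>I. \<integral>\<^sup>+x\<in>A i. f x \<partial>M)" by (rule nn_integral_sum) (rule assms(2))
  finally show ?thesis .
qed

lemma sum_UN_le:
  fixes f :: "'a \<Rightarrow> real"
  assumes "finite I" "\<And>i. i \<in> I \<Longrightarrow> finite (A i)" "\<And>i x. i \<in> I \<Longrightarrow> x \<in> A i \<Longrightarrow> f x \<ge> 0"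
  shows "sum f (\<Union>i\<in>I. A i) \<le> (\<Sum>i\<in>I. sum f (A i))"
  using assms
proof (induction I rule: finite_induct)
  case (insert i I)
  have "sum f (A i \<union> (\<Union>i\<in>I. A i)) + sum f (A i \<inter> (\<Union>i\<in>I. A i)) = sum f (A i) + sum f (\<Union>i\<in>I. A i)"
    using insert by (intro sum.union_inter) auto
  moreover have "sum f (A i \<inter> (\<Union>i\<in>I. A i)) \<ge> 0" using insert by (intro sum_nonneg) auto
  moreover have "sum f (\<Union>i\<in>I. A i) \<le> (\<Sum>i\<in>I. sum f (A i))" using insert by (intro insert.IH) auto
  ultimately show ?case using insert.hyps by simp
qed simp

section \<open>Iteration of curves in short pieces\<close>

definition cc :: "nat \<Rightarrow> real" where "cc n = (\<Sum>k\<le>Suc n. comp_const k)"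

lemma cc_ge: "k \<le> Suc n \<Longrightarrow> comp_const k \<le> cc n"
  unfolding cc_def by (rule member_le_sum) (auto simp: comp_const_nonneg)

lemma cc_ge1: "cc n \<ge> 1" using cc_ge[of 0 n] by simp

text \<open>Weighted pieces are triples of left end, width and weight.\<close>

abbreviation (input) "wd t \<equiv> fst (snd t)"
abbreviation (input) "wt t \<equiv> snd (snd t)"

text \<open>In the application \<open>g\<close> is the lift of f^p. For k = 1 the assumption
  \<open>gb\<close> says that E bounds the first derivative; for higher k it says that
  \<open>eps\<close> is so small that, rescaled to size 2 \<open>eps\<close>, the higher derivatives
  obey the same bound. With n \<ge> 3 the exponent 2/n is below 1.\<close>

locale iter_map =
  fixes S :: "real set" and g :: "nat \<Rightarrow> real \<Rightarrow> real" and n :: nat and E eps :: real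
  assumes S: "closed S" "convex S" and g: "dseq S g" and gS: "g 0 ` S \<subseteq> S"
    and n3: "n \<ge> 3" and E: "E \<ge> 1" and eps: "eps > 0"
    and gb: "\<And>x k. x \<in> S \<Longrightarrow> 1 \<le> k \<Longrightarrow> k \<le> Suc n \<Longrightarrow> \<bar>g k x\<bar> * (2 * eps) ^ (k - 1) \<le> E"
begin

primrec it :: "nat \<Rightarrow> nat \<Rightarrow> real \<Rightarrow> real" where
  "it 0 = (\<lambda>k x. if k = 0 then x else if k = 1 then 1 else 0)"
| "it (Suc m) = comp_seq g (it m)"

abbreviation "\<tau> \<equiv> 2 / real n"

definition lp :: "real \<Rightarrow> real" where "lp y = ln (max 1 \<bar>g 1 y\<bar>)"

definition len :: "nat \<Rightarrow> real \<Rightarrow> real \<Rightarrow> real" where "len m c a = a * \<bar>it m 1 c\<bar>"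

abbreviation (input) "plen m p \<equiv> len m (fst p) (snd p)"
abbreviation (input) "tlen m t \<equiv> len m (fst t) (wd t)"
abbreviation (input) "tw m t \<equiv> wd t * wt t * tlen m t powr (\<tau> - 1)"
abbreviation (input) "pbdd m p \<equiv> bdd_piece n (it m) (fst p) (snd p)"
abbreviation (input) "tbdd m t \<equiv> bdd_piece n (it m) (fst t) (wd t)"

text \<open>The factor by which the sum of length^\<tau> grows in one step: a piece of length l has
  rescaled derivatives at most \<open>cc n\<close> E (2 l) after the step, and
  \<open>subdivide\<close> multiplies the power \<tau> of this bound by \<open>C1 n\<close>.\<close>

definition \<theta>1 :: real where "\<theta>1 = C1 n * (2 * cc n * E) powr \<tau>"

lemma \<tau>: "0 < \<tau>" "\<tau> < 1" using n3 by auto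

lemma C1_ge1: "C1 n \<ge> 1"
proof -
  have "2 powr - \<tau> < (1::real)" using \<tau> by (simp add: powr_less_one)
  then show ?thesis by (simp add: C1_def)
qed

lemma \<theta>1: "\<theta>1 \<ge> 1"
proof -
  have "1 \<le> (2 * cc n) * E" using cc_ge1[of n] E by (intro mult_ge1_I) auto
  then have "(2 * cc n * E) powr \<tau> \<ge> 1" using \<tau> by (intro ge_one_powr_ge_zero) auto
  then show ?thesis unfolding \<theta>1_def using C1_ge1 by (intro mult_ge1_I) auto
qed

lemma it_1: "it (Suc m) 1 x = g 1 (it m 0 x) * it m 1 x" by simp

lemma it_S: "x \<in> S \<Longrightarrow> it m 0 x \<in> S"
  by (induction m) (use gS in auto)

lemma it_dseq: "dseq S (it m)"
proof (induction m)
  case 0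
  show ?case by (auto simp: dseq_def intro!: derivative_eq_intros)
next
  case (Suc m)
  then show ?case using dseq_comp[OF g Suc] it_S by (auto simp del: comp_seq.simps)
qed

lemma g1_le: "x \<in> S \<Longrightarrow> \<bar>g 1 x\<bar> \<le> E" using gb[of x 1] by simp

lemma lp_bounds: "x \<in> S \<Longrightarrow> 0 \<le> lp x \<and> lp x \<le> ln E"
  using g1_le E unfolding lp_def by (intro conjI) auto

lemma it_1_prod: "it m 1 x = (\<Prod>i<m. g 1 (it i 0 x))"
  by (induction m) (auto simp: it_1 mult.commute simp del: it.simps(2) comp_seq.simps One_nat_def)

lemma it_1_le: "x \<in> S \<Longrightarrow> \<bar>it m 1 x\<bar> \<le> E ^ m"
proof (induction m)
  case (Suc m)
  then show ?case unfolding it_1 abs_mult power_Suc using g1_le[OF it_S[OF Suc.prems]] E by (intro mult_mono) auto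
qed simp

text \<open>All rescaled derivatives of order 1 to n + 1 are controlled by the image length alone.
  This is the quantity \<open>\<beta>\<close> of \<open>comp_seq_bound\<close>, and it is at most 2
  \<open>eps\<close> for a short piece.\<close>

lemma piece_bound:
  assumes b: "bdd_piece n (it m) c a" and J: "{c..<c+a} \<subseteq> S" and x: "x \<in> {c..<c+a}" and k: "1 \<le> k" "k \<le> Suc n"
  shows "\<bar>it m k x\<bar> * a ^ k \<le> 2 * len m c a"
proof -
  have a: "a > 0" using b by (simp add: bdd_piece_def)
  have c: "c \<in> {c..<c+a}" using a by simp
  show ?thesis
  proof (cases "k = 1")
    case True
    have "n \<ge> 1" using n3 by simp
    from bdd_piece_distortion[OF b it_dseq J this x c] a show ?thesis
      by (simp add: True len_def mult.commute)
  next
    case False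
    define s where "s = k - 1"
    have s: "k = Suc s" "s \<in> {1..n}" using k False by (auto simp: s_def)
    have "a ^ s * \<bar>it m (Suc s) x\<bar> \<le> \<bar>it m 1 c\<bar>"
      using b x c s(2) unfolding bdd_piece_def by blast
    then have "a * (a ^ s * \<bar>it m (Suc s) x\<bar>) \<le> a * \<bar>it m 1 c\<bar>"
      using a by (intro mult_left_mono) auto
    moreover have "a * \<bar>it m 1 c\<bar> \<ge> 0" using a by simp
    ultimately show ?thesis unfolding s len_def power_Suc by (simp only: ac_simps)
  qed
qed

lemma len_pos: "bdd_piece n (it m) c a \<Longrightarrow> len m c a > 0"
  by (auto simp: bdd_piece_def len_def)

text \<open>The bound for a composition is linear in the length of the piece, so the factor
  \<open>\<theta>1\<close> is the same for all pieces, however short. A loss per piece that did not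
  scale with its length would destroy the iteration.\<close>

lemma step:
  assumes b: "bdd_piece n (it m) c a" and J: "{c..<c+a} \<subseteq> S" and short: "len m c a \<le> eps" and \<kappa>: "\<kappa> > 0"
  obtains \<B> where "finite \<B>" "\<And>c' a'. (c', a') \<in> \<B> \<Longrightarrow> bdd_piece n (it (Suc m)) c' a' \<and> {c'..<c'+a'} \<subseteq> {c..<c+a}"
    "disjoint_family_on (\<lambda>(c', a'). {c'..<c'+a'}) \<B>"
    "(\<Sum>(c', a')\<in>\<B>. len (Suc m) c' a' powr \<tau>) \<le> \<theta>1 * len m c a powr \<tau>"
    "measure lborel ({x\<in>{c..<c+a}. it (Suc m) 1 x \<noteq> 0} - (\<Union>(c', a')\<in>\<B>. {c'..<c'+a'})) \<le> \<kappa>"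
proof -
  define l where "l = len m c a"
  have l: "l > 0" using len_pos[OF b] by (simp add: l_def)
  have a: "a > 0" using b by (simp add: bdd_piece_def)
  have n1: "n \<ge> 1" using n3 by simp
  define K where "K = cc n * E * (2 * l)"
  have K: "K > 0" using l E cc_ge1[of n] by (simp add: K_def)
  have bd: "\<bar>it (Suc m) s x\<bar> * a ^ s \<le> K" if x: "x \<in> {c..<c+a}" and s: "1 \<le> s" "s \<le> Suc n" for x s
  proof -
    have "\<bar>comp_seq g (it m) s x\<bar> * a ^ s \<le> comp_const s * E * (2 * l)"
    proof (rule comp_seq_bound[where r = "Suc n" and \<eta> = "2 * eps"])
      show "\<bar>g k (it m 0 x)\<bar> * (2 * eps) ^ (k - 1) \<le> E" if "1 \<le> k" "k \<le> Suc n" for k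
        using gb it_S x J that by blast
      show "\<bar>it m k x\<bar> * a ^ k \<le> 2 * l" if "1 \<le> k" "k \<le> Suc n" for k
        using piece_bound[OF b J x that] by (simp add: l_def)
    qed (use short l s a eps in \<open>auto simp: l_def\<close>)
    also have "... \<le> K" unfolding K_def using cc_ge[OF s(2)] E l by (intro mult_right_mono) auto
    finally show ?thesis by (simp del: comp_seq.simps)
  qed
  obtain \<B> where B: "finite \<B>" "\<And>c' a'. (c', a') \<in> \<B> \<Longrightarrow> bdd_piece n (it (Suc m)) c' a' \<and> {c'..<c'+a'} \<subseteq> {c..<c+a}"
    "disjoint_family_on (\<lambda>(c', a'). {c'..<c'+a'}) \<B>"
    "(\<Sum>(c', a')\<in>\<B>. (a' * \<bar>it (Suc m) 1 c'\<bar>) powr \<tau>) \<le> C1 n * K powr \<tau>"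
    "measure lborel ({x\<in>{c..<c+a}. it (Suc m) 1 x \<noteq> 0} - (\<Union>(c', a')\<in>\<B>. {c'..<c'+a'})) \<le> \<kappa>"
    by (rule subdivide[OF it_dseq J a n1 K \<kappa> bd]) (assumption+, rule that)
  have "C1 n * K powr \<tau> = C1 n * ((2 * cc n * E) * l) powr \<tau>" by (simp add: K_def mult_ac)
  also have "... = \<theta>1 * l powr \<tau>" using l E cc_ge1[of n] by (simp add: \<theta>1_def powr_mult mult.assoc)
  finally show thesis using that[of \<B>] B by (simp add: len_def l_def)
qed

end

text \<open>\<open>u\<close> will be \<open>\<kappa>\<close> in the parameter, and \<open>Iu\<close>
  its integral over the whole space. Intervals of length 2 \<open>eps\<close> arise as images of
  short pieces, up to distortion.\<close>

locale pushed_map = iter_map +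
  fixes u :: "real \<Rightarrow> real" and Iu :: real
  assumes u: "continuous_on S u" "\<And>x. x \<in> S \<Longrightarrow> u x \<ge> 0"
    and Iu0: "Iu \<ge> 0" and Iu: "\<And>lo hi. lo \<le> hi \<Longrightarrow> {lo..hi} \<subseteq> S \<Longrightarrow> hi - lo \<le> 2 * eps \<Longrightarrow> integral {lo..hi} u \<le> Iu"
begin

abbreviation (input) "UI m A \<equiv> (\<integral>\<^sup>+x\<in>A. ennreal (u (it m 0 x)) \<partial>lborel)"

text \<open>4 \<theta>1 pays for the pieces with short image, the 4 being two uses of distortion 2;
  6 pays for the parts of long images, which have length at least \<open>eps\<close> / 6.\<close>

definition \<theta> :: real where "\<theta> = 4 * \<theta>1 + 6"

lemma measurable_u: "A \<in> sets borel \<Longrightarrow> A \<subseteq> S \<Longrightarrow> (\<lambda>x. ennreal (u (it m 0 x)) * indicator A x) \<in> borel_measurable lborel"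
  using it_S by (intro borel_continuous_indicator continuous_on_compose2[OF u(1) dseq_continuous[OF dseq_subset[OF it_dseq]]]) auto

text \<open>The pieces whose image is longer than \<open>eps\<close> are cut further, to image length comparable to \<open>eps\<close>. They form
  the set \<open>\<Gamma>\<close>, where the weight \<open>w\<close> is kept and the derivative of \<open>g\<close> is counted in \<open>lp\<close>; elsewhere the weight
  absorbs the derivative.\<close>

lemma child:
  assumes b: "bdd_piece n (it m) c a" and J: "{c..<c+a} \<subseteq> S" and short: "len m c a \<le> eps" and \<kappa>: "\<kappa> > 0" and w: "w > 0"
  obtains ch \<Gamma> where "finite ch"
    "\<And>c' a' w'. (c', a', w') \<in> ch \<Longrightarrow> bdd_piece n (it (Suc m)) c' a' \<and> {c'..<c'+a'} \<subseteq> {c..<c+a} \<and> len (Suc m) c' a' \<le> eps \<and> w' > 0"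
    "\<And>c' a' w' x. (c', a', w') \<in> ch \<Longrightarrow> x \<in> {c'..<c'+a'} \<Longrightarrow>
       ln \<bar>it (Suc m) 1 x\<bar> \<le> ln \<bar>it m 1 x\<bar> + ln w' - ln w + indicator \<Gamma> x * lp (it m 0 x)"
    "disjoint_family_on (\<lambda>(c', a', w'). {c'..<c'+a'}) ch"
    "(\<Sum>(c', a', w')\<in>ch. a' * w' * len (Suc m) c' a' powr (\<tau> - 1)) \<le> \<theta> * (a * w * len m c a powr (\<tau> - 1))"
    "measure lborel ({x\<in>{c..<c+a}. it (Suc m) 1 x \<noteq> 0} - (\<Union>(c', a', w')\<in>ch. {c'..<c'+a'})) \<le> \<kappa>"
    "\<Gamma> \<in> sets borel" "\<Gamma> \<subseteq> {c..<c+a}"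
    "UI m \<Gamma> \<le> ennreal (12 * E / eps * Iu) * emeasure lborel \<Gamma>"
proof -
  let ?M = "Suc m"
  define l where "l = len m c a"
  have l: "0 < l" "l \<le> eps" using len_pos[OF b] short by (auto simp: l_def)
  have a: "a > 0" using b by (simp add: bdd_piece_def)
  have n1: "n \<ge> 1" using n3 by simp
  obtain \<B> where B: "finite \<B>" "\<And>c' a'. (c', a') \<in> \<B> \<Longrightarrow> bdd_piece n (it ?M) c' a' \<and> {c'..<c'+a'} \<subseteq> {c..<c+a}"
    "disjoint_family_on (\<lambda>(c', a'). {c'..<c'+a'}) \<B>"
    "(\<Sum>(c', a')\<in>\<B>. len ?M c' a' powr \<tau>) \<le> \<theta>1 * len m c a powr \<tau>"
    "measure lborel ({x\<in>{c..<c+a}. it ?M 1 x \<noteq> 0} - (\<Union>(c', a')\<in>\<B>. {c'..<c'+a'})) \<le> \<kappa>"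
    by (rule step[OF b J short \<kappa>]) (rule that)
  define iv where "iv = (\<lambda>(c', a'). {c'..<c'+a'::real})"
  define N where "N = {D\<in>\<B>. plen ?M D \<le> eps}"
  define H where "H = {D\<in>\<B>. plen ?M D > eps}"
  have fin: "finite N" "finite H" using B(1) by (auto simp: N_def H_def)
  have BNH: "\<B> = N \<union> H" "N \<inter> H = {}" by (auto simp: N_def H_def)
  have Bp: "pbdd ?M D" "iv D \<subseteq> {c..<c+a}" "iv D \<subseteq> S" "snd D > 0" if "D \<in> \<B>" for D
    using B(2)[of "fst D" "snd D"] that J by (auto simp: iv_def case_prod_beta bdd_piece_def)
  have "\<exists>P. finite P \<and> (\<forall>p\<in>P. pbdd ?M p \<and> iv p \<subseteq> iv D \<and> eps / 6 \<le> plen ?M p \<and> plen ?M p \<le> eps)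
      \<and> disjoint_family_on iv P \<and> iv D = \<Union>(iv ` P) \<and> (\<Sum>p\<in>P. snd p) = snd D" if D: "D \<in> H" for D
  proof -
    have D': "D \<in> \<B>" "eps < snd D * \<bar>it ?M 1 (fst D)\<bar>" using D by (auto simp: H_def len_def)
    have J': "{fst D..<fst D + snd D} \<subseteq> S" using Bp(3)[OF D'(1)] by (simp add: iv_def case_prod_beta)
    obtain P where P: "finite P"
      "\<And>c' a'. (c', a') \<in> P \<Longrightarrow> bdd_piece n (it ?M) c' a' \<and> {c'..<c'+a'} \<subseteq> {fst D..<fst D + snd D} \<and> eps / 6 \<le> a' * \<bar>it ?M 1 c'\<bar> \<and> a' * \<bar>it ?M 1 c'\<bar> \<le> eps"
      "disjoint_family_on (\<lambda>(c', a'). {c'..<c'+a'}) P"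
      "{fst D..<fst D + snd D} = (\<Union>(c', a')\<in>P. {c'..<c'+a'})" "(\<Sum>(c', a')\<in>P. a') = snd D"
      by (rule split_piece[OF Bp(1)[OF D'(1)] it_dseq J' n1 eps D'(2)]) (rule that)
    have "\<forall>p\<in>P. pbdd ?M p \<and> iv p \<subseteq> iv D \<and> eps / 6 \<le> plen ?M p \<and> plen ?M p \<le> eps"
      using P(2) by (auto simp: iv_def case_prod_beta len_def)
    moreover have "disjoint_family_on iv P" using P(3) by (simp add: iv_def)
    moreover have "iv D = \<Union>(iv ` P)" using P(4) by (simp add: iv_def case_prod_beta)
    moreover have "(\<Sum>p\<in>P. snd p) = snd D" using P(5) by (simp add: case_prod_beta)
    ultimately show ?thesis using P(1) by blast
  qed
  then obtain P where P: "\<And>D. D \<in> H \<Longrightarrow> finite (P D)"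
    "\<And>D p. D \<in> H \<Longrightarrow> p \<in> P D \<Longrightarrow> pbdd ?M p \<and> iv p \<subseteq> iv D \<and> eps / 6 \<le> plen ?M p \<and> plen ?M p \<le> eps"
    "\<And>D. D \<in> H \<Longrightarrow> disjoint_family_on iv (P D)" "\<And>D. D \<in> H \<Longrightarrow> iv D = \<Union>(iv ` P D)" "\<And>D. D \<in> H \<Longrightarrow> (\<Sum>p\<in>P D. snd p) = snd D"
    by metis
  define \<Gamma> where "\<Gamma> = \<Union>(iv ` H)"
  \<comment> \<open>Four times the ratio of the slope length / width of the child to the slope l / a
    of the parent. The two factors 2 are distortions, so the logarithm of this ratio bounds the
    growth of the derivative at every point of the child.\<close>
  define wN where "wN = (\<lambda>D. w * (4 * plen ?M D * a / (snd D * l)))"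
  define chN where "chN = (\<lambda>D. (fst D, snd D, wN D)) ` N"
  define chH where "chH = (\<Union>D\<in>H. (\<lambda>p. (fst p, snd p, w)) ` P D)"
  define ch where "ch = chN \<union> chH"
  have ivb: "iv D \<in> sets borel" for D by (simp add: iv_def case_prod_beta)
  have ivm: "emeasure lborel (iv D) = ennreal (snd D)" if "snd D > 0" for D using that by (simp add: iv_def case_prod_beta)
  have HB: "H \<subseteq> \<B>" "N \<subseteq> \<B>" by (auto simp: H_def N_def)
  have disB: "disjoint_family_on iv \<B>" using B(3) by (simp add: iv_def)
  have em\<Gamma>: "emeasure lborel \<Gamma> = ennreal (\<Sum>D\<in>H. snd D)"
  proof -
    have "emeasure lborel \<Gamma> = (\<Sum>D\<in>H. emeasure lborel (iv D))"
      unfolding \<Gamma>_def using fin disB HB ivb by (intro sum_emeasure[symmetric]) (auto intro: disjoint_family_on_mono)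
    also have "... = (\<Sum>D\<in>H. ennreal (snd D))" using Bp(4) HB by (intro sum.cong ivm) auto
    finally show ?thesis using Bp(4) HB by (subst (asm) sum_ennreal) (auto intro: less_imp_le)
  qed
  have \<Gamma>J: "\<Gamma> \<subseteq> {c..<c+a}" using Bp(2) HB by (auto simp: \<Gamma>_def)
  then have "emeasure lborel \<Gamma> \<le> emeasure lborel {c..<c+a}" by (intro emeasure_mono) auto
  then have sumH: "(\<Sum>D\<in>H. snd D) \<le> a" using a by (simp add: em\<Gamma>)
  have low: "l / (2 * a) \<le> \<bar>it m 1 x\<bar>" if "x \<in> {c..<c+a}" for x
    using bdd_piece_distortion[OF b it_dseq J n1 _ that, of c] a by (simp add: l_def len_def)
  have nz: "it m 1 x \<noteq> 0" if "x \<in> {c..<c+a}" for x using low[OF that] l a by (auto simp: divide_le_0_iff)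
    have chp: "bdd_piece n (it ?M) c' a' \<and> {c'..<c'+a'} \<subseteq> {c..<c+a} \<and> len ?M c' a' \<le> eps \<and> w' > 0"
      if mem: "(c', a', w') \<in> ch" for c' a' w'
    proof -
      consider D where "D \<in> N" "c' = fst D" "a' = snd D" "w' = wN D"
        | D p where "D \<in> H" "p \<in> P D" "c' = fst p" "a' = snd p" "w' = w"
        using mem by (auto simp: ch_def chN_def chH_def)
      then show ?thesis
      proof cases
        case 1
        have D: "D \<in> \<B>" "len ?M c' a' \<le> eps" using 1 by (auto simp: N_def)
        have "len ?M c' a' > 0" using len_pos[OF Bp(1)[OF D(1)]] 1 by simp
        then have "wN D > 0" using w l a Bp(4)[OF D(1)] 1 by (simp add: wN_def)
        then show ?thesis using Bp[OF D(1)] D 1 by (auto simp: iv_def case_prod_beta)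
      next
        case 2
        then show ?thesis using P(2)[OF 2(1,2)] Bp(2)[of D] HB w by (auto simp: iv_def case_prod_beta)
      qed
    qed
  show thesis
  proof (rule that[of ch \<Gamma>])
    show "finite ch" using fin P(1) by (auto simp: ch_def chN_def chH_def)
    show "bdd_piece n (it ?M) c' a' \<and> {c'..<c'+a'} \<subseteq> {c..<c+a} \<and> len ?M c' a' \<le> eps \<and> w' > 0"
      if "(c', a', w') \<in> ch" for c' a' w'
      using chp[OF that] .
    show "ln \<bar>it ?M 1 x\<bar> \<le> ln \<bar>it m 1 x\<bar> + ln w' - ln w + indicator \<Gamma> x * lp (it m 0 x)"
      if mem: "(c', a', w') \<in> ch" and x: "x \<in> {c'..<c'+a'}" for c' a' w' x
    proof -
      consider D where "D \<in> N" "c' = fst D" "a' = snd D" "w' = wN D"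
        | D p where "D \<in> H" "p \<in> P D" "c' = fst p" "a' = snd p" "w' = w"
        using mem by (auto simp: ch_def chN_def chH_def)
      then show ?thesis
      proof cases
        case 1
        have D: "D \<in> \<B>" using 1 by (auto simp: N_def)
        have xD: "x \<in> iv D" using x 1 by (simp add: iv_def case_prod_beta)
        have xJ: "x \<in> {c..<c+a}" "x \<in> S" using xD Bp(2,3)[OF D] by auto
        define q where "q = 4 * len ?M c' a' * a / (a' * l)"
        have lD: "len ?M c' a' > 0" "a' > 0" using len_pos[OF Bp(1)[OF D]] Bp(4)[OF D] 1 by auto
        have q: "q > 0" using lD l a by (simp add: q_def)
        have "\<bar>it ?M 1 x\<bar> \<le> 2 * \<bar>it ?M 1 c'\<bar>"
          using 1 x lD Bp(1,3)[OF D] by (intro bdd_piece_distortion[of n "it ?M" c' a' S] it_dseq n1) (auto simp: iv_def case_prod_beta)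
        also have "... = q * (l / (2 * a))" using lD l a by (simp add: q_def len_def)
        also have "... \<le> q * \<bar>it m 1 x\<bar>" using low[OF xJ(1)] q by (intro mult_left_mono) auto
        finally have "\<bar>it ?M 1 x\<bar> \<le> q * \<bar>it m 1 x\<bar>" .
        moreover have "it ?M 1 x \<noteq> 0" using Bp(1)[OF D] xD unfolding bdd_piece_def iv_def by (auto simp: case_prod_beta simp del: it.simps)
        ultimately have "ln \<bar>it ?M 1 x\<bar> \<le> ln q + ln \<bar>it m 1 x\<bar>"
          using q nz[OF xJ(1)] by (subst ln_mult_pos[symmetric]) (auto simp del: it.simps)
        moreover have "w' = w * q" using 1 by (simp add: wN_def q_def)
        then have "ln w' = ln w + ln q" using ln_mult_pos[OF w q] by simp
        moreover have "indicator \<Gamma> x * lp (it m 0 x) \<ge> 0" using lp_bounds[OF it_S[OF xJ(2)]] by (simp add: indicator_def)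
        ultimately show ?thesis by linarith
      next
        case 2
        then have xD: "x \<in> iv D" using P(2)[OF 2(1,2)] x by (auto simp: iv_def case_prod_beta)
        then have x\<Gamma>: "x \<in> \<Gamma>" using 2 by (auto simp: \<Gamma>_def)
        have DB: "D \<in> \<B>" using 2 HB by blast
        have xJ: "x \<in> {c..<c+a}" "x \<in> S" using xD Bp(2,3)[OF DB] by blast+
        have "it ?M 1 x \<noteq> 0" using Bp(1)[OF DB] xD unfolding bdd_piece_def iv_def by (auto simp: case_prod_beta simp del: it.simps)
        then have g: "g 1 (it m 0 x) \<noteq> 0" by (metis it_1 mult_zero_left)
        have "ln \<bar>it ?M 1 x\<bar> = ln \<bar>g 1 (it m 0 x)\<bar> + ln \<bar>it m 1 x\<bar>"
          unfolding it_1 abs_mult using g nz[OF xJ(1)] by (intro ln_mult_pos) auto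
        also have "ln \<bar>g 1 (it m 0 x)\<bar> \<le> lp (it m 0 x)" using g by (auto simp: lp_def)
        finally show ?thesis using x\<Gamma> 2 by simp
      qed
    qed
    have ivch: "(case D of (c', a', w') \<Rightarrow> {c'..<c'+a'}) = iv (fst D, wd D)" for D :: "real \<times> real \<times> real"
      by (simp add: iv_def case_prod_beta)
    have shape: "(\<exists>D\<in>N. iv (fst t, wd t) = iv D \<and> t = (fst D, snd D, wN D)) \<or>
        (\<exists>D\<in>H. \<exists>p\<in>P D. iv (fst t, wd t) = iv p \<and> iv p \<subseteq> iv D \<and> t = (fst p, snd p, w))" if tch: "t \<in> ch" for t
    proof -
      consider D where "D \<in> N" "t = (fst D, snd D, wN D)" | D p where "D \<in> H" "p \<in> P D" "t = (fst p, snd p, w)"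
        using tch unfolding ch_def chN_def chH_def by blast
      then show ?thesis
      proof cases
        case 1
        then show ?thesis by (intro disjI1 bexI[of _ D]) auto
      next
        case 2
        then show ?thesis using P(2)[OF 2(1,2)] by (intro disjI2 bexI[of _ D] bexI[of _ p]) auto
      qed
    qed
    show "disjoint_family_on (\<lambda>(c', a', w'). {c'..<c'+a'}) ch"
      unfolding disjoint_family_on_def ivch
    proof (intro ballI impI)
      fix s t assume st: "s \<in> ch" "t \<in> ch" "s \<noteq> t"
      have dB: "iv D \<inter> iv D' = {}" if "D \<in> \<B>" "D' \<in> \<B>" "D \<noteq> D'" for D D'
        using disB that by (auto simp: disjoint_family_on_def)
      have dP: "iv p \<inter> iv p' = {}" if "D \<in> H" "p \<in> P D" "p' \<in> P D" "p \<noteq> p'" for D p p'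
        using P(3)[OF that(1)] that by (auto simp: disjoint_family_on_def)
      from shape[OF st(1)] shape[OF st(2)] show "iv (fst s, wd s) \<inter> iv (fst t, wd t) = {}"
      proof (elim disjE bexE conjE)
        fix D D' assume *: "D \<in> N" "D' \<in> N" "iv (fst s, wd s) = iv D" "iv (fst t, wd t) = iv D'" "s = (fst D, snd D, wN D)" "t = (fst D', snd D', wN D')"
        then have "D \<noteq> D'" using st by auto
        then have "iv D \<inter> iv D' = {}" using * HB by (intro dB) blast+
        then show ?thesis using *(3,4) by simp
      next
        fix D D' p assume *: "D \<in> N" "D' \<in> H" "iv (fst s, wd s) = iv D" "iv (fst t, wd t) = iv p" "iv p \<subseteq> iv D'"
        then have "D \<noteq> D'" using BNH by auto
        then have "iv D \<inter> iv D' = {}" using * HB by (intro dB) blast+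
        then show ?thesis using * by blast
      next
        fix D D' p assume *: "D \<in> N" "D' \<in> H" "iv (fst t, wd t) = iv D" "iv (fst s, wd s) = iv p" "iv p \<subseteq> iv D'"
        then have "D \<noteq> D'" using BNH by auto
        then have "iv D \<inter> iv D' = {}" using * HB by (intro dB) blast+
        then show ?thesis using * by blast
      next
        fix D D' p p' assume *: "D \<in> H" "D' \<in> H" "p \<in> P D" "p' \<in> P D'" "iv (fst s, wd s) = iv p" "iv p \<subseteq> iv D"
          "iv (fst t, wd t) = iv p'" "iv p' \<subseteq> iv D'" "s = (fst p, snd p, w)" "t = (fst p', snd p', w)"
        show ?thesis
        proof (cases "D = D'")
          case True
          moreover have "p \<noteq> p'" using * st by auto
          ultimately have "iv p \<inter> iv p' = {}" using * by (intro dP[of D]) blast+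
          then show ?thesis using * by simp
        next
          case False
          then have "iv D \<inter> iv D' = {}" using * HB by (intro dB) blast+
        then show ?thesis using * by blast
        qed
      qed
    qed
    show "measure lborel ({x\<in>{c..<c+a}. it ?M 1 x \<noteq> 0} - (\<Union>(c', a', w')\<in>ch. {c'..<c'+a'})) \<le> \<kappa>"
    proof -
      have "(\<Union>(c', a', w')\<in>ch. {c'..<c'+a'}) = (\<Union>(c', a')\<in>\<B>. {c'..<c'+a'})"
      proof -
        have "(\<Union>(c', a', w')\<in>ch. {c'..<c'+a'}) = \<Union>(iv ` N) \<union> (\<Union>D\<in>H. \<Union>(iv ` P D))"
          by (auto simp: ch_def chN_def chH_def iv_def case_prod_beta)
        also have "(\<Union>D\<in>H. \<Union>(iv ` P D)) = \<Union>(iv ` H)" using P(4) by simp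
        also have "\<Union>(iv ` N) \<union> \<Union>(iv ` H) = \<Union>(iv ` \<B>)" using BNH by auto
        finally show ?thesis by (simp add: iv_def)
      qed
      then show ?thesis using B(5) by simp
    qed
    show "\<Gamma> \<in> sets borel" unfolding \<Gamma>_def using fin ivb by auto
    show "\<Gamma> \<subseteq> {c..<c+a}" by (rule \<Gamma>J)
    show "(\<Sum>(c', a', w')\<in>ch. a' * w' * len ?M c' a' powr (\<tau> - 1)) \<le> \<theta> * (a * w * len m c a powr (\<tau> - 1))"
    proof -
      define F where "F = (\<lambda>(c', a', w'). a' * w' * len ?M c' a' powr (\<tau> - 1))"
      have "sum F chN = (\<Sum>D\<in>N. F (fst D, snd D, wN D))"
        unfolding chN_def by (subst sum.reindex) (auto simp: inj_on_def prod_eq_iff)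
      \<comment> \<open>With this weight the width cancels: what remains is a constant times
        length^\<tau>, the quantity controlled by \<open>step\<close>.\<close>
      also have "... = (\<Sum>D\<in>N. (4 * w * a / l) * plen ?M D powr \<tau>)"
      proof (rule sum.cong[OF refl])
        fix D assume "D \<in> N"
        then have D: "D \<in> \<B>" by (simp add: N_def)
        have "plen ?M D powr \<tau> = plen ?M D * plen ?M D powr (\<tau> - 1)"
          using len_pos[OF Bp(1)[OF D]] by (simp add: powr_diff)
        then show "F (fst D, snd D, wN D) = (4 * w * a / l) * plen ?M D powr \<tau>"
          using Bp(4)[OF D] l by (simp add: F_def wN_def field_simps)
      qed
      also have "... = (4 * w * a / l) * (\<Sum>D\<in>N. plen ?M D powr \<tau>)" by (simp add: sum_distrib_left)
      also have "... \<le> (4 * w * a / l) * (\<Sum>D\<in>\<B>. plen ?M D powr \<tau>)"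
        using HB B(1) w a l by (intro mult_left_mono sum_mono2) auto
      also have "... \<le> (4 * w * a / l) * (\<theta>1 * l powr \<tau>)"
        using B(4)[folded l_def] w a l by (intro mult_left_mono) (auto simp: case_prod_beta)
      also have "... = 4 * \<theta>1 * (a * w * l powr (\<tau> - 1))" using l by (simp add: powr_diff field_simps)
      finally have 1: "sum F chN \<le> 4 * \<theta>1 * (a * w * l powr (\<tau> - 1))" .
      have Fnn: "F t \<ge> 0" if "t \<in> ch" for t
      proof -
        have "wd t > 0" "wt t > 0"
          using chp[of "fst t" "wd t" "wt t"] that unfolding bdd_piece_def by simp_all
        then show ?thesis by (simp add: F_def case_prod_beta)
      qed
      \<comment> \<open>The exponent \<tau> - 1 is negative and the parent is no longer than
        \<open>eps\<close>, so children of length at least \<open>eps\<close> / 6 lose at most a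
        factor 6. Their widths add up to at most that of the parent.\<close>
      have powl: "x powr (\<tau> - 1) \<le> 6 * l powr (\<tau> - 1)" if "eps / 6 \<le> x" for x
      proof -
        have "x powr (\<tau> - 1) \<le> (l / 6) powr (\<tau> - 1)"
          using that l \<tau> by (intro powr_mono2') auto
        also have "... = 6 powr (1 - \<tau>) * l powr (\<tau> - 1)" using l by (simp add: powr_divide powr_diff field_simps)
        also have "... \<le> 6 powr 1 * l powr (\<tau> - 1)" using \<tau> by (intro mult_right_mono powr_mono) auto
        finally show ?thesis by simp
      qed
      have "sum F chH \<le> (\<Sum>D\<in>H. sum F ((\<lambda>p. (fst p, snd p, w)) ` P D))"
        unfolding chH_def
      proof (rule sum_UN_le)
        fix D t assume "D \<in> H" "t \<in> (\<lambda>p. (fst p, snd p, w)) ` P D"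
        then show "F t \<ge> 0" by (intro Fnn) (unfold ch_def chH_def, blast)
      qed (use fin P(1) in auto)
      also have "... \<le> (\<Sum>D\<in>H. 6 * w * l powr (\<tau> - 1) * snd D)"
      proof (rule sum_mono)
        fix D assume D: "D \<in> H"
        have "sum F ((\<lambda>p. (fst p, snd p, w)) ` P D) = (\<Sum>p\<in>P D. F (fst p, snd p, w))"
          by (subst sum.reindex) (auto simp: inj_on_def prod_eq_iff)
        also have "... \<le> (\<Sum>p\<in>P D. 6 * w * l powr (\<tau> - 1) * snd p)"
        proof (rule sum_mono)
          fix p assume p: "p \<in> P D"
          have "snd p > 0" using P(2)[OF D p] by (simp add: bdd_piece_def)
          have "plen ?M p powr (\<tau> - 1) \<le> 6 * l powr (\<tau> - 1)" using P(2)[OF D p] by (intro powl) auto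
          then have "snd p * w * plen ?M p powr (\<tau> - 1) \<le> snd p * w * (6 * l powr (\<tau> - 1))"
            using \<open>snd p > 0\<close> w by (intro mult_left_mono) auto
          then show "F (fst p, snd p, w) \<le> 6 * w * l powr (\<tau> - 1) * snd p" by (simp add: F_def mult_ac)
        qed
        also have "... = 6 * w * l powr (\<tau> - 1) * snd D" using P(5)[OF D] by (simp flip: sum_distrib_left)
        finally show "sum F ((\<lambda>p. (fst p, snd p, w)) ` P D) \<le> 6 * w * l powr (\<tau> - 1) * snd D" .
      qed
      also have "... = 6 * w * l powr (\<tau> - 1) * (\<Sum>D\<in>H. snd D)" by (simp add: sum_distrib_left)
      also have "... \<le> 6 * w * l powr (\<tau> - 1) * a" using sumH w by (intro mult_left_mono) auto
      finally have 2: "sum F chH \<le> 6 * (a * w * l powr (\<tau> - 1))" by (simp add: mult_ac)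
      have "sum F ch \<le> sum F chN + sum F chH"
      proof -
        have "finite chN" "finite chH" using fin P(1) by (auto simp: chN_def chH_def)
        then have "sum F ch + sum F (chN \<inter> chH) = sum F chN + sum F chH" unfolding ch_def by (rule sum.union_inter)
        moreover have "sum F (chN \<inter> chH) \<ge> 0" by (intro sum_nonneg Fnn) (simp add: ch_def)
        ultimately show ?thesis by linarith
      qed
      then show ?thesis using 1 2 by (simp add: F_def \<theta>_def l_def algebra_simps)
    qed
    show "UI m \<Gamma> \<le> ennreal (12 * E / eps * Iu) * emeasure lborel \<Gamma>"
    proof -
      define C where "C = 12 * E / eps * Iu"
      have C0: "C \<ge> 0" using E eps Iu0 by (simp add: C_def)
      have piece: "UI m (iv p) \<le> ennreal (C * snd p)" if D: "D \<in> H" and p: "p \<in> P D" for D p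
      proof -
        have pp: "pbdd ?M p" "iv p \<subseteq> iv D" "eps / 6 \<le> plen ?M p" using P(2)[OF D p] by auto
        have a': "snd p > 0" using pp by (simp add: bdd_piece_def)
        have DB: "D \<in> \<B>" using D HB by blast
        have sub: "iv p \<subseteq> {c..<c+a}" "iv p \<subseteq> S" using pp(2) Bp(2,3)[OF DB] by blast+
        have sub': "{fst p..<fst p + snd p} \<subseteq> {c..<c+a}" "{fst p..<fst p + snd p} \<subseteq> S" using sub by (auto simp: iv_def case_prod_beta)
        have a'a: "snd p \<le> a" using sub'(1) a' by auto
        \<comment> \<open>The image of p under the next iterate has length at least
          \<open>eps\<close> / 6. Distortion costs 2 and the last application of \<open>g\<close> at
          most E; this leaves a lower bound for the derivative of the current iterate.\<close>
        define b where "b = eps / (12 * snd p * E)"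
        have b0: "b > 0" using eps a' E by (simp add: b_def)
        have "(\<integral>\<^sup>+x\<in>{fst p..<fst p + snd p}. ennreal (u (it m 0 x)) \<partial>lborel) \<le> ennreal (Iu / b)"
        proof (rule push_piece[OF it_dseq sub'(2) a' S _ b0 _ _ u Iu])
          show "it m 0 ` S \<subseteq> S" using it_S by auto
          fix x assume x: "x \<in> {fst p..<fst p + snd p}"
          have xS: "x \<in> S" "x \<in> {c..<c+a}" using x sub' by auto
          have "eps / (6 * snd p) \<le> \<bar>it ?M 1 (fst p)\<bar>" using pp(3) a' by (simp add: len_def field_simps del: it.simps)
          also have "... \<le> 2 * \<bar>it ?M 1 x\<bar>" using x a' by (intro bdd_piece_distortion[OF pp(1) it_dseq sub'(2) n1]) auto
          also have "\<bar>it ?M 1 x\<bar> \<le> E * \<bar>it m 1 x\<bar>" unfolding it_1 abs_mult using g1_le[OF it_S[OF xS(1)]] by (rule mult_right_mono) simp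
          finally show "b \<le> \<bar>it m 1 x\<bar>" using E a' by (simp add: b_def field_simps)
          have "\<bar>it m 1 x\<bar> * snd p \<le> \<bar>it m 1 x\<bar> * a ^ 1" using a'a by (simp add: mult_left_mono)
          also have "... \<le> 2 * len m c a" by (rule piece_bound[OF b J xS(2)]) auto
          finally show "\<bar>it m 1 x\<bar> * snd p \<le> 2 * eps" using short by simp
        qed
        also have "Iu / b = C * snd p" using E eps a' by (simp add: b_def C_def field_simps)
        finally show ?thesis by (simp add: iv_def case_prod_beta)
      qed
      have perD: "UI m (iv D) \<le> ennreal (C * snd D)" if D: "D \<in> H" for D
      proof -
        have sub: "iv p \<subseteq> S" if "p \<in> P D" for p using P(2)[OF D that] Bp(3)[of D] D HB by blast
        have sp: "snd p > 0" if "p \<in> P D" for p using P(2)[OF D that] by (simp add: bdd_piece_def)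
        have "UI m (iv D) \<le> (\<Sum>p\<in>P D. \<integral>\<^sup>+x\<in>iv p. ennreal (u (it m 0 x)) \<partial>lborel)"
          unfolding P(4)[OF D] using P(1)[OF D] sub ivb by (intro nn_integral_UN_le measurable_u) auto
        also have "... \<le> (\<Sum>p\<in>P D. ennreal (C * snd p))" using piece[OF D] by (intro sum_mono) auto
        also have "... = ennreal (\<Sum>p\<in>P D. C * snd p)" using C0 sp by (intro sum_ennreal mult_nonneg_nonneg) (auto intro: less_imp_le)
        also have "(\<Sum>p\<in>P D. C * snd p) = C * snd D" using P(5)[OF D] by (simp flip: sum_distrib_left)
        finally show ?thesis .
      qed
      have "UI m \<Gamma> \<le> (\<Sum>D\<in>H. \<integral>\<^sup>+x\<in>iv D. ennreal (u (it m 0 x)) \<partial>lborel)"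
        unfolding \<Gamma>_def using fin Bp(3) HB ivb by (intro nn_integral_UN_le measurable_u) auto
      also have "... \<le> (\<Sum>D\<in>H. ennreal (C * snd D))" using perD by (intro sum_mono) auto
      also have "... = ennreal (\<Sum>D\<in>H. C * snd D)" using C0 Bp(4) HB by (intro sum_ennreal mult_nonneg_nonneg) (auto intro: less_imp_le)
      also have "... = ennreal C * emeasure lborel \<Gamma>" unfolding em\<Gamma> using C0 by (simp add: ennreal_mult' sum_distrib_left[symmetric])
      finally show ?thesis by (simp only: C_def)
    qed
  qed
qed

end


section \<open>Local volume growth\<close>

lemma emeasure_Ico_finite: "emeasure lborel {a..<b::real} < \<infinity>"
  by (cases "a \<le> b") auto

lemma measure_UN_diff_le:
  assumes "finite I" "X \<in> sets lborel" "emeasure lborel X < \<infinity>"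
    and "X \<subseteq> (\<Union>i\<in>I. A i) \<union> B"
    and "\<And>i. i \<in> I \<Longrightarrow> measure lborel (X \<inter> A i) \<le> k" "\<And>i. i \<in> I \<Longrightarrow> A i \<in> sets lborel"
    and "B \<in> sets lborel" "measure lborel (X \<inter> B) \<le> r"
  shows "measure lborel X \<le> real (card I) * k + r"
proof -
  have fm: "X \<in> fmeasurable lborel" using assms(2,3) by (auto simp: fmeasurable_def)
  have f1: "X \<inter> A i \<in> fmeasurable lborel" if "i \<in> I" for i using fm assms(6)[OF that] by (intro fmeasurable_Int_fmeasurable)
  have f2: "X \<inter> B \<in> fmeasurable lborel" using fm assms(7) by (intro fmeasurable_Int_fmeasurable)
  have "measure lborel X \<le> measure lborel ((\<Union>i\<in>I. X \<inter> A i) \<union> (X \<inter> B))"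
    using assms(1,4) f1 f2 fm by (intro measure_mono_fmeasurable fmeasurable.Un fmeasurable.finite_UN) (auto intro: fmeasurableD)
  also have "... \<le> measure lborel (\<Union>i\<in>I. X \<inter> A i) + measure lborel (X \<inter> B)"
    using assms(1) fmeasurableD[OF f1] fmeasurableD[OF f2] by (intro measure_Un_le sets.finite_UN) auto
  also have "measure lborel (\<Union>i\<in>I. X \<inter> A i) \<le> (\<Sum>i\<in>I. measure lborel (X \<inter> A i))"
    using assms(1) fmeasurableD[OF f1] by (intro measure_UNION_le) auto
  also have "... \<le> real (card I) * k" using assms(5) by (rule sum_bounded_above)
  finally show ?thesis using assms(8) by simp
qed

context iter_map begin

lemma it_nz_borel: "X \<in> sets borel \<Longrightarrow> X \<subseteq> S \<Longrightarrow> {x\<in>X. it m 1 x \<noteq> 0} \<in> sets borel"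
proof -
  assume X: "X \<in> sets borel" "X \<subseteq> S"
  have "it m 1 \<in> borel_measurable (restrict_space borel X)"
    by (rule borel_measurable_continuous_on_restrict[OF dseq_continuous[OF dseq_subset[OF it_dseq X(2)]]])
  then have "{x\<in>space (restrict_space borel X). it m 1 x \<noteq> 0} \<in> sets (restrict_space borel X)" by measurable
  then show ?thesis using X by (auto simp: space_restrict_space sets_restrict_space_iff)
qed

lemma bdd_piece_0: "a > 0 \<Longrightarrow> bdd_piece n (it 0) c a"
  by (auto simp: bdd_piece_def)

lemma it_1_Suc_nz: "it (Suc m) 1 x \<noteq> 0 \<Longrightarrow> it m 1 x \<noteq> 0"
  unfolding it_1 by auto

text \<open>Let D be the part of the piece in Y. Its image has diameter at most \<open>eps\<close> /
  2, so by distortion 2 the hull of D has length at most \<open>eps\<close>. The hull is half-open,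
  and the supremum of D may escape it: this is \<open>z\<close>. The factor 2 arises because the
  length is measured at the left end, which has moved.\<close>

lemma restrict_piece:
  assumes b: "bdd_piece n (it m) c a" and J: "{c..<c+a} \<subseteq> S"
    and Y: "\<And>x y. x \<in> Y \<Longrightarrow> y \<in> Y \<Longrightarrow> x \<in> {c..<c+a} \<Longrightarrow> y \<in> {c..<c+a} \<Longrightarrow> \<bar>it m 0 x - it m 0 y\<bar> \<le> eps / 2"
  shows "\<exists>T z. finite T \<and> (\<forall>(c',a')\<in>T. bdd_piece n (it m) c' a' \<and> {c'..<c'+a'} \<subseteq> {c..<c+a} \<and> len m c' a' \<le> eps)
    \<and> (\<Sum>(c',a')\<in>T. len m c' a' powr \<tau>) \<le> 2 * len m c a powr \<tau> \<and> {c..<c+a} \<inter> Y \<subseteq> (\<Union>(c',a')\<in>T. {c'..<c'+a'}) \<union> {z}"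
proof (cases "\<exists>x y. x \<in> {c..<c+a} \<inter> Y \<and> y \<in> {c..<c+a} \<inter> Y \<and> x < y")
  case False
  then have "\<exists>z. {c..<c+a} \<inter> Y \<subseteq> {z}" by (metis linorder_neqE_linordered_idom singletonI subsetI)
  then show ?thesis by (intro exI[of _ "{}"]) auto
next
  case True
  define D where "D = {c..<c+a} \<inter> Y"
  obtain x0 y0 where xy: "x0 \<in> D" "y0 \<in> D" "x0 < y0" using True by (auto simp: D_def)
  have a: "a > 0" using b by (simp add: bdd_piece_def)
  have n1: "n \<ge> 1" using n3 by simp
  have bd: "bdd_below D" "bdd_above D" by (auto simp: D_def intro!: bdd_belowI[of _ c] bdd_aboveI[of _ "c + a"])
  define c' a' where "c' = Inf D" and "a' = Sup D - Inf D"
  have "Inf D \<le> x0" "y0 \<le> Sup D" using xy bd by (auto intro: cInf_lower cSup_upper)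
  then have a': "a' > 0" using xy by (simp add: a'_def)
  have "D \<noteq> {}" using xy by auto
  then have cc': "c \<le> c'" "c' + a' \<le> c + a" unfolding c'_def a'_def
    by (auto intro!: cInf_greatest cSup_least simp: D_def)
  then have sub: "{c'..<c'+a'} \<subseteq> {c..<c+a}" by auto
  have mem: "c' \<in> {c..<c+a}" "c \<in> {c..<c+a}" using sub a' a by auto
  have b': "bdd_piece n (it m) c' a'" by (rule bdd_piece_sub[OF b sub a'])
  define v where "v = \<bar>it m 1 c'\<bar>"
  have v: "v > 0" using b' a' by (auto simp: bdd_piece_def v_def)
  have dist: "t - s \<le> eps / v" if "s \<in> D" "t \<in> D" for s t
  proof (cases "s < t")
    case True
    have st: "s \<in> {c..<c+a}" "t \<in> {c..<c+a}" "s \<in> Y" "t \<in> Y" using that by (auto simp: D_def)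
    then have st': "{s..t} \<subseteq> {c..<c+a}" by auto
    obtain z where z: "z \<in> {s<..<t}" "it m 0 t - it m 0 s = it m 1 z * (t - s)"
      using dseq_mvt[OF it_dseq True order.trans[OF st' J], of m 0] by auto
    have zJ: "z \<in> {c..<c+a}" using z subsetD[OF st', of z] by simp
    have "v \<le> 2 * \<bar>it m 1 z\<bar>" unfolding v_def by (rule bdd_piece_distortion[OF b it_dseq J n1 mem(1) zJ])
    then have "v * (t - s) \<le> 2 * (\<bar>it m 1 z\<bar> * (t - s))" using True by (simp add: mult_right_mono mult.assoc[symmetric])
    also have "\<bar>it m 1 z\<bar> * (t - s) = \<bar>it m 0 t - it m 0 s\<bar>" using True by (simp add: z(2) abs_mult)
    also have "... \<le> eps / 2" using Y st by blast
    finally show ?thesis using v by (simp add: field_simps)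
  next
    case False
    moreover have "0 \<le> eps / v" using v eps by simp
    ultimately show ?thesis by linarith
  qed
  have "Sup D \<le> Inf D + eps / v"
  proof (rule cSup_least)
    fix t assume t: "t \<in> D"
    have "t - eps / v \<le> Inf D" using xy dist[OF _ t] by (intro cInf_greatest) (auto simp: algebra_simps)
    then show "t \<le> Inf D + eps / v" by simp
  qed (use xy in auto)
  then have len': "len m c' a' \<le> eps" using v unfolding len_def v_def[symmetric] a'_def by (simp add: field_simps)
  have "len m c' a' \<le> 2 * len m c a"
  proof -
    have "a' * \<bar>it m 1 c'\<bar> \<le> a * (2 * \<bar>it m 1 c\<bar>)"
      using bdd_piece_distortion[OF b it_dseq J n1 mem] cc' a a' by (intro mult_mono) auto
    then show ?thesis by (simp add: len_def)
  qed
  then have "len m c' a' powr \<tau> \<le> (2 * len m c a) powr \<tau>"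
    using len_pos[OF b'] \<tau> by (intro powr_mono2) auto
  also have "... = 2 powr \<tau> * len m c a powr \<tau>" using len_pos[OF b] by (simp add: powr_mult)
  also have "... \<le> 2 powr 1 * len m c a powr \<tau>" using \<tau> by (intro mult_right_mono powr_mono) auto
  finally have "len m c' a' powr \<tau> \<le> 2 * len m c a powr \<tau>" by simp
  moreover have "D \<subseteq> {c'..<c'+a'} \<union> {Sup D}"
  proof
    fix x assume "x \<in> D"
    from cInf_lower[OF this bd(1)] cSup_upper[OF this bd(2)] show "x \<in> {c'..<c'+a'} \<union> {Sup D}"
      by (auto simp: c'_def a'_def)
  qed
  ultimately show ?thesis using b' sub len'
    by (intro exI[of _ "{(c',a')}"] exI[of _ "Sup D"]) (auto simp: D_def)
qed

definition orbit_in :: "(nat \<Rightarrow> real set) \<Rightarrow> nat \<Rightarrow> real set \<Rightarrow> real set" where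
  "orbit_in Q m X = {x\<in>X. \<forall>j\<le>m. it j 0 x \<in> Q j}"

lemma orbit_in_Suc: "orbit_in Q (Suc m) X = orbit_in Q m X \<inter> {x. it (Suc m) 0 x \<in> Q (Suc m)}"
  by (auto simp: orbit_in_def le_Suc_eq)

text \<open>Orbits confined to prescribed small cells: after each step the pieces are restricted to
  the cell instead of being cut, so the sum of length^\<tau> grows by at most 2 \<theta>1 per step.
  The condition on \<open>Q\<close> is that of a union of intervals of length at most
  \<open>eps\<close> / 2 which are far apart, such as all lifts of one cell of the circle.\<close>

lemma local_pieces:
  assumes X: "X \<in> sets borel" "X \<subseteq> S" "X \<subseteq> {0..<L}" and Qm: "\<And>m. orbit_in Q m X \<in> sets borel"
    and Q0: "X \<inter> Q 0 \<subseteq> {c0..<c0+a0}" "{c0..<c0+a0} \<subseteq> S" "a0 > 0" "a0 \<le> eps"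
    and Q: "\<And>j x y. x \<in> Q j \<Longrightarrow> y \<in> Q j \<Longrightarrow> \<bar>x - y\<bar> \<le> 2 * E * eps \<Longrightarrow> \<bar>x - y\<bar> \<le> eps / 2"
    and \<kappa>: "\<kappa> > 0"
  shows "\<exists>T. finite T \<and> (\<forall>(c,a)\<in>T. bdd_piece n (it m) c a \<and> {c..<c+a} \<subseteq> S \<and> len m c a \<le> eps)
    \<and> (\<Sum>(c,a)\<in>T. len m c a powr \<tau>) \<le> (2 * \<theta>1) ^ m * eps powr \<tau>
    \<and> measure lborel ({x\<in>orbit_in Q m X. it m 1 x \<noteq> 0} - (\<Union>(c,a)\<in>T. {c..<c+a})) \<le> \<kappa>"
  using \<kappa>
proof (induction m arbitrary: \<kappa>)
  case 0
  have "{x\<in>orbit_in Q 0 X. it 0 1 x \<noteq> 0} - {c0..<c0+a0} = {}" using Q0(1) by (auto simp: orbit_in_def)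
  then have "measure lborel ({x\<in>orbit_in Q 0 X. it 0 1 x \<noteq> 0} - {c0..<c0+a0}) \<le> \<kappa>" using 0 by (simp only: measure_empty)
  moreover have "len 0 c0 a0 powr \<tau> \<le> eps powr \<tau>" using Q0 \<tau> by (intro powr_mono2) (auto simp: len_def)
  moreover have "len 0 c0 a0 \<le> eps" using Q0 by (simp add: len_def)
  moreover have "(\<Union>(c,a)\<in>{(c0,a0)}. {c..<c+a}) = {c0..<c0+a0}" by simp
  ultimately show ?case using Q0 bdd_piece_0[of a0 c0] 0
    by (intro exI[of _ "{(c0,a0)}"]) (simp del: it.simps)
next
  case (Suc m)
  obtain T where T: "finite T" "\<And>t. t \<in> T \<Longrightarrow> pbdd m t \<and> {fst t..<fst t+snd t} \<subseteq> S \<and> plen m t \<le> eps"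
    "(\<Sum>(c,a)\<in>T. len m c a powr \<tau>) \<le> (2 * \<theta>1) ^ m * eps powr \<tau>"
    "measure lborel ({x\<in>orbit_in Q m X. it m 1 x \<noteq> 0} - (\<Union>(c,a)\<in>T. {c..<c+a})) \<le> \<kappa> / 2"
    using Suc.IH[of "\<kappa> / 2"] Suc.prems by (force simp: case_prod_beta)
  let ?M = "Suc m"
  define iv where "iv = (\<lambda>(c, a). {c..<c+a::real})"
  define k where "k = \<kappa> / (2 * (real (card T) + 1))"
  have k: "k > 0" using Suc.prems by (simp add: k_def)
  let ?Y = "{x. it ?M 0 x \<in> Q ?M}"
  define P where "P = (\<lambda>t \<B>. finite \<B> \<and> (\<forall>b\<in>\<B>. pbdd ?M b \<and> iv b \<subseteq> iv t) \<and>
     (\<Sum>b\<in>\<B>. plen ?M b powr \<tau>) \<le> \<theta>1 * plen m t powr \<tau> \<and>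
     measure lborel ({x\<in>iv t. it ?M 1 x \<noteq> 0} - \<Union>(iv ` \<B>)) \<le> k)"
  have "\<exists>\<B>. P t \<B>" if t: "t \<in> T" for t
  proof -
    obtain \<B> where "finite \<B>" "\<And>c' a'. (c', a') \<in> \<B> \<Longrightarrow> bdd_piece n (it ?M) c' a' \<and> {c'..<c'+a'} \<subseteq> {fst t..<fst t + snd t}"
      "disjoint_family_on (\<lambda>(c', a'). {c'..<c'+a'}) \<B>"
      "(\<Sum>(c', a')\<in>\<B>. len ?M c' a' powr \<tau>) \<le> \<theta>1 * plen m t powr \<tau>"
      "measure lborel ({x\<in>{fst t..<fst t + snd t}. it ?M 1 x \<noteq> 0} - (\<Union>(c', a')\<in>\<B>. {c'..<c'+a'})) \<le> k"
      using T(2)[OF t] by (elim conjE) (rule step[OF _ _ _ k], assumption+, rule that)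
    then show ?thesis unfolding P_def by (intro exI[of _ \<B>]) (auto simp: iv_def case_prod_beta)
  qed
  then obtain \<B> where "\<And>t. t \<in> T \<Longrightarrow> P t (\<B> t)" by metis
  then have B: "\<And>t. t \<in> T \<Longrightarrow> finite (\<B> t)"
    "\<And>t b. t \<in> T \<Longrightarrow> b \<in> \<B> t \<Longrightarrow> pbdd ?M b \<and> iv b \<subseteq> iv t"
    "\<And>t. t \<in> T \<Longrightarrow> (\<Sum>b\<in>\<B> t. plen ?M b powr \<tau>) \<le> \<theta>1 * plen m t powr \<tau>"
    "\<And>t. t \<in> T \<Longrightarrow> measure lborel ({x\<in>iv t. it ?M 1 x \<noteq> 0} - \<Union>(iv ` \<B> t)) \<le> k" unfolding P_def by blast+
  define BB where "BB = (\<Union>t\<in>T. \<B> t)"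
  have finBB: "finite BB" using T(1) B(1) by (auto simp: BB_def)
  define P' where "P' = (\<lambda>b R z. finite R \<and> (\<forall>r\<in>R. pbdd ?M r \<and> iv r \<subseteq> iv b \<and> plen ?M r \<le> eps)
    \<and> (\<Sum>r\<in>R. plen ?M r powr \<tau>) \<le> 2 * plen ?M b powr \<tau> \<and> iv b \<inter> ?Y \<subseteq> \<Union>(iv ` R) \<union> {z})"
  have "\<exists>R z. P' b R z"
    if bB: "b \<in> BB" for b
  proof -
    obtain t where t: "t \<in> T" "b \<in> \<B> t" using bB by (auto simp: BB_def)
    have bp: "pbdd ?M b" "iv b \<subseteq> iv t" using B(2)[OF t] by auto
    have tp: "pbdd m t" "iv t \<subseteq> S" "plen m t \<le> eps" using T(2)[OF t(1)] by (auto simp: iv_def case_prod_beta)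
    \<comment> \<open>A piece is shorter than \<open>eps\<close> before the step, so its image has
      diameter at most 2 E \<open>eps\<close>. Hence it cannot reach two components of the
      prescribed set.\<close>
    have small: "\<bar>it ?M 0 x - it ?M 0 y\<bar> \<le> 2 * E * eps" if "x \<in> iv b" "y \<in> iv b" "x < y" for x y
    proof -
      have xyt: "{x..y} \<subseteq> iv t" using that bp(2) by (auto simp: iv_def case_prod_beta)
      obtain z where z: "z \<in> {x<..<y}" "it ?M 0 y - it ?M 0 x = it ?M 1 z * (y - x)"
        using dseq_mvt[OF it_dseq \<open>x < y\<close> order.trans[OF xyt tp(2)], of ?M 0] by auto
      have zt: "z \<in> iv t" "z \<in> S" using z subsetD[OF xyt, of z] tp(2) by auto
      have "\<bar>it ?M 1 z\<bar> * (y - x) \<le> (E * \<bar>it m 1 z\<bar>) * snd t"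
      proof (rule mult_mono)
        show "\<bar>it ?M 1 z\<bar> \<le> E * \<bar>it m 1 z\<bar>" unfolding it_1 abs_mult using g1_le[OF it_S[OF zt(2)]] by (rule mult_right_mono) simp
        show "y - x \<le> snd t" using that bp(2) by (auto simp: iv_def case_prod_beta)
      qed (use that E in auto)
      also have "... = E * (\<bar>it m 1 z\<bar> * snd t ^ 1)" by simp
      also have "... \<le> E * (2 * plen m t)"
        using tp zt(1) E by (intro mult_left_mono piece_bound[OF tp(1)]) (auto simp: iv_def case_prod_beta)
      also have "... \<le> E * (2 * eps)" using tp(3) E by (intro mult_left_mono) auto
      finally have "\<bar>it ?M 1 z\<bar> * (y - x) \<le> 2 * E * eps" by simp
      moreover have "\<bar>it ?M 0 x - it ?M 0 y\<bar> = \<bar>it ?M 1 z\<bar> * (y - x)"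
        unfolding abs_minus_commute[of "it ?M 0 x"] z(2) abs_mult using that by simp
      ultimately show ?thesis by simp
    qed
    have small': "\<bar>it ?M 0 x - it ?M 0 y\<bar> \<le> eps / 2" if "x \<in> ?Y" "y \<in> ?Y" "x \<in> iv b" "y \<in> iv b" for x y
    proof -
      have "\<bar>it ?M 0 x - it ?M 0 y\<bar> \<le> 2 * E * eps"
        using small[of x y] small[of y x] that E eps
        by (cases x y rule: linorder_cases) (auto simp: abs_minus_commute simp del: it.simps)
      then show ?thesis using Q that(1,2) by blast
    qed
    have sub: "{fst b..<fst b + snd b} \<subseteq> S" using bp(2) tp(2) by (auto simp: iv_def case_prod_beta)
    have small'': "\<bar>it ?M 0 x - it ?M 0 y\<bar> \<le> eps / 2" if "x \<in> ?Y" "y \<in> ?Y" "x \<in> {fst b..<fst b + snd b}" "y \<in> {fst b..<fst b + snd b}" for x y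
      using small'[of x y] that by (simp add: iv_def case_prod_beta)
    from restrict_piece[OF bp(1) sub small''] show ?thesis
      unfolding P'_def iv_def case_prod_beta .
  qed
  then obtain R z where "\<And>b. b \<in> BB \<Longrightarrow> P' b (R b) (z b)" by metis
  then have R: "\<And>b. b \<in> BB \<Longrightarrow> finite (R b)"
    "\<And>b r. b \<in> BB \<Longrightarrow> r \<in> R b \<Longrightarrow> pbdd ?M r \<and> iv r \<subseteq> iv b \<and> plen ?M r \<le> eps"
    "\<And>b. b \<in> BB \<Longrightarrow> (\<Sum>r\<in>R b. plen ?M r powr \<tau>) \<le> 2 * plen ?M b powr \<tau>"
    "\<And>b. b \<in> BB \<Longrightarrow> iv b \<inter> ?Y \<subseteq> \<Union>(iv ` R b) \<union> {z b}" unfolding P'_def by blast+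
  define T' where "T' = (\<Union>b\<in>BB. R b)"
  have fin': "finite T'" using finBB R(1) by (auto simp: T'_def)
  have p1: "\<forall>t\<in>T'. pbdd ?M t \<and> iv t \<subseteq> S \<and> plen ?M t \<le> eps"
  proof
    fix r assume "r \<in> T'"
    then obtain b t where b: "b \<in> BB" "r \<in> R b" "t \<in> T" "b \<in> \<B> t" unfolding T'_def BB_def by blast
    have "iv r \<subseteq> iv t" using R(2)[OF b(1,2)] B(2)[OF b(3,4)] by blast
    moreover have "iv t \<subseteq> S" using T(2)[OF b(3)] by (simp add: iv_def case_prod_beta)
    ultimately show "pbdd ?M r \<and> iv r \<subseteq> S \<and> plen ?M r \<le> eps" using R(2)[OF b(1,2)] by blast
  qed
  have "(\<Sum>r\<in>T'. plen ?M r powr \<tau>) \<le> (\<Sum>b\<in>BB. \<Sum>r\<in>R b. plen ?M r powr \<tau>)"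
    unfolding T'_def using finBB R(1) by (intro sum_UN_le) auto
  also have "... \<le> (\<Sum>b\<in>BB. 2 * plen ?M b powr \<tau>)" using R(3) by (rule sum_mono)
  also have "... \<le> (\<Sum>t\<in>T. \<Sum>b\<in>\<B> t. 2 * plen ?M b powr \<tau>)"
    unfolding BB_def using T(1) B(1) by (intro sum_UN_le) auto
  also have "... \<le> (\<Sum>t\<in>T. 2 * (\<theta>1 * plen m t powr \<tau>))"
    using B(3) by (intro sum_mono) (simp add: sum_distrib_left[symmetric])
  also have "... = 2 * \<theta>1 * (\<Sum>(c,a)\<in>T. len m c a powr \<tau>)" by (simp add: sum_distrib_left case_prod_beta mult.assoc)
  also have "... \<le> 2 * \<theta>1 * ((2 * \<theta>1) ^ m * eps powr \<tau>)" using T(3) \<theta>1 by (intro mult_left_mono) auto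
  finally have p2: "(\<Sum>r\<in>T'. plen ?M r powr \<tau>) \<le> (2 * \<theta>1) ^ ?M * eps powr \<tau>" by (simp add: mult.assoc)
  define Z where "Z = {x\<in>orbit_in Q ?M X. it ?M 1 x \<noteq> 0} - \<Union>(iv ` T')"
  have ivb: "iv t \<in> sets borel" for t by (simp add: iv_def case_prod_beta)
  have oX: "orbit_in Q m X \<subseteq> X" for m by (auto simp: orbit_in_def)
  have Zb: "Z \<in> sets borel"
    unfolding Z_def using fin' ivb it_nz_borel[OF Qm order.trans[OF oX X(2)]] by blast
  have finL: "emeasure lborel Y < \<infinity>" if "Y \<subseteq> {0..<L}" for Y
    using emeasure_mono[OF that, of lborel] le_less_trans[OF _ emeasure_Ico_finite] by simp
  have ZX: "Z \<subseteq> {0..<L}" using oX X(3) by (auto simp: Z_def)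
  define U where "U = {x\<in>orbit_in Q m X. it m 1 x \<noteq> 0} - \<Union>(iv ` T)"
  have "measure lborel Z \<le> real (card T) * k + \<kappa> / 2"
  proof (rule measure_UN_diff_le[OF T(1), where A = iv and B = "U"])
    show "Z \<in> sets lborel" using Zb by simp
    show "emeasure lborel Z < \<infinity>" by (rule finL[OF ZX])
    show "Z \<subseteq> (\<Union>i\<in>T. iv i) \<union> U" using it_1_Suc_nz by (auto simp: Z_def U_def orbit_in_Suc simp del: it.simps)
    show "iv t \<in> sets lborel" for t using ivb by simp
    show Ub: "U \<in> sets lborel"
      unfolding U_def using T(1) ivb it_nz_borel[OF Qm order.trans[OF oX X(2)]] by simp blast
    have "U \<subseteq> {0..<L}" using oX X(3) by (auto simp: U_def)
    then have "U \<in> fmeasurable lborel" using Ub finL by (auto simp: fmeasurable_def)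
    then have "measure lborel (Z \<inter> U) \<le> measure lborel U" using Zb by (intro measure_mono_fmeasurable) auto
    then show "measure lborel (Z \<inter> U) \<le> \<kappa> / 2" using T(4) by (simp add: U_def iv_def case_prod_beta)
    show "measure lborel (Z \<inter> iv t) \<le> k" if t: "t \<in> T" for t
    proof -
      define V where "V = {x\<in>iv t. it ?M 1 x \<noteq> 0} - \<Union>(iv ` \<B> t)"
      have tS: "iv t \<subseteq> S" using T(2)[OF t] by (simp add: iv_def case_prod_beta)
      have Vb: "V \<in> sets borel" unfolding V_def using it_nz_borel[OF ivb tS] ivb B(1)[OF t] by blast
      have "emeasure lborel V \<le> emeasure lborel (iv t)" by (intro emeasure_mono) (auto simp: V_def ivb)
      then have "emeasure lborel V < \<infinity>" using le_less_trans[OF _ emeasure_Ico_finite] by (simp add: iv_def case_prod_beta)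
      then have Vf: "V \<in> fmeasurable lborel" using Vb by (auto simp: fmeasurable_def)
      \<comment> \<open>The points lost at the ends of the hulls, one for each restricted piece,
        form a finite set.\<close>
      have Zf: "finite (z ` \<B> t)" using B(1)[OF t] by simp
      then have nz: "emeasure lborel (z ` \<B> t) = 0" by (intro emeasure_lborel_countable countable_finite)
      have Zs: "z ` \<B> t \<in> sets borel" using Zf by (intro borel_closed finite_imp_closed)
      then have Zfm: "z ` \<B> t \<in> fmeasurable lborel" by (intro fmeasurableI) (simp_all add: nz)
      have "Z \<inter> iv t \<subseteq> V \<union> z ` \<B> t"
      proof
        fix x assume x: "x \<in> Z \<inter> iv t"
        then have xY: "x \<in> ?Y" "it ?M 1 x \<noteq> 0" "x \<notin> \<Union>(iv ` T')" by (auto simp: Z_def orbit_in_Suc simp del: it.simps)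
        show "x \<in> V \<union> z ` \<B> t"
        proof (cases "x \<in> \<Union>(iv ` \<B> t)")
          case True
          then obtain b where b: "b \<in> \<B> t" "x \<in> iv b" by blast
          then have "b \<in> BB" using t by (auto simp: BB_def)
          then show ?thesis using R(4)[of b] b xY by (auto simp: T'_def simp del: it.simps)
        next
          case False
          then show ?thesis using x xY by (auto simp: V_def simp del: it.simps)
        qed
      qed
      then have "measure lborel (Z \<inter> iv t) \<le> measure lborel (V \<union> z ` \<B> t)"
        using Zb ivb Vf Zfm by (intro measure_mono_fmeasurable fmeasurable.Un) auto
      also have "... \<le> measure lborel V + measure lborel (z ` \<B> t)"
        using Vb Zs by (intro measure_Un_le) auto
      also have "measure lborel (z ` \<B> t) = 0" by (simp add: measure_def nz)
      finally show ?thesis using B(4)[OF t] by (simp add: V_def)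
    qed
  qed
  also have "real (card T) * k \<le> \<kappa> / 2" using Suc.prems by (simp add: k_def field_simps)
  finally have p3: "measure lborel Z \<le> \<kappa>" by simp
  show ?case
    using fin' p1 p2 p3 by (intro exI[of _ T']) (simp add: Z_def iv_def case_prod_beta del: it.simps)
qed

text \<open>By distortion the integral over a piece is at most twice its length, and length \<le>
  \<open>eps\<close>^(1 - \<tau>) length^\<tau> brings in the sum of \<open>local_pieces\<close>.
  The uncovered set has measure \<kappa> and derivative at most E^m there; since \<kappa> is
  arbitrary, it contributes nothing in the limit.\<close>

lemma local_volume:
  assumes X: "X \<in> sets borel" "X \<subseteq> S" "X \<subseteq> {0..<L}" and Qm: "\<And>m. orbit_in Q m X \<in> sets borel"
    and Q0: "X \<inter> Q 0 \<subseteq> {c0..<c0+a0}" "{c0..<c0+a0} \<subseteq> S" "a0 > 0" "a0 \<le> eps"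
    and Q: "\<And>j x y. x \<in> Q j \<Longrightarrow> y \<in> Q j \<Longrightarrow> \<bar>x - y\<bar> \<le> 2 * E * eps \<Longrightarrow> \<bar>x - y\<bar> \<le> eps / 2"
  shows "(\<integral>\<^sup>+x\<in>orbit_in Q m X. ennreal \<bar>it m 1 x\<bar> \<partial>lborel) \<le> ennreal (2 * eps * (2 * \<theta>1) ^ m)"
proof (rule ennreal_le_epsilon)
  fix e :: real assume e: "e > 0"
  define \<kappa> where "\<kappa> = e / E ^ m"
  have Em: "E ^ m > 0" using E by simp
  have \<kappa>: "\<kappa> > 0" using e Em by (simp add: \<kappa>_def)
  obtain T where T: "finite T" "\<And>t. t \<in> T \<Longrightarrow> pbdd m t \<and> {fst t..<fst t+snd t} \<subseteq> S \<and> plen m t \<le> eps"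
    "(\<Sum>(c,a)\<in>T. len m c a powr \<tau>) \<le> (2 * \<theta>1) ^ m * eps powr \<tau>"
    "measure lborel ({x\<in>orbit_in Q m X. it m 1 x \<noteq> 0} - (\<Union>(c,a)\<in>T. {c..<c+a})) \<le> \<kappa>"
    using local_pieces[where m = m, OF X Qm Q0 Q \<kappa>] by (force simp: case_prod_beta)
  define iv where "iv = (\<lambda>(c, a). {c..<c+a::real})"
  have n1: "n \<ge> 1" using n3 by simp
  let ?U = "{x\<in>orbit_in Q m X. it m 1 x \<noteq> 0} - \<Union>(iv ` T)"
  have ivb: "iv t \<in> sets borel" for t by (simp add: iv_def case_prod_beta)
  have oX: "orbit_in Q m X \<subseteq> X" by (auto simp: orbit_in_def)
  have Ub: "?U \<in> sets borel" using T(1) ivb it_nz_borel[OF Qm order.trans[OF oX X(2)]] by blast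
  have UL: "?U \<subseteq> {0..<L}" using oX X(3) by auto
  have "emeasure lborel ?U < \<infinity>"
    using emeasure_mono[OF UL, of lborel] le_less_trans[OF _ emeasure_Ico_finite] by simp
  then have Uk: "emeasure lborel ?U \<le> ennreal \<kappa>"
    using T(4) by (simp add: iv_def case_prod_beta emeasure_eq_ennreal_measure less_top[symmetric] ennreal_leI)
  have "(\<integral>\<^sup>+x\<in>orbit_in Q m X. ennreal \<bar>it m 1 x\<bar> \<partial>lborel)
     \<le> (\<integral>\<^sup>+x. (\<Sum>t\<in>T. ennreal (2 * \<bar>it m 1 (fst t)\<bar>) * indicator (iv t) x) + ennreal (E ^ m) * indicator ?U x \<partial>lborel)"
  proof (rule nn_integral_mono)
    fix x
    show "ennreal \<bar>it m 1 x\<bar> * indicator (orbit_in Q m X) x \<le> (\<Sum>t\<in>T. ennreal (2 * \<bar>it m 1 (fst t)\<bar>) * indicator (iv t) x) + ennreal (E ^ m) * indicator ?U x"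
    proof (cases "x \<in> orbit_in Q m X \<and> it m 1 x \<noteq> 0")
      case True
      then have xS: "x \<in> S" using oX X(2) by blast
      show ?thesis
      proof (cases "x \<in> \<Union>(iv ` T)")
        case True
        then obtain t where t: "t \<in> T" "x \<in> iv t" by blast
        have "\<bar>it m 1 x\<bar> \<le> 2 * \<bar>it m 1 (fst t)\<bar>"
          using T(2)[OF t(1)] t(2) by (intro bdd_piece_distortion[of n "it m" "fst t" "snd t" S] it_dseq n1) (auto simp: iv_def case_prod_beta bdd_piece_def)
        then have "ennreal \<bar>it m 1 x\<bar> \<le> ennreal (2 * \<bar>it m 1 (fst t)\<bar>) * indicator (iv t) x"
          using t by (simp add: ennreal_leI)
        also have "... \<le> (\<Sum>t\<in>T. ennreal (2 * \<bar>it m 1 (fst t)\<bar>) * indicator (iv t) x)"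
          using T(1) t by (intro member_le_sum[of t T "\<lambda>t. ennreal (2 * \<bar>it m 1 (fst t)\<bar>) * indicator (iv t) x"]) auto
        finally show ?thesis using \<open>x \<in> orbit_in Q m X \<and> it m 1 x \<noteq> 0\<close> by (simp add: add_increasing2)
      next
        case False
        then have "x \<in> ?U" using True by blast
        then show ?thesis using it_1_le[OF xS, of m] True by (simp add: add_increasing ennreal_leI)
      qed
    qed auto
  qed
  also have "... = (\<Sum>t\<in>T. ennreal (2 * \<bar>it m 1 (fst t)\<bar>) * emeasure lborel (iv t)) + ennreal (E ^ m) * emeasure lborel ?U"
    using Ub ivb by (subst nn_integral_add) (auto simp: nn_integral_sum nn_integral_cmult_indicator)
  also have "(\<Sum>t\<in>T. ennreal (2 * \<bar>it m 1 (fst t)\<bar>) * emeasure lborel (iv t)) \<le> (\<Sum>t\<in>T. ennreal (2 * eps powr (1 - \<tau>) * plen m t powr \<tau>))"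
  proof (rule sum_mono)
    fix t assume t: "t \<in> T"
    have b: "pbdd m t" "plen m t \<le> eps" using T(2)[OF t] by auto
    have l: "plen m t > 0" "snd t > 0" using len_pos[OF b(1)] b(1) by (auto simp: bdd_piece_def)
    \<comment> \<open>This uses that the pieces are no longer than \<open>eps\<close>; the sum of
      the lengths themselves is not what the iteration controls.\<close>
    have "plen m t = plen m t powr (1 - \<tau>) * plen m t powr \<tau>"
      using l by (simp flip: powr_add)
    also have "... \<le> eps powr (1 - \<tau>) * plen m t powr \<tau>"
      using l b(2) \<tau> by (intro mult_right_mono powr_mono2) auto
    finally have "2 * \<bar>it m 1 (fst t)\<bar> * snd t \<le> 2 * eps powr (1 - \<tau>) * plen m t powr \<tau>"
      by (simp add: len_def mult.commute)
    then show "ennreal (2 * \<bar>it m 1 (fst t)\<bar>) * emeasure lborel (iv t) \<le> ennreal (2 * eps powr (1 - \<tau>) * plen m t powr \<tau>)"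
      using l by (simp add: iv_def case_prod_beta ennreal_mult'[symmetric] ennreal_leI)
  qed
  also have "... = ennreal (2 * eps powr (1 - \<tau>) * (\<Sum>(c,a)\<in>T. len m c a powr \<tau>))"
    by (subst sum_ennreal) (auto simp: sum_distrib_left case_prod_beta)
  also have "... \<le> ennreal (2 * eps powr (1 - \<tau>) * ((2 * \<theta>1) ^ m * eps powr \<tau>))"
    using T(3) by (intro ennreal_leI mult_left_mono) auto
  also have "2 * eps powr (1 - \<tau>) * ((2 * \<theta>1) ^ m * eps powr \<tau>) = 2 * (eps powr (1 - \<tau>) * eps powr \<tau>) * (2 * \<theta>1) ^ m" by simp
  also have "eps powr (1 - \<tau>) * eps powr \<tau> = eps" using eps by (simp flip: powr_add)
  also have "ennreal (E ^ m) * emeasure lborel ?U \<le> ennreal (E ^ m) * ennreal \<kappa>" by (intro mult_left_mono Uk) auto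
  also have "ennreal (E ^ m) * ennreal \<kappa> = ennreal e" using Em E e by (simp add: \<kappa>_def ennreal_mult'[symmetric])
  finally show "(\<integral>\<^sup>+x\<in>orbit_in Q m X. ennreal \<bar>it m 1 x\<bar> \<partial>lborel) \<le> ennreal (2 * eps * (2 * \<theta>1) ^ m) + ennreal e"
    by (simp add: add_mono)
qed

end


section \<open>Averaged growth of the derivative\<close>

definition ivl :: "real \<times> real \<Rightarrow> real set" where "ivl p = {fst p..<fst p + snd p}"

definition tvl :: "real \<times> real \<times> real \<Rightarrow> real set" where "tvl t = {fst t..<fst t + wd t}"

lemma ivl_borel: "ivl p \<in> sets borel" and tvl_borel: "tvl t \<in> sets borel"
  by (simp_all add: ivl_def tvl_def)

context pushed_map begin

definition Cu :: real where "Cu = 12 * E / eps * Iu"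

lemma Cu: "Cu \<ge> 0" using E eps Iu0 by (simp add: Cu_def)

lemma \<theta>_ge1: "\<theta> \<ge> 1" using \<theta>1 by (simp add: \<theta>_def)

text \<open>The conclusion of \<open>child\<close> as one predicate, so that children for all pieces
  of a level can be chosen at once.\<close>

definition is_child where
  "is_child m t k ch \<Gamma> \<longleftrightarrow> finite ch \<and>
    (\<forall>s\<in>ch. bdd_piece n (it (Suc m)) (fst s) (wd s) \<and> tvl s \<subseteq> tvl t \<and> tlen (Suc m) s \<le> eps \<and> wt s > 0) \<and>
    (\<forall>s\<in>ch. \<forall>x\<in>tvl s. ln \<bar>it (Suc m) 1 x\<bar> \<le> ln \<bar>it m 1 x\<bar> + ln (wt s) - ln (wt t) + indicator \<Gamma> x * lp (it m 0 x)) \<and>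
    disjoint_family_on tvl ch \<and>
    (\<Sum>s\<in>ch. tw (Suc m) s)
      \<le> \<theta> * (tw m t) \<and>
    measure lborel ({x\<in>tvl t. it (Suc m) 1 x \<noteq> 0} - \<Union>(tvl ` ch)) \<le> k \<and>
    \<Gamma> \<in> sets borel \<and> \<Gamma> \<subseteq> tvl t \<and>
    UI m \<Gamma> \<le> ennreal Cu * emeasure lborel \<Gamma>"

lemma ex_child:
  assumes "tbdd m t" "tvl t \<subseteq> S" "tlen m t \<le> eps" "k > 0" "wt t > 0"
  shows "\<exists>ch \<Gamma>. is_child m t k ch \<Gamma>"
proof -
  have sub: "{fst t..<fst t + wd t} \<subseteq> S" using assms(2) by (simp add: tvl_def)
  obtain ch \<Gamma> where c: "finite ch"
    "\<And>c' a' w'. (c', a', w') \<in> ch \<Longrightarrow> bdd_piece n (it (Suc m)) c' a' \<and> {c'..<c'+a'} \<subseteq> {fst t..<fst t + wd t} \<and> len (Suc m) c' a' \<le> eps \<and> w' > 0"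
    "\<And>c' a' w' x. (c', a', w') \<in> ch \<Longrightarrow> x \<in> {c'..<c'+a'} \<Longrightarrow>
       ln \<bar>it (Suc m) 1 x\<bar> \<le> ln \<bar>it m 1 x\<bar> + ln w' - ln (wt t) + indicator \<Gamma> x * lp (it m 0 x)"
    "disjoint_family_on (\<lambda>(c', a', w'). {c'..<c'+a'}) ch"
    "(\<Sum>(c', a', w')\<in>ch. a' * w' * len (Suc m) c' a' powr (\<tau> - 1)) \<le> \<theta> * (tw m t)"
    "measure lborel ({x\<in>{fst t..<fst t + wd t}. it (Suc m) 1 x \<noteq> 0} - (\<Union>(c', a', w')\<in>ch. {c'..<c'+a'})) \<le> k"
    "\<Gamma> \<in> sets borel" "\<Gamma> \<subseteq> {fst t..<fst t + wd t}"
    "UI m \<Gamma> \<le> ennreal (12 * E / eps * Iu) * emeasure lborel \<Gamma>"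
    by (rule child[OF assms(1) sub assms(3-5)]) (rule that)
  have tv: "(\<lambda>(c', a', w'). {c'..<c'+a'}) = tvl" by (auto simp: tvl_def fun_eq_iff)
  show ?thesis
    unfolding is_child_def
  proof (intro exI[of _ ch] exI[of _ \<Gamma>] conjI ballI)
    fix s assume s: "s \<in> ch"
    have "(fst s, wd s, wt s) \<in> ch" using s by simp
    note c23 = c(2)[OF this] c(3)[OF this]
    show "bdd_piece n (it (Suc m)) (fst s) (wd s)" "tvl s \<subseteq> tvl t" "tlen (Suc m) s \<le> eps" "wt s > 0"
      using c23(1) by (simp_all add: tvl_def)
    show "ln \<bar>it (Suc m) 1 x\<bar> \<le> ln \<bar>it m 1 x\<bar> + ln (wt s) - ln (wt t) + indicator \<Gamma> x * lp (it m 0 x)" if "x \<in> tvl s" for x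
      using c23(2)[of x] that by (simp add: tvl_def)
  next
    show "measure lborel ({x\<in>tvl t. it (Suc m) 1 x \<noteq> 0} - \<Union>(tvl ` ch)) \<le> k"
      using c(6) unfolding tv by (simp add: tvl_def[of t])
  qed (use c tv in \<open>simp_all add: case_prod_beta Cu_def tvl_def[of t]\<close>)
qed

definition mass :: "(real \<times> real) set \<Rightarrow> (real \<Rightarrow> real) \<Rightarrow> ennreal" where
  "mass T0 \<rho> = (\<integral>\<^sup>+x\<in>\<Union>(ivl ` T0). ennreal (\<rho> x) \<partial>lborel)"

text \<open>Level m of the tree of weighted pieces. \<open>Gs j\<close> is the set where the growth
  of step j is counted in \<open>lp\<close>; the last clause bounds it, as seen through
  \<open>u\<close> at time j and with the density \<open>\<rho>\<close>. All other growth sits in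
  the weights, and the sum of width times weight times length^(\<tau> - 1) is what each step
  multiplies by at most \<theta>.\<close>

definition tree_at where
  "tree_at T0 \<rho> W0 m k T Gs \<longleftrightarrow> finite T \<and>
    (\<forall>t\<in>T. tbdd m t \<and> (\<exists>p\<in>T0. tvl t \<subseteq> ivl p) \<and> tlen m t \<le> eps \<and> wt t > 0) \<and>
    disjoint_family_on tvl T \<and>
    (\<forall>t\<in>T. \<forall>x\<in>tvl t. ln \<bar>it m 1 x\<bar> \<le> ln (wt t) + (\<Sum>j<m. indicator (Gs j) x * lp (it j 0 x))) \<and>
    (\<Sum>t\<in>T. tw m t) \<le> \<theta> ^ m * W0 \<and>
    measure lborel ({x\<in>\<Union>(ivl ` T0). it m 1 x \<noteq> 0} - \<Union>(tvl ` T)) \<le> k \<and>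
    (\<forall>j<m. Gs j \<in> sets borel \<and> Gs j \<subseteq> \<Union>(ivl ` T0) \<and>
      (\<integral>\<^sup>+x\<in>Gs j. ennreal (\<rho> x) * ennreal (u (it j 0 x)) \<partial>lborel) \<le> ennreal Cu * mass T0 \<rho>)"

text \<open>Every step applies \<open>child\<close> to all pieces of the level, and \<open>G\<close>
  collects their sets \<Gamma>. All pieces lie inside initial ones, where \<open>\<rho>\<close> is
  constant; so Lebesgue estimates on a piece are estimates for the measure with density
  \<open>\<rho>\<close>.\<close>

lemma tree:
  assumes T0: "finite T0" "\<And>p. p \<in> T0 \<Longrightarrow> snd p > 0 \<and> snd p \<le> eps \<and> ivl p \<subseteq> S" "disjoint_family_on ivl T0"
    and \<rho>: "\<rho> \<in> borel_measurable borel" "\<And>x. \<rho> x \<ge> 0" "\<And>p x. p \<in> T0 \<Longrightarrow> x \<in> ivl p \<Longrightarrow> \<rho> x = \<rho> (fst p)"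
    and k: "k > 0"
  shows "\<exists>T Gs. tree_at T0 \<rho> (\<Sum>p\<in>T0. snd p * snd p powr (\<tau> - 1)) m k T Gs"
  using k
proof (induction m arbitrary: k)
  case 0
  let ?T = "(\<lambda>p. (fst p, snd p, 1::real)) ` T0"
  have tv: "tvl (fst p, snd p, 1) = ivl p" for p by (simp add: tvl_def ivl_def)
  have inj: "inj_on (\<lambda>p. (fst p, snd p, 1::real)) T0" by (auto simp: inj_on_def prod_eq_iff)
  have "tree_at T0 \<rho> (\<Sum>p\<in>T0. snd p * snd p powr (\<tau> - 1)) 0 k ?T (\<lambda>_. {})"
    unfolding tree_at_def
  proof (intro conjI)
    show "disjoint_family_on tvl ?T"
      unfolding disjoint_family_on_def
    proof (intro ballI impI)
      fix r s assume "r \<in> ?T" "s \<in> ?T" "r \<noteq> s"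
      then obtain p q where pq: "p \<in> T0" "q \<in> T0" "p \<noteq> q" "r = (fst p, snd p, 1)" "s = (fst q, snd q, 1)" by blast
      then have "ivl p \<inter> ivl q = {}" using T0(3) unfolding disjoint_family_on_def by blast
      then show "tvl r \<inter> tvl s = {}" by (simp add: pq tv)
    qed
    have "\<Union>(tvl ` ?T) = \<Union>(ivl ` T0)" by (simp add: image_image tv)
    then have "{x\<in>\<Union>(ivl ` T0). it 0 1 x \<noteq> 0} - \<Union>(tvl ` ?T) = {}" by blast
    then show "measure lborel ({x\<in>\<Union>(ivl ` T0). it 0 1 x \<noteq> 0} - \<Union>(tvl ` ?T)) \<le> k" using 0 by (simp only: measure_empty)
    show "(\<Sum>t\<in>?T. tw 0 t) \<le> \<theta> ^ 0 * (\<Sum>p\<in>T0. snd p * snd p powr (\<tau> - 1))"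
      by (subst sum.reindex[OF inj]) (simp add: len_def)
  qed (use T0 tv bdd_piece_0 in \<open>auto simp: len_def\<close>)
  then show ?case by blast
next
  case (Suc m)
  let ?M = "Suc m"
  define W0 where "W0 = (\<Sum>p\<in>T0. snd p * snd p powr (\<tau> - 1))"
  define X0 where "X0 = \<Union>(ivl ` T0)"
  obtain T Gs where "tree_at T0 \<rho> W0 m (k / 2) T Gs" using Suc.IH[of "k / 2"] Suc.prems by (auto simp: W0_def)
  then have T: "finite T" "\<And>t. t \<in> T \<Longrightarrow> tbdd m t \<and> (\<exists>p\<in>T0. tvl t \<subseteq> ivl p) \<and> tlen m t \<le> eps \<and> wt t > 0"
    "disjoint_family_on tvl T"
    "\<And>t x. t \<in> T \<Longrightarrow> x \<in> tvl t \<Longrightarrow> ln \<bar>it m 1 x\<bar> \<le> ln (wt t) + (\<Sum>j<m. indicator (Gs j) x * lp (it j 0 x))"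
    "(\<Sum>t\<in>T. tw m t) \<le> \<theta> ^ m * W0"
    "measure lborel ({x\<in>X0. it m 1 x \<noteq> 0} - \<Union>(tvl ` T)) \<le> k / 2"
    "\<And>j. j < m \<Longrightarrow> Gs j \<in> sets borel \<and> Gs j \<subseteq> X0 \<and>
      (\<integral>\<^sup>+x\<in>Gs j. ennreal (\<rho> x) * ennreal (u (it j 0 x)) \<partial>lborel) \<le> ennreal Cu * mass T0 \<rho>"
    unfolding tree_at_def X0_def by blast+
  define k' where "k' = k / (2 * (real (card T) + 1))"
  have k': "k' > 0" using Suc.prems by (simp add: k'_def)
  have TS: "tvl t \<subseteq> S" "tvl t \<subseteq> X0" if "t \<in> T" for t using T(2)[OF that] T0(2) unfolding X0_def by blast+
  have "\<exists>ch \<Gamma>. is_child m t k' ch \<Gamma>" if "t \<in> T" for t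
    using T(2)[OF that] TS[OF that] k' by (intro ex_child) auto
  then obtain ch \<Gamma> where "\<And>t. t \<in> T \<Longrightarrow> is_child m t k' (ch t) (\<Gamma> t)" by metis
  then have ch: "\<And>t. t \<in> T \<Longrightarrow> finite (ch t)"
    "\<And>t s. t \<in> T \<Longrightarrow> s \<in> ch t \<Longrightarrow> tbdd ?M s \<and> tvl s \<subseteq> tvl t \<and> tlen ?M s \<le> eps \<and> wt s > 0"
    "\<And>t s x. t \<in> T \<Longrightarrow> s \<in> ch t \<Longrightarrow> x \<in> tvl s \<Longrightarrow> ln \<bar>it ?M 1 x\<bar> \<le> ln \<bar>it m 1 x\<bar> + ln (wt s) - ln (wt t) + indicator (\<Gamma> t) x * lp (it m 0 x)"
    "\<And>t. t \<in> T \<Longrightarrow> disjoint_family_on tvl (ch t)"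
    "\<And>t. t \<in> T \<Longrightarrow> (\<Sum>s\<in>ch t. tw ?M s)
      \<le> \<theta> * (tw m t)"
    "\<And>t. t \<in> T \<Longrightarrow> measure lborel ({x\<in>tvl t. it ?M 1 x \<noteq> 0} - \<Union>(tvl ` ch t)) \<le> k'"
    "\<And>t. t \<in> T \<Longrightarrow> \<Gamma> t \<in> sets borel" "\<And>t. t \<in> T \<Longrightarrow> \<Gamma> t \<subseteq> tvl t"
    "\<And>t. t \<in> T \<Longrightarrow> UI m (\<Gamma> t) \<le> ennreal Cu * emeasure lborel (\<Gamma> t)"
    unfolding is_child_def by blast+
  define T' where "T' = (\<Union>t\<in>T. ch t)"
  define G where "G = (\<Union>t\<in>T. \<Gamma> t)"
  define Gs' where "Gs' = Gs(m := G)"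
  have "tree_at T0 \<rho> W0 ?M k T' Gs'"
    unfolding tree_at_def
  proof (intro conjI)
    show "finite T'" using T(1) ch(1) by (auto simp: T'_def)
    show "\<forall>s\<in>T'. tbdd ?M s \<and> (\<exists>p\<in>T0. tvl s \<subseteq> ivl p) \<and> tlen ?M s \<le> eps \<and> wt s > 0"
    proof
      fix s assume "s \<in> T'"
      then obtain t where t: "t \<in> T" "s \<in> ch t" unfolding T'_def by blast
      show "tbdd ?M s \<and> (\<exists>p\<in>T0. tvl s \<subseteq> ivl p) \<and> tlen ?M s \<le> eps \<and> wt s > 0"
        using ch(2)[OF t] T(2)[OF t(1)] by blast
    qed
    show "disjoint_family_on tvl T'"
      unfolding disjoint_family_on_def
    proof (intro ballI impI)
      fix r s assume rs: "r \<in> T'" "s \<in> T'" "r \<noteq> s"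
      then obtain t t' where t: "t \<in> T" "r \<in> ch t" "t' \<in> T" "s \<in> ch t'" unfolding T'_def by blast
      show "tvl r \<inter> tvl s = {}"
      proof (cases "t = t'")
        case True
        then show ?thesis using ch(4)[OF t(1)] t rs by (auto simp: disjoint_family_on_def)
      next
        case False
        then have "tvl t \<inter> tvl t' = {}" using T(3) t unfolding disjoint_family_on_def by blast
        then show ?thesis using ch(2)[OF t(1,2)] ch(2)[OF t(3,4)] by blast
      qed
    qed
    show "\<forall>s\<in>T'. \<forall>x\<in>tvl s. ln \<bar>it ?M 1 x\<bar> \<le> ln (wt s) + (\<Sum>j<?M. indicator (Gs' j) x * lp (it j 0 x))"
    proof (intro ballI)
      fix s x assume s: "s \<in> T'" and x: "x \<in> tvl s"
      then obtain t where t: "t \<in> T" "s \<in> ch t" unfolding T'_def by blast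
      have xt: "x \<in> tvl t" using ch(2)[OF t] x by blast
      have l0: "lp (it m 0 x) \<ge> 0" using lp_bounds[OF it_S] TS(1)[OF t(1)] xt by blast
      have ind: "indicator (\<Gamma> t) x \<le> (indicator G x :: real)"
        using t(1) by (auto simp: G_def indicator_def)
      have "ln \<bar>it ?M 1 x\<bar> \<le> ln \<bar>it m 1 x\<bar> + ln (wt s) - ln (wt t) + indicator (\<Gamma> t) x * lp (it m 0 x)"
        by (rule ch(3)[OF t x])
      also have "... \<le> ln (wt s) + (\<Sum>j<m. indicator (Gs j) x * lp (it j 0 x)) + indicator G x * lp (it m 0 x)"
        using T(4)[OF t(1) xt] mult_right_mono[OF ind l0] by simp
      also have "... = ln (wt s) + (\<Sum>j<?M. indicator (Gs' j) x * lp (it j 0 x))"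
        by (simp add: Gs'_def)
      finally show "ln \<bar>it ?M 1 x\<bar> \<le> ln (wt s) + (\<Sum>j<?M. indicator (Gs' j) x * lp (it j 0 x))" .
    qed
    have "(\<Sum>s\<in>T'. tw ?M s)
      \<le> (\<Sum>t\<in>T. \<Sum>s\<in>ch t. tw ?M s)"
      unfolding T'_def
    proof (rule sum_UN_le)
      fix t s assume ts: "t \<in> T" "s \<in> ch t"
      have "wd s > 0" "wt s > 0" using ch(2)[OF ts] by (auto simp: bdd_piece_def)
      then show "0 \<le> tw ?M s" by simp
    qed (use T(1) ch(1) in auto)
    also have "... \<le> (\<Sum>t\<in>T. \<theta> * (tw m t))"
      using ch(5) by (rule sum_mono)
    also have "... \<le> \<theta> * (\<theta> ^ m * W0)"
      using T(5) \<theta>_ge1 by (simp add: sum_distrib_left[symmetric])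
    finally show "(\<Sum>s\<in>T'. tw ?M s) \<le> \<theta> ^ ?M * W0"
      by (simp add: mult.assoc)
    have X0b: "X0 \<in> sets borel" "X0 \<subseteq> S" "emeasure lborel X0 < \<infinity>"
    proof -
      show "X0 \<in> sets borel" unfolding X0_def using T0(1) ivl_borel by blast
      show "X0 \<subseteq> S" using T0(2) by (auto simp: X0_def)
      have "emeasure lborel X0 \<le> (\<Sum>p\<in>T0. emeasure lborel (ivl p))"
        unfolding X0_def using T0(1) ivl_borel by (intro emeasure_subadditive_finite) auto
      also have "... < \<infinity>" using emeasure_Ico_finite T0(1) by (simp add: ivl_def)
      finally show "emeasure lborel X0 < \<infinity>" .
    qed
    have finX: "Y \<in> fmeasurable lborel" if "Y \<in> sets borel" "Y \<subseteq> X0" for Y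
      using that X0b emeasure_mono[OF that(2), of lborel] by (auto simp: fmeasurable_def intro: le_less_trans)
    show "measure lborel ({x\<in>\<Union>(ivl ` T0). it ?M 1 x \<noteq> 0} - \<Union>(tvl ` T')) \<le> k"
    proof -
      define Z where "Z = {x\<in>X0. it ?M 1 x \<noteq> 0} - \<Union>(tvl ` T')"
      define U where "U = {x\<in>X0. it m 1 x \<noteq> 0} - \<Union>(tvl ` T)"
      have fT': "finite T'" using T(1) ch(1) by (auto simp: T'_def)
      have Zb: "Z \<in> sets borel" unfolding Z_def using it_nz_borel[OF X0b(1,2)] fT' tvl_borel by blast
      have Ub: "U \<in> sets borel" unfolding U_def using it_nz_borel[OF X0b(1,2)] T(1) tvl_borel by blast
      have ZX: "Z \<subseteq> X0" "U \<subseteq> X0" by (auto simp: Z_def U_def)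
      have "measure lborel Z \<le> real (card T) * k' + k / 2"
      proof (rule measure_UN_diff_le[OF T(1), where A = tvl and B = U])
        show "Z \<in> sets lborel" "U \<in> sets lborel" using Zb Ub by auto
        show "emeasure lborel Z < \<infinity>" using finX[OF Zb ZX(1)] by (simp add: fmeasurable_def)
        show "Z \<subseteq> (\<Union>i\<in>T. tvl i) \<union> U" using it_1_Suc_nz by (auto simp: Z_def U_def simp del: it.simps)
        have "measure lborel (Z \<inter> U) \<le> measure lborel U" using Zb Ub finX[OF Ub ZX(2)] by (intro measure_mono_fmeasurable) auto
        then show "measure lborel (Z \<inter> U) \<le> k / 2" using T(6) by (simp add: U_def)
        fix t assume t: "t \<in> T"
        show "tvl t \<in> sets lborel" using tvl_borel by simp
        have Vb: "{x\<in>tvl t. it ?M 1 x \<noteq> 0} - \<Union>(tvl ` ch t) \<in> sets borel"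
          using it_nz_borel[OF tvl_borel TS(1)[OF t]] ch(1)[OF t] tvl_borel by blast
        have "Z \<inter> tvl t \<subseteq> {x\<in>tvl t. it ?M 1 x \<noteq> 0} - \<Union>(tvl ` ch t)"
          using t by (auto simp: Z_def T'_def simp del: it.simps)
        then have "measure lborel (Z \<inter> tvl t) \<le> measure lborel ({x\<in>tvl t. it ?M 1 x \<noteq> 0} - \<Union>(tvl ` ch t))"
          using Zb tvl_borel Vb TS(2)[OF t] by (intro measure_mono_fmeasurable finX[OF Vb]) auto
        then show "measure lborel (Z \<inter> tvl t) \<le> k'" using ch(6)[OF t] by simp
      qed
      also have "real (card T) * k' \<le> k / 2" using Suc.prems by (simp add: k'_def field_simps)
      finally show ?thesis by (simp add: Z_def X0_def)
    qed
    have Gb: "G \<in> sets borel" unfolding G_def using T(1) ch(7) by blast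
    have GX: "G \<subseteq> X0" unfolding G_def using ch(8) TS(2) by blast
    have "(\<integral>\<^sup>+x\<in>G. ennreal (\<rho> x) * ennreal (u (it m 0 x)) \<partial>lborel) \<le> ennreal Cu * mass T0 \<rho>"
    proof -
      have "\<exists>c\<ge>0. \<forall>x\<in>tvl t. \<rho> x = c" if t: "t \<in> T" for t
        using T(2)[OF t] \<rho>(2,3) by (metis subsetD)
      then obtain c where c: "\<And>t. t \<in> T \<Longrightarrow> c t \<ge> 0" "\<And>t x. t \<in> T \<Longrightarrow> x \<in> tvl t \<Longrightarrow> \<rho> x = c t" by metis
      have c': "ennreal (\<rho> x) * indicator (\<Gamma> t) x = ennreal (c t) * indicator (\<Gamma> t) x" if "t \<in> T" for t x
        using c(2)[OF that, of x] ch(8)[OF that] by (auto simp: indicator_def)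
      have e1: "(\<integral>\<^sup>+x\<in>\<Gamma> t. ennreal (\<rho> x) * ennreal (u (it m 0 x)) \<partial>lborel) \<le> ennreal Cu * (\<integral>\<^sup>+x\<in>\<Gamma> t. ennreal (\<rho> x) \<partial>lborel)"
        and e2: "(\<lambda>x. ennreal (\<rho> x) * ennreal (u (it m 0 x)) * indicator (\<Gamma> t) x) \<in> borel_measurable lborel" if t: "t \<in> T" for t
      proof -
        have mu: "(\<lambda>x. ennreal (u (it m 0 x)) * indicator (\<Gamma> t) x) \<in> borel_measurable lborel"
          using ch(7,8)[OF t] TS(1)[OF t] by (intro measurable_u) auto
        have eq: "ennreal (\<rho> x) * ennreal (u (it m 0 x)) * indicator (\<Gamma> t) x = ennreal (c t) * (ennreal (u (it m 0 x)) * indicator (\<Gamma> t) x)" for x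
          using c(2)[OF t, of x] ch(8)[OF t] by (auto simp: indicator_def)
        show "(\<lambda>x. ennreal (\<rho> x) * ennreal (u (it m 0 x)) * indicator (\<Gamma> t) x) \<in> borel_measurable lborel"
          unfolding eq using mu by measurable
        have "(\<integral>\<^sup>+x\<in>\<Gamma> t. ennreal (\<rho> x) * ennreal (u (it m 0 x)) \<partial>lborel) = ennreal (c t) * UI m (\<Gamma> t)"
          unfolding eq by (rule nn_integral_cmult[OF mu])
        also have "... \<le> ennreal (c t) * (ennreal Cu * emeasure lborel (\<Gamma> t))" by (intro mult_left_mono ch(9)[OF t]) auto
        also have "... = ennreal Cu * (\<integral>\<^sup>+x\<in>\<Gamma> t. ennreal (\<rho> x) \<partial>lborel)"
          unfolding c'[OF t] using ch(7)[OF t] by (simp add: nn_integral_cmult_indicator mult_ac)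
        finally show "(\<integral>\<^sup>+x\<in>\<Gamma> t. ennreal (\<rho> x) * ennreal (u (it m 0 x)) \<partial>lborel) \<le> ennreal Cu * (\<integral>\<^sup>+x\<in>\<Gamma> t. ennreal (\<rho> x) \<partial>lborel)" .
      qed
      have "(\<integral>\<^sup>+x\<in>G. ennreal (\<rho> x) * ennreal (u (it m 0 x)) \<partial>lborel) \<le> (\<Sum>t\<in>T. \<integral>\<^sup>+x\<in>\<Gamma> t. ennreal (\<rho> x) * ennreal (u (it m 0 x)) \<partial>lborel)"
        unfolding G_def by (intro nn_integral_UN_le T(1) e2)
      also have "... \<le> (\<Sum>t\<in>T. ennreal Cu * (\<integral>\<^sup>+x\<in>\<Gamma> t. ennreal (\<rho> x) \<partial>lborel))" by (intro sum_mono e1)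
      also have "... = ennreal Cu * (\<Sum>t\<in>T. \<integral>\<^sup>+x\<in>\<Gamma> t. ennreal (\<rho> x) \<partial>lborel)" by (simp add: sum_distrib_left)
      also have "(\<Sum>t\<in>T. \<integral>\<^sup>+x\<in>\<Gamma> t. ennreal (\<rho> x) \<partial>lborel) = (\<integral>\<^sup>+x. (\<Sum>t\<in>T. ennreal (\<rho> x) * indicator (\<Gamma> t) x) \<partial>lborel)"
        using \<rho>(1) ch(7) by (intro nn_integral_sum[symmetric]) auto
      also have "... \<le> mass T0 \<rho>"
        unfolding mass_def
      proof (rule nn_integral_mono)
        fix x
        show "(\<Sum>t\<in>T. ennreal (\<rho> x) * indicator (\<Gamma> t) x) \<le> ennreal (\<rho> x) * indicator (\<Union>(ivl ` T0)) x"
        proof (cases "\<exists>t\<in>T. x \<in> \<Gamma> t")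
          case False
          then show ?thesis by simp
        next
          case True
          then obtain t where t: "t \<in> T" "x \<in> \<Gamma> t" by blast
          \<comment> \<open>The sets \<Gamma> of distinct pieces are disjoint, so no mass is counted
            twice.\<close>
          have "x \<notin> \<Gamma> s" if "s \<in> T - {t}" for s
          proof -
            have "tvl s \<inter> tvl t = {}" using T(3) t that unfolding disjoint_family_on_def by blast
            then show ?thesis using ch(8)[of s] ch(8)[OF t(1)] t(2) that by blast
          qed
          then have "(\<Sum>t\<in>T. ennreal (\<rho> x) * indicator (\<Gamma> t) x) = ennreal (\<rho> x)"
            using t T(1) by (subst sum.remove[of _ t]) auto
          moreover have "x \<in> \<Union>(ivl ` T0)" using ch(8)[OF t(1)] t(2) TS(2)[OF t(1)] by (auto simp: X0_def)
          ultimately show ?thesis by simp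
        qed
      qed
      finally show ?thesis by (simp add: mult_left_mono)
    qed
    then show "\<forall>j<?M. Gs' j \<in> sets borel \<and> Gs' j \<subseteq> \<Union>(ivl ` T0) \<and>
      (\<integral>\<^sup>+x\<in>Gs' j. ennreal (\<rho> x) * ennreal (u (it j 0 x)) \<partial>lborel) \<le> ennreal Cu * mass T0 \<rho>"
      using T(7) Gb GX unfolding Gs'_def X0_def less_Suc_eq by auto
  qed
  then show ?case unfolding W0_def by blast
qed

text \<open>On a piece of weight w, put h = w / \<theta>^N; then ln w = N ln \<theta> + ln h \<le> N
  ln \<theta> + h. The integral of h over all pieces is bounded independently of N, because the
  weighted sum grows by at most \<theta> per step. So only N ln \<theta> and the terms along the
  orbit grow with N. \<open>v\<close> takes the part of \<open>lp\<close> that is not dominated by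
  \<open>u\<close>.\<close>

lemma averaged:
  assumes T0: "finite T0" "\<And>p. p \<in> T0 \<Longrightarrow> snd p > 0 \<and> snd p \<le> eps \<and> ivl p \<subseteq> S" "disjoint_family_on ivl T0"
    and \<rho>: "\<rho> \<in> borel_measurable borel" "\<And>x. \<rho> x \<ge> 0" "\<And>p x. p \<in> T0 \<Longrightarrow> x \<in> ivl p \<Longrightarrow> \<rho> x = \<rho> (fst p)"
    and M: "\<And>x. \<rho> x \<le> M"
    and v: "continuous_on S v" "\<And>y. y \<in> S \<Longrightarrow> v y \<ge> 0" "\<And>y. y \<in> S \<Longrightarrow> lp y \<le> ln E * u y + v y"
  defines "X0 \<equiv> \<Union>(ivl ` T0)"
  shows "(\<integral>\<^sup>+x\<in>X0. ennreal (\<rho> x) * ennreal (ln (max 1 \<bar>it N 1 x\<bar>)) \<partial>lborel)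
    \<le> ennreal (real N * (ln \<theta> + ln E * Cu)) * mass T0 \<rho>
      + ennreal (M * eps powr (1 - \<tau>) * (\<Sum>p\<in>T0. snd p * snd p powr (\<tau> - 1)))
      + (\<integral>\<^sup>+x\<in>X0. ennreal (\<rho> x) * ennreal (\<Sum>j<N. v (it j 0 x)) \<partial>lborel)"
proof (rule ennreal_le_epsilon)
  fix e :: real assume e: "e > 0"
  define W0 where "W0 = (\<Sum>p\<in>T0. snd p * snd p powr (\<tau> - 1))"
  have M0: "M \<ge> 0" using \<rho>(2) M order.trans by blast
  define Y where "Y = M * (real N * ln E) + 1"
  have lnE: "ln E \<ge> 0" using E by simp
  have Y: "Y > 0" using M0 lnE by (simp add: Y_def add_nonneg_pos)
  obtain T Gs where "tree_at T0 \<rho> W0 N (e / Y) T Gs" using tree[OF T0 \<rho> divide_pos_pos[OF e Y], of N] unfolding W0_def by blast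
  then have T: "finite T" "\<And>t. t \<in> T \<Longrightarrow> tbdd N t \<and> (\<exists>p\<in>T0. tvl t \<subseteq> ivl p) \<and> tlen N t \<le> eps \<and> wt t > 0"
    "disjoint_family_on tvl T"
    "\<And>t x. t \<in> T \<Longrightarrow> x \<in> tvl t \<Longrightarrow> ln \<bar>it N 1 x\<bar> \<le> ln (wt t) + (\<Sum>j<N. indicator (Gs j) x * lp (it j 0 x))"
    "(\<Sum>t\<in>T. tw N t) \<le> \<theta> ^ N * W0"
    "measure lborel ({x\<in>X0. it N 1 x \<noteq> 0} - \<Union>(tvl ` T)) \<le> e / Y"
    "\<And>j. j < N \<Longrightarrow> Gs j \<in> sets borel \<and> Gs j \<subseteq> X0 \<and>
      (\<integral>\<^sup>+x\<in>Gs j. ennreal (\<rho> x) * ennreal (u (it j 0 x)) \<partial>lborel) \<le> ennreal Cu * mass T0 \<rho>"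
    unfolding tree_at_def X0_def by blast+
  have X0b: "X0 \<in> sets borel" unfolding X0_def using T0(1) ivl_borel by blast
  have X0S: "X0 \<subseteq> S" using T0(2) by (auto simp: X0_def)
  have "emeasure lborel X0 \<le> (\<Sum>p\<in>T0. emeasure lborel (ivl p))"
    unfolding X0_def using T0(1) ivl_borel by (intro emeasure_subadditive_finite) auto
  also have "... < \<infinity>" using emeasure_Ico_finite T0(1) by (simp add: ivl_def)
  finally have X0f: "emeasure lborel X0 < \<infinity>" .
  define U where "U = {x\<in>X0. it N 1 x \<noteq> 0} - \<Union>(tvl ` T)"
  have Ub: "U \<in> sets borel" unfolding U_def using it_nz_borel[OF X0b X0S] T(1) tvl_borel by blast
  have "emeasure lborel U \<le> emeasure lborel X0" using X0b by (intro emeasure_mono) (auto simp: U_def)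
  then have "emeasure lborel U < \<infinity>" using X0f by (rule le_less_trans)
  then have Ue: "emeasure lborel U \<le> ennreal (e / Y)"
    using T(6) by (simp add: emeasure_eq_ennreal_measure less_top[symmetric] ennreal_leI U_def)
  define h where "h = (\<lambda>t::real\<times>real\<times>real. wt t / \<theta> ^ N :: real)"
  have \<theta>N: "\<theta> ^ N \<ge> 1" using \<theta>_ge1 by simp
  have T2: "wd t > 0" "wt t > 0" "0 < h t" "tlen N t > 0" "tlen N t \<le> eps" "tvl t \<subseteq> X0" if "t \<in> T" for t
  proof -
    have b: "tbdd N t" "\<exists>p\<in>T0. tvl t \<subseteq> ivl p" "tlen N t \<le> eps" "wt t > 0"
      using T(2)[OF that] by auto
    show "wd t > 0" using b(1) by (simp add: bdd_piece_def)
    show "tvl t \<subseteq> X0" using b(2) unfolding X0_def by blast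
    show "0 < h t" using b(4) \<theta>N by (simp add: h_def)
  qed (use T(2)[OF that] len_pos in auto)
  have vc: "(\<lambda>x. ennreal (\<rho> x) * ennreal (\<Sum>j<N. v (it j 0 x)) * indicator X0 x) \<in> borel_measurable lborel"
  proof -
    have "(\<lambda>x. ennreal (\<Sum>j<N. v (it j 0 x)) * indicator X0 x) \<in> borel_measurable lborel"
      using it_S X0S X0b by (intro borel_continuous_indicator continuous_on_sum continuous_on_compose2[OF v(1) dseq_continuous[OF dseq_subset[OF it_dseq]]]) auto
    then have "(\<lambda>x. ennreal (\<rho> x) * (ennreal (\<Sum>j<N. v (it j 0 x)) * indicator X0 x)) \<in> borel_measurable lborel"
      using \<rho>(1) by measurable
    then show ?thesis by (simp add: mult.assoc)
  qed
  have um: "(\<lambda>x. ennreal (\<rho> x) * ennreal (u (it j 0 x)) * indicator (Gs j) x) \<in> borel_measurable lborel" if "j < N" for j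
  proof -
    have "(\<lambda>x. ennreal (u (it j 0 x)) * indicator (Gs j) x) \<in> borel_measurable lborel"
      using T(7)[OF that] X0S by (intro measurable_u) auto
    then have "(\<lambda>x. ennreal (\<rho> x) * (ennreal (u (it j 0 x)) * indicator (Gs j) x)) \<in> borel_measurable lborel"
      using \<rho>(1) by measurable
    then show ?thesis by (simp add: mult.assoc)
  qed
  define F1 where "F1 = (\<lambda>x. ennreal (real N * ln \<theta>) * (ennreal (\<rho> x) * indicator X0 x))"
  define F2 where "F2 = (\<lambda>x. \<Sum>t\<in>T. ennreal (M * h t) * indicator (tvl t) x)"
  define F3 where "F3 = (\<lambda>x. \<Sum>j<N. ennreal (ln E) * (ennreal (\<rho> x) * ennreal (u (it j 0 x)) * indicator (Gs j) x))"
  define F4 where "F4 = (\<lambda>x. ennreal (\<rho> x) * ennreal (\<Sum>j<N. v (it j 0 x)) * indicator X0 x)"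
  define F5 where "F5 = (\<lambda>x. ennreal (M * (real N * ln E)) * indicator U x)"
  have meas: "F1 \<in> borel_measurable lborel" "F2 \<in> borel_measurable lborel" "F3 \<in> borel_measurable lborel" "F4 \<in> borel_measurable lborel" "F5 \<in> borel_measurable lborel"
    using \<rho>(1) X0b Ub vc um tvl_borel unfolding F1_def F2_def F3_def F4_def F5_def by (auto intro!: borel_measurable_sum)
  have "(\<integral>\<^sup>+x\<in>X0. ennreal (\<rho> x) * ennreal (ln (max 1 \<bar>it N 1 x\<bar>)) \<partial>lborel) \<le> (\<integral>\<^sup>+x. F1 x + F2 x + F3 x + F4 x + F5 x \<partial>lborel)"
  proof (rule nn_integral_mono)
    fix x
    show "ennreal (\<rho> x) * ennreal (ln (max 1 \<bar>it N 1 x\<bar>)) * indicator X0 x \<le> F1 x + F2 x + F3 x + F4 x + F5 x"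
    proof (cases "x \<in> X0 \<and> \<bar>it N 1 x\<bar> > 1")
      case False
      then have "ennreal (\<rho> x) * ennreal (ln (max 1 \<bar>it N 1 x\<bar>)) * indicator X0 x = 0" by (cases "x \<in> X0") auto
      then show ?thesis by (simp only: zero_le)
    next
      case True
      then have x: "x \<in> X0" "x \<in> S" "it N 1 x \<noteq> 0" using X0S by auto
      define P where "P = ln \<bar>it N 1 x\<bar>"
      have P: "ln (max 1 \<bar>it N 1 x\<bar>) = P" using True by (simp add: P_def)
      show ?thesis
      proof (cases "x \<in> \<Union>(tvl ` T)")
        case False
        \<comment> \<open>Outside all pieces the trivial bound E^N is enough: the exceptional set
          has measure at most e / \<open>Y\<close>, with \<open>Y\<close> chosen for this
          purpose.\<close>
        have "P \<le> ln (E ^ N)" unfolding P_def using True it_1_le[OF x(2)] E by (subst ln_le_cancel_iff) auto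
        then have "P \<le> real N * ln E" using E by (simp add: ln_realpow)
        then have "\<rho> x * P \<le> M * (real N * ln E)" using M0 M \<rho>(2) True by (intro mult_mono) (auto simp: P_def)
        then have "ennreal (\<rho> x) * ennreal P * indicator X0 x \<le> F5 x"
          using x False \<rho>(2)[of x] by (simp add: F5_def U_def ennreal_mult'[symmetric] ennreal_leI)
        then show ?thesis unfolding P by (rule order.trans) simp
      next
        case True
        then obtain t where t: "t \<in> T" "x \<in> tvl t" by blast
        let ?w = "wt t"
        have "?w = \<theta> ^ N * h t" using \<theta>_ge1 by (simp add: h_def)
        then have "ln ?w = ln (\<theta> ^ N) + ln (h t)" using T2(3)[OF t(1)] \<theta>N by (simp add: ln_mult_pos)
        moreover have "ln (\<theta> ^ N) = real N * ln \<theta>" using \<theta>_ge1 by (simp add: ln_realpow)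
        moreover have "ln (h t) \<le> h t" using ln_le_minus_one[OF T2(3)[OF t(1)]] by simp
        ultimately have lw: "ln ?w \<le> real N * ln \<theta> + h t" by simp
        have lv: "indicator (Gs j) x * lp (it j 0 x) \<le> ln E * (indicator (Gs j) x * u (it j 0 x)) + v (it j 0 x)" for j
          using v(2,3)[OF it_S[OF x(2), of j]] by (auto simp: indicator_def)
        have "(\<Sum>j<N. indicator (Gs j) x * lp (it j 0 x)) \<le> (\<Sum>j<N. ln E * (indicator (Gs j) x * u (it j 0 x)) + v (it j 0 x))"
          by (intro sum_mono lv)
        also have "... = (\<Sum>j<N. ln E * (indicator (Gs j) x * u (it j 0 x))) + (\<Sum>j<N. v (it j 0 x))" by (simp add: sum.distrib)
        finally have "P \<le> real N * ln \<theta> + h t + (\<Sum>j<N. ln E * (indicator (Gs j) x * u (it j 0 x))) + (\<Sum>j<N. v (it j 0 x))"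
          using T(4)[OF t] lw by (simp add: P_def)
        then have "\<rho> x * P \<le> \<rho> x * (real N * ln \<theta> + h t + (\<Sum>j<N. ln E * (indicator (Gs j) x * u (it j 0 x))) + (\<Sum>j<N. v (it j 0 x)))"
          using \<rho>(2) by (rule mult_left_mono)
        also have "... = real N * ln \<theta> * \<rho> x + \<rho> x * h t + (\<Sum>j<N. ln E * (\<rho> x * u (it j 0 x) * indicator (Gs j) x)) + \<rho> x * (\<Sum>j<N. v (it j 0 x))"
          by (simp add: algebra_simps sum_distrib_left)
        also have "... \<le> real N * ln \<theta> * \<rho> x + M * h t + (\<Sum>j<N. ln E * (\<rho> x * u (it j 0 x) * indicator (Gs j) x)) + \<rho> x * (\<Sum>j<N. v (it j 0 x))"
          using M[of x] T2(3)[OF t(1)] by (simp add: mult_right_mono)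
        finally have "ennreal (\<rho> x * P) \<le> ennreal (real N * ln \<theta> * \<rho> x + M * h t + (\<Sum>j<N. ln E * (\<rho> x * u (it j 0 x) * indicator (Gs j) x)) + \<rho> x * (\<Sum>j<N. v (it j 0 x)))"
          by (rule ennreal_leI)
        also have "... = ennreal (real N * ln \<theta> * \<rho> x) + ennreal (M * h t) + ennreal (\<Sum>j<N. ln E * (\<rho> x * u (it j 0 x) * indicator (Gs j) x)) + ennreal (\<rho> x * (\<Sum>j<N. v (it j 0 x)))"
        proof -
          have 4: "ennreal (a + b + c + d) = ennreal a + ennreal b + ennreal c + ennreal d" if "0 \<le> a" "0 \<le> b" "0 \<le> c" "0 \<le> d" for a b c d
            using that by (simp add: ennreal_plus)
          show ?thesis
          proof (rule 4)
            show "0 \<le> real N * ln \<theta> * \<rho> x" using \<rho>(2) \<theta>_ge1 by simp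
            show "0 \<le> M * h t" using M0 less_imp_le[OF T2(3)[OF t(1)]] by simp
            show "0 \<le> (\<Sum>j<N. ln E * (\<rho> x * u (it j 0 x) * indicator (Gs j) x))"
              using lnE \<rho>(2) u(2)[OF it_S[OF x(2)]] by (intro sum_nonneg mult_nonneg_nonneg) auto
            show "0 \<le> \<rho> x * (\<Sum>j<N. v (it j 0 x))"
              using \<rho>(2) v(2)[OF it_S[OF x(2)]] by (intro sum_nonneg mult_nonneg_nonneg) auto
          qed
        qed
        also have "ennreal (real N * ln \<theta> * \<rho> x) = F1 x" using x \<theta>_ge1 by (simp add: F1_def ennreal_mult')
        also have "ennreal (M * h t) \<le> F2 x"
          unfolding F2_def using t T(1) member_le_sum[of t T "\<lambda>t. ennreal (M * h t) * indicator (tvl t) x"] by simp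
        also have "ennreal (\<Sum>j<N. ln E * (\<rho> x * u (it j 0 x) * indicator (Gs j) x)) = F3 x"
          unfolding F3_def using \<rho>(2) lnE u(2)[OF it_S[OF x(2)]]
          by (subst sum_ennreal[symmetric]) (auto simp: indicator_def ennreal_mult' intro!: sum.cong)
        also have "ennreal (\<rho> x * (\<Sum>j<N. v (it j 0 x))) = F4 x" using x \<rho>(2) by (simp add: F4_def ennreal_mult')
        finally have "ennreal (\<rho> x * P) \<le> F1 x + F2 x + F3 x + F4 x" by (simp add: add_mono)
        then have "ennreal (\<rho> x * P) \<le> F1 x + F2 x + F3 x + F4 x + F5 x" by (rule order.trans) simp
        then show ?thesis unfolding P using x \<rho>(2) by (simp add: ennreal_mult')
      qed
    qed
  qed
  also have "... = integral\<^sup>N lborel F1 + integral\<^sup>N lborel F2 + integral\<^sup>N lborel F3 + integral\<^sup>N lborel F4 + integral\<^sup>N lborel F5"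
    using meas by (simp add: nn_integral_add)
  also have "integral\<^sup>N lborel F1 = ennreal (real N * ln \<theta>) * mass T0 \<rho>"
    unfolding F1_def mass_def X0_def[symmetric] using \<rho>(1) X0b by (intro nn_integral_cmult) auto
  also have "integral\<^sup>N lborel F2 \<le> ennreal (M * eps powr (1 - \<tau>) * W0)"
  proof -
    have "integral\<^sup>N lborel F2 = (\<Sum>t\<in>T. ennreal (M * h t) * emeasure lborel (tvl t))"
      unfolding F2_def using tvl_borel by (simp add: nn_integral_sum nn_integral_cmult_indicator)
    also have "... = (\<Sum>t\<in>T. ennreal (M * h t * wd t))"
    proof (rule sum.cong[OF refl])
      fix t assume t: "t \<in> T"
      have "emeasure lborel (tvl t) = ennreal (wd t)" using T2(1)[OF t] by (simp add: tvl_def)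
      then show "ennreal (M * h t) * emeasure lborel (tvl t) = ennreal (M * h t * wd t)"
        using T2(1,3)[OF t] M0 by (simp add: ennreal_mult')
    qed
    also have "... = ennreal (\<Sum>t\<in>T. M * h t * wd t)"
      using M0 less_imp_le[OF T2(1)] less_imp_le[OF T2(3)] by (intro sum_ennreal mult_nonneg_nonneg) auto
    also have "(\<Sum>t\<in>T. M * h t * wd t) \<le> (\<Sum>t\<in>T. M * eps powr (1 - \<tau>) / \<theta> ^ N * (tw N t))"
    proof (rule sum_mono)
      fix t assume t: "t \<in> T"
      define l where "l = tlen N t"
      have l: "l > 0" "l \<le> eps" using T2(4,5)[OF t] by (auto simp: l_def)
      \<comment> \<open>Pieces are no longer than \<open>eps\<close> and \<tau> - 1 < 0, so this
        factor is at least 1 and turns the plain sum of h times width into the weighted sum of the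
        tree.\<close>
      have "1 = eps powr (1 - \<tau>) * eps powr (\<tau> - 1)" using eps by (simp flip: powr_add)
      also have "... \<le> eps powr (1 - \<tau>) * l powr (\<tau> - 1)"
        using l \<tau> by (intro mult_left_mono powr_mono2') auto
      finally have 1: "1 \<le> eps powr (1 - \<tau>) * l powr (\<tau> - 1)" .
      have "0 \<le> M * h t * wd t" using M0 T2(1,3)[OF t] by simp
      from mult_left_mono[OF 1 this] show "M * h t * wd t \<le> M * eps powr (1 - \<tau>) / \<theta> ^ N * (tw N t)"
        by (simp add: h_def l_def field_simps)
    qed
    also have "... \<le> M * eps powr (1 - \<tau>) / \<theta> ^ N * (\<theta> ^ N * W0)"
      unfolding sum_distrib_left[symmetric] using T(5) M0 \<theta>N by (intro mult_left_mono) auto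
    also have "... = M * eps powr (1 - \<tau>) * W0" using \<theta>_ge1 by simp
    finally show ?thesis by (simp add: ennreal_leI)
  qed
  also have "integral\<^sup>N lborel F3 \<le> ennreal (real N * (ln E * Cu)) * mass T0 \<rho>"
  proof -
    have "integral\<^sup>N lborel F3 = (\<Sum>j<N. ennreal (ln E) * (\<integral>\<^sup>+x\<in>Gs j. ennreal (\<rho> x) * ennreal (u (it j 0 x)) \<partial>lborel))"
      unfolding F3_def using um by (subst nn_integral_sum) (auto simp: nn_integral_cmult)
    also have "... \<le> (\<Sum>j<N. ennreal (ln E) * (ennreal Cu * mass T0 \<rho>))"
      using T(7) by (intro sum_mono mult_left_mono) auto
    also have "... = ennreal (real N * (ln E * Cu)) * mass T0 \<rho>"
      using lnE Cu by (simp add: ennreal_mult ennreal_of_nat_eq_real_of_nat mult.assoc)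
    finally show ?thesis .
  qed
  also have "integral\<^sup>N lborel F5 \<le> ennreal e"
  proof -
    have "integral\<^sup>N lborel F5 = ennreal (M * (real N * ln E)) * emeasure lborel U"
      unfolding F5_def using Ub by (simp add: nn_integral_cmult_indicator)
    also have "... \<le> ennreal Y * ennreal (e / Y)"
      using Ue by (intro mult_mono ennreal_leI) (auto simp: Y_def)
    also have "... = ennreal e" using Y e by (simp add: ennreal_mult'[symmetric])
    finally show ?thesis .
  qed
  finally have "(\<integral>\<^sup>+x\<in>X0. ennreal (\<rho> x) * ennreal (ln (max 1 \<bar>it N 1 x\<bar>)) \<partial>lborel) \<le>
     ennreal (real N * ln \<theta>) * mass T0 \<rho> + ennreal (M * eps powr (1 - \<tau>) * W0) + ennreal (real N * (ln E * Cu)) * mass T0 \<rho> + integral\<^sup>N lborel F4 + ennreal e"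
    by (simp add: add_mono)
  also have "... = (ennreal (real N * ln \<theta>) + ennreal (real N * (ln E * Cu))) * mass T0 \<rho> + ennreal (M * eps powr (1 - \<tau>) * W0) + integral\<^sup>N lborel F4 + ennreal e"
    by (simp only: distrib_right) (simp only: ac_simps)
  also have "ennreal (real N * ln \<theta>) + ennreal (real N * (ln E * Cu)) = ennreal (real N * (ln \<theta> + ln E * Cu))"
    using \<theta>_ge1 lnE Cu by (subst ennreal_plus[symmetric]) (auto simp: algebra_simps)
  finally show "(\<integral>\<^sup>+x\<in>X0. ennreal (\<rho> x) * ennreal (ln (max 1 \<bar>it N 1 x\<bar>)) \<partial>lborel)
    \<le> ennreal (real N * (ln \<theta> + ln E * Cu)) * mass T0 \<rho>
      + ennreal (M * eps powr (1 - \<tau>) * (\<Sum>p\<in>T0. snd p * snd p powr (\<tau> - 1)))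
      + (\<integral>\<^sup>+x\<in>X0. ennreal (\<rho> x) * ennreal (\<Sum>j<N. v (it j 0 x)) \<partial>lborel) + ennreal e"
    by (simp add: W0_def F4_def)
qed

end


section \<open>Entropy\<close>

text \<open>Division with remainder by an m for which a m / m is close to the infimum.\<close>

lemma fekete:
  fixes a :: "nat \<Rightarrow> real"
  assumes sub: "\<And>m n. a (m + n) \<le> a m + a n" and nn: "\<And>n. a n \<ge> 0"
  shows "convergent (\<lambda>n. a n / real n)"
proof -
  define L where "L = Inf ((\<lambda>n. a n / real n) ` {1..})"
  have bdd: "bdd_below ((\<lambda>n. a n / real n) ` {1..})"
    using nn by (intro bdd_belowI[of _ 0]) auto
  have low: "L \<le> a n / real n" if "n \<ge> 1" for n
    unfolding L_def using bdd that by (intro cInf_lower) auto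
  have mult: "a (q * m + r) \<le> real q * a m + a r" for q m r
  proof (induction q)
    case (Suc q)
    have "a (Suc q * m + r) = a (m + (q * m + r))" by (simp add: algebra_simps)
    also have "... \<le> a m + a (q * m + r)" by (rule sub)
    finally show ?case using Suc by (simp add: algebra_simps)
  qed simp
  have "(\<lambda>n. a n / real n) \<longlonglongrightarrow> L"
  proof (rule LIMSEQ_I)
    fix e :: real assume e: "e > 0"
    have "\<exists>x\<in>(\<lambda>n. a n / real n) ` {1..}. x < L + e / 2"
      unfolding L_def using bdd e by (intro cInf_lessD) auto
    then obtain m where m: "m \<ge> 1" "a m / real m < L + e / 2" by auto
    define C where "C = (\<Sum>r<m. a r)"
    have C: "a r \<le> C" if "r < m" for r unfolding C_def using nn that by (intro member_le_sum) auto
    have C0: "C \<ge> 0" unfolding C_def using nn by (intro sum_nonneg) auto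
    obtain N :: nat where N: "C / (e / 2) < real N" using reals_Archimedean2 by blast
    show "\<exists>no. \<forall>n\<ge>no. norm (a n / real n - L) < e"
    proof (intro exI[of _ "max 1 N"] allI impI)
      fix n assume n: "n \<ge> max 1 N"
      have "a n = a ((n div m) * m + n mod m)" by simp
      also have "... \<le> real (n div m) * a m + a (n mod m)" by (rule mult)
      also have "... \<le> real (n div m) * a m + C" using C m by simp
      also have "real (n div m) * a m = (real (n div m) * real m) * (a m / real m)" using m by simp
      also have "... \<le> real n * (a m / real m)"
      proof (rule mult_right_mono)
        have "n div m * m \<le> n" by simp
        then show "real (n div m) * real m \<le> real n" by (metis of_nat_le_iff of_nat_mult)
      qed (use nn in simp)
      finally have "a n \<le> real n * (a m / real m) + C" by simp
      then have "a n / real n \<le> a m / real m + C / real n" using n by (simp add: field_simps)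
      moreover have "C / real n < e / 2"
      proof -
        have "C / (e / 2) < real n" using N n by linarith
        then show ?thesis using e n by (simp add: field_simps)
      qed
      ultimately have "a n / real n < L + e" using m(2) by linarith
      then show "norm (a n / real n - L) < e" using low[of n] n by simp
    qed
  qed
  then show ?thesis by (auto simp: convergent_def)
qed

section \<open>Entropy of random variables with finitely many values\<close>

context prob_space begin

definition pr :: "('a \<Rightarrow> 'b) \<Rightarrow> 'b \<Rightarrow> real" where "pr Y y = prob (Y -` {y} \<inter> space M)"

text \<open>Partitions are represented by functions with finitely many values: a common refinement
  is then a pair, and a coarsening is a composition.\<close>

definition ent :: "('a \<Rightarrow> 'b) \<Rightarrow> real" where
  "ent Y = - (\<Sum>y\<in>Y ` space M. pr Y y * ln (pr Y y))"

lemma expectation_simple: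
  assumes Y: "simple_function M Y"
  shows "integrable M (\<lambda>x. \<phi> (Y x))" "expectation (\<lambda>x. \<phi> (Y x) :: real) = (\<Sum>y\<in>Y ` space M. pr Y y * \<phi> y)"
proof -
  have fin: "finite (Y ` space M)" using Y by (simp add: simple_function_def)
  have m: "Y -` {y} \<inter> space M \<in> sets M" if "y \<in> Y ` space M" for y using Y that by (auto simp: simple_function_def)
  have eq: "\<phi> (Y x) = (\<Sum>y\<in>Y ` space M. \<phi> y * indicator (Y -` {y} \<inter> space M) x)" if "x \<in> space M" for x
  proof -
    have "(\<Sum>y\<in>Y ` space M. \<phi> y * indicator (Y -` {y} \<inter> space M) x) = (\<Sum>y\<in>Y ` space M. if y = Y x then \<phi> y else 0)"
      using that by (intro sum.cong) (auto simp: indicator_def)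
    then show ?thesis using that fin by simp
  qed
  have i: "integrable M (\<lambda>x. \<Sum>y\<in>Y ` space M. \<phi> y * indicator (Y -` {y} \<inter> space M) x)"
    using m by (intro Bochner_Integration.integrable_sum integrable_mult_right integrable_real_indicator) (auto simp: emeasure_finite less_top[symmetric])
  then show "integrable M (\<lambda>x. \<phi> (Y x))" using eq by (subst Bochner_Integration.integrable_cong[OF refl]) auto
  have "expectation (\<lambda>x. \<phi> (Y x)) = expectation (\<lambda>x. \<Sum>y\<in>Y ` space M. \<phi> y * indicator (Y -` {y} \<inter> space M) x)"
    using eq by (intro Bochner_Integration.integral_cong) auto
  also have "... = (\<Sum>y\<in>Y ` space M. expectation (\<lambda>x. \<phi> y * indicator (Y -` {y} \<inter> space M) x))"
    using m by (intro Bochner_Integration.integral_sum integrable_mult_right integrable_real_indicator) (auto simp: emeasure_finite less_top[symmetric])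
  also have "... = (\<Sum>y\<in>Y ` space M. pr Y y * \<phi> y)"
    by (intro sum.cong) (auto simp: pr_def)
  finally show "expectation (\<lambda>x. \<phi> (Y x)) = (\<Sum>y\<in>Y ` space M. pr Y y * \<phi> y)" .
qed

lemma pr_nonneg: "pr Y y \<ge> 0" by (simp add: pr_def)

lemma pr_le1: "pr Y y \<le> 1" by (simp add: pr_def)

lemma sum_pr: "simple_function M Y \<Longrightarrow> (\<Sum>y\<in>Y ` space M. pr Y y) = 1"
  using expectation_simple(2)[of Y "\<lambda>_. 1"] by (simp add: prob_space)

lemma ent_nonneg: "ent Y \<ge> 0"
proof -
  have "pr Y y * ln (pr Y y) \<le> 0" for y
    using pr_nonneg[of Y y] pr_le1[of Y y] by (cases "pr Y y = 0") (auto intro!: mult_nonneg_nonpos)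
  then show ?thesis unfolding ent_def by (simp add: sum_nonpos)
qed

text \<open>Nonnegativity of relative entropy, from ln x \<le> x - 1. The comparison weights may
  have total mass below 1, which spares normalising them.\<close>

lemma gibbs:
  assumes Y: "simple_function M Y" and k: "\<And>y. y \<in> Y ` space M \<Longrightarrow> \<kappa> y \<ge> 0"
    and kp: "\<And>y. y \<in> Y ` space M \<Longrightarrow> pr Y y > 0 \<Longrightarrow> \<kappa> y > 0" and s: "(\<Sum>y\<in>Y ` space M. \<kappa> y) \<le> 1"
  shows "ent Y \<le> - (\<Sum>y\<in>Y ` space M. pr Y y * ln (\<kappa> y))"
proof -
  have "pr Y y * ln (\<kappa> y) - pr Y y * ln (pr Y y) \<le> \<kappa> y - pr Y y" if "y \<in> Y ` space M" for y
  proof (cases "pr Y y = 0")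
    case False
    then have p: "pr Y y > 0" "\<kappa> y > 0" using pr_nonneg[of Y y] kp[OF that] by auto
    have "ln (\<kappa> y / pr Y y) \<le> \<kappa> y / pr Y y - 1" using p by (intro ln_le_minus_one) auto
    then have "pr Y y * ln (\<kappa> y / pr Y y) \<le> pr Y y * (\<kappa> y / pr Y y - 1)" using p by (intro mult_left_mono) auto
    then show ?thesis using p by (simp add: ln_div algebra_simps)
  qed (use k that in simp)
  then have "(\<Sum>y\<in>Y ` space M. pr Y y * ln (\<kappa> y) - pr Y y * ln (pr Y y)) \<le> (\<Sum>y\<in>Y ` space M. \<kappa> y - pr Y y)"
    by (rule sum_mono)
  then show ?thesis using s sum_pr[OF Y] by (simp add: ent_def sum_subtractf)
qed

lemma pr_mono_comp: "simple_function M Y \<Longrightarrow> pr Y y \<le> pr (\<lambda>x. h (Y x)) (h y)"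
  unfolding pr_def using simple_functionD(2)[OF simple_function_compose1[of M Y h], of "{h y}"]
  by (intro finite_measure_mono) auto

lemma ent_comp_le:
  assumes Y: "simple_function M Y"
  shows "ent (\<lambda>x. h (Y x)) \<le> ent Y"
proof -
  let ?Z = "\<lambda>x. h (Y x)"
  have Z: "simple_function M ?Z" using simple_function_compose1[OF Y, of h] .
  have 1: "ent ?Z = - expectation (\<lambda>x. ln (pr ?Z (?Z x)))"
    unfolding ent_def expectation_simple(2)[OF Z, of "\<lambda>z. ln (pr ?Z z)"] by simp
  have 2: "expectation (\<lambda>x. ln (pr ?Z (?Z x))) = (\<Sum>y\<in>Y ` space M. pr Y y * ln (pr ?Z (h y)))"
    by (rule expectation_simple(2)[OF Y])
  have "(\<Sum>y\<in>Y ` space M. pr Y y * ln (pr Y y)) \<le> (\<Sum>y\<in>Y ` space M. pr Y y * ln (pr ?Z (h y)))"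
  proof (rule sum_mono)
    fix y
    show "pr Y y * ln (pr Y y) \<le> pr Y y * ln (pr ?Z (h y))"
    proof (cases "pr Y y = 0")
      case False
      then have "pr Y y > 0" using pr_nonneg[of Y y] by simp
      then show ?thesis using pr_mono_comp[OF Y, of y h] by (intro mult_left_mono) auto
    qed simp
  qed
  then show ?thesis unfolding 1 2 by (simp add: ent_def)
qed

text \<open>\<open>\<kappa> y\<close> is a guess for the law of Z given Y = y. Gibbs' inequality for
  the weights pr(y) \<kappa>(y, z) bounds the conditional entropy by the expected cost of the guess.
  Subadditivity and the comparison with a Markov chain are both instances.\<close>

lemma ent_pair_le:
  assumes Y: "simple_function M Y" and Z: "simple_function M Z"
    and k: "\<And>y z. y \<in> Y ` space M \<Longrightarrow> z \<in> Z ` space M \<Longrightarrow> \<kappa> y z \<ge> 0"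
    and kp: "\<And>x. x \<in> space M \<Longrightarrow> pr (\<lambda>x. (Y x, Z x)) (Y x, Z x) > 0 \<Longrightarrow> \<kappa> (Y x) (Z x) > 0"
    and s: "\<And>y. y \<in> Y ` space M \<Longrightarrow> (\<Sum>z\<in>Z ` space M. \<kappa> y z) \<le> 1"
  shows "ent (\<lambda>x. (Y x, Z x)) \<le> ent Y - expectation (\<lambda>x. ln (\<kappa> (Y x) (Z x)))"
proof -
  let ?W = "\<lambda>x. (Y x, Z x)"
  have W: "simple_function M ?W" by (rule simple_function_Pair[OF Y Z])
  have finY: "finite (Y ` space M)" "finite (Z ` space M)" using Y Z by (auto simp: simple_function_def)
  have prY: "pr Y y > 0" if "pr ?W (y, z) > 0" for y z
    using pr_mono_comp[OF W, of "(y, z)" fst] that by simp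
  define q where "q = (\<lambda>w. pr Y (fst w) * \<kappa> (fst w) (snd w))"
  have "ent ?W \<le> - (\<Sum>w\<in>?W ` space M. pr ?W w * ln (q w))"
  proof (rule gibbs[OF W])
    show "q w \<ge> 0" if "w \<in> ?W ` space M" for w using that k by (auto simp: q_def intro!: mult_nonneg_nonneg pr_nonneg)
    show "q w > 0" if "w \<in> ?W ` space M" "pr ?W w > 0" for w using that kp prY by (auto simp: q_def)
    have "sum q (?W ` space M) \<le> sum q (Y ` space M \<times> Z ` space M)"
      using finY k by (intro sum_mono2) (auto simp: q_def intro!: mult_nonneg_nonneg pr_nonneg)
    also have "... = (\<Sum>y\<in>Y ` space M. pr Y y * (\<Sum>z\<in>Z ` space M. \<kappa> y z))"
      by (simp add: q_def sum.cartesian_product' sum_distrib_left)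
    also have "... \<le> (\<Sum>y\<in>Y ` space M. pr Y y * 1)" using s by (intro sum_mono mult_left_mono pr_nonneg) auto
    finally show "sum q (?W ` space M) \<le> 1" using sum_pr[OF Y] by simp
  qed
  also have "(\<Sum>w\<in>?W ` space M. pr ?W w * ln (q w)) = (\<Sum>w\<in>?W ` space M. pr ?W w * (ln (pr Y (fst w)) + ln (\<kappa> (fst w) (snd w))))"
  proof (rule sum.cong[OF refl])
    fix w assume w: "w \<in> ?W ` space M"
    show "pr ?W w * ln (q w) = pr ?W w * (ln (pr Y (fst w)) + ln (\<kappa> (fst w) (snd w)))"
    proof (cases "pr ?W w = 0")
      case False
      then have p: "pr ?W w > 0" using pr_nonneg[of ?W w] by simp
      then have "pr Y (fst w) > 0" "\<kappa> (fst w) (snd w) > 0" using prY[of "fst w" "snd w"] kp w by auto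
      then show ?thesis by (simp add: q_def ln_mult_pos)
    qed simp
  qed
  also have "... = expectation (\<lambda>x. ln (pr Y (Y x)) + ln (\<kappa> (Y x) (Z x)))"
    using expectation_simple(2)[OF W, of "\<lambda>w. ln (pr Y (fst w)) + ln (\<kappa> (fst w) (snd w))"] by simp
  also have "... = expectation (\<lambda>x. ln (pr Y (Y x))) + expectation (\<lambda>x. ln (\<kappa> (Y x) (Z x)))"
    using expectation_simple(1)[OF Y, of "\<lambda>y. ln (pr Y y)"] expectation_simple(1)[OF W, of "\<lambda>w. ln (\<kappa> (fst w) (snd w))"]
    by (intro Bochner_Integration.integral_add) auto
  also have "expectation (\<lambda>x. ln (pr Y (Y x))) = - ent Y"
    using expectation_simple(2)[OF Y, of "\<lambda>y. ln (pr Y y)"] by (simp add: ent_def)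
  finally show ?thesis by simp
qed

lemma ent_pair_subadd:
  assumes Y: "simple_function M Y" and Z: "simple_function M Z"
  shows "ent (\<lambda>x. (Y x, Z x)) \<le> ent Y + ent Z"
proof -
  have W: "simple_function M (\<lambda>x. (Y x, Z x))" by (rule simple_function_Pair[OF Y Z])
  have "ent (\<lambda>x. (Y x, Z x)) \<le> ent Y - expectation (\<lambda>x. ln (pr Z (Z x)))"
  proof (rule ent_pair_le[OF Y Z, where \<kappa> = "\<lambda>y z. pr Z z"])
    show "pr Z (Z x) > 0" if "pr (\<lambda>x. (Y x, Z x)) (Y x, Z x) > 0" for x
      using pr_mono_comp[OF W, of "(Y x, Z x)" snd] that by simp
  qed (use sum_pr[OF Z] pr_nonneg in auto)
  then show ?thesis using expectation_simple(2)[OF Z, of "\<lambda>z. ln (pr Z z)"] by (simp add: ent_def)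
qed

lemma ent_cong: "(\<And>x. x \<in> space M \<Longrightarrow> Y x = Z x) \<Longrightarrow> ent Y = ent Z"
proof -
  assume eq: "\<And>x. x \<in> space M \<Longrightarrow> Y x = Z x"
  have "Y ` space M = Z ` space M" using eq by auto
  moreover have "pr Y y = pr Z y" for y unfolding pr_def using eq by (intro arg_cong[where f = prob]) auto
  ultimately show ?thesis by (simp add: ent_def)
qed

end

section \<open>Measure-preserving systems\<close>

locale mp_system = prob_space M for M :: "'a measure" +
  fixes T :: "'a \<Rightarrow> 'a"
  assumes T_meas: "T \<in> measurable M M" and T_inv: "distr M M T = M"
begin

lemma T_iter_meas: "(T ^^ i) \<in> measurable M M"
proof (induction i)
  case (Suc i)
  then show ?case using measurable_comp[OF Suc T_meas] by (simp only: funpow.simps)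
qed (simp add: measurable_ident)

lemma T_iter_space: "x \<in> space M \<Longrightarrow> (T ^^ i) x \<in> space M"
  using T_iter_meas[of i] by (rule measurable_space)

lemma T_iter_inv: "distr M M (T ^^ i) = M"
proof (induction i)
  case (Suc i)
  have "distr M M (T ^^ Suc i) = distr (distr M M (T ^^ i)) M T"
    by (simp only: distr_distr[OF T_meas T_iter_meas] funpow.simps)
  then show ?case by (simp only: Suc T_inv)
qed (simp add: distr_id)

lemma simple_iter: "simple_function M Y \<Longrightarrow> simple_function M (\<lambda>x. Y ((T ^^ i) x))"
proof -
  assume Y: "simple_function M Y"
  have "(\<lambda>x. Y ((T ^^ i) x)) ` space M \<subseteq> Y ` space M" using T_iter_space by auto
  moreover have "(\<lambda>x. Y ((T ^^ i) x)) -` {y} \<inter> space M = (T ^^ i) -` (Y -` {y} \<inter> space M) \<inter> space M" for y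
    using T_iter_space by auto
  moreover have "(T ^^ i) -` (Y -` {y} \<inter> space M) \<inter> space M \<in> sets M" for y
    by (intro measurable_sets[OF T_iter_meas] simple_functionD(2)[OF Y])
  ultimately show ?thesis
    using Y by (auto simp: simple_function_def intro: finite_subset)
qed

lemma pr_iter: "simple_function M Y \<Longrightarrow> pr (\<lambda>x. Y ((T ^^ i) x)) y = pr Y y"
proof -
  assume Y: "simple_function M Y"
  have "pr Y y = measure (distr M M (T ^^ i)) (Y -` {y} \<inter> space M)" by (simp add: pr_def T_iter_inv)
  also have "... = prob ((T ^^ i) -` (Y -` {y} \<inter> space M) \<inter> space M)"
    by (rule measure_distr[OF T_iter_meas]) (rule simple_functionD(2)[OF Y])
  also have "(T ^^ i) -` (Y -` {y} \<inter> space M) \<inter> space M = (\<lambda>x. Y ((T ^^ i) x)) -` {y} \<inter> space M"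
    using T_iter_space by auto
  finally show ?thesis by (simp add: pr_def)
qed

lemma expectation_iter:
  assumes "\<phi> \<in> borel_measurable M"
  shows "expectation (\<lambda>x. \<phi> ((T ^^ i) x) :: real) = expectation \<phi>"
  using integral_distr[OF T_iter_meas assms, of i] by (simp add: T_iter_inv)

lemma ent_iter: "simple_function M Y \<Longrightarrow> ent (\<lambda>x. Y ((T ^^ i) x)) = ent Y"
proof -
  assume Y: "simple_function M Y"
  have sub: "(\<lambda>x. Y ((T ^^ i) x)) ` space M \<subseteq> Y ` space M" using T_iter_space by auto
  have "pr Y y = 0" if "y \<notin> (\<lambda>x. Y ((T ^^ i) x)) ` space M" for y
  proof -
    have "(\<lambda>x. Y ((T ^^ i) x)) -` {y} \<inter> space M = {}" using that by auto
    then have "pr (\<lambda>x. Y ((T ^^ i) x)) y = 0" by (simp add: pr_def)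
    then show ?thesis using pr_iter[OF Y] by simp
  qed
  then have "(\<Sum>y\<in>(\<lambda>x. Y ((T ^^ i) x)) ` space M. pr Y y * ln (pr Y y)) = (\<Sum>y\<in>Y ` space M. pr Y y * ln (pr Y y))"
    using sub Y by (intro sum.mono_neutral_left) (auto simp: simple_function_def)
  then show ?thesis by (simp add: ent_def pr_iter[OF Y])
qed

text \<open>The level sets of the list of labels form the common refinement of the preimages, and
  concatenation of lists gives subadditivity.\<close>

definition itin :: "('a \<Rightarrow> 'b) \<Rightarrow> nat \<Rightarrow> 'a \<Rightarrow> 'b list" where
  "itin Y n x = map (\<lambda>i. Y ((T ^^ i) x)) [0..<n]"

lemma itin_Suc: "itin Y (Suc n) x = itin Y n x @ [Y ((T ^^ n) x)]"
  by (simp add: itin_def)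

lemma itin_add: "itin Y (m + n) x = itin Y m x @ itin Y n ((T ^^ m) x)"
proof -
  have "[0..<m + n] = [0..<m] @ map (\<lambda>i. i + m) [0..<n]"
    using upt_add_eq_append[of 0 m n] map_add_upt[of m n] by (simp add: add.commute)
  then show ?thesis by (simp add: itin_def funpow_add)
qed

lemma simple_itin: "simple_function M Y \<Longrightarrow> simple_function M (itin Y n)"
proof (induction n)
  case 0
  then show ?case by (simp add: itin_def simple_function_const)
next
  case (Suc n)
  have "simple_function M (\<lambda>x. (\<lambda>(a, b). a @ [b]) (itin Y n x, Y ((T ^^ n) x)))"
    by (rule simple_function_compose1[OF simple_function_Pair[OF Suc.IH[OF Suc.prems] simple_iter[OF Suc.prems]]])
  then show ?case by (simp add: itin_Suc[abs_def])
qed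

lemma ent_itin_subadd:
  assumes Y: "simple_function M Y"
  shows "ent (itin Y (m + n)) \<le> ent (itin Y m) + ent (itin Y n)"
proof -
  have "ent (itin Y (m + n)) = ent (\<lambda>x. (\<lambda>(a, b). a @ b) (itin Y m x, itin Y n ((T ^^ m) x)))"
    by (intro ent_cong) (simp add: itin_add)
  also have "... \<le> ent (\<lambda>x. (itin Y m x, itin Y n ((T ^^ m) x)))"
    by (rule ent_comp_le[OF simple_function_Pair[OF simple_itin[OF Y] simple_iter[OF simple_itin[OF Y]]]])
  also have "... \<le> ent (itin Y m) + ent (\<lambda>x. itin Y n ((T ^^ m) x))"
    by (rule ent_pair_subadd[OF simple_itin[OF Y] simple_iter[OF simple_itin[OF Y]]])
  finally show ?thesis by (simp add: ent_iter[OF simple_itin[OF Y]])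
qed

definition ent_rate :: "('a \<Rightarrow> 'b) \<Rightarrow> real" where
  "ent_rate Y = lim (\<lambda>n. ent (itin Y n) / real n)"

lemma ent_rate_tendsto: "simple_function M Y \<Longrightarrow> (\<lambda>n. ent (itin Y n) / real n) \<longlonglongrightarrow> ent_rate Y"
  unfolding ent_rate_def
  using fekete[of "\<lambda>n. ent (itin Y n)", OF ent_itin_subadd ent_nonneg] by (simp add: convergent_LIMSEQ_iff)

definition cell :: "'a set set \<Rightarrow> 'a \<Rightarrow> 'a set" where "cell P x = (THE A. A \<in> P \<and> x \<in> A)"

lemma cell_eq: "measurable_partition M P \<Longrightarrow> A \<in> P \<Longrightarrow> x \<in> A \<Longrightarrow> cell P x = A"
  unfolding cell_def
proof (rule the_equality)
  fix B assume "measurable_partition M P" "A \<in> P" "x \<in> A" "B \<in> P \<and> x \<in> B"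
  then show "B = A" unfolding measurable_partition_def partition_on_def disjoint_def by blast
qed simp

lemma cell_in: "measurable_partition M P \<Longrightarrow> x \<in> space M \<Longrightarrow> cell P x \<in> P \<and> x \<in> cell P x"
  using cell_eq unfolding measurable_partition_def partition_on_def by (metis UnionE)

lemma simple_cell: "measurable_partition M P \<Longrightarrow> simple_function M (cell P)"
  unfolding simple_function_def
proof (intro conjI ballI)
  assume P: "measurable_partition M P"
  have sub: "cell P ` space M \<subseteq> P" using cell_in[OF P] by auto
  then show "finite (cell P ` space M)" using P by (auto simp: measurable_partition_def intro: finite_subset)
  fix A assume "A \<in> cell P ` space M"
  then have "A \<in> P" using sub by auto
  then have "A \<subseteq> space M" "A \<in> sets M" using P by (auto simp: measurable_partition_def partition_on_def)
  moreover have "cell P -` {A} \<inter> space M = A"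
    using cell_eq[OF P \<open>A \<in> P\<close>] cell_in[OF P] \<open>A \<subseteq> space M\<close> by auto
  ultimately show "cell P -` {A} \<inter> space M \<in> sets M" by simp
qed

text \<open>A point of a cell of the refinement determines the whole choice of partition elements,
  so the nonempty cells are exactly the fibres of the itinerary.\<close>

lemma partition_entropy_itin:
  assumes P: "measurable_partition M P"
  shows "partition_entropy M (dyn_refinement M T P n) = ent (itin (cell P) n)"
proof -
  let ?Y = "itin (cell P) n"
  let ?fib = "\<lambda>y. ?Y -` {y} \<inter> space M"
  have fib: "{z \<in> space M. \<forall>i<n. (T ^^ i) z \<in> A i} = ?fib (?Y x)"
    if "A \<in> {..<n} \<rightarrow>\<^sub>E P" "x \<in> space M" "\<forall>i<n. (T ^^ i) x \<in> A i" for A x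
  proof -
    have A: "A i = cell P ((T ^^ i) x)" if "i < n" for i
      using that \<open>A \<in> _\<close> \<open>\<forall>i<n. _\<close> cell_eq[OF P, of "A i" "(T ^^ i) x"] by (auto simp: PiE_def Pi_def)
    have "(T ^^ i) z \<in> A i \<longleftrightarrow> cell P ((T ^^ i) z) = cell P ((T ^^ i) x)" if "i < n" "z \<in> space M" for i z
      using A[OF that(1)] cell_in[OF P T_iter_space[OF that(2)]] cell_in[OF P T_iter_space[OF \<open>x \<in> space M\<close>]] cell_eq[OF P]
      by metis
    then show ?thesis by (auto simp: itin_def)
  qed
  have "dyn_refinement M T P n = ?fib ` (?Y ` space M)"
  proof (intro equalityI subsetI)
    fix B assume "B \<in> dyn_refinement M T P n"
    then obtain A where A: "A \<in> {..<n} \<rightarrow>\<^sub>E P" "B = {x \<in> space M. \<forall>i<n. (T ^^ i) x \<in> A i}" "B \<noteq> {}"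
      unfolding dyn_refinement_def by blast
    then obtain x where "x \<in> B" by blast
    then have x: "x \<in> space M" "\<forall>i<n. (T ^^ i) x \<in> A i" using A(2) by auto
    then show "B \<in> ?fib ` (?Y ` space M)" using fib[OF A(1) x] A(2) by blast
  next
    fix B assume "B \<in> ?fib ` (?Y ` space M)"
    then obtain x where x: "x \<in> space M" "B = ?fib (?Y x)" by blast
    define A where "A = (\<lambda>i\<in>{..<n}. cell P ((T ^^ i) x))"
    have A: "A \<in> {..<n} \<rightarrow>\<^sub>E P" "\<forall>i<n. (T ^^ i) x \<in> A i"
      using cell_in[OF P T_iter_space[OF x(1)]] by (auto simp: A_def)
    have "B = {z \<in> space M. \<forall>i<n. (T ^^ i) z \<in> A i}" using fib[OF A(1) x(1) A(2)] x(2) by simp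
    moreover have "B \<noteq> {}" using x by auto
    ultimately show "B \<in> dyn_refinement M T P n" unfolding dyn_refinement_def using A(1) by blast
  qed
  moreover have "inj_on ?fib (?Y ` space M)" by (rule inj_onI) blast
  ultimately show ?thesis
    unfolding partition_entropy_def ent_def by (simp add: sum.reindex pr_def)
qed

lemma metric_entropy_eq: "metric_entropy M T = (SUP P \<in> {P. measurable_partition M P}. ereal (ent_rate (cell P)))"
  unfolding metric_entropy_def
proof (rule SUP_cong[OF refl])
  fix P assume "P \<in> {P. measurable_partition M P}"
  then have P: "measurable_partition M P" by simp
  have "(\<lambda>n. ereal (partition_entropy M (dyn_refinement M T P n) / real n)) \<longlonglongrightarrow> ereal (ent_rate (cell P))"
    unfolding partition_entropy_itin[OF P] using ent_rate_tendsto[OF simple_cell[OF P]] by simp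
  then show "lim (\<lambda>n. ereal (partition_entropy M (dyn_refinement M T P n) / real n)) = ereal (ent_rate (cell P))"
    by (rule limI)
qed

text \<open>The level sets of Y form the partition. Bounds along the multiples of p suffice, because
  the limit that defines the rate exists; the constant c disappears after division.\<close>

lemma metric_entropy_ge:
  assumes Y: "simple_function M Y" and low: "\<And>n. N \<le> n \<Longrightarrow> ent (itin Y (n * p)) \<ge> b * real (n * p) - c" and p: "p > 0"
  shows "metric_entropy M T \<ge> ereal b"
proof -
  define P where "P = (\<lambda>y. Y -` {y} \<inter> space M) ` (Y ` space M)"
  have P: "measurable_partition M P"
    unfolding measurable_partition_def partition_on_def disjoint_def
    using Y by (auto simp: P_def simple_function_def)
  have cellY: "cell P x = Y -` {Y x} \<inter> space M" if "x \<in> space M" for x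
    using that by (intro cell_eq[OF P]) (auto simp: P_def)
  have "ent (itin Y n) \<le> ent (itin (cell P) n)" for n
  proof -
    define h where "h = (\<lambda>A. Y (SOME x. x \<in> A))"
    have hc: "h (cell P x) = Y x" if "x \<in> space M" for x
      using someI[of "\<lambda>z. z \<in> cell P x" x] cellY[OF that] that by (auto simp: h_def)
    have "ent (itin Y n) = ent (\<lambda>x. map h (itin (cell P) n x))"
      using hc T_iter_space by (intro ent_cong) (auto simp: itin_def)
    also have "... \<le> ent (itin (cell P) n)" by (rule ent_comp_le[OF simple_itin[OF simple_cell[OF P]]])
    finally show ?thesis .
  qed
  then have low': "ent (itin (cell P) (n * p)) \<ge> b * real (n * p) - c" if "n \<ge> N" for n
    using low[OF that] order.trans by blast
  have sm: "strict_mono (\<lambda>n. n * p)" using p by (auto simp: strict_mono_def)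
  have lim: "(\<lambda>n. ent (itin (cell P) (n * p)) / real (n * p)) \<longlonglongrightarrow> ent_rate (cell P)"
    using LIMSEQ_subseq_LIMSEQ[OF ent_rate_tendsto[OF simple_cell[OF P]] sm] unfolding comp_def .
  have "(\<lambda>n. c / real (n * p)) \<longlonglongrightarrow> 0"
    using LIMSEQ_subseq_LIMSEQ[OF lim_const_over_n[of c] sm] unfolding comp_def .
  then have lim': "(\<lambda>n. b - c / real (n * p)) \<longlonglongrightarrow> b - 0" by (intro tendsto_diff tendsto_const)
  have "b - 0 \<le> ent_rate (cell P)"
  proof (rule LIMSEQ_le[OF lim' lim])
    show "\<exists>N'. \<forall>n\<ge>N'. b - c / real (n * p) \<le> ent (itin (cell P) (n * p)) / real (n * p)"
    proof (intro exI[of _ "max 1 N"] allI impI)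
      fix n assume n: "n \<ge> max 1 N"
      define r where "r = real (n * p)"
      have r: "r > 0" using p n by (simp add: r_def)
      have "ent (itin (cell P) (n * p)) \<ge> b * r - c" using low' n by (simp add: r_def)
      then have "(b * r - c) / r \<le> ent (itin (cell P) (n * p)) / r" using r by (intro divide_right_mono) auto
      then show "b - c / real (n * p) \<le> ent (itin (cell P) (n * p)) / real (n * p)"
        using r unfolding r_def[symmetric] by (simp add: diff_divide_distrib)
    qed
  qed
  then have "ereal b \<le> ereal (ent_rate (cell P))" by simp
  also have "... \<le> metric_entropy M T" unfolding metric_entropy_eq using P by (intro SUP_upper) auto
  finally show ?thesis .
qed

text \<open>The entropy is compared with that of a Markov chain on the cells of \<open>A\<close>, with uniform transitions,
  decorated with the block of length \<open>n\<close> predicted by the cell.\<close>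

lemma ruelle:
  fixes Y :: "'a \<Rightarrow> 'b" and A :: "'a \<Rightarrow> 'c"
  assumes Y: "simple_function M Y" and A: "simple_function M A" and n: "n > 0" and \<eta>: "0 < \<eta>" "\<eta> < 1"
    and mis: "prob {x\<in>space M. \<phi> (A x) \<noteq> itin Y n x} \<le> \<delta>"
  defines "suc \<equiv> \<lambda>a. (\<lambda>x. A ((T ^^ n) x)) ` {x\<in>space M. A x = a}"
  shows "ent_rate Y * real n \<le> expectation (\<lambda>x. ln (real (card (suc (A x))))) - ln (1 - \<eta>)
     + \<delta> * ln (real (card (itin Y n ` space M)) / \<eta>)"
proof -
  let ?Z = "itin Y n"
  have Z: "simple_function M ?Z" by (rule simple_itin[OF Y])
  \<comment> \<open>The j-th state of the chain: the cell at time n j, decorated with the block of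
    labels that starts there.\<close>
  define X where "X = (\<lambda>j x. (A ((T ^^ (n * j)) x), ?Z ((T ^^ (n * j)) x)))"
  have AZ: "simple_function M (\<lambda>x. (A x, ?Z x))" by (rule simple_function_Pair[OF A Z])
  have X: "simple_function M (X j)" for j
    unfolding X_def by (rule simple_iter[OF AZ])
  define W where "W = (\<lambda>k x. map (\<lambda>j. X j x) [0..<k])"
  have W_Suc: "W (Suc k) x = W k x @ [X k x]" for k x by (simp add: W_def)
  have W: "simple_function M (W k)" for k
  proof (induction k)
    case 0
    then show ?case by (simp add: W_def simple_function_const)
  next
    case (Suc k)
    have "simple_function M (\<lambda>x. (\<lambda>(a, b). a @ [b]) (W k x, X k x))"
      by (rule simple_function_compose1[OF simple_function_Pair[OF Suc X]])
    then show ?case by (simp add: W_Suc[abs_def])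
  qed
  define Zs where "Zs = ?Z ` space M"
  have finZ: "finite Zs" "finite (A ` space M)" using Z A by (auto simp: Zs_def simple_function_def)
  obtain x0 where x0: "x0 \<in> space M" using not_empty by blast
  then have Z0: "real (card Zs) \<ge> 1" using finZ by (auto simp: Zs_def Suc_le_eq card_gt_0_iff)
  \<comment> \<open>The predicted block gets probability 1 - \<eta>, and every block a share of
    \<eta> otherwise; so a wrong prediction costs only the logarithm of card / \<eta>.\<close>
  define \<zeta> where "\<zeta> = (\<lambda>v. if snd v = \<phi> (fst v) then 1 - \<eta> else \<eta> / real (card Zs))"
  have \<zeta>0: "\<zeta> v > 0" for v using \<eta> Z0 by (simp add: \<zeta>_def)
  have \<zeta>ne: "\<zeta> v \<noteq> 0" for v using \<zeta>0[of v] by simp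
  have \<zeta>s: "(\<Sum>z\<in>Zs. \<zeta> (a, z)) \<le> 1" for a
  proof -
    have "(\<Sum>z\<in>Zs. \<zeta> (a, z)) \<le> (\<Sum>z\<in>Zs. (if z = \<phi> a then 1 - \<eta> else 0) + \<eta> / real (card Zs))"
      using \<eta> by (intro sum_mono) (auto simp: \<zeta>_def)
    also have "... = (if \<phi> a \<in> Zs then 1 - \<eta> else 0) + \<eta>"
      using finZ(1) Z0 by (subst sum.distrib) auto
    also have "... \<le> 1" using \<eta> by auto
    finally show ?thesis .
  qed
  have suc_sub: "suc a \<subseteq> A ` space M" for a using T_iter_space by (auto simp: suc_def)
  have finS: "finite (suc a)" for a using finite_subset[OF suc_sub finZ(2)] .
  have suc_ne: "A ((T ^^ n) x) \<in> suc (A x)" if "x \<in> space M" for x using that by (auto simp: suc_def)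
  have cpos: "real (card (suc (A x))) \<ge> 1" if "x \<in> space M" for x
    using suc_ne[OF that] finS[of "A x"] by (auto simp: Suc_le_eq card_gt_0_iff)
  define c where "c = expectation (\<lambda>x. ln (real (card (suc (A x))))) - expectation (\<lambda>x. ln (\<zeta> (A x, ?Z x)))"
  have step: "ent (W (Suc (Suc k))) \<le> ent (W (Suc k)) + c" for k
  proof -
    let ?k = "Suc k"
    \<comment> \<open>One transition of the comparison chain: a uniformly chosen successor cell and
      then its decoration. Only the last state of the history enters.\<close>
    define q :: "('c \<times> 'b list) list \<Rightarrow> 'c \<times> 'b list \<Rightarrow> real"
      where "q = (\<lambda>w v. (if fst v \<in> suc (fst (last w)) then 1 / real (card (suc (fst (last w)))) else 0) * \<zeta> v)"
    have "ent (W (Suc ?k)) = ent (\<lambda>x. (\<lambda>(a, b). a @ [b]) (W ?k x, X ?k x))" by (simp add: W_Suc[abs_def])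
    also have "... \<le> ent (\<lambda>x. (W ?k x, X ?k x))" by (rule ent_comp_le[OF simple_function_Pair[OF W X]])
    also have "... \<le> ent (W ?k) - expectation (\<lambda>x. ln (q (W ?k x) (X ?k x)))"
    proof (rule ent_pair_le[OF W X])
      show "0 \<le> q w v" for w v using \<zeta>0[of v] by (simp add: q_def)
    next
      fix x assume "x \<in> space M"
      then have y: "(T ^^ (n * k)) x \<in> space M" by (rule T_iter_space)
      have "(T ^^ (n * Suc k)) x = (T ^^ n) ((T ^^ (n * k)) x)" by (simp add: funpow_add)
      then show "q (W ?k x) (X ?k x) > 0"
        using suc_ne[OF y] cpos[OF y] \<zeta>0 by (simp add: q_def W_Suc X_def)
    next
      fix w :: "('c \<times> 'b list) list"
      let ?a = "fst (last w)"
      have "(\<Sum>v\<in>X ?k ` space M. q w v) \<le> (\<Sum>v\<in>A ` space M \<times> Zs. q w v)"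
        using finZ T_iter_space less_imp_le[OF \<zeta>0] by (intro sum_mono2) (auto simp: X_def Zs_def q_def)
      also have "... = (\<Sum>b\<in>A ` space M. (if b \<in> suc ?a then 1 / real (card (suc ?a)) else 0) * (\<Sum>z\<in>Zs. \<zeta> (b, z)))"
        by (simp add: q_def sum.cartesian_product' sum_distrib_left)
      also have "... \<le> (\<Sum>b\<in>A ` space M. (if b \<in> suc ?a then 1 / real (card (suc ?a)) else 0) * 1)"
        by (intro sum_mono mult_left_mono \<zeta>s) auto
      also have "... = (\<Sum>b\<in>suc ?a. 1 / real (card (suc ?a)))"
        using finZ(2) suc_sub[of ?a] by (simp add: sum.If_cases Int_absorb1)
      also have "... \<le> 1" by simp
      finally show "(\<Sum>v\<in>X ?k ` space M. q w v) \<le> 1" .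
    qed
    also have "expectation (\<lambda>x. ln (q (W ?k x) (X ?k x)))
      = expectation (\<lambda>x. ln (\<zeta> (A ((T ^^ (n * ?k)) x), ?Z ((T ^^ (n * ?k)) x))) - ln (real (card (suc (A ((T ^^ (n * k)) x))))))"
    proof (rule Bochner_Integration.integral_cong[OF refl])
      fix x assume "x \<in> space M"
      then have y: "(T ^^ (n * k)) x \<in> space M" by (rule T_iter_space)
      have "(T ^^ (n * Suc k)) x = (T ^^ n) ((T ^^ (n * k)) x)" by (simp add: funpow_add)
      then show "ln (q (W ?k x) (X ?k x)) = ln (\<zeta> (A ((T ^^ (n * ?k)) x), ?Z ((T ^^ (n * ?k)) x))) - ln (real (card (suc (A ((T ^^ (n * k)) x)))))"
        using suc_ne[OF y] cpos[OF y] \<zeta>0 \<zeta>ne by (simp add: q_def W_Suc X_def ln_div)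
    qed
    also have "... = expectation (\<lambda>x. ln (\<zeta> (A ((T ^^ (n * ?k)) x), ?Z ((T ^^ (n * ?k)) x)))) - expectation (\<lambda>x. ln (real (card (suc (A ((T ^^ (n * k)) x))))))"
      using expectation_simple(1)[OF X[of ?k], of "\<lambda>v. ln (\<zeta> v)"] expectation_simple(1)[OF simple_iter[OF A, of "n * k"], of "\<lambda>a. ln (real (card (suc a)))"]
      by (intro Bochner_Integration.integral_diff) (simp_all add: X_def)
    also have "expectation (\<lambda>x. ln (\<zeta> (A ((T ^^ (n * ?k)) x), ?Z ((T ^^ (n * ?k)) x)))) = expectation (\<lambda>x. ln (\<zeta> (A x, ?Z x)))"
      using borel_measurable_integrable[OF expectation_simple(1)[OF AZ, of "\<lambda>v. ln (\<zeta> v)"]] by (intro expectation_iter) simp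
    also have "expectation (\<lambda>x. ln (real (card (suc (A ((T ^^ (n * k)) x)))))) = expectation (\<lambda>x. ln (real (card (suc (A x)))))"
      using borel_measurable_integrable[OF expectation_simple(1)[OF A, of "\<lambda>a. ln (real (card (suc a)))"]] by (intro expectation_iter) simp
    finally show ?thesis by (simp add: c_def)
  qed
  have bound: "ent (W (Suc k)) \<le> ent (W 1) + real k * c" for k
  proof (induction k)
    case (Suc k)
    then show ?case using step[of k] by (simp add: algebra_simps)
  qed simp
  \<comment> \<open>The itinerary can be read off the decorations, so its entropy is at most that of
    the chain.\<close>
  have blocks: "itin Y (n * k) x = concat (map snd (W k x))" for k x
  proof (induction k)
    case (Suc k)
    have "itin Y (n * Suc k) x = itin Y (n * k) x @ ?Z ((T ^^ (n * k)) x)"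
      using itin_add[of Y "n * k" n x] by (simp add: add.commute)
    then show ?case using Suc by (simp add: W_Suc X_def)
  qed (simp add: itin_def W_def)
  have le: "ent (itin Y (n * k)) \<le> ent (W k)" for k
    using ent_comp_le[OF W[of k], of "\<lambda>w. concat (map snd w)"] by (simp add: blocks[abs_def])
  have sm: "strict_mono (\<lambda>k. n * Suc k)" using n by (auto simp: strict_mono_def)
  have l1: "(\<lambda>k. ent (itin Y (n * Suc k)) / real (n * Suc k)) \<longlonglongrightarrow> ent_rate Y"
    using LIMSEQ_subseq_LIMSEQ[OF ent_rate_tendsto[OF Y] sm] unfolding comp_def .
  have "(\<lambda>k. (ent (W 1) - c) / real (n * Suc k)) \<longlonglongrightarrow> 0"
    using LIMSEQ_subseq_LIMSEQ[OF lim_const_over_n[of "ent (W 1) - c"] sm] unfolding comp_def .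
  then have l2: "(\<lambda>k. (ent (W 1) - c) / real (n * Suc k) + c / real n) \<longlonglongrightarrow> 0 + c / real n" by (intro tendsto_add tendsto_const)
  have "ent_rate Y \<le> 0 + c / real n"
  proof (rule LIMSEQ_le[OF l1 l2], intro exI[of _ 0] allI impI)
    fix k
    have "ent (itin Y (n * Suc k)) \<le> (ent (W 1) - c) + real (Suc k) * c" using le[of "Suc k"] bound[of k] by (simp add: algebra_simps)
    moreover have p: "real (n * Suc k) > 0" using n by (simp only: of_nat_0_less_iff mult_pos_pos zero_less_Suc)
    ultimately have "ent (itin Y (n * Suc k)) / real (n * Suc k) \<le> ((ent (W 1) - c) + real (Suc k) * c) / real (n * Suc k)" by (rule divide_right_mono[OF _ less_imp_le])
    also have "... = (ent (W 1) - c) / real (n * Suc k) + c / real n" by (simp only: add_divide_distrib of_nat_mult) (use n in simp)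
    finally show "ent (itin Y (n * Suc k)) / real (n * Suc k) \<le> (ent (W 1) - c) / real (n * Suc k) + c / real n" .
  qed
  then have "ent_rate Y * real n \<le> c" using n by (simp add: field_simps)
  also have "c \<le> expectation (\<lambda>x. ln (real (card (suc (A x))))) - ln (1 - \<eta>) + \<delta> * ln (real (card Zs) / \<eta>)"
  proof -
    let ?B = "{x\<in>space M. \<phi> (A x) \<noteq> ?Z x}"
    have "?B = (\<lambda>x. (A x, ?Z x)) -` {v. \<phi> (fst v) \<noteq> snd v} \<inter> space M" by auto
    then have B: "?B \<in> sets M" using simple_functionD(2)[OF AZ, of "{v. \<phi> (fst v) \<noteq> snd v}"] by (simp only:)
    let ?l = "ln (real (card Zs) / \<eta>)"
    have l0: "?l \<ge> 0" using Z0 \<eta> by (intro ln_ge_zero) (simp add: field_simps)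
    have "expectation (\<lambda>x. - ln (\<zeta> (A x, ?Z x))) \<le> expectation (\<lambda>x. - ln (1 - \<eta>) + ?l * indicator ?B x)"
    proof (rule integral_mono)
      show "integrable M (\<lambda>x. - ln (\<zeta> (A x, ?Z x)))" using expectation_simple(1)[OF AZ, of "\<lambda>v. - ln (\<zeta> v)"] by simp
      show "integrable M (\<lambda>x. - ln (1 - \<eta>) + ?l * indicator ?B x)"
        using B by (intro Bochner_Integration.integrable_add integrable_mult_right integrable_real_indicator) (auto simp: emeasure_finite less_top[symmetric])
      fix x assume x: "x \<in> space M"
      have "- ln (1 - \<eta>) \<ge> 0" using \<eta> by simp
      moreover have "- ln (\<eta> / real (card Zs)) = ?l" using \<eta> Z0 by (simp add: ln_div)
      ultimately show "- ln (\<zeta> (A x, ?Z x)) \<le> - ln (1 - \<eta>) + ?l * indicator ?B x"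
        using x by (auto simp: \<zeta>_def indicator_def)
    qed
    also have "... = - ln (1 - \<eta>) + ?l * prob ?B"
      using B by (subst Bochner_Integration.integral_add) (auto simp: prob_space emeasure_finite less_top[symmetric])
    also have "?l * prob ?B \<le> ?l * \<delta>" using mis l0 by (intro mult_left_mono) auto
    finally show ?thesis by (simp add: c_def mult.commute)
  qed
  finally show ?thesis by (simp add: Zs_def)
qed

end


section \<open>The interval and the circle\<close>

text \<open>The density is cut at a height m, replaced by a continuous function and sampled at the
  left ends of the cells; each step costs \<eta> / 3. The statement covers all large K because later
  choices of K must meet further conditions.\<close>

lemma step_approx:
  fixes \<rho> :: "real \<Rightarrow> real"
  assumes \<rho>: "integrable lborel \<rho>" "\<And>t. \<rho> t \<ge> 0" and L: "L > 0" and \<eta>: "\<eta> > 0"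
  shows "\<exists>K0\<ge>1. \<forall>K\<ge>K0. \<exists>r M. (\<forall>i. 0 \<le> r i \<and> r i \<le> (M::real)) \<and>
    (\<integral>\<^sup>+t\<in>{0..<L}. ennreal \<bar>\<rho> t - r \<lfloor>t * real K / L\<rfloor>\<bar> \<partial>lborel) \<le> ennreal \<eta>"
proof -
  have \<rho>m [measurable]: "\<rho> \<in> borel_measurable borel" using borel_measurable_integrable[OF \<rho>(1)] by simp
  have "(\<lambda>m::nat. \<integral>t. \<rho> t - min (\<rho> t) (real m) \<partial>lborel) \<longlonglongrightarrow> (\<integral>t. 0 \<partial>(lborel :: real measure))"
  proof (rule integral_dominated_convergence[where w = \<rho>])
    have "\<forall>\<^sub>F m in sequentially. \<rho> t - min (\<rho> t) (real m) = 0" for t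
      using eventually_ge_at_top[of "nat \<lceil>\<rho> t\<rceil>"] by eventually_elim linarith
    then show "AE t in lborel. (\<lambda>m. \<rho> t - min (\<rho> t) (real m)) \<longlonglongrightarrow> 0" by (simp add: tendsto_eventually)
  qed (use \<rho> in \<open>auto simp: min_def\<close>)
  then have "\<forall>\<^sub>F m in sequentially. (\<integral>t. \<rho> t - min (\<rho> t) (real m) \<partial>lborel) < \<eta> / 3" using \<eta> by (intro order_tendstoD) auto
  then obtain m :: nat where m: "(\<integral>t. \<rho> t - min (\<rho> t) (real m) \<partial>lborel) < \<eta> / 3" by (auto dest: eventually_happens)
  have "\<rho> measurable_on UNIV" 
    by (intro lebesgue_measurable_imp_measurable_on measurable_completion) simp_all
  \<comment> \<open>Measurability supplies continuous functions converging almost everywhere.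
    Clipped to [0, m] they converge in mean on [0, L), by dominated convergence.\<close>
  then obtain N g where g: "negligible N" "\<And>n. continuous_on UNIV (g n)" "\<And>t. t \<notin> N \<Longrightarrow> (\<lambda>n. g n t) \<longlonglongrightarrow> \<rho> t"
    unfolding measurable_on_def by auto
  define c where "c = (\<lambda>n t. max 0 (min (real m) (g n t)))"
  have cc: "continuous_on A (c n)" for n A unfolding c_def by (intro continuous_intros continuous_on_subset[OF g(2)]) auto
  have [measurable]: "c n \<in> borel_measurable borel" for n by (rule borel_measurable_continuous_onI[OF cc])
  have c01: "0 \<le> c n t" "c n t \<le> real m" for n t by (auto simp: c_def)
  let ?d = "\<lambda>n t. indicator {0..<L} t * \<bar>min (\<rho> t) (real m) - c n t\<bar>"
  have db: "norm (?d n t) \<le> real m * indicator {0..<L} t" for n t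
  proof -
    have "\<bar>min (\<rho> t) (real m) - c n t\<bar> \<le> real m" using c01[where n = n and t = t] \<rho>(2)[of t] by linarith
    then show ?thesis by (simp add: indicator_def)
  qed
  have iL: "integrable lborel (\<lambda>t. real m * indicator {0..<L} t)" using L by simp
  have d: "integrable lborel (?d n)" for n
    by (rule Bochner_Integration.integrable_bound[OF iL _ AE_I2]) (use db in \<open>auto intro: order.trans[OF _ abs_ge_self]\<close>)
  have "(\<lambda>n. \<integral>t. ?d n t \<partial>lborel) \<longlonglongrightarrow> (\<integral>t. 0 \<partial>(lborel :: real measure))"
  proof (rule integral_dominated_convergence[where w = "\<lambda>t. real m * indicator {0..<L} t"])
    have "AE t in lborel. t \<notin> N" 
      using g(1) AE_not_in[of N lebesgue] by (simp add: negligible_iff_null_sets AE_completion_iff)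
    then show "AE t in lborel. (\<lambda>n. ?d n t) \<longlonglongrightarrow> 0"
    proof eventually_elim
      case (elim t)
      have "(\<lambda>n. ?d n t) \<longlonglongrightarrow> indicator {0..<L} t * \<bar>min (\<rho> t) (real m) - max 0 (min (real m) (\<rho> t))\<bar>"
        unfolding c_def by (intro tendsto_intros g(3) elim)
      then show ?case using \<rho>(2)[of t] by (simp add: min.commute max_absorb2)
    qed
  qed (use db iL in auto)
  then have "\<forall>\<^sub>F n in sequentially. (\<integral>t. ?d n t \<partial>lborel) < \<eta> / 3" using \<eta> by (intro order_tendstoD) auto
  then obtain n where n: "(\<integral>t. ?d n t \<partial>lborel) < \<eta> / 3" by (auto dest: eventually_happens)
  have "\<eta> / (3 * L) > 0" using \<eta> L by simp
  then obtain e where e: "e > 0" "\<And>s t. s \<in> {0..L} \<Longrightarrow> t \<in> {0..L} \<Longrightarrow> dist s t < e \<Longrightarrow> dist (c n s) (c n t) < \<eta> / (3 * L)"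
    using compact_uniformly_continuous[OF cc compact_Icc] unfolding uniformly_continuous_on_def by blast
  show ?thesis
  proof (intro exI[of _ "nat \<lceil>L / e\<rceil> + 1"] conjI allI impI)
    fix K assume K: "nat \<lceil>L / e\<rceil> + 1 \<le> K"
    then have "L / e < real K" "K > 0" by linarith+
    then have Ke: "L / real K < e" using e(1) by (simp add: field_simps)
    define r where "r = (\<lambda>i. c n (of_int i * L / real K))"
    have close: "\<bar>c n t - r \<lfloor>t * real K / L\<rfloor>\<bar> \<le> \<eta> / (3 * L)" if t: "t \<in> {0..<L}" for t
    proof -
      let ?i = "\<lfloor>t * real K / L\<rfloor>"
      have "of_int ?i * (L / real K) \<le> (t * real K / L) * (L / real K)" "(t * real K / L) * (L / real K) < (of_int ?i + 1) * (L / real K)"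
        using L \<open>K > 0\<close> by (intro mult_right_mono mult_strict_right_mono; simp; linarith)+
      then have "of_int ?i * L / real K \<le> t" "t < of_int ?i * L / real K + L / real K"
        using L \<open>K > 0\<close> by (simp_all add: add_divide_distrib distrib_right)
      moreover have "0 \<le> of_int ?i * L / real K" using t L \<open>K > 0\<close> by simp
      ultimately show ?thesis using e(2)[of t "of_int ?i * L / real K"] t Ke by (simp add: r_def dist_real_def)
    qed
    let ?F = "\<lambda>t. (\<rho> t - min (\<rho> t) (real m)) + ?d n t + \<eta> / (3 * L) * indicator {0..<L} t"
    have im: "integrable lborel (\<lambda>t. \<rho> t - min (\<rho> t) (real m))"
      by (rule Bochner_Integration.integrable_bound[OF \<rho>(1)]) (use \<rho>(2) in \<open>auto simp: min_def\<close>)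
    have iF: "integrable lborel ?F" using im d L by auto
    have "(\<integral>\<^sup>+t\<in>{0..<L}. ennreal \<bar>\<rho> t - r \<lfloor>t * real K / L\<rfloor>\<bar> \<partial>lborel) \<le> (\<integral>\<^sup>+t. ennreal (?F t) \<partial>lborel)"
    proof (rule nn_integral_mono)
      fix t
      show "ennreal \<bar>\<rho> t - r \<lfloor>t * real K / L\<rfloor>\<bar> * indicator {0..<L} t \<le> ennreal (?F t)"
      proof (cases "t \<in> {0..<L}")
        case True
        have "\<bar>\<rho> t - r \<lfloor>t * real K / L\<rfloor>\<bar> \<le> (\<rho> t - min (\<rho> t) (real m)) + \<bar>min (\<rho> t) (real m) - c n t\<bar> + \<eta> / (3 * L)"
          using close[OF True] by linarith
        then show ?thesis using True by (simp add: ennreal_leI del: ennreal_plus)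
      qed simp
    qed
    also have "... = ennreal (integral\<^sup>L lborel ?F)"
      using iF \<eta> L \<rho>(2) by (intro nn_integral_eq_integral) (auto simp: min_def)
    also have "integral\<^sup>L lborel ?F = (\<integral>t. \<rho> t - min (\<rho> t) (real m) \<partial>lborel) + (\<integral>t. ?d n t \<partial>lborel) + \<eta> / 3"
      using im d L by simp
    also have "... \<le> \<eta>" using m n by linarith
    finally show "\<exists>r M. (\<forall>i. 0 \<le> r i \<and> r i \<le> (M::real)) \<and> (\<integral>\<^sup>+t\<in>{0..<L}. ennreal \<bar>\<rho> t - r \<lfloor>t * real K / L\<rfloor>\<bar> \<partial>lborel) \<le> ennreal \<eta>"
      using c01 by (intro exI[of _ r] exI[of _ "real m"]) (auto simp: r_def ennreal_leI)
  qed simp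
qed

text \<open>The label of a cell is the value whose approximate density is largest there.\<close>

lemma cells_simple:
  fixes \<rho> :: "real \<Rightarrow> real"
  assumes \<rho>: "integrable lborel \<rho>" "\<And>t. \<rho> t \<ge> 0" and Z: "finite (Z ` {0..<L})" "\<And>z. {t\<in>{0..<L}. Z t = z} \<in> sets borel"
    and L: "L > 0" and \<eta>: "\<eta> > 0"
  shows "\<exists>K0\<ge>1. \<forall>K\<ge>K0. \<exists>\<phi>. (\<integral>\<^sup>+t\<in>{0..<L}. ennreal (\<rho> t) * indicator {t. \<phi> \<lfloor>t * real K / L\<rfloor> \<noteq> Z t} t \<partial>lborel) \<le> ennreal \<eta>"
proof -
  let ?V = "Z ` {0..<L}"
  have V: "?V \<noteq> {}" "card ?V > 0" using L Z(1) by (auto simp: card_gt_0_iff)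
  define b where "b = (\<lambda>z t. indicator {t\<in>{0..<L}. Z t = z} t * \<rho> t)"
  define P where "P = (\<lambda>z K r. (\<integral>\<^sup>+t\<in>{0..<L}. ennreal \<bar>b z t - r \<lfloor>t * real K / L\<rfloor>\<bar> \<partial>lborel) \<le> ennreal (\<eta> / card ?V))"
  have bi: "integrable lborel (b z)" for z unfolding b_def using integrable_mult_indicator[OF _ \<rho>(1), of "{t\<in>{0..<L}. Z t = z}"] Z(2) by simp
  have "\<exists>K0. \<forall>K\<ge>K0. \<exists>r. P z K r" for z
    using step_approx[OF bi _ L, of z "\<eta> / card ?V"] \<rho>(2) \<eta> V unfolding P_def by (auto simp: b_def) blast
  then obtain K0 where K0: "\<And>z K. K \<ge> K0 z \<Longrightarrow> \<exists>r. P z K r" by metis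
  have "\<exists>\<phi>. (\<integral>\<^sup>+t\<in>{0..<L}. ennreal (\<rho> t) * indicator {t. \<phi> \<lfloor>t * real K / L\<rfloor> \<noteq> Z t} t \<partial>lborel) \<le> ennreal \<eta>"
    if K: "(\<Sum>z\<in>?V. K0 z) + 1 \<le> K" for K
  proof -
    have "\<exists>r. P z K r" if "z \<in> ?V" for z using K0[of z K] K member_le_sum[OF that, of K0] Z(1) by simp
    then obtain r where r: "\<And>z. z \<in> ?V \<Longrightarrow> P z K (r z)" by metis
    have "\<exists>z\<in>?V. \<forall>z'\<in>?V. r z' i \<le> r z i" for i
    proof -
      have "Max ((\<lambda>z. r z i) ` ?V) \<in> (\<lambda>z. r z i) ` ?V" by (rule Max_in) (use Z(1) V(1) in blast)+
      then obtain z where z: "z \<in> ?V" "Max ((\<lambda>z. r z i) ` ?V) = r z i" by (rule imageE)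
      have "r z' i \<le> Max ((\<lambda>z. r z i) ` ?V)" if "z' \<in> ?V" for z' using Z(1) that by (intro Max_ge) blast+
      then show ?thesis using z by auto
    qed
    then obtain \<phi> where \<phi>: "\<And>i. \<phi> i \<in> ?V" "\<And>i z. z \<in> ?V \<Longrightarrow> r z i \<le> r (\<phi> i) i" by metis
    define e where "e = (\<lambda>z t. ennreal \<bar>b z t - r z \<lfloor>t * real K / L\<rfloor>\<bar> * indicator {0..<L} t)"
    have [measurable]: "b z \<in> borel_measurable borel" for z using borel_measurable_integrable[OF bi] by simp
    have "(\<integral>\<^sup>+t\<in>{0..<L}. ennreal (\<rho> t) * indicator {t. \<phi> \<lfloor>t * real K / L\<rfloor> \<noteq> Z t} t \<partial>lborel) \<le> (\<integral>\<^sup>+t. (\<Sum>z\<in>?V. e z t) \<partial>lborel)"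
    proof (rule nn_integral_mono)
      fix t
      let ?i = "\<lfloor>t * real K / L\<rfloor>"
      show "ennreal (\<rho> t) * indicator {t. \<phi> \<lfloor>t * real K / L\<rfloor> \<noteq> Z t} t * indicator {0..<L} t \<le> (\<Sum>z\<in>?V. e z t)"
      proof (cases "t \<in> {0..<L} \<and> \<phi> ?i \<noteq> Z t")
        case True
        then have Zt: "Z t \<in> ?V" and t: "t \<in> {0..<L}" by auto
        have "b (Z t) t = \<rho> t" "b (\<phi> ?i) t = 0" using True by (auto simp: b_def)
        \<comment> \<open>The density of the chosen label vanishes at t, although its approximation
          there is at least that of the true label. So the two approximation errors together are at
          least \<rho> t.\<close>
        then have "\<rho> t \<le> \<bar>b (Z t) t - r (Z t) ?i\<bar> + \<bar>b (\<phi> ?i) t - r (\<phi> ?i) ?i\<bar>" using \<phi>(2)[OF Zt, of ?i] by linarith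
        then have "ennreal (\<rho> t) \<le> e (Z t) t + e (\<phi> ?i) t" using t by (simp add: e_def ennreal_plus[symmetric] ennreal_leI del: ennreal_plus)
        also have "... = (\<Sum>z\<in>{Z t, \<phi> ?i}. e z t)" using True by (subst sum.insert) auto
        also have "... \<le> (\<Sum>z\<in>?V. e z t)" using Zt \<phi>(1) Z(1) by (intro sum_mono2) auto
        finally show ?thesis using True by simp
      qed auto
    qed
    also have "... = (\<Sum>z\<in>?V. integral\<^sup>N lborel (e z))" unfolding e_def by (intro nn_integral_sum) measurable
    also have "... \<le> (\<Sum>z\<in>?V. ennreal (\<eta> / card ?V))" using r by (intro sum_mono) (auto simp: P_def e_def)
    also have "... = ennreal \<eta>" using V \<eta> by (simp add: ennreal_of_nat_eq_real_of_nat ennreal_mult[symmetric])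
    finally show ?thesis by blast
  qed
  then show ?thesis by (intro exI[of _ "(\<Sum>z\<in>?V. K0 z) + 1"]) auto
qed

text \<open>\<open>L\<close> is the length of the space and \<open>lab K x\<close> the number of the cell of length \<open>L / K\<close> containing \<open>x\<close>. The map
  \<open>red K\<close> reduces the number of a cell of the parameter line to that of its image: modulo \<open>K\<close> on the circle.\<close>

locale one_dim_space =
  fixes I :: "('a::euclidean_space) one_dim" and L :: real and red :: "nat \<Rightarrow> int \<Rightarrow> int" and lab :: "nat \<Rightarrow> 'a \<Rightarrow> int"
  assumes L: "L > 0" and S: "closed (pdom I)" "convex (pdom I)" "{0..L} \<subseteq> pdom I"
    and q_cont: "continuous_on (pdom I) (param I)" and q_image: "param I ` pdom I = points I" "param I ` {0..L} = points I"
    and leb_sets: "sets (leb I) = sets (restrict_space borel (points I))"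
    and leb_nn: "\<And>\<Phi>. \<Phi> \<in> borel_measurable (restrict_space borel (points I)) \<Longrightarrow>
       integral\<^sup>N (leb I) \<Phi> = (\<integral>\<^sup>+t\<in>{0..<L}. \<Phi> (param I t) \<partial>lborel)"
    and period: "\<And>u lo hi. continuous_on (points I) u \<Longrightarrow> (\<And>x. x \<in> points I \<Longrightarrow> (0::real) \<le> u x) \<Longrightarrow> lo \<le> hi \<Longrightarrow> {lo..hi} \<subseteq> pdom I
       \<Longrightarrow> hi - lo \<le> L \<Longrightarrow> integral {lo..hi} (\<lambda>t. u (param I t)) \<le> integral {0..L} (\<lambda>t. u (param I t))"
    and lab_red: "\<And>K t. K \<ge> 1 \<Longrightarrow> t \<in> pdom I \<Longrightarrow> lab K (param I t) = red K \<lfloor>t * real K / L\<rfloor>"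
    and lab_id: "\<And>K t. K \<ge> 1 \<Longrightarrow> t \<in> {0..<L} \<Longrightarrow> lab K (param I t) = \<lfloor>t * real K / L\<rfloor>"
    and red_inj: "\<And>K i j. red K i = red K j \<Longrightarrow> \<bar>i - j\<bar> < int K \<Longrightarrow> i = j"
    and lab_meas: "\<And>K i. K \<ge> 1 \<Longrightarrow> {x\<in>points I. lab K x = i} \<in> sets borel"
    and null_image: "\<And>N. N \<subseteq> pdom I \<Longrightarrow> negligible N \<Longrightarrow> \<exists>Z\<in>null_sets (leb I). param I ` N \<subseteq> Z"
    and absd: "\<And>f t. f \<in> smooth_maps I \<Longrightarrow> t \<in> pdom I \<Longrightarrow> abs_deriv I f (param I t) = norm (nth_deriv 1 I f t)"
    and deriv_bdd: "\<And>f k. f \<in> smooth_maps I \<Longrightarrow> \<exists>B. \<forall>t\<in>pdom I. norm (nth_deriv k I f t) \<le> B"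
    and lift: "\<And>f. f \<in> smooth_maps I \<Longrightarrow> \<exists>d. dseq (pdom I) d \<and> d 0 ` pdom I \<subseteq> pdom I \<and>
       (\<forall>t\<in>pdom I. f (param I t) = param I (d 0 t) \<and> \<bar>d 1 t\<bar> = norm (nth_deriv 1 I f t)) \<and>
       (\<forall>r B. B \<ge> 1 \<longrightarrow> (\<forall>j\<le>r. \<forall>t\<in>pdom I. norm (nth_deriv j I f t) \<le> B) \<longrightarrow> (\<forall>k. 1 \<le> k \<longrightarrow> k \<le> r \<longrightarrow> (\<forall>t\<in>pdom I. \<bar>d k t\<bar> \<le> 2 ^ r * B\<^sup>2)))"


section \<open>The unit interval\<close>

lemma negligible_borel:
  assumes "negligible (N::real set)" obtains N' where "N \<subseteq> N'" "N' \<in> sets borel" "emeasure lborel N' = 0"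
  using assms unfolding negligible_iff_null_sets null_sets_completion_iff2 by (auto simp: null_sets_def)

lemma nth_deriv_Suc: "nth_deriv (Suc k) I f = (\<lambda>t. vector_derivative (nth_deriv k I f) (at t within pdom I))"
  by (simp add: nth_deriv_def)

lemma nth_deriv_0: "nth_deriv 0 I f = (\<lambda>t. f (param I t))"
  by (simp add: nth_deriv_def)

lemma dseq_nth_deriv: "f \<in> smooth_maps I \<Longrightarrow> dseq (pdom I) (\<lambda>k. nth_deriv k I f)"
  by (auto simp: dseq_def nth_deriv_Suc smooth_maps_def vector_derivative_works[symmetric])

lemma unit_interval_simps [simp]:
  "points unit_interval = {0..1}" "pdom unit_interval = {0..1}" "param unit_interval = (\<lambda>t. t)"
  "leb unit_interval = restrict_space lborel {0..1}"
  by (simp_all add: unit_interval_def)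

lemma circle_simps [simp]:
  "points circle = sphere 0 1" "pdom circle = UNIV" "param circle = cis"
  "leb circle = distr (restrict_space lborel {0..<2 * pi}) (restrict_space borel (sphere 0 1)) cis"
  by (simp_all add: circle_def)

text \<open>Labels need no reduction, so \<open>red\<close> is the identity, and the derivatives of
  f are themselves the lift. The cases are numbered in the order of the locale assumptions, each
  single fact counted.\<close>

lemma one_dim_space_interval: "one_dim_space unit_interval 1 (\<lambda>K i. i) (\<lambda>K t. \<lfloor>t * real K\<rfloor>)"
proof (unfold_locales, goal_cases)
  case 8
  show ?case by (simp, intro sets_restrict_space_cong) simp
next
  case (9 \<Phi>)
  have "integral\<^sup>N (leb unit_interval) \<Phi> = (\<integral>\<^sup>+t\<in>{0..1}. \<Phi> t \<partial>lborel)"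
    by (simp add: nn_integral_restrict_space)
  also have "... = (\<integral>\<^sup>+t\<in>{0..<1}. \<Phi> t \<partial>lborel)"
  proof (rule nn_integral_cong_AE)
    have "AE t in lborel. t \<noteq> (1::real)" by (rule AE_lborel_singleton)
    then show "AE t in lborel. \<Phi> t * indicator {0..1} t = \<Phi> t * indicator {0..<1} t"
      by eventually_elim (auto simp: indicator_def)
  qed
  finally show ?case by simp
next
  case (10 u lo hi)
  then have c: "continuous_on {0..1} u" "continuous_on {lo..hi} u" by (auto intro: continuous_on_subset)
  show ?case using 10 c by (auto intro!: integral_subset_le integrable_continuous_real)
next
  case (14 K i)
  have "{x\<in>{0..1}. \<lfloor>x * real K\<rfloor> = i} = {0..1} \<inter> ((\<lambda>x. \<lfloor>x * real K\<rfloor>) -` {i} \<inter> space borel)" by auto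
  also have "... \<in> sets borel" by (intro sets.Int measurable_sets[of _ borel "count_space UNIV"]) auto
  finally show ?case by simp
next
  case (15 N)
  obtain N' where N': "N \<subseteq> N'" "N' \<in> sets borel" "emeasure lborel N' = 0" using negligible_borel[OF 15(2)] .
  have "N' \<in> null_sets lborel" using N' by (auto simp: null_sets_def)
  then have "N' \<inter> {0..1} \<in> null_sets lborel" by (intro null_set_Int2) auto
  then have "N' \<inter> {0..1} \<in> null_sets (restrict_space lborel {0..1})" by (subst null_sets_restrict_space) auto
  then show ?case using N' 15 by (intro bexI[of _ "N' \<inter> {0..1}"]) auto
next
  case (16 f t)
  then show ?case by (simp add: abs_deriv_unit_interval nth_deriv_def)
next
  case (17 f k)
  have "continuous_on {0..1} (nth_deriv k unit_interval f)" using dseq_continuous[OF dseq_nth_deriv[OF 17], of k] by simp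
  then have "bounded (nth_deriv k unit_interval f ` {0..1})" by (intro compact_imp_bounded compact_continuous_image) auto
  then show ?case by (auto simp: bounded_iff)
next
  case (18 f)
  have im: "f t \<in> {0..1}" if "t \<in> {0..1}" for t using 18 that by (auto simp: smooth_maps_def)
  show ?case
  proof (intro exI[of _ "\<lambda>k. nth_deriv k unit_interval f"] conjI allI impI ballI)
    show "dseq (pdom unit_interval) (\<lambda>k. nth_deriv k unit_interval f)" by (rule dseq_nth_deriv[OF 18])
    fix r :: nat and B :: real and k t assume B: "1 \<le> B" and b: "\<forall>j\<le>r. \<forall>t\<in>pdom unit_interval. norm (nth_deriv j unit_interval f t) \<le> B"
      and k: "1 \<le> k" "k \<le> r" and t: "t \<in> pdom unit_interval"
    have "\<bar>nth_deriv k unit_interval f t\<bar> \<le> B" using b k t by auto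
    also have "B \<le> B * B" using B by simp
    also have "... \<le> 2 ^ r * B\<^sup>2" using B by (simp add: power2_eq_square)
    finally show "\<bar>nth_deriv k unit_interval f t\<bar> \<le> 2 ^ r * B\<^sup>2" .
  qed (use im in \<open>auto simp: nth_deriv_0\<close>)
qed auto

section \<open>The circle\<close>

lemma Arg2pi_borel: "Arg2pi \<in> borel_measurable borel"
  unfolding borel_measurable_iff_greater using open_Arg2pi2pi_gt by (auto intro: borel_open)

lemma cis_reduce: "cis (t - 2 * pi * of_int m) = cis t"
proof -
  have "cis (2 * pi * of_int m) = 1" by (metis cis_multiple_2pi Ints_of_int mult.commute)
  then show ?thesis by (simp flip: cis_divide)
qed

lemma Arg2pi_cis: "0 \<le> t \<Longrightarrow> t < 2 * pi \<Longrightarrow> Arg2pi (cis t) = t"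
  by (rule Arg2pi_unique[of 1]) (auto simp: cis_conv_exp)

lemma cis_Arg2pi: "norm z = 1 \<Longrightarrow> cis (Arg2pi z) = z"
  using complex_norm_eq_1_exp[of z] by (simp add: cis_conv_exp)

lemma floor_turn: "2 * pi * of_int \<lfloor>t / (2 * pi)\<rfloor> \<le> t" "t < 2 * pi * of_int \<lfloor>t / (2 * pi)\<rfloor> + 2 * pi"
proof -
  define y where "y = t / (2 * pi)"
  have t: "t = 2 * pi * y" by (simp add: y_def)
  have "of_int \<lfloor>y\<rfloor> \<le> y" "y < of_int \<lfloor>y\<rfloor> + 1" by linarith+
  then have "2 * pi * of_int \<lfloor>y\<rfloor> \<le> 2 * pi * y" "2 * pi * y < 2 * pi * (of_int \<lfloor>y\<rfloor> + 1)" by (intro mult_left_mono mult_strict_left_mono; simp)+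
  then show "2 * pi * of_int \<lfloor>t / (2 * pi)\<rfloor> \<le> t" "t < 2 * pi * of_int \<lfloor>t / (2 * pi)\<rfloor> + 2 * pi"
    unfolding y_def[symmetric] t[symmetric] by (simp_all add: distrib_left)
qed

lemma Arg2pi_cis_gen: "Arg2pi (cis t) = t - 2 * pi * of_int \<lfloor>t / (2 * pi)\<rfloor>"
proof -
  let ?m = "\<lfloor>t / (2 * pi)\<rfloor>"
  have "0 \<le> t - 2 * pi * of_int ?m" "t - 2 * pi * of_int ?m < 2 * pi"
    using floor_turn[of t] by linarith+
  from Arg2pi_cis[OF this] show ?thesis by (simp add: cis_reduce)
qed

text \<open>The interval is enlarged to a full period and its left end moved into [0, 2 pi); the
  part sticking out beyond 2 pi is translated back to the beginning.\<close>

lemma integral_period_le: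
  fixes v :: "real \<Rightarrow> real"
  assumes v: "continuous_on UNIV v" "\<And>t. v t \<ge> 0" "\<And>t m. v (t - 2 * pi * of_int m) = v t" and l: "lo \<le> hi" "hi - lo \<le> 2 * pi"
  shows "integral {lo..hi} v \<le> integral {0..2 * pi} v"
proof -
  define m where "m = \<lfloor>lo / (2 * pi)\<rfloor>"
  define r where "r = lo - 2 * pi * of_int m"
  have r: "0 \<le> r" "r < 2 * pi"
    using floor_turn[of lo] unfolding r_def m_def by linarith+
  have int: "v integrable_on {a..b}" for a b by (rule integrable_continuous_real[OF continuous_on_subset[OF v(1)]]) simp
  have shift: "integral {a + 2 * pi * of_int k..b + 2 * pi * of_int k} v = integral {a..b} v" for a b k
  proof -
    have "v (2 * pi * of_int k + t) = v t" for t using v(3)[of "2 * pi * of_int k + t" k] by simp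
    then have "v \<circ> (+) (2 * pi * of_int k) = v" by auto
    then show ?thesis using integral_shift_Icc_real[of a b v "2 * pi * of_int k"] by simp
  qed
  have "integral {lo..hi} v \<le> integral {lo..lo + 2 * pi} v"
    using l v(2) by (intro integral_subset_le int) auto
  also have "... = integral {r..r + 2 * pi} v" using shift[of r m "r + 2 * pi"] by (simp add: r_def algebra_simps)
  also have "... = integral {r..2 * pi} v + integral {2 * pi..r + 2 * pi} v"
    using r by (intro Henstock_Kurzweil_Integration.integral_combine[symmetric] int) auto
  also have "integral {2 * pi..r + 2 * pi} v = integral {0..r} v" using shift[of 0 1 r] by simp
  also have "integral {r..2 * pi} v + integral {0..r} v = integral {0..2 * pi} v"
    using Henstock_Kurzweil_Integration.integral_combine[OF _ _ int, of 0 r "2 * pi"] r by simp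
  finally show ?thesis .
qed

text \<open>For the curve \<gamma> t = f (cis t) of modulus 1 the product of cnj \<gamma> with
  \<gamma>' is purely imaginary, and its imaginary part is the angular speed. The lift is a
  primitive of it. Its derivatives are Leibniz sums of products of two derivatives of \<gamma>, and
  the binomial coefficients of a row add up to a power of 2: hence the bound 2^r B^2.\<close>

lemma circle_lift:
  assumes f: "f \<in> smooth_maps circle"
  shows "\<exists>d. dseq UNIV d \<and> (\<forall>t. f (cis t) = cis (d 0 t) \<and> \<bar>d 1 t\<bar> = norm (nth_deriv 1 circle f t)) \<and>
       (\<forall>r B. B \<ge> 1 \<longrightarrow> (\<forall>j\<le>r. \<forall>t. norm (nth_deriv j circle f t) \<le> B) \<longrightarrow> (\<forall>k. 1 \<le> k \<longrightarrow> k \<le> r \<longrightarrow> (\<forall>t. \<bar>d k t\<bar> \<le> 2 ^ r * B\<^sup>2)))"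
proof -
  define \<gamma> where "\<gamma> = (\<lambda>k. nth_deriv k circle f)"
  have \<gamma>: "(\<gamma> k has_vector_derivative \<gamma> (Suc k) t) (at t)" for k t
    using dseqD[OF dseq_nth_deriv[OF f], of t k] by (simp add: \<gamma>_def)
  have \<gamma>0: "\<gamma> 0 t = f (cis t)" for t by (simp add: \<gamma>_def nth_deriv_0)
  have unit: "norm (\<gamma> 0 t) = 1" for t using f by (auto simp: smooth_maps_def \<gamma>0 PiE_def Pi_def)
  have cnj\<gamma>: "((\<lambda>t. cnj (\<gamma> k t)) has_vector_derivative cnj (\<gamma> (Suc k) t)) (at t)" for k t
    using has_vector_derivative_cnj[OF \<gamma>] .
  define w where "w = (\<lambda>k t. \<Sum>i\<le>k. of_nat (k choose i) * (cnj (\<gamma> i t) * \<gamma> (Suc (k - i)) t))"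
  have w: "(w k has_vector_derivative w (Suc k) t) (at t)" for k t
  proof -
    have "((\<lambda>x. \<Sum>i\<le>k. of_nat (k choose i) * (cnj (\<gamma> i x) * \<gamma> (Suc (k - i)) x)) has_vector_derivative
       (\<Sum>i\<le>Suc k. of_nat (Suc k choose i) * (cnj (\<gamma> i t) * \<gamma> (Suc (Suc k - i)) t))) (at t within UNIV)"
      using leibniz_deriv[where p = "\<lambda>i t. cnj (\<gamma> i t)" and r = "\<lambda>i. \<gamma> (Suc i)" and x = t and S = UNIV and k = k] \<gamma> cnj\<gamma> by simp
    then show ?thesis by (simp add: w_def)
  qed
  have imd: "((\<lambda>t. Im (w k t)) has_real_derivative Im (w (Suc k) t)) (at t)" for k t
    using bounded_linear.has_vector_derivative[OF bounded_linear_Im w] by (simp add: has_real_derivative_iff_has_vector_derivative)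
  define a where "a = Arg2pi (\<gamma> 0 0)"
  have "continuous_on UNIV (\<lambda>t. Im (w 0 t))"
    using imd[of 0] by (intro DERIV_continuous_on) (auto intro: has_field_derivative_at_within)
  then obtain F where F: "\<And>t. (F has_real_derivative Im (w 0 t)) (at t)" "F 0 = a"
  proof -
    assume c: "continuous_on UNIV (\<lambda>t. Im (w 0 t))" and th: "\<And>F. (\<And>t. (F has_real_derivative Im (w 0 t)) (at t)) \<Longrightarrow> F 0 = a \<Longrightarrow> thesis"
    define F where "F = (\<lambda>t. LBINT s=ereal 0..ereal t. Im (w 0 s))"
    have "(F has_vector_derivative Im (w 0 t)) (at t)" for t
    proof -
      have "(F has_vector_derivative Im (w 0 t)) (at t within {min 0 t - 1..max 0 t + 1})"
        unfolding F_def by (rule interval_integral_FTC2) (auto intro: continuous_on_subset[OF c])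
      moreover have "at t within {min 0 t - 1..max 0 t + 1} = at t" by (rule at_within_interior) (auto simp: interior_atLeastAtMost_real)
      ultimately show ?thesis by simp
    qed
    then have "((\<lambda>t. F t - F 0 + a) has_real_derivative Im (w 0 t)) (at t)" for t
      by (auto intro!: derivative_eq_intros simp: has_real_derivative_iff_has_vector_derivative[symmetric])
    then show thesis by (rule th) simp
  qed
  define d where "d = (\<lambda>k. if k = 0 then F else (\<lambda>t. Im (w (k - 1) t)))"
  have d: "dseq UNIV d"
    unfolding dseq_def
  proof (intro allI ballI)
    fix k t show "(d k has_vector_derivative d (Suc k) t) (at t within UNIV)"
      using F(1)[of t] imd[of "k - 1" t] by (cases k) (auto simp: d_def has_real_derivative_iff_has_vector_derivative)
  qed
  have w0: "w 0 t = \<i> * of_real (Im (w 0 t))" for t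
  proof -
    have "((\<lambda>t. cnj (\<gamma> 0 t) * \<gamma> 0 t) has_vector_derivative (cnj (\<gamma> 0 t) * \<gamma> (Suc 0) t + cnj (\<gamma> (Suc 0) t) * \<gamma> 0 t)) (at t)"
      by (rule has_vector_derivative_mult[OF cnj\<gamma> \<gamma>])
    moreover have "(\<lambda>t. cnj (\<gamma> 0 t) * \<gamma> 0 t) = (\<lambda>t. 1)"
      using unit by (auto simp: fun_eq_iff mult.commute[of "cnj _"] complex_norm_square[symmetric])
    ultimately have "cnj (\<gamma> 0 t) * \<gamma> (Suc 0) t + cnj (\<gamma> (Suc 0) t) * \<gamma> 0 t = 0"
      using vector_derivative_unique_at[OF _ has_vector_derivative_const] by metis
    then have "Re (w 0 t) = 0" by (simp add: w_def complex_eq_iff)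
    then show ?thesis by (simp add: complex_eq_iff)
  qed
  have \<gamma>1: "\<gamma> 1 t = \<gamma> 0 t * w 0 t" for t
  proof -
    have "\<gamma> 0 t * w 0 t = (\<gamma> 0 t * cnj (\<gamma> 0 t)) * \<gamma> 1 t" by (simp add: w_def)
    also have "\<gamma> 0 t * cnj (\<gamma> 0 t) = 1" using unit by (simp add: complex_norm_square[symmetric])
    finally show ?thesis by simp
  qed
  have d1: "\<bar>d 1 t\<bar> = norm (\<gamma> 1 t)" for t
    unfolding \<gamma>1 norm_mult unit by (subst w0) (simp add: d_def norm_mult)
  have lift: "f (cis t) = cis (F t)" for t
  proof -
    \<comment> \<open>The quotient of \<gamma> by the candidate has derivative zero, and it is 1 at
      t = 0 by the choice of the initial angle.\<close>
    define h where "h = (\<lambda>t. \<gamma> 0 t * cis (- F t))"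
    have "(h has_vector_derivative 0) (at t within UNIV)" for t
    proof -
      have "((\<lambda>t. cis (- F t)) has_vector_derivative (- Im (w 0 t)) *\<^sub>R (\<i> * cis (- F t))) (at t)"
      proof -
        have "((\<lambda>t. - F t) has_vector_derivative - Im (w 0 t)) (at t)"
          using F(1)[of t] by (auto intro!: derivative_eq_intros simp: has_real_derivative_iff_has_vector_derivative)
        moreover have "(cis has_vector_derivative \<i> * cis s) (at s)" for s
          by (auto simp: has_vector_derivative_complex_iff intro!: derivative_eq_intros)
        ultimately show ?thesis using vector_diff_chain_at[of "\<lambda>t. - F t" "- Im (w 0 t)" t cis] by (simp add: comp_def)
      qed
      from has_vector_derivative_mult[OF \<gamma>[of 0 t] this]
      have "(h has_vector_derivative \<gamma> 0 t * ((- Im (w 0 t)) *\<^sub>R (\<i> * cis (- F t))) + \<gamma> (Suc 0) t * cis (- F t)) (at t)"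
        by (simp add: h_def)
      moreover have "\<gamma> (Suc 0) t = \<gamma> 0 t * (\<i> * of_real (Im (w 0 t)))" using \<gamma>1[of t] w0[of t] by simp
      ultimately show ?thesis by (simp add: scaleR_conv_of_real algebra_simps)
    qed
    then have "h t = h 0" using has_vector_derivative_zero_constant[of UNIV h] by (metis UNIV_I convex_UNIV)
    also have "h 0 = cis a * cis (- a)" using F(2) cis_Arg2pi[OF unit[of 0]] by (simp add: h_def a_def)
    also have "... = 1" by (simp add: cis_mult)
    finally have "h t * cis (F t) = cis (F t)" by simp
    then show ?thesis by (simp add: h_def cis_mult \<gamma>0 mult.assoc)
  qed
  have bound: "\<bar>d k t\<bar> \<le> 2 ^ r * B\<^sup>2" if B: "B \<ge> 1" "\<And>j t. j \<le> r \<Longrightarrow> norm (\<gamma> j t) \<le> B" and k: "1 \<le> k" "k \<le> r" for r B k t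
  proof -
    obtain m where m: "k = Suc m" using k by (cases k) auto
    have "\<bar>d k t\<bar> \<le> norm (w m t)" by (simp add: d_def m abs_Im_le_cmod)
    also have "... \<le> (\<Sum>i\<le>m. norm (of_nat (m choose i) * (cnj (\<gamma> i t) * \<gamma> (Suc (m - i)) t)))" unfolding w_def by (rule norm_sum)
    also have "... \<le> (\<Sum>i\<le>m. real (m choose i) * (B * B))"
      using B k m by (intro sum_mono) (auto simp: norm_mult intro!: mult_left_mono mult_mono B(2))
    also have "... = 2 ^ m * (B * B)"
      using choose_row_sum[of m] by (simp add: sum_distrib_right[symmetric] of_nat_sum[symmetric] del: of_nat_sum)
    also have "... \<le> 2 ^ r * B\<^sup>2" using k m by (auto simp: power2_eq_square intro!: mult_right_mono power_increasing)
    finally show ?thesis .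
  qed
  show ?thesis
    using d d1 lift bound by (intro exI[of _ d]) (auto simp: d_def \<gamma>_def)
qed

lemma one_dim_space_circle: "one_dim_space circle (2 * pi) (\<lambda>K i. i mod int K) (\<lambda>K z. \<lfloor>Arg2pi z * real K / (2 * pi)\<rfloor>)"
proof (unfold_locales, goal_cases)
  case 5
  show ?case by (auto simp: continuous_on_cis)
next
  case 6
  have "z \<in> range cis" if "norm z = 1" for z
    using cis_Arg2pi[OF that] by (intro image_eqI[of _ _ "Arg2pi z"]) auto
  then show ?case by auto
next
  case 7
  have "z \<in> cis ` {0..2 * pi}" if "norm z = 1" for z
    using cis_Arg2pi[OF that] Arg2pi[of z] by (intro image_eqI[of _ _ "Arg2pi z"]) auto
  then show ?case by auto
next
  case 8
  then show ?case by simp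
next
  case (9 \<Phi>)
  have m: "cis \<in> measurable (restrict_space lborel {0..<2 * pi}) (restrict_space borel (sphere 0 1))"
    by (intro measurable_restrict_space2 measurable_restrict_space1)
      (simp_all add: borel_measurable_continuous_onI[OF continuous_on_cis[OF continuous_on_id]])
  have "integral\<^sup>N (leb circle) \<Phi> = (\<integral>\<^sup>+t. \<Phi> (cis t) \<partial>restrict_space lborel {0..<2 * pi})"
    using 9 by (simp add: nn_integral_distr[OF m])
  also have "... = (\<integral>\<^sup>+t\<in>{0..<2 * pi}. \<Phi> (cis t) \<partial>lborel)" by (rule nn_integral_restrict_space) simp
  finally show ?case by simp
next
  case (10 u lo hi)
  show ?case
  proof (simp, rule integral_period_le)
    show "continuous_on UNIV (\<lambda>t. u (cis t))"
      by (rule continuous_on_compose2[of "sphere 0 1" u UNIV cis]) (use 10(1) continuous_on_cis[OF continuous_on_id] in \<open>simp_all add: image_subset_iff\<close>)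
  qed (use 10 in \<open>auto simp: cis_reduce\<close>)
next
  case (11 K t)
  let ?m = "\<lfloor>t / (2 * pi)\<rfloor>"
  have K: "real K > 0" using 11 by simp
  have eq: "Arg2pi (cis t) * real K / (2 * pi) = t * real K / (2 * pi) - of_int (?m * int K)"
    unfolding Arg2pi_cis_gen by (simp add: field_simps)
  have "0 \<le> Arg2pi (cis t) * real K / (2 * pi)" using Arg2pi[of "cis t"] K by simp
  moreover have "Arg2pi (cis t) * real K / (2 * pi) < real K" using Arg2pi[of "cis t"] K by (simp add: field_simps)
  ultimately have "0 \<le> \<lfloor>t * real K / (2 * pi)\<rfloor> - ?m * int K" "\<lfloor>t * real K / (2 * pi)\<rfloor> - ?m * int K < int K"
    unfolding eq by linarith+
  from mod_pos_pos_trivial[OF this] have "(\<lfloor>t * real K / (2 * pi)\<rfloor> - ?m * int K) mod int K = \<lfloor>t * real K / (2 * pi)\<rfloor> - ?m * int K" .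
  then have "\<lfloor>t * real K / (2 * pi)\<rfloor> mod int K = \<lfloor>t * real K / (2 * pi)\<rfloor> - ?m * int K"
    using mod_mult_self1[of "\<lfloor>t * real K / (2 * pi)\<rfloor>" "- ?m" "int K"] by simp
  moreover have "\<lfloor>Arg2pi (cis t) * real K / (2 * pi)\<rfloor> = \<lfloor>t * real K / (2 * pi)\<rfloor> - ?m * int K"
    unfolding eq by (rule floor_diff_of_int)
  ultimately show ?case by simp
next
  case (12 K t)
  then show ?case by (simp add: Arg2pi_cis)
next
  case (13 K i j)
  then have "int K dvd i - j" by (simp add: mod_eq_dvd_iff)
  then show ?case using 13(2) dvd_imp_le_int[of "i - j" "int K"] by (cases "i = j") auto
next
  case (14 K i)
  have "{x\<in>sphere 0 1. \<lfloor>Arg2pi x * real K / (2 * pi)\<rfloor> = i} = sphere 0 1 \<inter> ((\<lambda>x. \<lfloor>Arg2pi x * real K / (2 * pi)\<rfloor>) -` {i} \<inter> space borel)" by auto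
  also have "... \<in> sets borel" using Arg2pi_borel by (intro sets.Int measurable_sets[of _ borel "count_space UNIV"]) auto
  finally show ?case by simp
next
  case (15 N)
  obtain N' where N': "N \<subseteq> N'" "N' \<in> sets borel" "emeasure lborel N' = 0" using negligible_borel[OF 15(2)] .
  \<comment> \<open>All translates by periods, because a point of N is replaced by its
    representative in [0, 2 pi).\<close>
  define N2 where "N2 = (\<Union>m::int. (\<lambda>t. t + 2 * pi * of_int m) -` N')"
  have tb: "(\<lambda>t. t + 2 * pi * of_int m) -` N' \<in> sets borel" for m :: int
    using measurable_sets[of "\<lambda>t. t + 2 * pi * of_int m" borel borel N'] N' by simp
  have "emeasure lborel ((\<lambda>t. t + 2 * pi * of_int m) -` N') = 0" for m :: int
  proof -
    have "emeasure lborel N' = emeasure (distr lborel borel (\<lambda>t. 2 * pi * of_int m + t)) N'" by (simp add: lborel_distr_plus)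
    also have "... = emeasure lborel ((\<lambda>t. 2 * pi * of_int m + t) -` N')" using N'(2) by (subst emeasure_distr) auto
    finally show ?thesis using N'(3) by (simp add: add.commute)
  qed
  then have N2: "N2 \<in> null_sets lborel" unfolding N2_def using tb by (intro null_sets_UN) (auto simp: null_sets_def)
  define Z where "Z = sphere 0 1 \<inter> Arg2pi -` N2"
  have Zb: "Z \<in> sets (restrict_space borel (sphere 0 1))"
    using N2 measurable_sets[OF Arg2pi_borel, of N2] by (auto simp: sets_restrict_space Z_def null_sets_def)
  have m: "cis \<in> measurable (restrict_space lborel {0..<2 * pi}) (restrict_space borel (sphere 0 1))"
    by (intro measurable_restrict_space2 measurable_restrict_space1)
      (simp_all add: borel_measurable_continuous_onI[OF continuous_on_cis[OF continuous_on_id]])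
  have "emeasure (leb circle) Z = emeasure (restrict_space lborel {0..<2 * pi}) (cis -` Z \<inter> {0..<2 * pi})"
    using emeasure_distr[OF m Zb] by (simp add: space_restrict_space)
  also have "... = emeasure lborel (cis -` Z \<inter> {0..<2 * pi})" by (rule emeasure_restrict_space) auto
  also have "... \<le> emeasure lborel N2" using N2 by (intro emeasure_mono) (auto simp: Z_def Arg2pi_cis)
  finally have "Z \<in> null_sets (leb circle)" using Zb N2 by (auto simp: null_sets_def)
  moreover have "cis ` N \<subseteq> Z"
  proof
    fix z assume "z \<in> cis ` N"
    then obtain t where t: "t \<in> N" "z = cis t" by blast
    have "Arg2pi z + 2 * pi * of_int \<lfloor>t / (2 * pi)\<rfloor> = t" by (simp add: t Arg2pi_cis_gen)
    then have "Arg2pi z + 2 * pi * of_int \<lfloor>t / (2 * pi)\<rfloor> \<in> N'" using t(1) N'(1) by auto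
    then have "Arg2pi z \<in> N2" unfolding N2_def by blast
    then show "z \<in> Z" by (simp add: Z_def t)
  qed
  ultimately show ?case by auto
next
  case (16 f t)
  then show ?case by (simp add: abs_deriv_circle nth_deriv_def)
next
  case (17 f k)
  have c: "continuous_on UNIV (nth_deriv k circle f)" using dseq_continuous[OF dseq_nth_deriv[OF 17], of k] by simp
  then have "bounded (nth_deriv k circle f ` {0..2 * pi})" by (intro compact_imp_bounded compact_continuous_image continuous_on_subset[OF c]) auto
  then obtain B where B: "\<And>t. t \<in> {0..2 * pi} \<Longrightarrow> norm (nth_deriv k circle f t) \<le> B" unfolding bounded_iff by blast
  \<comment> \<open>Periodicity passes to all derivatives, so a bound on one compact period is
    global.\<close>
  have per: "nth_deriv k circle f (t - 2 * pi * of_int m) = nth_deriv k circle f t" for t m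
  proof (induction k arbitrary: t)
    case (Suc k)
    have der: "(nth_deriv k circle f has_vector_derivative nth_deriv (Suc k) circle f t) (at t)" for t
      using dseqD[OF dseq_nth_deriv[OF 17], of t k] by simp
    have "((\<lambda>s. s - 2 * pi * of_int m) has_vector_derivative 1) (at t)" by (auto intro!: derivative_eq_intros)
    from vector_diff_chain_at[OF this der]
    have "(nth_deriv k circle f \<circ> (\<lambda>s. s - 2 * pi * of_int m) has_vector_derivative nth_deriv (Suc k) circle f (t - 2 * pi * of_int m)) (at t)" by simp
    moreover have "nth_deriv k circle f \<circ> (\<lambda>s. s - 2 * pi * of_int m) = nth_deriv k circle f" using Suc.IH by (auto simp: fun_eq_iff)
    ultimately show ?case using vector_derivative_unique_at[OF der] by metis
  qed (simp add: nth_deriv_0 cis_reduce)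
  have "norm (nth_deriv k circle f t) \<le> B" for t
  proof -
    let ?s = "t - 2 * pi * of_int \<lfloor>t / (2 * pi)\<rfloor>"
    have "?s \<in> {0..2 * pi}" using Arg2pi[of "cis t"] unfolding Arg2pi_cis_gen by auto
    then show ?thesis using B[of ?s] by (simp add: per)
  qed
  then show ?case by auto
next
  case (18 f)
  then show ?case using circle_lift[OF 18] by simp
qed auto


section \<open>Derivatives along orbits and lifts of iterates\<close>

definition jac :: "('a::real_normed_vector) one_dim \<Rightarrow> ('a \<Rightarrow> 'a) \<Rightarrow> nat \<Rightarrow> 'a \<Rightarrow> real" where
  "jac I f n x = (\<Prod>i<n. abs_deriv I f ((f ^^ i) x))"

text \<open>The positive part of the logarithm is continuous also at critical points, so it may be
  integrated against weak limits; being nonnegative, it may be restricted to subsets without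
  increasing the integral.\<close>

definition logp :: "('a::real_normed_vector) one_dim \<Rightarrow> ('a \<Rightarrow> 'a) \<Rightarrow> nat \<Rightarrow> 'a \<Rightarrow> real" where
  "logp I f n x = ln (max 1 (jac I f n x))"

lemma jac_nonneg: "jac I f n x \<ge> 0"
  unfolding jac_def abs_deriv_def by (intro prod_nonneg) simp

lemma jac_add: "jac I f (m + n) x = jac I f m x * jac I f n ((f ^^ m) x)"
proof (induction n)
  case (Suc n)
  have "(f ^^ n) ((f ^^ m) x) = (f ^^ (m + n)) x" by (metis add.commute comp_apply funpow_add)
  then show ?case using Suc by (simp add: jac_def)
qed (simp add: jac_def)

lemma ln_max_mult_le: "a \<ge> 0 \<Longrightarrow> b \<ge> 0 \<Longrightarrow> ln (max 1 (a * b)) \<le> ln (max 1 a) + ln (max 1 (b::real))"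
proof -
  assume ab: "a \<ge> 0" "b \<ge> 0"
  have "max 1 (a * b) \<le> max 1 a * max 1 b"
    using ab mult_mono[of a "max 1 a" b "max 1 b"] mult_mono[of 1 "max 1 a" 1 "max 1 b"] by auto
  then have "ln (max 1 (a * b)) \<le> ln (max 1 a * max 1 b)" by (intro ln_mono) auto
  also have "... = ln (max 1 a) + ln (max 1 b)" by (intro ln_mult_pos) auto
  finally show ?thesis .
qed

lemma logp_nonneg: "logp I f n x \<ge> 0"
  by (simp add: logp_def)

context one_dim_space begin

abbreviation "q \<equiv> param I"
abbreviation "dm \<equiv> pdom I"
abbreviation "pts \<equiv> points I"
abbreviation (input) "dbd r B f \<equiv> \<forall>j\<le>r. \<forall>t\<in>dm. norm (nth_deriv j I f t) \<le> B"
abbreviation (input) "lbd \<Lambda> f \<equiv> \<forall>x\<in>pts. abs_deriv I f x \<le> exp \<Lambda>"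

lemma q_pts: "t \<in> dm \<Longrightarrow> q t \<in> pts" using q_image by auto

lemma Ico_dm: "{0..<L} \<subseteq> dm" using S(3) by auto

lemma compact_pts: "compact pts"
  using compact_continuous_image[OF continuous_on_subset[OF q_cont S(3)]] q_image(2) by simp

lemma pts_borel: "pts \<in> sets borel"
  using compact_pts by (simp add: borel_compact)

text \<open>On the compact interval [0, L] the parametrisation maps closed sets to closed sets. It
  is therefore a quotient map, and continuity can be tested in the parameter.\<close>

lemma cont_q:
  fixes u :: "'a \<Rightarrow> 'b::t2_space"
  assumes u: "continuous_on {0..L} (\<lambda>t. u (q t))"
  shows "continuous_on pts u"
  unfolding continuous_on_closed_vimage[OF compact_imp_closed[OF compact_pts]]
proof (intro allI impI)
  fix B :: "'b set" assume "closed B"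
  then have "closed ((\<lambda>t. u (q t)) -` B \<inter> {0..L})" using u continuous_on_closed_vimage[of "{0..L}"] by blast
  then have "compact ((\<lambda>t. u (q t)) -` B \<inter> {0..L})" using compact_Int_closed[of "{0..L}" "(\<lambda>t. u (q t)) -` B \<inter> {0..L}"] by (simp add: Int_absorb1)
  moreover have "continuous_on ((\<lambda>t. u (q t)) -` B \<inter> {0..L}) q" using S(3) by (intro continuous_on_subset[OF q_cont]) auto
  ultimately have "closed (q ` ((\<lambda>t. u (q t)) -` B \<inter> {0..L}))" using compact_continuous_image compact_imp_closed by blast
  moreover have "q ` ((\<lambda>t. u (q t)) -` B \<inter> {0..L}) = u -` B \<inter> pts" unfolding q_image(2)[symmetric] by blast
  ultimately show "closed (u -` B \<inter> pts)" by simp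
qed

lemma q_meas: "\<Phi> \<in> measurable (restrict_space borel pts) N \<Longrightarrow> (\<lambda>t. \<Phi> (q t)) \<in> measurable (restrict_space borel {0..<L}) N"
proof -
  assume \<Phi>: "\<Phi> \<in> measurable (restrict_space borel pts) N"
  have "q \<in> borel_measurable (restrict_space borel {0..<L})"
    by (intro borel_measurable_continuous_on_restrict continuous_on_subset[OF q_cont Ico_dm])
  then have "q \<in> measurable (restrict_space borel {0..<L}) (restrict_space borel pts)"
    using q_pts Ico_dm by (intro measurable_restrict_space2) (auto simp: space_restrict_space)
  from measurable_compose[OF this \<Phi>] show ?thesis .
qed

lemma cont_meas: "continuous_on pts u \<Longrightarrow> u \<in> borel_measurable (restrict_space borel pts)"
  by (rule borel_measurable_continuous_on_restrict)

lemma fun_pts: "f \<in> smooth_maps I \<Longrightarrow> x \<in> pts \<Longrightarrow> (f ^^ n) x \<in> pts"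
  by (induction n) (auto simp: smooth_maps_def)

lemma fun_cont: "f \<in> smooth_maps I \<Longrightarrow> continuous_on pts (f ^^ n)"
proof (induction n)
  case 0 then show ?case by (simp add: id_def)
next
  case (Suc n)
  have "continuous_on {0..L} (nth_deriv 0 I f)" using dseq_continuous[OF dseq_nth_deriv[OF Suc.prems]] S(3) by (rule continuous_on_subset)
  then have "continuous_on pts f" by (intro cont_q) (simp add: nth_deriv_0)
  then show ?case using Suc fun_pts[OF Suc.prems] by (auto intro!: continuous_on_compose2[of pts f pts "f ^^ n"] simp: comp_def)
qed

lemma abs_deriv_cont: "f \<in> smooth_maps I \<Longrightarrow> continuous_on pts (abs_deriv I f)"
proof (rule cont_q)
  assume f: "f \<in> smooth_maps I"
  have c: "continuous_on {0..L} (\<lambda>t. norm (nth_deriv 1 I f t))"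
    by (intro continuous_on_norm continuous_on_subset[OF dseq_continuous[OF dseq_nth_deriv[OF f]]] S(3))
  have "norm (nth_deriv 1 I f t) = abs_deriv I f (q t)" if "t \<in> {0..L}" for t using absd[OF f] S(3) that by (metis subsetD)
  then show "continuous_on {0..L} (\<lambda>t. abs_deriv I f (q t))" by (rule continuous_on_eq[OF c])
qed

lemma jac_cont: "f \<in> smooth_maps I \<Longrightarrow> continuous_on pts (jac I f n)"
  unfolding jac_def
proof (rule continuous_on_prod)
  assume f: "f \<in> smooth_maps I"
  show "continuous_on pts (\<lambda>x. abs_deriv I f ((f ^^ i) x))" for i
    by (rule continuous_on_compose2[OF abs_deriv_cont[OF f] fun_cont[OF f]]) (use fun_pts[OF f] in auto)
qed

lemma logp_cont: "f \<in> smooth_maps I \<Longrightarrow> continuous_on pts (logp I f n)"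
  unfolding logp_def by (intro continuous_intros jac_cont) auto

lemma jac_le:
  assumes "f \<in> smooth_maps I" "\<And>x. x \<in> pts \<Longrightarrow> abs_deriv I f x \<le> exp \<Lambda>" "x \<in> pts"
  shows "jac I f n x \<le> exp (real n * \<Lambda>)"
proof -
  have "jac I f n x \<le> (\<Prod>i<n. exp \<Lambda>)"
    unfolding jac_def using assms fun_pts by (intro prod_mono) (auto simp: abs_deriv_def)
  then show ?thesis by (simp add: exp_of_nat_mult)
qed

lemma logp_le:
  assumes "f \<in> smooth_maps I" "\<And>x. x \<in> pts \<Longrightarrow> abs_deriv I f x \<le> exp \<Lambda>" "\<Lambda> \<ge> 0" "x \<in> pts"
  shows "logp I f n x \<le> real n * \<Lambda>"
proof -
  have "max 1 (jac I f n x) \<le> exp (real n * \<Lambda>)" using jac_le[OF assms(1,2,4)] assms(3) by simp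
  then show ?thesis unfolding logp_def using ln_mono[of "max 1 (jac I f n x)" "exp (real n * \<Lambda>)"] by simp
qed

lemma deriv_bound: "f \<in> smooth_maps I \<Longrightarrow> \<exists>B\<ge>1. dbd r B f"
proof -
  assume "f \<in> smooth_maps I"
  then obtain B where B: "\<And>k t. t \<in> dm \<Longrightarrow> norm (nth_deriv k I f t) \<le> B k" using deriv_bdd by metis
  have "B j \<le> (\<Sum>k\<le>r. \<bar>B k\<bar>)" if "j \<le> r" for j
    using member_le_sum[of j "{..r}" "\<lambda>k. \<bar>B k\<bar>"] that by (auto intro: order.trans[OF abs_ge_self])
  moreover have "0 \<le> (\<Sum>k\<le>r. \<bar>B k\<bar>)" by (simp add: sum_nonneg)
  ultimately show ?thesis using B by (intro exI[of _ "1 + (\<Sum>k\<le>r. \<bar>B k\<bar>)"]) (smt (verit))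
qed

definition is_lift :: "('a \<Rightarrow> 'a) \<Rightarrow> (nat \<Rightarrow> real \<Rightarrow> real) \<Rightarrow> bool" where
  "is_lift f d \<longleftrightarrow> dseq dm d \<and> d 0 ` dm \<subseteq> dm \<and>
       (\<forall>t\<in>dm. f (q t) = q (d 0 t) \<and> \<bar>d 1 t\<bar> = norm (nth_deriv 1 I f t)) \<and>
       (\<forall>r B. B \<ge> 1 \<longrightarrow> (dbd r B f) \<longrightarrow> (\<forall>k. 1 \<le> k \<longrightarrow> k \<le> r \<longrightarrow> (\<forall>t\<in>dm. \<bar>d k t\<bar> \<le> 2 ^ r * B\<^sup>2)))"

definition lft :: "('a \<Rightarrow> 'a) \<Rightarrow> nat \<Rightarrow> real \<Rightarrow> real" where "lft f = (SOME d. is_lift f d)"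

lemma is_lift_lft: "f \<in> smooth_maps I \<Longrightarrow> is_lift f (lft f)"
  unfolding lft_def using lift[of f] by (intro someI_ex[of "is_lift f"]) (simp only: is_lift_def)

lemma
  assumes f: "f \<in> smooth_maps I"
  shows lft_dseq: "dseq dm (lft f)" and lft_into: "lft f 0 ` dm \<subseteq> dm"
    and lft: "t \<in> dm \<Longrightarrow> f (q t) = q (lft f 0 t)" and lft_1: "t \<in> dm \<Longrightarrow> \<bar>lft f 1 t\<bar> = abs_deriv I f (q t)"
proof -
  note l = is_lift_lft[OF f, unfolded is_lift_def]
  show "dseq dm (lft f)" "lft f 0 ` dm \<subseteq> dm" using l by (rule conjunct1, rule conjunct1[OF conjunct2])
  note 1 = conjunct1[OF conjunct2[OF conjunct2[OF l]], rule_format]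
  show "t \<in> dm \<Longrightarrow> f (q t) = q (lft f 0 t)" using 1[of t] by (rule conjunct1)
  show "t \<in> dm \<Longrightarrow> \<bar>lft f 1 t\<bar> = abs_deriv I f (q t)" using 1[of t] absd[OF f, of t] by (simp only:)
qed

lemma lft_bound:
  assumes f: "f \<in> smooth_maps I" and B: "B \<ge> 1" "dbd r B f" and k: "1 \<le> k" "k \<le> r" "t \<in> dm"
  shows "\<bar>lft f k t\<bar> \<le> 2 ^ r * B\<^sup>2"
  using conjunct2[OF conjunct2[OF conjunct2[OF is_lift_lft[OF f, unfolded is_lift_def]]], rule_format, OF B(1) _ k] B(2) by blast

text \<open>\<open>it\<close> depends on the map only and not on the constants of
  \<open>iter_map\<close>. So iterates of the lift are available before a scale is fixed;
  \<open>fit_facts\<close> gives an instance with crude constants.\<close>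

definition fit :: "('a \<Rightarrow> 'a) \<Rightarrow> nat \<Rightarrow> nat \<Rightarrow> real \<Rightarrow> real" where "fit f = iter_map.it (lft f)"

lemma fit_facts:
  assumes f: "f \<in> smooth_maps I"
  shows "\<exists>E eps. iter_map dm (lft f) 3 E eps"
proof -
  obtain B where B: "B \<ge> 1" "dbd 4 B f" using deriv_bound[OF f] by blast
  have "iter_map dm (lft f) 3 (2 ^ 4 * B\<^sup>2) (1 / 2)"
  proof
    have "1 \<le> B\<^sup>2" using B(1) by simp
    then show "1 \<le> 2 ^ 4 * B\<^sup>2" by simp
    show "\<bar>lft f k x\<bar> * (2 * (1 / 2)) ^ (k - 1) \<le> 2 ^ 4 * B\<^sup>2" if "x \<in> dm" "1 \<le> k" "k \<le> Suc 3" for x k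
      using lft_bound[OF f B, of k x] that by simp
  qed (use S lft_dseq[OF f] lft_into[OF f] in auto)
  then show ?thesis by blast
qed

lemma
  assumes f: "f \<in> smooth_maps I"
  shows fit_dseq: "dseq dm (fit f m)" and fit_into: "t \<in> dm \<Longrightarrow> fit f m 0 t \<in> dm"
    and fit_0: "t \<in> dm \<Longrightarrow> (f ^^ m) (q t) = q (fit f m 0 t)"
    and fit_1: "t \<in> dm \<Longrightarrow> \<bar>fit f m 1 t\<bar> = jac I f m (q t)"
    and fit_Suc: "fit f (Suc m) = comp_seq (lft f) (fit f m)"
proof -
  obtain E eps where "iter_map dm (lft f) 3 E eps" using fit_facts[OF f] by blast
  then interpret iter_map dm "lft f" 3 E eps .
  show "dseq dm (fit f m)" unfolding fit_def by (rule it_dseq)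
  show into: "t \<in> dm \<Longrightarrow> fit f m 0 t \<in> dm" for t m unfolding fit_def by (rule it_S)
  show "fit f (Suc m) = comp_seq (lft f) (fit f m)" unfolding fit_def by simp
  show 0: "t \<in> dm \<Longrightarrow> (f ^^ m) (q t) = q (fit f m 0 t)" for t m
    by (induction m) (simp_all add: fit_def lft[OF f] it_S)
  show "t \<in> dm \<Longrightarrow> \<bar>fit f m 1 t\<bar> = jac I f m (q t)"
    using it_1_prod[of m t] 0 lft_1[OF f into] by (simp add: fit_def jac_def abs_prod del: One_nat_def)
qed

text \<open>The constant depends on r, B and p but not on the map. This is the source of uniformity
  near f.\<close>

lemma fit_bound: "\<exists>C\<ge>1. \<forall>f\<in>smooth_maps I. (dbd r B f) \<longrightarrow>
    (\<forall>k t. 1 \<le> k \<longrightarrow> k \<le> r \<longrightarrow> t \<in> dm \<longrightarrow> \<bar>fit f p k t\<bar> \<le> C)" if B: "B \<ge> 1"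
proof (induction p)
  case 0
  have "\<bar>fit f 0 k t\<bar> \<le> 1" if f0: "f \<in> smooth_maps I" and k0: "1 \<le> k" for f k t
  proof -
    obtain E eps where "iter_map dm (lft f) 3 E eps" using fit_facts[OF f0] by blast
    then interpret iter_map dm "lft f" 3 E eps .
    show ?thesis using k0 by (simp add: fit_def)
  qed
  then show ?case by (intro exI[of _ 1]) auto
next
  case (Suc p)
  then obtain C where C: "C \<ge> 1" "\<And>f k t. f \<in> smooth_maps I \<Longrightarrow> (dbd r B f) \<Longrightarrow>
     1 \<le> k \<Longrightarrow> k \<le> r \<Longrightarrow> t \<in> dm \<Longrightarrow> \<bar>fit f p k t\<bar> \<le> C" by blast
  define B' where "B' = 2 ^ r * B\<^sup>2 * C ^ r"
  define C' where "C' = 1 + (\<Sum>k\<le>r. comp_const k * B' * C)"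
  have B': "B' \<ge> 0" unfolding B'_def using B C by simp
  have "\<bar>fit f (Suc p) k t\<bar> \<le> C'" if f: "f \<in> smooth_maps I" "dbd r B f"
    and k: "1 \<le> k" "k \<le> r" and t: "t \<in> dm" for f k t
  proof -
    have "\<bar>comp_seq (lft f) (fit f p) k t\<bar> * 1 ^ k \<le> comp_const k * B' * C"
    proof (rule comp_seq_bound[where r = r and \<eta> = C])
      fix k' assume k': "1 \<le> k'" "k' \<le> r"
      have "C ^ (k' - 1) \<le> C ^ r" using C k' by (intro power_increasing) auto
      then show "\<bar>lft f k' (fit f p 0 t)\<bar> * C ^ (k' - 1) \<le> B'"
        unfolding B'_def using lft_bound[OF f(1) B f(2) k' fit_into[OF f(1) t]] C(1) B by (intro mult_mono) auto
      show "\<bar>fit f p k' t\<bar> * 1 ^ k' \<le> C" using C(2)[OF f k' t] by simp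
    qed (use C k in auto)
    also have "... \<le> (\<Sum>k\<le>r. comp_const k * B' * C)"
      using k B' C by (intro member_le_sum) (auto simp: comp_const_nonneg)
    finally show ?thesis by (simp add: fit_Suc[OF f(1)] C'_def)
  qed
  moreover have "C' \<ge> 1" unfolding C'_def using B' C by (simp add: sum_nonneg comp_const_nonneg)
  ultimately show ?case by blast
qed

text \<open>The first derivative satisfies the bound exp (p \<Lambda>) by the chain rule. For higher
  orders there is at least one factor 2 \<open>eps\<close> \<le> 1 / C, which absorbs the uniform
  bound C. So E is exp (p \<Lambda>) however large C is; only \<open>eps\<close> pays for
  it.\<close>

lemma iter_map_fit:
  assumes B: "B \<ge> 1" and \<Lambda>: "\<Lambda> \<ge> 0" and n: "n \<ge> 3"
  shows "\<exists>eps0>0. \<forall>f\<in>smooth_maps I. (dbd (Suc n) B f) \<longrightarrow> (lbd \<Lambda> f) \<longrightarrow>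
     (\<forall>eps. 0 < eps \<longrightarrow> eps \<le> eps0 \<longrightarrow> iter_map dm (fit f p) n (exp (real p * \<Lambda>)) eps)"
proof -
  obtain C where C: "C \<ge> 1" "\<And>f k t. f \<in> smooth_maps I \<Longrightarrow> (dbd (Suc n) B f) \<Longrightarrow>
     1 \<le> k \<Longrightarrow> k \<le> Suc n \<Longrightarrow> t \<in> dm \<Longrightarrow> \<bar>fit f p k t\<bar> \<le> C" using fit_bound[OF B, of "Suc n" p] by blast
  have "iter_map dm (fit f p) n (exp (real p * \<Lambda>)) eps"
    if f: "f \<in> smooth_maps I" "dbd (Suc n) B f" "lbd \<Lambda> f"
      and eps: "0 < eps" "eps \<le> 1 / (2 * C)" for f eps
  proof
    show E1: "1 \<le> exp (real p * \<Lambda>)" using \<Lambda> by simp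
    fix x k assume x: "x \<in> dm" and k: "1 \<le> k" "k \<le> Suc n"
    show "\<bar>fit f p k x\<bar> * (2 * eps) ^ (k - 1) \<le> exp (real p * \<Lambda>)"
    proof (cases "k = 1")
      case True
      then show ?thesis using fit_1[OF f(1) x] jac_le[OF f(1) _ q_pts[OF x]] f(3) by simp
    next
      case False
      have 2: "2 * eps \<le> 1 / C" using eps C by (simp add: field_simps)
      also have "1 / C \<le> 1" using C by simp
      finally have le1: "2 * eps \<le> 1" .
      have "\<bar>fit f p k x\<bar> * (2 * eps) ^ (k - 1) \<le> C * (2 * eps) ^ 1"
        using C(2)[OF f(1,2) k x] eps C(1) le1 False k by (intro mult_mono power_decreasing) auto
      also have "... \<le> C * (1 / C)" using 2 C(1) by (intro mult_left_mono) auto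
      also have "... \<le> exp (real p * \<Lambda>)" using C(1) E1 by simp
      finally show ?thesis .
    qed
  qed (use S n eps fit_dseq[OF f(1)] fit_into[OF f(1)] in auto)
  moreover have "1 / (2 * C) > 0" using C by simp
  ultimately show ?thesis by blast
qed

lemma it_fit:
  assumes f: "f \<in> smooth_maps I" and im: "iter_map dm (fit f p) n E eps" and t: "t \<in> dm"
  shows "q (iter_map.it (fit f p) m 0 t) = (f ^^ (p * m)) (q t)" "\<bar>iter_map.it (fit f p) m 1 t\<bar> = jac I f (p * m) (q t)"
proof -
  interpret iter_map dm "fit f p" n E eps by (rule im)
  show 0: "q (iter_map.it (fit f p) m 0 t) = (f ^^ (p * m)) (q t)" for m
  proof (induction m)
    case (Suc m)
    then show ?case using fit_0[OF f it_S[OF t, of m], of p] by (simp add: funpow_add)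
  qed simp
  show "\<bar>iter_map.it (fit f p) m 1 t\<bar> = jac I f (p * m) (q t)"
  proof (induction m)
    case (Suc m)
    have "\<bar>fit f p 1 (it m 0 t)\<bar> = jac I f p ((f ^^ (p * m)) (q t))" using fit_1[OF f it_S[OF t]] 0[of m] by simp
    moreover have "jac I f (p * Suc m) (q t) = jac I f (p * m) (q t) * jac I f p ((f ^^ (p * m)) (q t))"
      using jac_add[of I f "p * m" p] by (simp add: add.commute)
    ultimately show ?case using Suc it_1[of m t] by (simp add: abs_mult del: it.simps One_nat_def)
  qed (simp add: jac_def)
qed

end


section \<open>Absolutely continuous invariant measures\<close>

context one_dim_space begin

abbreviation (input) "LI g \<equiv> (\<integral>\<^sup>+t\<in>{0..<L}. g t \<partial>lborel)"
abbreviation (input) "fl K t \<equiv> \<lfloor>t * real K / L\<rfloor>"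

end

locale ac_system = one_dim_space I L red lab
  for I :: "('a::euclidean_space) one_dim" and L red lab +
  fixes f :: "'a \<Rightarrow> 'a" and \<mu> :: "'a measure"
  assumes f: "f \<in> smooth_maps I" and inv: "invariant_prob I f \<mu>" and ac: "absolutely_continuous (leb I) \<mu>"

sublocale ac_system \<subseteq> mp_system \<mu> f
  using inv by (simp add: invariant_prob_def mp_system_def mp_system_axioms_def)

lemma card_floor_le: "card {\<lfloor>y - w\<rfloor>..\<lfloor>y + w\<rfloor>} \<le> 2 * w + 2" if "w \<ge> 0" for y w :: real
proof -
  have "real (card {\<lfloor>y - w\<rfloor>..\<lfloor>y + w\<rfloor>}) = real_of_int (\<lfloor>y + w\<rfloor> - \<lfloor>y - w\<rfloor> + 1)"
    using floor_mono[of "y - w" "y + w"] that by simp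
  also have "... \<le> 2 * w + 2" by linarith
  finally show ?thesis .
qed

lemma (in one_dim_space) pts_obtain:
  assumes "x \<in> pts" obtains t where "t \<in> {0..L}" "x = q t" "t \<in> dm"
  using assms S(3) unfolding q_image(2)[symmetric] by blast

lemma (in one_dim_space) q_vimage_borel: "A \<in> sets (restrict_space borel pts) \<Longrightarrow> {t\<in>{0..<L}. q t \<in> A} \<in> sets borel"
proof -
  assume "A \<in> sets (restrict_space borel pts)"
  then have "(indicator A :: 'a \<Rightarrow> ennreal) \<in> borel_measurable (restrict_space borel pts)" by simp
  from q_meas[OF this] have "(\<lambda>t. indicator A (q t)) -` {1::ennreal} \<inter> space (restrict_space borel {0..<L}) \<in> sets (restrict_space borel {0..<L})"
    by (rule measurable_sets) simp
  moreover have "(\<lambda>t. indicator A (q t)) -` {1::ennreal} \<inter> space (restrict_space borel {0..<L}) = {t\<in>{0..<L}. q t \<in> A}"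
    by (auto simp: space_restrict_space indicator_def split: if_splits)
  ultimately show ?thesis by (simp add: sets_restrict_space_iff)
qed

section \<open>Densities and Ruelle's inequality\<close>

context ac_system begin

definition is_dens :: "(real \<Rightarrow> real) \<Rightarrow> bool" where
  "is_dens \<rho> \<longleftrightarrow> integrable lborel \<rho> \<and> (\<forall>t. 0 \<le> \<rho> t) \<and>
  (\<forall>\<Phi>\<in>borel_measurable \<mu>. integral\<^sup>N \<mu> \<Phi> = LI (\<lambda>t. ennreal (\<rho> t) * \<Phi> (q t)))"

definition dens :: "real \<Rightarrow> real" where "dens = (SOME \<rho>. is_dens \<rho>)"

lemma sets_mu: "sets \<mu> = sets (restrict_space borel pts)" using inv by (simp add: invariant_prob_def)

lemma space_mu: "space \<mu> = pts" using sets_eq_imp_space_eq[OF sets_mu] by (simp add: space_restrict_space)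

lemma meas_mu: "\<Phi> \<in> measurable (restrict_space borel pts) N \<longleftrightarrow> \<Phi> \<in> measurable \<mu> N"
  using measurable_cong_sets[OF sets_mu refl] by blast

text \<open>The Radon-Nikodym derivative composed with the parametrisation. It is finite almost
  everywhere, since its integral is 1, and can therefore be replaced by a real function.\<close>

lemma density_ex: "\<exists>\<rho>. is_dens \<rho>"
proof -
  have lebm: "measurable (leb I) = measurable \<mu>" "space (leb I) = pts"
    using measurable_cong_sets[OF leb_sets[folded sets_mu] refl] sets_eq_imp_space_eq[OF leb_sets] by (auto simp: fun_eq_iff space_restrict_space)
  have "emeasure (leb I) (space (leb I)) = integral\<^sup>N (leb I) (\<lambda>_. 1)" by simp
  also have "... = ennreal L" using L by (subst leb_nn) auto
  finally interpret leb: finite_measure "leb I" by (intro finite_measureI) simp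
  obtain r where r: "r \<in> borel_measurable (leb I)" "density (leb I) r = \<mu>"
    using leb.Radon_Nikodym[OF ac] leb_sets sets_mu by auto
  have r': "r \<in> borel_measurable (restrict_space borel pts)" using r(1) by (simp add: lebm(1) meas_mu)
  have r0: "(\<lambda>t. r (q t) * indicator {0..<L} t) \<in> borel_measurable borel"
    using q_meas[OF r'] by (subst (asm) borel_measurable_restrict_space_iff_ennreal) auto
  have nn: "integral\<^sup>N \<mu> \<Phi> = LI (\<lambda>t. r (q t) * \<Phi> (q t))" if "\<Phi> \<in> borel_measurable \<mu>" for \<Phi>
  proof -
    have "integral\<^sup>N \<mu> \<Phi> = (\<integral>\<^sup>+x. r x * \<Phi> x \<partial>leb I)" using r(1) that by (subst r(2)[symmetric], subst nn_integral_density) (auto simp: lebm)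
    also have "... = LI (\<lambda>t. r (q t) * \<Phi> (q t))" using r' that by (intro leb_nn) (auto simp: meas_mu)
    finally show ?thesis .
  qed
  have one: "(\<integral>\<^sup>+t. r (q t) * indicator {0..<L} t \<partial>lborel) = 1" using nn[of "\<lambda>_. 1"] emeasure_space_1 by simp
  define \<rho> where "\<rho> = (\<lambda>t. enn2real (r (q t) * indicator {0..<L} t))"
  have "AE t in lborel. r (q t) * indicator {0..<L} t \<noteq> \<infinity>" using r0 one by (intro nn_integral_PInf_AE) auto
  then have AE: "AE t in lborel. ennreal (\<rho> t) = r (q t) * indicator {0..<L} t"
    unfolding \<rho>_def by eventually_elim (simp add: ennreal_enn2real_if)
  have nn\<rho>: "(\<integral>\<^sup>+t. ennreal (\<rho> t) \<partial>lborel) = 1" using nn_integral_cong_AE[OF AE] one by simp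
  have "\<rho> \<in> borel_measurable lborel" unfolding \<rho>_def using r0 by simp
  then have int: "integrable lborel \<rho>" using nn\<rho> by (intro integrableI_nonneg) (auto simp: \<rho>_def)
  have "integral\<^sup>N \<mu> \<Phi> = LI (\<lambda>t. ennreal (\<rho> t) * \<Phi> (q t))" if "\<Phi> \<in> borel_measurable \<mu>" for \<Phi>
    unfolding nn[OF that] using AE by (intro nn_integral_cong_AE, eventually_elim) (auto split: split_indicator)
  moreover have "\<rho> t \<ge> 0" for t by (simp add: \<rho>_def)
  ultimately have "is_dens \<rho>" unfolding is_dens_def using int by blast
  then show ?thesis by blast
qed

lemma dens_int: "integrable lborel dens" and dens_nonneg: "0 \<le> dens t"
  and dens_nn: "\<Phi> \<in> borel_measurable \<mu> \<Longrightarrow> integral\<^sup>N \<mu> \<Phi> = LI (\<lambda>t. ennreal (dens t) * \<Phi> (q t))"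
proof -
  have "is_dens dens" unfolding dens_def using density_ex by (rule someI_ex)
  note d = this[unfolded is_dens_def]
  show "integrable lborel dens" using d by (rule conjunct1)
  show "0 \<le> dens t" using d by simp
  show "\<Phi> \<in> borel_measurable \<mu> \<Longrightarrow> integral\<^sup>N \<mu> \<Phi> = LI (\<lambda>t. ennreal (dens t) * \<Phi> (q t))" using d by blast
qed

lemma dens_meas [measurable]: "dens \<in> borel_measurable borel" using borel_measurable_integrable[OF dens_int] by simp

lemma exp_dens:
  assumes "integrable \<mu> \<phi>" "\<And>x. x \<in> pts \<Longrightarrow> 0 \<le> \<phi> x"
  shows "ennreal (expectation \<phi>) = LI (\<lambda>t. ennreal (dens t) * ennreal (\<phi> (q t)))"
proof -
  have "ennreal (expectation \<phi>) = (\<integral>\<^sup>+x. ennreal (\<phi> x) \<partial>\<mu>)" using assms by (subst nn_integral_eq_integral) (auto simp: space_mu)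
  also have "... = LI (\<lambda>t. ennreal (dens t) * ennreal (\<phi> (q t)))"
    using borel_measurable_integrable[OF assms(1)] by (intro dens_nn) simp
  finally show ?thesis .
qed

lemma cont_int: "continuous_on pts \<phi> \<Longrightarrow> integrable \<mu> (\<phi> :: 'a \<Rightarrow> real)"
proof -
  assume c: "continuous_on pts \<phi>"
  then obtain B where "\<And>x. x \<in> pts \<Longrightarrow> norm (\<phi> x) \<le> B"
    using compact_imp_bounded[OF compact_continuous_image[OF c compact_pts]] by (auto simp: bounded_iff)
  moreover have "\<phi> \<in> borel_measurable \<mu>" using cont_meas[OF c] by (simp add: meas_mu)
  ultimately show ?thesis by (intro integrable_const_bound[of _ B]) (auto simp: space_mu)
qed

lemma logp_int: "integrable \<mu> (logp I f n)" by (rule cont_int[OF logp_cont[OF f]])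

lemma dens_mass: "LI (\<lambda>t. ennreal (dens t)) = 1"
  using dens_nn[of "\<lambda>_. 1"] emeasure_space_1 by simp

text \<open>The same measure seen on the parameter line, where finite measures on the reals and
  their weak convergence are available.\<close>

definition line :: "real measure" where "line = density lborel (\<lambda>t. ennreal (dens t) * indicator {0..<L} t)"

lemma line_sets: "sets line = sets borel" by (simp add: line_def)

lemma line_emeasure: "A \<in> sets borel \<Longrightarrow> emeasure line A = LI (\<lambda>t. ennreal (dens t) * indicator A t)"
  unfolding line_def by (subst emeasure_density) (auto simp: mult_ac)

lemma line_finite: "finite_measure line"
  using line_emeasure[of UNIV] dens_mass line_sets sets_eq_imp_space_eq[OF line_sets] by (intro finite_measureI) simp

lemma q_vimage: "A \<in> sets \<mu> \<Longrightarrow> {t\<in>{0..<L}. q t \<in> A} \<in> sets borel"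
  unfolding sets_mu by (rule q_vimage_borel)

lemma line_q: "A \<in> sets \<mu> \<Longrightarrow> emeasure line {t\<in>{0..<L}. q t \<in> A} = emeasure \<mu> A"
proof -
  assume A: "A \<in> sets \<mu>"
  have "emeasure \<mu> A = LI (\<lambda>t. ennreal (dens t) * indicator A (q t))" using dens_nn[of "indicator A"] A by simp
  also have "... = emeasure line {t\<in>{0..<L}. q t \<in> A}"
    unfolding line_emeasure[OF q_vimage[OF A]] by (intro nn_integral_cong) (auto split: split_indicator)
  finally show ?thesis by simp
qed

lemma simple_lab: "K \<ge> 1 \<Longrightarrow> simple_function \<mu> (lab K)"
  unfolding simple_function_def
proof (intro conjI ballI)
  assume K: "K \<ge> 1"
  have "lab K ` pts \<subseteq> red K ` {0..int K}"
  proof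
    fix i assume "i \<in> lab K ` pts"
    then obtain x where x: "x \<in> pts" "i = lab K x" by blast
    obtain t where t0: "t \<in> {0..L}" "x = q t" "t \<in> dm" by (rule pts_obtain[OF x(1)])
    then have t: "t \<in> {0..L}" "i = lab K (q t)" using x by auto
    then have "0 \<le> t * real K / L" "t * real K / L \<le> real K" using L by (auto simp: field_simps mult_right_mono)
    then have "(fl K t) \<in> {0..int K}" by (simp add: floor_le_iff)
    then show "i \<in> red K ` {0..int K}" using t lab_red[OF K, of t] S(3) by auto
  qed
  then show "finite (lab K ` space \<mu>)" unfolding space_mu by (rule finite_subset) simp
  fix i
  have "lab K -` {i} \<inter> pts = {x\<in>pts. lab K x = i}" by auto
  then show "lab K -` {i} \<inter> space \<mu> \<in> sets \<mu>"
    using lab_meas[OF K, of i] pts_borel by (simp add: space_mu sets_mu sets_restrict_space_iff)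
qed

text \<open>On a cell the derivative of the lift of f^n is at most J + 1, where J is its modulus at
  t. So the image stays within J + 1 cell lengths of the image of t and meets at most 2 (J + 1) + 2
  cells. One more label is allowed for the end point \<open>q L\<close>, which \<open>lab_id\<close>
  does not cover. Altogether 2 J + 5 \<le> 7 max 1 J.\<close>

lemma card_suc_le:
  assumes K: "K \<ge> 1" and t: "t \<in> {0..<L}"
    and d: "\<And>s. s \<in> {0..L} \<Longrightarrow> \<bar>s - t\<bar> \<le> L / real K \<Longrightarrow> \<bar>fit f n 1 s\<bar> \<le> \<bar>fit f n 1 t\<bar> + 1"
  shows "real (card ((\<lambda>x. lab K ((f ^^ n) x)) ` {x\<in>pts. lab K x = lab K (q t)})) \<le> 7 * max 1 (jac I f n (q t))"
proof -
  define J where "J = \<bar>fit f n 1 t\<bar>"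
  define G where "G = fit f n 0"
  have tdm: "t \<in> dm" using t S(3) by auto
  have J: "J = jac I f n (q t)" unfolding J_def using fit_1[OF f tdm] .
  let ?y = "G t * real K / L" let ?R = "red K ` {\<lfloor>?y - (J + 1)\<rfloor>..\<lfloor>?y + (J + 1)\<rfloor>}"
  have "(\<lambda>x. lab K ((f ^^ n) x)) ` {x\<in>pts. lab K x = lab K (q t)} \<subseteq> insert (lab K ((f ^^ n) (q L))) ?R"
  proof (intro image_subsetI)
    fix x assume x: "x \<in> {x\<in>pts. lab K x = lab K (q t)}"
    then have "x \<in> pts" by simp
    then obtain s where s: "s \<in> {0..L}" "x = q s" "s \<in> dm" by (rule pts_obtain)
    show "lab K ((f ^^ n) x) \<in> insert (lab K ((f ^^ n) (q L))) ?R"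
    proof (cases "s = L")
      case False
      then have s': "s \<in> {0..<L}" "s \<in> dm" using s S(3) by auto
      have fl: "(fl K s) = (fl K t)" using x lab_id[OF K t] lab_id[OF K s'(1)] s by simp
      have "\<bar>s * real K / L - t * real K / L\<bar> \<le> 1" using fl by linarith
      also have "\<bar>s * real K / L - t * real K / L\<bar> = \<bar>s - t\<bar> * (real K / L)" using L by (simp add: abs_mult diff_divide_distrib[symmetric] left_diff_distrib[symmetric])
      finally have st: "\<bar>s - t\<bar> * (real K / L) \<le> 1" .
      then have close: "\<bar>s - t\<bar> \<le> L / real K" using L K by (simp add: field_simps)
      have "\<bar>G s - G t\<bar> \<le> (J + 1) * \<bar>s - t\<bar>"
      proof -
        have "{min s t..max s t} \<subseteq> {0..L}" using s' t by auto
        then have sub: "{min s t..max s t} \<subseteq> dm" using S(3) by blast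
        show ?thesis
        proof (cases "s = t")
          case False
          then have lt: "min s t < max s t" by linarith
          obtain z where z: "z \<in> {min s t<..<max s t}" "G (max s t) - G (min s t) = fit f n (Suc 0) z * (max s t - min s t)"
            using dseq_mvt[OF fit_dseq[OF f] lt sub, of n 0] unfolding G_def by blast
          have "\<bar>G s - G t\<bar> = \<bar>G (max s t) - G (min s t)\<bar>" by (simp add: max_def min_def abs_minus_commute)
          also have "... = \<bar>fit f n 1 z\<bar> * \<bar>s - t\<bar>" unfolding z(2) by (simp add: abs_mult max_def min_def abs_minus_commute)
          also have "... \<le> (J + 1) * \<bar>s - t\<bar>"
            unfolding J_def using z(1) s' t close by (intro mult_right_mono d) auto
          finally show ?thesis .
        qed simp
      qed
      then have "\<bar>G s - G t\<bar> * (real K / L) \<le> (J + 1) * (\<bar>s - t\<bar> * (real K / L))"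
        using L K mult_right_mono[of "\<bar>G s - G t\<bar>" "(J + 1) * \<bar>s - t\<bar>" "real K / L"] by (simp add: mult.assoc)
      also have "... \<le> (J + 1) * 1" using st by (intro mult_left_mono) (auto simp: J_def)
      also have "\<bar>G s - G t\<bar> * (real K / L) = \<bar>G s * real K / L - ?y\<bar>" using L by (simp add: abs_mult diff_divide_distrib[symmetric] left_diff_distrib[symmetric])
      finally have "\<lfloor>G s * real K / L\<rfloor> \<in> {\<lfloor>?y - (J + 1)\<rfloor>..\<lfloor>?y + (J + 1)\<rfloor>}"
        by (auto intro!: floor_mono)
      then show ?thesis
        using fit_0[OF f s'(2), of n] lab_red[OF K fit_into[OF f s'(2)], of n] s(2) by (auto simp: G_def)
    qed (use s in simp)
  qed
  then have "card ((\<lambda>x. lab K ((f ^^ n) x)) ` {x\<in>pts. lab K x = lab K (q t)}) \<le> card (insert (lab K ((f ^^ n) (q L))) ?R)"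
    by (intro card_mono) auto
  also have "... \<le> Suc (card ?R)" by (rule card_insert_le_m1) auto
  also have "card ?R \<le> card {\<lfloor>?y - (J + 1)\<rfloor>..\<lfloor>?y + (J + 1)\<rfloor>}" by (rule card_image_le) simp
  finally have "real (card ((\<lambda>x. lab K ((f ^^ n) x)) ` {x\<in>pts. lab K x = lab K (q t)})) \<le> 1 + real (card {\<lfloor>?y - (J + 1)\<rfloor>..\<lfloor>?y + (J + 1)\<rfloor>})"
    by linarith
  also have "... \<le> 1 + (2 * (J + 1) + 2)" using card_floor_le[of "J + 1" ?y] by (simp add: J_def)
  also have "... \<le> 7 * max 1 (jac I f n (q t))" unfolding J[symmetric] by (auto simp: max_def)
  finally show ?thesis .
qed

text \<open>In the constant, ln 7 comes from counting the successors of a cell, ln 2 from \<eta> =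
  1/2 in \<open>ruelle\<close>, and 1 bounds the cost of wrong predictions. Because \<mu> has a
  density, fine cells predict the block of n labels up to small probability; \<delta> is adapted to
  the number of blocks.\<close>

lemma ent_rate_le:
  assumes Y: "simple_function \<mu> Y" and n: "n > 0"
  shows "ent_rate Y * real n \<le> expectation (logp I f n) + (ln 7 + ln 2 + 1)"
proof -
  let ?W = "itin Y n"
  have W: "simple_function \<mu> ?W" by (rule simple_itin[OF Y])
  define \<delta> where "\<delta> = 1 / (\<bar>ln (real (card (?W ` space \<mu>)) / (1/2))\<bar> + 1)"
  have \<delta>: "\<delta> > 0" by (simp add: \<delta>_def add_nonneg_pos)
  have "uniformly_continuous_on {0..L} (fit f n 1)"
    by (intro compact_uniformly_continuous continuous_on_subset[OF dseq_continuous[OF fit_dseq[OF f]]] S(3)) simp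
  then obtain d where d: "d > 0" "\<And>s t. s \<in> {0..L} \<Longrightarrow> t \<in> {0..L} \<Longrightarrow> dist s t < d \<Longrightarrow> dist (fit f n 1 s) (fit f n 1 t) < 1"
    unfolding uniformly_continuous_on_def by (metis zero_less_one)
  have Zb: "{t\<in>{0..<L}. ?W (q t) = z} \<in> sets borel" for z
  proof -
    have "?W -` {z} \<inter> space \<mu> \<in> sets \<mu>" by (rule simple_functionD(2)[OF W])
    from q_vimage[OF this] have "{t\<in>{0..<L}. q t \<in> ?W -` {z} \<inter> space \<mu>} \<in> sets borel" .
    moreover have "{t\<in>{0..<L}. q t \<in> ?W -` {z} \<inter> space \<mu>} = {t\<in>{0..<L}. ?W (q t) = z}"
      using q_pts Ico_dm by (auto simp: space_mu)
    ultimately show ?thesis by simp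
  qed
  have fin: "finite ((\<lambda>t. ?W (q t)) ` {0..<L})"
    by (rule finite_subset[OF _ simple_functionD(1)[OF W]]) (use q_pts Ico_dm in \<open>auto simp: space_mu\<close>)
  obtain K0 where K0: "K0 \<ge> 1" "\<And>K. K \<ge> K0 \<Longrightarrow> \<exists>\<phi>. LI (\<lambda>t. ennreal (dens t) * indicator {t. \<phi> (fl K t) \<noteq> ?W (q t)} t) \<le> ennreal \<delta>"
    using cells_simple[OF dens_int dens_nonneg fin Zb L \<delta>] by blast
  \<comment> \<open>Two demands on K: the cells predict the blocks, and the derivative of the lift
    varies by less than 1 on a cell.\<close>
  define K where "K = max K0 (nat \<lceil>L / d\<rceil> + 1)"
  have K: "K \<ge> 1" "K \<ge> K0" using K0(1) by (auto simp: K_def)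
  have "L / d < real K" unfolding K_def by linarith
  then have Kd: "L / real K < d" using d(1) K(1) by (simp add: field_simps)
  obtain \<phi> where \<phi>: "LI (\<lambda>t. ennreal (dens t) * indicator {t. \<phi> (fl K t) \<noteq> ?W (q t)} t) \<le> ennreal \<delta>" using K0(2)[OF K(2)] by blast
  note lab = simple_lab[OF K(1)]
  have B: "{x\<in>space \<mu>. \<phi> (lab K x) \<noteq> ?W x} \<in> sets \<mu>"
  proof -
    have "(\<lambda>x. (lab K x, ?W x)) -` {w. \<phi> (fst w) \<noteq> snd w} \<inter> space \<mu> \<in> sets \<mu>" by (rule simple_functionD(2)[OF simple_function_Pair[OF lab W]])
    moreover have "(\<lambda>x. (lab K x, ?W x)) -` {w. \<phi> (fst w) \<noteq> snd w} \<inter> space \<mu> = {x\<in>space \<mu>. \<phi> (lab K x) \<noteq> ?W x}" by auto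
    ultimately show ?thesis by simp
  qed
  have mis: "prob {x\<in>space \<mu>. \<phi> (lab K x) \<noteq> ?W x} \<le> \<delta>"
  proof -
    have "emeasure \<mu> {x\<in>space \<mu>. \<phi> (lab K x) \<noteq> ?W x} = LI (\<lambda>t. ennreal (dens t) * indicator {x\<in>space \<mu>. \<phi> (lab K x) \<noteq> ?W x} (q t))"
      using dens_nn[of "indicator {x\<in>space \<mu>. \<phi> (lab K x) \<noteq> ?W x}"] B by simp
    also have "... = LI (\<lambda>t. ennreal (dens t) * indicator {t. \<phi> (fl K t) \<noteq> ?W (q t)} t)"
      using q_pts Ico_dm lab_id[OF K(1)] by (intro nn_integral_cong) (auto simp: space_mu split: split_indicator)
    also note \<phi>
    finally show ?thesis using \<delta> by (simp add: emeasure_eq_measure)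
  qed
  define suc where "suc = (\<lambda>a. (\<lambda>x. lab K ((f ^^ n) x)) ` {x\<in>space \<mu>. lab K x = a})"
  have main: "ent_rate Y * real n \<le> expectation (\<lambda>x. ln (real (card (suc (lab K x))))) - ln (1 - 1/2) + \<delta> * ln (real (card (?W ` space \<mu>)) / (1/2))"
    unfolding suc_def by (rule ruelle[OF Y lab n _ _ mis]) auto
  have "\<delta> * ln (real (card (?W ` space \<mu>)) / (1/2)) \<le> \<delta> * \<bar>ln (real (card (?W ` space \<mu>)) / (1/2))\<bar>" using \<delta> by (intro mult_left_mono) auto
  also have "... \<le> 1" unfolding \<delta>_def by (simp add: field_simps)
  finally have d1: "\<delta> * ln (real (card (?W ` space \<mu>)) / (1/2)) \<le> 1" .
  have finsuc: "finite (suc a)" for a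
  proof -
    have "suc a \<subseteq> lab K ` space \<mu>" unfolding suc_def using T_iter_space by auto
    then show ?thesis using simple_functionD(1)[OF lab] finite_subset by blast
  qed
  have ge1: "real (card (suc (lab K x))) \<ge> 1" if "x \<in> pts" for x
  proof -
    have "suc (lab K x) \<noteq> {}" unfolding suc_def using that by (auto simp: space_mu)
    then have "card (suc (lab K x)) > 0" using finsuc by (simp add: card_gt_0_iff)
    then show ?thesis by linarith
  qed
  have "ennreal (expectation (\<lambda>x. ln (real (card (suc (lab K x)))))) = LI (\<lambda>t. ennreal (dens t) * ennreal (ln (real (card (suc (lab K (q t)))))))"
    using ge1 by (intro exp_dens expectation_simple(1)[OF lab]) auto
  also have "... \<le> LI (\<lambda>t. ennreal (dens t) * ennreal (ln 7 + logp I f n (q t)))"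
  proof (rule nn_integral_mono)
    fix t
    show "ennreal (dens t) * ennreal (ln (real (card (suc (lab K (q t)))))) * indicator {0..<L} t \<le> ennreal (dens t) * ennreal (ln 7 + logp I f n (q t)) * indicator {0..<L} t"
    proof (cases "t \<in> {0..<L}")
      case True
      have "real (card (suc (lab K (q t)))) \<le> 7 * max 1 (jac I f n (q t))"
        unfolding suc_def space_mu
      proof (rule card_suc_le[OF K(1) True])
        show "\<bar>fit f n 1 s\<bar> \<le> \<bar>fit f n 1 t\<bar> + 1" if "s \<in> {0..L}" "\<bar>s - t\<bar> \<le> L / real K" for s
          using d(2)[of s t] that True Kd by (simp add: dist_real_def)
      qed
      then have "ln (real (card (suc (lab K (q t))))) \<le> ln (7 * max 1 (jac I f n (q t)))" using ge1[OF q_pts] True Ico_dm by (intro ln_mono) force+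
      also have "... = ln 7 + logp I f n (q t)" unfolding logp_def by (intro ln_mult_pos) auto
      finally show ?thesis using True by (auto intro!: mult_left_mono ennreal_leI)
    qed simp
  qed
  also have "... = ennreal (expectation (\<lambda>x. ln 7 + logp I f n x))"
    using logp_int by (intro exp_dens[symmetric]) (auto intro!: add_nonneg_nonneg logp_nonneg)
  also have "expectation (\<lambda>x. ln 7 + logp I f n x) = ln 7 + expectation (logp I f n)"
    using logp_int by (simp add: prob_space)
  finally have "expectation (\<lambda>x. ln (real (card (suc (lab K x))))) \<le> ln 7 + expectation (logp I f n)"
    by (subst (asm) ennreal_le_iff) (auto intro!: add_nonneg_nonneg Bochner_Integration.integral_nonneg logp_nonneg)
  moreover have "- ln (1 - 1/2) = ln (2::real)" using ln_div[of 1 2] by simp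
  ultimately show ?thesis using main d1 by linarith
qed

lemma entropy_le:
  assumes h: "metric_entropy \<mu> f \<ge> ereal h" and n: "n > 0"
  shows "h * real n \<le> expectation (logp I f n) + (ln 7 + ln 2 + 1)"
proof -
  have "metric_entropy \<mu> f \<le> ereal ((expectation (logp I f n) + (ln 7 + ln 2 + 1)) / real n)"
    unfolding metric_entropy_eq
  proof (rule SUP_least)
    fix P assume "P \<in> {P. measurable_partition \<mu> P}"
    then show "ereal (ent_rate (cell P)) \<le> ereal ((expectation (logp I f n) + (ln 7 + ln 2 + 1)) / real n)"
      using ent_rate_le[OF simple_cell n] n by (simp add: pos_le_divide_eq)
  qed
  then have "ereal h \<le> ereal ((expectation (logp I f n) + (ln 7 + ln 2 + 1)) / real n)" using h by (rule order.trans[rotated])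
  then show ?thesis using n by (simp add: pos_le_divide_eq)
qed

end


section \<open>The averaged bound for an absolutely continuous measure\<close>

lemma nn_integral_diff_le:
  fixes a b \<phi> :: "real \<Rightarrow> real"
  assumes a: "a \<in> borel_measurable borel" and b: "b \<in> borel_measurable borel" "\<And>t. b t \<ge> 0" and X: "X \<in> sets borel"
    and \<phi>: "\<phi> \<in> borel_measurable (restrict_space borel X)" "\<And>t. t \<in> X \<Longrightarrow> 0 \<le> \<phi> t \<and> \<phi> t \<le> c" and c: "c \<ge> 0"
    and d: "(\<integral>\<^sup>+t\<in>X. ennreal \<bar>a t - b t\<bar> \<partial>lborel) \<le> ennreal \<eta>"
  shows "(\<integral>\<^sup>+t\<in>X. ennreal (a t) * ennreal (\<phi> t) \<partial>lborel) \<le> (\<integral>\<^sup>+t\<in>X. ennreal (b t) * ennreal (\<phi> t) \<partial>lborel) + ennreal (c * \<eta>)"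
proof -
  have [measurable]: "(\<lambda>t. ennreal (\<phi> t) * indicator X t) \<in> borel_measurable borel"
    using borel_restrict_indicator[OF \<phi>(1) X] by simp
  note [measurable] = a b(1) X
  have "(\<integral>\<^sup>+t\<in>X. ennreal (a t) * ennreal (\<phi> t) \<partial>lborel)
     \<le> (\<integral>\<^sup>+t. ennreal (b t) * (ennreal (\<phi> t) * indicator X t) + ennreal c * (ennreal \<bar>a t - b t\<bar> * indicator X t) \<partial>lborel)"
  proof (rule nn_integral_mono)
    fix t
    show "ennreal (a t) * ennreal (\<phi> t) * indicator X t \<le> ennreal (b t) * (ennreal (\<phi> t) * indicator X t) + ennreal c * (ennreal \<bar>a t - b t\<bar> * indicator X t)"
    proof (cases "t \<in> X")
      case True
      have "a t * \<phi> t \<le> (b t + \<bar>a t - b t\<bar>) * \<phi> t" using \<phi>(2)[OF True] by (intro mult_right_mono) auto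
      also have "... \<le> b t * \<phi> t + c * \<bar>a t - b t\<bar>"
        using mult_right_mono[of "\<phi> t" c "\<bar>a t - b t\<bar>"] \<phi>(2)[OF True] by (simp add: algebra_simps)
      finally have "ennreal (a t * \<phi> t) \<le> ennreal (b t * \<phi> t + c * \<bar>a t - b t\<bar>)" by (rule ennreal_leI)
      then show ?thesis using True \<phi>(2)[OF True] b(2) c by (simp add: ennreal_mult'' ennreal_mult)
    qed simp
  qed
  also have "... = (\<integral>\<^sup>+t. ennreal (b t) * (ennreal (\<phi> t) * indicator X t) \<partial>lborel) + ennreal c * (\<integral>\<^sup>+t\<in>X. ennreal \<bar>a t - b t\<bar> \<partial>lborel)"
    by (subst nn_integral_add) (auto simp: nn_integral_cmult)
  also have "... \<le> (\<integral>\<^sup>+t. ennreal (b t) * (ennreal (\<phi> t) * indicator X t) \<partial>lborel) + ennreal c * ennreal \<eta>"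
    using d by (intro add_left_mono mult_left_mono) auto
  finally show ?thesis using c by (simp add: ennreal_mult' mult.assoc)
qed

lemma linear_growth_le:
  fixes a b c :: real
  assumes "\<And>N::nat. N > 0 \<Longrightarrow> a * real N \<le> b * real N + c"
  shows "a \<le> b"
proof (rule ccontr)
  assume "\<not> a \<le> b"
  then have d: "a - b > 0" by simp
  obtain N :: nat where N: "real N > \<bar>c\<bar> / (a - b)" using reals_Archimedean2 by blast
  then have "real N * (a - b) > \<bar>c\<bar>" using d by (simp add: field_simps)
  moreover have "0 < real N" using N divide_nonneg_pos[of "\<bar>c\<bar>" "a - b"] d by linarith
  then have "N > 0" by simp
  ultimately show False using assms[of N] by (simp add: algebra_simps)
qed

lemma ln_mult_exp_powr:
  assumes "k > 0" "\<tau> > 0" "c > 0"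
  shows "ln (k * (c * exp s) powr \<tau>) = ln (k * c powr \<tau>) + \<tau> * (s::real)"
proof -
  have "k * (c * exp s) powr \<tau> = (k * c powr \<tau>) * exp (\<tau> * s)"
    using assms by (simp add: powr_mult exp_powr_real mult.commute)
  then show ?thesis using assms by (simp add: ln_mult)
qed

context ac_system begin

text \<open>\<open>averaged\<close> starts from a density that is constant on short intervals, so it
  is applied to a step function close to the density in mean. Ruelle's inequality for f^(p N) bounds
  the entropy from above, and invariance turns the sum along orbits into N equal integrals. Division
  by N removes the additive constants, including the one from the initial partition; then the
  approximation is refined.\<close>

lemma averaged_entropy:
  assumes im: "iter_map dm (fit f p) n E eps" and epsL: "2 * eps \<le> L" and h: "metric_entropy \<mu> f \<ge> ereal h" and p: "p > 0"
    and \<kappa>: "continuous_on pts \<kappa>" "\<And>x. x \<in> pts \<Longrightarrow> 0 \<le> \<kappa> x \<and> \<kappa> x \<le> 1"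
  shows "h * real p \<le> ln (4 * (C1 n * (2 * cc n * E) powr (2 / real n)) + 6)
     + ln E * (12 * E / eps * integral {0..L} (\<lambda>t. \<kappa> (q t))) + expectation (\<lambda>x. (1 - \<kappa> x) * logp I f p x)"
proof -
  let ?u = "\<lambda>t. \<kappa> (q t)" and ?Iu = "integral {0..L} (\<lambda>t. \<kappa> (q t))"
  interpret im: iter_map dm "fit f p" n E eps by (rule im)
  have uc: "continuous_on dm ?u" by (rule continuous_on_compose2[OF \<kappa>(1) q_cont]) (use q_pts in auto)
  interpret pm: pushed_map dm "fit f p" n E eps ?u ?Iu
  proof
    show "continuous_on dm ?u" by (rule uc)
    show "0 \<le> \<kappa> (q x)" if "x \<in> dm" for x using \<kappa>(2) q_pts[OF that] by blast
    show "0 \<le> ?Iu" using \<kappa>(2) q_pts S(3) by (intro Henstock_Kurzweil_Integration.integral_nonneg integrable_continuous_real continuous_on_subset[OF uc]) auto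
    show "integral {lo..hi} ?u \<le> ?Iu" if "lo \<le> hi" "{lo..hi} \<subseteq> dm" "hi - lo \<le> 2 * eps" for lo hi
      using that epsL \<kappa> by (intro period) auto
  qed
  define c0 where "c0 = ln pm.\<theta> + ln E * pm.Cu"
  have c0: "c0 = ln (4 * (C1 n * (2 * cc n * E) powr (2 / real n)) + 6) + ln E * (12 * E / eps * ?Iu)"
    by (simp add: c0_def pm.\<theta>_def im.\<theta>1_def pm.Cu_def)
  have E: "E \<ge> 1" "ln E \<ge> 0" using im.E by auto
  have c0_nn: "c0 \<ge> 0" unfolding c0_def using pm.\<theta>_ge1 pm.Cu E by (intro add_nonneg_nonneg mult_nonneg_nonneg) auto
  define \<Phi> where "\<Phi> = (\<lambda>N. logp I f (p * N))"
  define \<psi> where "\<psi> = (\<lambda>x. (1 - \<kappa> x) * logp I f p x)"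
  define \<Psi> where "\<Psi> = (\<lambda>N x. \<Sum>j<N. \<psi> ((f ^^ (p * j)) x))"
  have pc: "continuous_on pts \<psi>" unfolding \<psi>_def by (intro continuous_intros \<kappa>(1) logp_cont[OF f])
  have \<Phi>c: "continuous_on pts (\<Phi> N)" for N unfolding \<Phi>_def by (rule logp_cont[OF f])
  have \<Psi>c: "continuous_on pts (\<Psi> N)" for N unfolding \<Psi>_def
    by (intro continuous_on_sum continuous_on_compose2[OF pc fun_cont[OF f]]) (use fun_pts[OF f] in auto)
  have lp: "im.lp t = logp I f p (q t)" if "t \<in> dm" for t
    unfolding im.lp_def logp_def using fit_1[OF f that] by simp
  have lp_le: "logp I f p x \<le> ln E" if xp: "x \<in> pts" for x
  proof -
    obtain t where t: "t \<in> {0..L}" "x = q t" and td: "t \<in> dm" by (rule pts_obtain[OF xp])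
    show ?thesis using im.lp_bounds[OF td] lp[OF td] t(2) by simp
  qed
  have \<psi>b: "0 \<le> \<psi> x \<and> \<psi> x \<le> ln E" if "x \<in> pts" for x
    using \<kappa>(2)[OF that] lp_le[OF that] logp_nonneg[of I f p x] mult_left_le_one_le[of "logp I f p x" "1 - \<kappa> x"] by (auto simp: \<psi>_def)
  have \<Psi>b: "0 \<le> \<Psi> N x \<and> \<Psi> N x \<le> real N * ln E" if "x \<in> pts" for N x
    using \<psi>b[OF fun_pts[OF f that]] sum_mono[of "{..<N}" "\<lambda>j. \<psi> ((f ^^ (p * j)) x)" "\<lambda>_. ln E"] by (auto simp: \<Psi>_def intro!: sum_nonneg)
  have \<Phi>t: "ln (max 1 \<bar>im.it N 1 t\<bar>) = \<Phi> N (q t)" if "t \<in> dm" for N t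
    using it_fit(2)[OF f im that] by (simp add: \<Phi>_def logp_def)
  have \<Phi>b: "0 \<le> \<Phi> N (q t) \<and> \<Phi> N (q t) \<le> real N * ln E" if "t \<in> dm" for N t
  proof -
    have "ln (max 1 \<bar>im.it N 1 t\<bar>) \<le> ln (E ^ N)" using im.it_1_le[OF that, of N] E by (intro ln_mono) auto
    then show ?thesis using E by (simp add: \<Phi>t[OF that, symmetric] ln_realpow)
  qed
  have \<Psi>t: "(\<Sum>j<N. (1 - ?u (im.it j 0 t)) * im.lp (im.it j 0 t)) = \<Psi> N (q t)" if "t \<in> dm" for N t
    unfolding \<Psi>_def \<psi>_def using it_fit(1)[OF f im that] lp[OF im.it_S[OF that]] by simp
  \<comment> \<open>Both exchanges of the density for \<open>r\<close> cost at most N ln E times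
    \<eta>, as the integrands are at most N ln E. This is linear in N, but with a factor \<eta> that
    is sent to 0 at the end.\<close>
  have main: "h * real p * real N \<le> (c0 * (1 + \<eta>) + expectation \<psi> + 2 * \<eta> * ln E) * real N + (W + (ln 7 + ln 2 + 1))"
    if \<eta>: "\<eta> > 0" and N: "N > 0" and W: "W \<ge> 0"
      and r: "r \<in> borel_measurable borel" "\<And>t. 0 \<le> r t" "LI (\<lambda>t. ennreal \<bar>dens t - r t\<bar>) \<le> ennreal \<eta>"
      and av: "LI (\<lambda>t. ennreal (r t) * ennreal (ln (max 1 \<bar>im.it N 1 t\<bar>)))
    \<le> ennreal (real N * c0) * LI (\<lambda>t. ennreal (r t)) + ennreal W
      + LI (\<lambda>t. ennreal (r t) * ennreal (\<Sum>j<N. (1 - ?u (im.it j 0 t)) * im.lp (im.it j 0 t)))" for \<eta> N W r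
  proof -
    note Xb = atLeastLessThan_borel[of 0 L]
    have r': "LI (\<lambda>t. ennreal \<bar>r t - dens t\<bar>) \<le> ennreal \<eta>" using r(3) by (simp add: abs_minus_commute)
    have m1: "LI (\<lambda>t. ennreal (r t)) \<le> ennreal (1 + \<eta>)"
      using nn_integral_diff_le[OF r(1) dens_meas dens_nonneg Xb, of "\<lambda>_. 1" 1 \<eta>] r' dens_mass \<eta> by simp
    have qm: "(\<lambda>t. \<phi> (q t)) \<in> borel_measurable (restrict_space borel {0..<L})" if "continuous_on pts \<phi>" for \<phi> :: "'a \<Rightarrow> real"
      by (rule q_meas[OF cont_meas[OF that]])
    have e\<psi>: "expectation \<psi> \<ge> 0" using \<psi>b by (intro Bochner_Integration.integral_nonneg_AE) (auto simp: space_mu)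
    have "ennreal (expectation (\<Phi> N)) = LI (\<lambda>t. ennreal (dens t) * ennreal (\<Phi> N (q t)))"
      by (rule exp_dens[OF cont_int[OF \<Phi>c]]) (simp add: \<Phi>_def logp_nonneg)
    also have "... \<le> LI (\<lambda>t. ennreal (r t) * ennreal (\<Phi> N (q t))) + ennreal (real N * ln E * \<eta>)"
      by (rule nn_integral_diff_le[OF dens_meas r(1,2) Xb qm[OF \<Phi>c] _ _ r(3)]) (use \<Phi>b Ico_dm E in auto)
    also have "LI (\<lambda>t. ennreal (r t) * ennreal (\<Phi> N (q t))) = LI (\<lambda>t. ennreal (r t) * ennreal (ln (max 1 \<bar>im.it N 1 t\<bar>)))"
      using \<Phi>t Ico_dm by (intro nn_integral_cong) (auto split: split_indicator)
    also note av
    also have "LI (\<lambda>t. ennreal (r t) * ennreal (\<Sum>j<N. (1 - ?u (im.it j 0 t)) * im.lp (im.it j 0 t)))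
       = LI (\<lambda>t. ennreal (r t) * ennreal (\<Psi> N (q t)))"
      using \<Psi>t Ico_dm by (intro nn_integral_cong) (auto split: split_indicator)
    also have "... \<le> LI (\<lambda>t. ennreal (dens t) * ennreal (\<Psi> N (q t))) + ennreal (real N * ln E * \<eta>)"
      by (rule nn_integral_diff_le[OF r(1) dens_meas dens_nonneg Xb qm[OF \<Psi>c] _ _ r']) (use \<Psi>b q_pts Ico_dm E in auto)
    also have "LI (\<lambda>t. ennreal (dens t) * ennreal (\<Psi> N (q t))) = ennreal (expectation (\<Psi> N))"
      using \<Psi>b by (intro exp_dens[symmetric] cont_int \<Psi>c) auto
    also have "expectation (\<Psi> N) = real N * expectation \<psi>"
    proof -
      have \<psi>m: "\<psi> \<in> borel_measurable \<mu>" using cont_meas[OF pc] by (simp add: meas_mu)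
      have "integrable \<mu> (\<lambda>x. \<psi> ((f ^^ i) x))" for i
        by (intro cont_int continuous_on_compose2[OF pc fun_cont[OF f]]) (use fun_pts[OF f] in auto)
      then show ?thesis unfolding \<Psi>_def using expectation_iter[OF \<psi>m] by simp
    qed
    finally have "ennreal (expectation (\<Phi> N)) \<le> ennreal (real N * c0) * LI (\<lambda>t. ennreal (r t)) + ennreal W
       + (ennreal (real N * expectation \<psi>) + ennreal (real N * ln E * \<eta>)) + ennreal (real N * ln E * \<eta>)"
      by (auto intro: add_mono order.trans)
    also have "... \<le> ennreal (real N * c0) * ennreal (1 + \<eta>) + ennreal W + (ennreal (real N * expectation \<psi>) + ennreal (real N * ln E * \<eta>)) + ennreal (real N * ln E * \<eta>)"
      by (intro add_mono mult_left_mono m1) auto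
    also have "ennreal (real N * c0) * ennreal (1 + \<eta>) + ennreal W + (ennreal (real N * expectation \<psi>) + ennreal (real N * ln E * \<eta>)) + ennreal (real N * ln E * \<eta>)
      = ennreal (real N * c0 * (1 + \<eta>) + W + (real N * expectation \<psi> + real N * ln E * \<eta>) + real N * ln E * \<eta>)"
      using c0_nn \<eta> W e\<psi> E by (simp add: ennreal_plus[symmetric] ennreal_mult[symmetric] del: ennreal_plus)
    finally have "expectation (\<Phi> N) \<le> real N * c0 * (1 + \<eta>) + W + (real N * expectation \<psi> + real N * ln E * \<eta>) + real N * ln E * \<eta>"
      using c0_nn \<eta> W e\<psi> E by (subst (asm) ennreal_le_iff) auto
    moreover have "h * real (p * N) \<le> expectation (\<Phi> N) + (ln 7 + ln 2 + 1)"
      unfolding \<Phi>_def using p N by (intro entropy_le[OF h]) auto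
    ultimately show ?thesis by (simp add: algebra_simps)
  qed
  have step: "h * real p \<le> c0 * (1 + \<eta>) + expectation \<psi> + 2 * \<eta> * ln E" if \<eta>: "\<eta> > 0" for \<eta>
  proof -
    obtain K0 where K0: "K0 \<ge> 1" "\<And>K. K \<ge> K0 \<Longrightarrow> \<exists>r M. (\<forall>i. 0 \<le> r i \<and> r i \<le> (M::real)) \<and>
      LI (\<lambda>t. ennreal \<bar>dens t - r (fl K t)\<bar>) \<le> ennreal \<eta>"
      using step_approx[OF dens_int dens_nonneg L \<eta>] by blast
    define K where "K = max K0 (nat \<lceil>L / eps\<rceil> + 1)"
    have K: "K \<ge> 1" "K \<ge> K0" using K0(1) by (auto simp: K_def)
    have "L / eps < real K" unfolding K_def by linarith
    then have Keps: "L / real K \<le> eps" using im.eps K(1) by (simp add: field_simps)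
    obtain r M where r: "\<And>i. 0 \<le> r i \<and> r i \<le> (M::real)" "LI (\<lambda>t. ennreal \<bar>dens t - r (fl K t)\<bar>) \<le> ennreal \<eta>"
      using K0(2)[OF K(2)] by blast
    define cl where "cl = (\<lambda>i::nat. (real i * L / real K, L / real K))"
    define T0 where "T0 = cl ` {..<K}"
    define \<rho> where "\<rho> = (\<lambda>t. r (fl K t))"
    have cl: "x \<in> ivl (cl i) \<longleftrightarrow> (fl K x) = int i" for x i
      using L K(1) by (auto simp: cl_def ivl_def floor_eq_iff field_simps)
    have X0: "\<Union>(ivl ` T0) = {0..<L}"
    proof (intro set_eqI iffI)
      fix x assume "x \<in> \<Union>(ivl ` T0)"
      then obtain i where "i < K" "(fl K x) = int i" using cl by (auto simp: T0_def)
      then have "0 \<le> x * real K / L" "x * real K / L < real K" by linarith+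
      then show "x \<in> {0..<L}" using L K(1) by (auto simp: field_simps zero_le_mult_iff)
    next
      fix x assume x: "x \<in> {0..<L}"
      then have 0: "0 \<le> x * real K / L" "x * real K / L < real K" using L K(1) by (auto simp: field_simps)
      define i where "i = nat (fl K x)"
      have "(fl K x) = int i" "i < K" using 0 by (auto simp: i_def) linarith
      then show "x \<in> \<Union>(ivl ` T0)" using cl by (auto simp: T0_def)
    qed
    define W where "W = M * eps powr (1 - im.\<tau>) * (\<Sum>p\<in>T0. snd p * snd p powr (im.\<tau> - 1))"
    have M: "M \<ge> 0" using r(1)[of 0] by linarith
    have W: "W \<ge> 0" unfolding W_def using M L by (intro mult_nonneg_nonneg sum_nonneg) (auto simp: T0_def cl_def)
    have \<rho>m: "\<rho> \<in> borel_measurable borel" unfolding \<rho>_def by measurable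
    show ?thesis
    proof (rule linear_growth_le)
      fix N :: nat assume N: "N > 0"
      show "h * real p * real N \<le> (c0 * (1 + \<eta>) + expectation \<psi> + 2 * \<eta> * ln E) * real N + (W + (ln 7 + ln 2 + 1))"
      proof (rule main[OF \<eta> N W \<rho>m])
        show "0 \<le> \<rho> t" for t using r(1) by (simp add: \<rho>_def)
        show "LI (\<lambda>t. ennreal \<bar>dens t - \<rho> t\<bar>) \<le> ennreal \<eta>" using r(2) by (simp add: \<rho>_def)
        have fin: "finite T0" by (simp add: T0_def)
        have cells: "snd c > 0 \<and> snd c \<le> eps \<and> ivl c \<subseteq> dm" if c: "c \<in> T0" for c
        proof -
          have "ivl c \<subseteq> {0..<L}" using c X0 by blast
          then show ?thesis using c Keps L K(1) Ico_dm by (auto simp: T0_def cl_def)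
        qed
        have disj: "disjoint_family_on ivl T0"
          unfolding disjoint_family_on_def T0_def using cl by (auto simp: set_eq_iff)
        have const: "\<rho> x = \<rho> (fst c)" if "c \<in> T0" "x \<in> ivl c" for c x
        proof -
          have "fst c \<in> ivl c" using cells[OF that(1)] by (simp add: ivl_def)
          then show ?thesis using that cl by (auto simp: T0_def \<rho>_def)
        qed
        have vc: "continuous_on dm (\<lambda>y. (1 - ?u y) * im.lp y)"
        proof (intro continuous_on_mult continuous_on_diff continuous_on_const uc)
          show "continuous_on dm im.lp" unfolding im.lp_def
            by (intro continuous_intros dseq_continuous[OF fit_dseq[OF f]]) auto
        qed
        have vb: "0 \<le> (1 - ?u y) * im.lp y" "im.lp y \<le> ln E * ?u y + (1 - ?u y) * im.lp y" if "y \<in> dm" for y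
        proof -
          have u: "0 \<le> ?u y" "?u y \<le> 1" using \<kappa>(2) q_pts[OF that] by auto
          show "0 \<le> (1 - ?u y) * im.lp y" using u im.lp_bounds[OF that] by auto
          have "im.lp y * ?u y \<le> ln E * ?u y" using u im.lp_bounds[OF that] by (intro mult_right_mono) auto
          then show "im.lp y \<le> ln E * ?u y + (1 - ?u y) * im.lp y" by (simp add: algebra_simps)
        qed
        show "LI (\<lambda>t. ennreal (\<rho> t) * ennreal (ln (max 1 \<bar>im.it N 1 t\<bar>)))
          \<le> ennreal (real N * c0) * LI (\<lambda>t. ennreal (\<rho> t)) + ennreal W
           + LI (\<lambda>t. ennreal (\<rho> t) * ennreal (\<Sum>j<N. (1 - ?u (im.it j 0 t)) * im.lp (im.it j 0 t)))"
          using pm.averaged[OF fin cells disj \<rho>m _ const _ vc vb, of M N] r(1)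
          unfolding X0 pm.mass_def c0_def W_def \<rho>_def by blast
      qed
    qed
  qed
  have "h * real p \<le> c0 + expectation \<psi>"
  proof (rule field_le_epsilon)
    fix e :: real assume e: "e > 0"
    define \<eta> where "\<eta> = e / (c0 + 2 * ln E + 1)"
    have D: "c0 + 2 * ln E + 1 > 0" using c0_nn E(2) by linarith
    have \<eta>: "\<eta> > 0" using e D by (simp add: \<eta>_def)
    have "\<eta> * (c0 + 2 * ln E + 1) = e" unfolding \<eta>_def using D by simp
    then have "\<eta> * (c0 + 2 * ln E) \<le> e" using \<eta> by (simp add: algebra_simps)
    then show "h * real p \<le> c0 + expectation \<psi> + e" using step[OF \<eta>] by (simp add: algebra_simps)
  qed
  then show ?thesis unfolding c0 \<psi>_def .
qed

section \<open>The lower bound for the entropy\<close>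

lemma dens_tail: "\<eta> > 0 \<Longrightarrow> \<exists>M\<ge>0. LI (\<lambda>t. ennreal (dens t * indicator {t. dens t > M} t)) \<le> ennreal \<eta>"
proof -
  assume \<eta>: "\<eta> > 0"
  interpret line: finite_measure line by (rule line_finite)
  define A where "A = (\<lambda>k::nat. {t. dens t > real k})"
  have Ab: "A k \<in> sets borel" for k unfolding A_def by measurable
  have "(\<lambda>k. measure line (A k)) \<longlonglongrightarrow> measure line (\<Inter>k. A k)"
    using Ab by (intro line.finite_Lim_measure_decseq) (auto simp: line_sets A_def decseq_def)
  moreover have "(\<Inter>k. A k) = {}" unfolding A_def 
  proof (intro equals0I)
    fix t assume t: "t \<in> (\<Inter>k::nat. {t. dens t > real k})"
    obtain k :: nat where "dens t < real k" using reals_Archimedean2 by blast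
    moreover have "dens t > real k" using t by blast
    ultimately show False by simp
  qed
  ultimately have "\<forall>\<^sub>F k in sequentially. measure line (A k) < \<eta>" using \<eta> by (intro order_tendstoD) auto
  then obtain k where k: "measure line (A k) < \<eta>" by (auto dest: eventually_happens)
  have "LI (\<lambda>t. ennreal (dens t * indicator (A k) t)) = emeasure line (A k)"
    unfolding line_emeasure[OF Ab] by (intro nn_integral_cong) (auto split: split_indicator)
  also have "... \<le> ennreal \<eta>" using k by (simp add: line.emeasure_eq_measure ennreal_leI)
  finally show ?thesis unfolding A_def by (intro exI[of _ "real k"]) simp
qed

text \<open>An atom is a set of points with a common itinerary through the cells.
  \<open>local_volume\<close> bounds the integral of the derivative over an atom by 2
  \<open>eps\<close> T, with T = (2 \<theta>1)^m. Where the density is at most M, ln x \<le> x - 1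
  turns this into a bound for the mean of the logarithm on the atom by ln T - ln (probability);
  summing over atoms yields the entropy of the itinerary. The rest, of mass \<eta>, costs at most
  \<eta> m ln E.\<close>

lemma expectation_le_itin:
  assumes im: "iter_map dm (fit f p) n E eps" and p: "p > 0" and K: "K \<ge> 4" "L / real K \<le> eps / 2" and Eeps: "8 * E * eps \<le> L"
    and M: "M \<ge> 0" "\<eta> \<ge> 0" "LI (\<lambda>t. ennreal (dens t * indicator {t. dens t > M} t)) \<le> ennreal \<eta>"
  shows "expectation (logp I f (p * m)) \<le> ent (itin (lab K) (Suc m * p)) + real m * ln (2 * iter_map.\<theta>1 n E) + M * (L + 2 * eps) + \<eta> * (real m * ln E)"
proof -
  interpret im: iter_map dm "fit f p" n E eps by (rule im)
  define W where "W = itin (lab K) (Suc m * p)"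
  define X where "X = {0..<L}"
  define s where "s = (\<lambda>t. logp I f (p * m) (q t))"
  define c where "c = real m * ln E"
  define T where "T = (2 * im.\<theta>1) ^ m"
  have K1: "K \<ge> 1" using K by simp
  have Xb: "X \<in> sets borel" and Xdm: "X \<subseteq> dm" using Ico_dm by (auto simp: X_def)
  have E: "E \<ge> 1" "ln E \<ge> 0" using im.E by auto
  have c: "c \<ge> 0" using E by (simp add: c_def)
  have T: "T \<ge> 1" unfolding T_def using im.\<theta>1 by (intro one_le_power) simp
  have labs: "simple_function \<mu> (lab K)" by (rule simple_lab[OF K1])
  have Ws: "simple_function \<mu> W" unfolding W_def by (rule simple_itin[OF labs])
  have jt: "\<bar>im.it m 1 t\<bar> = jac I f (p * m) (q t)" if "t \<in> dm" for t by (rule it_fit(2)[OF f im that])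
  have s: "0 \<le> s t" "s t \<le> c" "exp (s t) \<le> 1 + \<bar>im.it m 1 t\<bar>" if "t \<in> dm" for t
  proof -
    show "0 \<le> s t" by (simp add: s_def logp_nonneg)
    have st: "s t = ln (max 1 \<bar>im.it m 1 t\<bar>)" unfolding s_def logp_def jt[OF that] ..
    also have "... \<le> ln (E ^ m)" using im.it_1_le[OF that, of m] E by (intro ln_mono) auto
    finally show "s t \<le> c" using E by (simp add: c_def ln_realpow)
    show "exp (s t) \<le> 1 + \<bar>im.it m 1 t\<bar>" unfolding st by (simp add: max_def)
  qed
  define A where "A = (\<lambda>w. {t\<in>X. W (q t) = w})"
  have Aw: "A w = {t\<in>{0..<L}. q t \<in> W -` {w} \<inter> space \<mu>}" for w
    using q_pts Xdm by (auto simp: A_def X_def space_mu)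
  have Wm: "W -` {w} \<inter> space \<mu> \<in> sets \<mu>" for w by (rule simple_functionD(2)[OF Ws])
  have Ab [measurable]: "A w \<in> sets borel" for w unfolding Aw by (rule q_vimage[OF Wm])
  have sm: "s \<in> borel_measurable (restrict_space borel X)"
    unfolding s_def X_def by (rule q_meas[OF cont_meas[OF logp_cont[OF f]]])
  have sX [measurable]: "(\<lambda>t. ennreal (s t) * indicator X t) \<in> borel_measurable borel"
    using borel_restrict_indicator[OF sm Xb] by simp
  have sA [measurable]: "(\<lambda>t. ennreal (s t) * indicator (A w) t) \<in> borel_measurable borel" for w
  proof -
    have "(\<lambda>t. ennreal (s t) * indicator (A w) t) = (\<lambda>t. (ennreal (s t) * indicator X t) * indicator (A w) t)"
      by (auto simp: fun_eq_iff A_def split: split_indicator)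
    then show ?thesis by simp
  qed
  have Adens: "(\<integral>\<^sup>+t\<in>A w. ennreal (dens t) \<partial>lborel) = ennreal (pr W w)" for w
  proof -
    have "(\<integral>\<^sup>+t\<in>A w. ennreal (dens t) \<partial>lborel) = emeasure line (A w)"
      unfolding line_emeasure[OF Ab] by (intro nn_integral_cong) (auto simp: A_def X_def split: split_indicator)
    also have "... = emeasure \<mu> (W -` {w} \<inter> space \<mu>)" unfolding Aw by (rule line_q[OF Wm])
    finally show ?thesis by (simp add: pr_def emeasure_eq_measure)
  qed
  have volume: "(\<integral>\<^sup>+t\<in>A w. ennreal \<bar>im.it m 1 t\<bar> \<partial>lborel) \<le> ennreal (2 * eps * T)" for w
  proof (cases "A w = {}")
    case False
    then obtain t0 where t0: "t0 \<in> A w" by blast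
    then have t0X: "t0 \<in> {0..<L}" "W (q t0) = w" by (auto simp: A_def X_def)
    \<comment> \<open>All parameters of the cell prescribed at time p j; on the circle this is the
      union of the lifts of that cell.\<close>
    define Q where "Q = (\<lambda>j. {y\<in>dm. lab K (q y) = w ! (j * p)})"
    define i where "i = (fl K t0)"
    have i: "0 \<le> i" "i < int K"
    proof -
      have "0 \<le> t0 * real K / L" "t0 * real K / L < real K" using t0X L K1 by (auto simp: field_simps)
      then show "0 \<le> i" "i < int K" unfolding i_def by linarith+
    qed
    \<comment> \<open>The itinerary has (m + 1) p entries and not m p, so that position m p
      exists.\<close>
    have nth: "W x ! (j * p) = lab K ((f ^^ (p * j)) x)" if "j \<le> m" for x j
    proof -
      have "j * p \<le> m * p" using that by (rule mult_le_mono1)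
      then have "j * p < Suc m * p" using p unfolding mult_Suc by linarith
      then show ?thesis by (simp add: W_def itin_def mult.commute)
    qed
    have Xj: "{t\<in>X. im.it j 0 t \<in> Q j} \<in> sets borel" for j
    proof -
      have "{t\<in>X. im.it j 0 t \<in> Q j} = {t\<in>{0..<L}. q t \<in> (\<lambda>x. lab K ((f ^^ (p * j)) x)) -` {w ! (j * p)} \<inter> space \<mu>}"
        using it_fit(1)[OF f im] im.it_S q_pts Xdm by (auto simp: Q_def X_def space_mu)
      then show ?thesis using q_vimage[OF simple_functionD(2)[OF simple_iter[OF labs]], of "p * j" "{w ! (j * p)}"] by (simp only:)
    qed
    have orb: "im.orbit_in Q m' X \<in> sets borel" for m'
    proof (induction m')
      case 0
      have "im.orbit_in Q 0 X = {t\<in>X. im.it 0 0 t \<in> Q 0}" by (auto simp: im.orbit_in_def)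
      then show ?case using Xj[of 0] by simp
    next
      case (Suc m')
      have "im.orbit_in Q (Suc m') X = im.orbit_in Q m' X \<inter> {t\<in>X. im.it (Suc m') 0 t \<in> Q (Suc m')}" by (auto simp: im.orbit_in_def le_Suc_eq simp del: im.it.simps)
      then show ?case using Suc Xj[of "Suc m'"] by (simp del: im.it.simps)
    qed
    have bound: "(\<integral>\<^sup>+t\<in>im.orbit_in Q m X. ennreal \<bar>im.it m 1 t\<bar> \<partial>lborel) \<le> ennreal (2 * eps * (2 * im.\<theta>1) ^ m)"
    proof (rule im.local_volume[where ?c0.0 = "of_int i * L / real K" and ?a0.0 = "L / real K", OF Xb Xdm _ orb])
      show "X \<subseteq> {0..<L}" by (simp add: X_def)
      show "X \<inter> Q 0 \<subseteq> {of_int i * L / real K..<of_int i * L / real K + L / real K}"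
      proof
        fix y assume y: "y \<in> X \<inter> Q 0"
        have "lab K (q y) = lab K (q t0)" using y nth[of 0 "q t0"] t0X(2) by (auto simp: Q_def)
        then have "(fl K y) = i" using lab_id[OF K1, of y] lab_id[OF K1 t0X(1)] y by (auto simp: X_def i_def)
        then show "y \<in> {of_int i * L / real K..<of_int i * L / real K + L / real K}" using L K1 by (auto simp: floor_eq_iff field_simps)
      qed
      have "of_int i * L / real K + L / real K \<le> L"
      proof -
        have "of_int i + 1 \<le> real K" using i(2) by linarith
        then have "(of_int i + 1) * (L / real K) \<le> real K * (L / real K)" using L by (intro mult_right_mono) auto
        then show ?thesis using K1 by (simp add: algebra_simps add_divide_distrib)
      qed
      moreover have "0 \<le> of_int i * L / real K" using i L by simp
      ultimately show "{of_int i * L / real K..<of_int i * L / real K + L / real K} \<subseteq> dm" using S(3) by auto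
      show "0 < L / real K" using L K1 by simp
      show "L / real K \<le> eps" using K(2) im.eps by linarith
      \<comment> \<open>Parameters with equal reduced labels lie in one cell unless their indices
        differ by at least K. Distance 2 E \<open>eps\<close> \<le> L / 4 and K \<ge> 4 exclude the
        latter.\<close>
      show "\<bar>x - y\<bar> \<le> eps / 2" if "x \<in> Q j" "y \<in> Q j" "\<bar>x - y\<bar> \<le> 2 * E * eps" for j x y
      proof -
        have e1: "\<bar>x * real K / L - y * real K / L\<bar> = \<bar>x - y\<bar> * (real K / L)"
          using L by (simp add: abs_mult diff_divide_distrib[symmetric] left_diff_distrib[symmetric])
        also have "... \<le> (L / 4) * (real K / L)" using that(3) Eeps L by (intro mult_right_mono) auto
        also have "... = real K / 4" using L by simp
        finally have "\<bar>(fl K x) - (fl K y)\<bar> < int K" using K(1) by linarith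
        moreover have "red K (fl K x) = red K (fl K y)" using that(1,2) lab_red[OF K1, of x] lab_red[OF K1, of y] by (simp add: Q_def)
        ultimately have "(fl K x) = (fl K y)" by (rule red_inj[rotated])
        then have "\<bar>x * real K / L - y * real K / L\<bar> \<le> 1" by linarith
        then have "\<bar>x - y\<bar> * (real K / L) \<le> 1" unfolding e1 .
        then have "\<bar>x - y\<bar> \<le> L / real K" using L K1 by (simp add: field_simps)
        then show ?thesis using K(2) by linarith
      qed
    qed
    have "A w \<subseteq> im.orbit_in Q m X"
    proof
      fix t assume t: "t \<in> A w"
      then have tX: "t \<in> X" "t \<in> dm" "W (q t) = w" using Xdm by (auto simp: A_def)
      have "im.it j 0 t \<in> Q j" if "j \<le> m" for j
        using it_fit(1)[OF f im tX(2), of j] im.it_S[OF tX(2)] nth[OF that, of "q t"] tX(3) by (simp add: Q_def)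
      then show "t \<in> im.orbit_in Q m X" using tX by (simp add: im.orbit_in_def)
    qed
    from order.trans[OF nn_set_integral_set_mono[OF this] bound] show ?thesis unfolding T_def .
  qed simp
  \<comment> \<open>The volume bound concerns Lebesgue measure, so the density is set to 0 where it
    exceeds M.\<close>
  define dl where "dl = (\<lambda>t. dens t * indicator {t. dens t \<le> M} t)"
  define B where "B = (\<lambda>w. pr W w * (ln T - ln (pr W w)) + pr W w / T * (M * (L + 2 * eps * T)))"
  have dl: "0 \<le> dl t" "dl t \<le> dens t" "dl t \<le> M" for t using dens_nonneg[of t] M by (auto simp: dl_def indicator_def)
  have dlm [measurable]: "dl \<in> borel_measurable borel" unfolding dl_def by measurable
  have B: "B w \<ge> 0" "(\<integral>\<^sup>+t\<in>A w. ennreal (dl t) * ennreal (s t) \<partial>lborel) \<le> ennreal (B w)" for w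
  proof -
    let ?v = "pr W w"
    have v: "0 \<le> ?v" "?v \<le> 1" by (rule pr_nonneg pr_le1)+
    have lnv: "0 \<le> ln T - ln ?v" if "?v > 0" using T v that by (smt (verit) ln_ge_zero ln_le_zero_iff)
    have LT: "0 \<le> L + 2 * eps * T" using L im.eps T by simp
    show "B w \<ge> 0" unfolding B_def using v lnv M LT T by (cases "?v = 0") (auto intro!: add_nonneg_nonneg mult_nonneg_nonneg)
    show "(\<integral>\<^sup>+t\<in>A w. ennreal (dl t) * ennreal (s t) \<partial>lborel) \<le> ennreal (B w)"
    proof (cases "?v = 0")
      case True
      have "(\<integral>\<^sup>+t\<in>A w. ennreal (dl t) * ennreal (s t) \<partial>lborel) \<le> (\<integral>\<^sup>+t. ennreal c * (ennreal (dens t) * indicator (A w) t) \<partial>lborel)"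
      proof (rule nn_integral_mono)
        fix t
        have "ennreal (dl t) * ennreal (s t) \<le> ennreal (dens t) * ennreal c" if "t \<in> A w"
          using that s(1,2)[of t] dl[of t] Xdm by (intro mult_mono ennreal_leI) (auto simp: A_def)
        then show "ennreal (dl t) * ennreal (s t) * indicator (A w) t \<le> ennreal c * (ennreal (dens t) * indicator (A w) t)"
          by (auto split: split_indicator simp: mult.commute)
      qed
      also have "... = 0" using Adens[of w] True by (simp add: nn_integral_cmult)
      finally show ?thesis by simp
    next
      case False
      then have vp: "?v > 0" using v by simp
      define k where "k = M * ?v / T"
      have k: "k \<ge> 0" unfolding k_def using M v T by simp
      have itA [measurable]: "(\<lambda>t. ennreal \<bar>im.it m 1 t\<bar> * indicator (A w) t) \<in> borel_measurable borel"
      proof -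
        have "A w \<subseteq> dm" using Xdm by (auto simp: A_def)
        then have "continuous_on (A w) (\<lambda>t. \<bar>im.it m 1 t\<bar>)"
          by (intro continuous_intros continuous_on_subset[OF dseq_continuous[OF im.it_dseq]])
        from borel_continuous_indicator[OF this Ab] show ?thesis by simp
      qed
      have "(\<integral>\<^sup>+t\<in>A w. ennreal (dl t) * ennreal (s t) \<partial>lborel)
        \<le> (\<integral>\<^sup>+t. ennreal (ln T - ln ?v) * (ennreal (dens t) * indicator (A w) t) + ennreal k * (indicator (A w) t + ennreal \<bar>im.it m 1 t\<bar> * indicator (A w) t) \<partial>lborel)"
      proof (rule nn_integral_mono)
        fix t
        show "ennreal (dl t) * ennreal (s t) * indicator (A w) t \<le> ennreal (ln T - ln ?v) * (ennreal (dens t) * indicator (A w) t) + ennreal k * (indicator (A w) t + ennreal \<bar>im.it m 1 t\<bar> * indicator (A w) t)"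
        proof (cases "t \<in> A w")
          case True
          then have t: "t \<in> dm" using Xdm by (auto simp: A_def)
          \<comment> \<open>Here ln x \<le> x - 1 does the work of Jensen's inequality:
            \<open>?v\<close> is the probability of the atom and T the scale of its volume
            growth.\<close>
          have "ln (exp (s t) * ?v / T) \<le> exp (s t) * ?v / T - 1" using vp T by (intro ln_le_minus_one) auto
          also have "ln (exp (s t) * ?v / T) = s t + ln ?v - ln T" using vp T by (simp add: ln_div ln_mult)
          finally have "s t \<le> (ln T - ln ?v) + exp (s t) * ?v / T" by linarith
          also have "exp (s t) * ?v / T \<le> (1 + \<bar>im.it m 1 t\<bar>) * (?v / T)" using s(3)[OF t] vp T mult_right_mono[of "exp (s t)" "1 + \<bar>im.it m 1 t\<bar>" "?v / T"] by simp
          finally have "dl t * s t \<le> dl t * ((ln T - ln ?v) + (1 + \<bar>im.it m 1 t\<bar>) * (?v / T))" using dl(1) by (intro mult_left_mono) auto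
          also have "... = (ln T - ln ?v) * dl t + dl t * (?v / T * (1 + \<bar>im.it m 1 t\<bar>))" by (simp add: algebra_simps)
          also have "... \<le> (ln T - ln ?v) * dens t + M * (?v / T * (1 + \<bar>im.it m 1 t\<bar>))"
            using dl[of t] lnv[OF vp] vp T by (intro add_mono mult_left_mono mult_right_mono) auto
          also have "... = (ln T - ln ?v) * dens t + k * (1 + \<bar>im.it m 1 t\<bar>)" by (simp add: k_def)
          finally have "ennreal (dl t * s t) \<le> ennreal ((ln T - ln ?v) * dens t + k * (1 + \<bar>im.it m 1 t\<bar>))" by (rule ennreal_leI)
          also have "... = ennreal (ln T - ln ?v) * ennreal (dens t) + ennreal k * (1 + ennreal \<bar>im.it m 1 t\<bar>)"
            using lnv[OF vp] dens_nonneg[of t] k by (simp add: ennreal_mult ennreal_plus)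
          finally show ?thesis using True dl(1) s(1)[OF t] by (simp add: ennreal_mult)
        qed simp
      qed
      also have "... = ennreal (ln T - ln ?v) * ennreal ?v + ennreal k * (emeasure lborel (A w) + (\<integral>\<^sup>+t\<in>A w. ennreal \<bar>im.it m 1 t\<bar> \<partial>lborel))"
        by (simp add: nn_integral_add nn_integral_cmult Adens del: One_nat_def)
      also have "... \<le> ennreal (ln T - ln ?v) * ennreal ?v + ennreal k * (ennreal L + ennreal (2 * eps * T))"
      proof (intro add_left_mono mult_left_mono add_mono volume)
        have "emeasure lborel (A w) \<le> emeasure lborel {0..<L}" by (intro emeasure_mono) (auto simp: A_def X_def)
        then show "emeasure lborel (A w) \<le> ennreal L" using L by simp
      qed auto
      also have "... = ennreal ((ln T - ln ?v) * ?v + k * (L + 2 * eps * T))"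
        using lnv[OF vp] v k L im.eps T by (simp add: ennreal_plus[symmetric] ennreal_mult[symmetric] del: ennreal_plus)
      also have "(ln T - ln ?v) * ?v + k * (L + 2 * eps * T) = B w" by (simp add: B_def k_def algebra_simps)
      finally show ?thesis .
    qed
  qed
  let ?R = "W ` space \<mu>"
  have fin: "finite ?R" by (rule simple_functionD(1)[OF Ws])
  have "(\<integral>\<^sup>+t\<in>X. ennreal (dl t) * ennreal (s t) \<partial>lborel) = (\<integral>\<^sup>+t. (\<Sum>w\<in>?R. ennreal (dl t) * (ennreal (s t) * indicator (A w) t)) \<partial>lborel)"
  proof (rule nn_integral_cong)
    fix t
    have "indicator X t = (\<Sum>w\<in>?R. indicator (A w) t :: ennreal)"
    proof (cases "t \<in> X")
      case True
      then have "W (q t) \<in> ?R" using q_pts Xdm by (auto simp: space_mu)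
      then have "(\<Sum>w\<in>?R. indicator (A w) t :: ennreal) = (\<Sum>w\<in>?R. if w = W (q t) then 1 else 0)"
        using True by (intro sum.cong) (auto simp: A_def indicator_def)
      then show ?thesis using fin True \<open>W (q t) \<in> ?R\<close> by simp
    qed (simp add: A_def)
    then show "ennreal (dl t) * ennreal (s t) * indicator X t = (\<Sum>w\<in>?R. ennreal (dl t) * (ennreal (s t) * indicator (A w) t))"
      by (simp add: sum_distrib_left mult.assoc)
  qed
  also have "... = (\<Sum>w\<in>?R. \<integral>\<^sup>+t\<in>A w. ennreal (dl t) * ennreal (s t) \<partial>lborel)"
    by (subst nn_integral_sum) (auto simp: mult.assoc)
  also have "... \<le> (\<Sum>w\<in>?R. ennreal (B w))" by (intro sum_mono B)
  also have "... = ennreal (\<Sum>w\<in>?R. B w)" using B(1) by (rule sum_ennreal)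
  finally have atoms: "(\<integral>\<^sup>+t\<in>X. ennreal (dl t) * ennreal (s t) \<partial>lborel) \<le> ennreal (\<Sum>w\<in>?R. B w)" .
  have "ennreal (expectation (logp I f (p * m))) = (\<integral>\<^sup>+t\<in>X. ennreal (dens t) * ennreal (s t) \<partial>lborel)"
    unfolding X_def s_def by (rule exp_dens[OF logp_int]) (simp add: logp_nonneg)
  also have "... \<le> (\<integral>\<^sup>+t\<in>X. ennreal (dl t) * ennreal (s t) \<partial>lborel) + ennreal (c * \<eta>)"
  proof (rule nn_integral_diff_le[OF dens_meas dlm dl(1) Xb sm _ c])
    have "(\<integral>\<^sup>+t\<in>X. ennreal \<bar>dens t - dl t\<bar> \<partial>lborel) = LI (\<lambda>t. ennreal (dens t * indicator {t. dens t > M} t))"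
      using dens_nonneg by (intro nn_integral_cong) (auto simp: X_def dl_def split: split_indicator)
    then show "(\<integral>\<^sup>+t\<in>X. ennreal \<bar>dens t - dl t\<bar> \<partial>lborel) \<le> ennreal \<eta>" using M(3) by simp
  qed (use s Xdm in auto)
  also have "... \<le> ennreal (\<Sum>w\<in>?R. B w) + ennreal (c * \<eta>)" by (intro add_right_mono atoms)
  also have "ennreal (\<Sum>w\<in>?R. B w) + ennreal (c * \<eta>) = ennreal ((\<Sum>w\<in>?R. B w) + c * \<eta>)" using B(1) c M by (simp add: sum_nonneg)
  finally have "expectation (logp I f (p * m)) \<le> (\<Sum>w\<in>?R. B w) + c * \<eta>"
    using B(1) c M by (subst (asm) ennreal_le_iff) (auto intro!: add_nonneg_nonneg sum_nonneg)
  also have "(\<Sum>w\<in>?R. B w) = ln T + ent W + 1 / T * (M * (L + 2 * eps * T))"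
  proof -
    have "(\<Sum>w\<in>?R. B w) = (\<Sum>w\<in>?R. pr W w) * (ln T + 1 / T * (M * (L + 2 * eps * T))) - (\<Sum>w\<in>?R. pr W w * ln (pr W w))"
      unfolding sum_distrib_right sum_subtractf[symmetric] B_def by (intro sum.cong) (auto simp: algebra_simps)
    then show ?thesis by (simp add: sum_pr[OF Ws] ent_def)
  qed
  also have "1 / T * (M * (L + 2 * eps * T)) \<le> M * (L + 2 * eps)"
  proof -
    have "1 / T * (M * (L + 2 * eps * T)) = M * (L / T + 2 * eps)" using T by (simp add: field_simps)
    also have "... \<le> M * (L + 2 * eps)" using T L M by (intro mult_left_mono add_right_mono) (auto simp: field_simps)
    finally show ?thesis .
  qed
  also have "ln T = real m * ln (2 * im.\<theta>1)" unfolding T_def using im.\<theta>1 by (intro ln_realpow)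
  finally show ?thesis by (simp add: W_def c_def algebra_simps)
qed

text \<open>The loss per unit of time has three parts, each made at most e / 3: n is chosen so that
  (2/n) \<Lambda> is small, then p so that D / p is small, and \<eta> so that \<eta> \<Lambda> is
  small. The remaining terms are bounded in m.\<close>

lemma entropy_ge_growth:
  assumes growth: "\<And>m. m \<ge> n0 \<Longrightarrow> expectation (logp I f m) \<ge> b * real m"
  shows "metric_entropy \<mu> f \<ge> ereal b"
proof (rule ereal_le_epsilon2)
  fix e :: real assume e: "e > 0"
  obtain B1 where B1: "B1 \<ge> 1" "dbd 1 B1 f" using deriv_bound[OF f] by blast
  define \<Lambda> where "\<Lambda> = ln B1"
  have \<Lambda>: "\<Lambda> \<ge> 0" using B1(1) by (simp add: \<Lambda>_def)
  have absb: "lbd \<Lambda> f"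
  proof
    fix x assume "x \<in> pts"
    then obtain t where t: "t \<in> {0..L}" "x = q t" and td: "t \<in> dm" by (rule pts_obtain)
    show "abs_deriv I f x \<le> exp \<Lambda>" using td absd[OF f, of t] B1 t(2) by (simp add: \<Lambda>_def)
  qed
  define n where "n = max 3 (nat \<lceil>6 * \<Lambda> / e\<rceil> + 1)"
  have n: "n \<ge> 3" by (simp add: n_def)
  have "6 * \<Lambda> / e \<le> real n" unfolding n_def by linarith
  then have n\<Lambda>: "2 / real n * \<Lambda> \<le> e / 3" using e n by (simp add: field_simps)
  define D where "D = ln (2 * C1 n * (2 * cc n) powr (2 / real n))"
  define p where "p = nat \<lceil>3 * \<bar>D\<bar> / e\<rceil> + 1"
  have p: "p > 0" by (simp add: p_def)
  have "3 * \<bar>D\<bar> / e \<le> real p" unfolding p_def by linarith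
  then have pD: "D \<le> real p * (e / 3)" using e by (simp add: field_simps)
  define \<eta> where "\<eta> = e / (3 * (\<Lambda> + 1))"
  have \<eta>: "\<eta> > 0" "\<eta> * \<Lambda> \<le> e / 3" using e \<Lambda> by (auto simp: \<eta>_def field_simps)
  obtain B where B: "B \<ge> 1" "dbd (Suc n) B f" using deriv_bound[OF f] by blast
  obtain eps0 where eps0: "eps0 > 0" "\<And>eps. 0 < eps \<Longrightarrow> eps \<le> eps0 \<Longrightarrow> iter_map dm (fit f p) n (exp (real p * \<Lambda>)) eps"
    using iter_map_fit[OF B(1) \<Lambda> n, of p] f B(2) absb by blast
  define E where "E = exp (real p * \<Lambda>)"
  have E: "E > 0" by (simp add: E_def)
  define eps where "eps = min eps0 (L / (8 * E))"
  have eps: "0 < eps" "eps \<le> eps0" "8 * E * eps \<le> L"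
  proof -
    show "0 < eps" "eps \<le> eps0" using eps0(1) L E by (auto simp: eps_def)
    have "8 * E * eps \<le> 8 * E * (L / (8 * E))" using E by (intro mult_left_mono) (auto simp: eps_def)
    then show "8 * E * eps \<le> L" using E by simp
  qed
  have im: "iter_map dm (fit f p) n E eps" unfolding E_def using eps0(2) eps by blast
  interpret im: iter_map dm "fit f p" n E eps by (rule im)
  define K where "K = max 4 (nat \<lceil>2 * L / eps\<rceil> + 1)"
  have K: "K \<ge> 4" by (simp add: K_def)
  have "2 * L / eps \<le> real K" unfolding K_def by linarith
  then have Keps: "L / real K \<le> eps / 2" using eps(1) K by (simp add: field_simps)
  obtain M where M: "M \<ge> 0" "LI (\<lambda>t. ennreal (dens t * indicator {t. dens t > M} t)) \<le> ennreal \<eta>"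
    using dens_tail[OF \<eta>(1)] by blast
  define W where "W = M * (L + 2 * eps)"
  have \<theta>: "ln (2 * im.\<theta>1) \<le> real p * (2 * e / 3)"
  proof -
    have "2 * im.\<theta>1 = 2 * C1 n * (2 * cc n * exp (real p * \<Lambda>)) powr (2 / real n)" unfolding im.\<theta>1_def by (simp add: E_def)
    then have "ln (2 * im.\<theta>1) = D + 2 / real n * (real p * \<Lambda>)"
      unfolding D_def using im.C1_ge1 cc_ge1[of n] n by (subst ln_mult_exp_powr[symmetric]) auto
    also have "... = D + real p * (2 / real n * \<Lambda>)" by simp
    also have "... \<le> real p * (e / 3) + real p * (e / 3)" using pD n\<Lambda> by (intro add_mono mult_left_mono) auto
    finally show ?thesis by (simp add: mult_ac)
  qed
  have "metric_entropy \<mu> f \<ge> ereal (b - e)"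
  proof (rule metric_entropy_ge[OF simple_lab _ p])
    fix k assume "Suc n0 \<le> k"
    then obtain m where m: "k = Suc m" "n0 \<le> m" by (cases k) auto
    have "n0 \<le> p * m" using m(2) p by (cases p) (auto intro: trans_le_add1)
    then have "b * real (p * m) \<le> expectation (logp I f (p * m))" by (rule growth)
    also have "... \<le> ent (itin (lab K) (Suc m * p)) + real m * ln (2 * im.\<theta>1) + W + \<eta> * (real m * ln E)"
      unfolding W_def using \<eta> by (intro expectation_le_itin[OF im p K Keps eps(3) M(1) _ M(2)]) auto
    also have "... \<le> ent (itin (lab K) (Suc m * p)) + real m * (real p * (2 * e / 3)) + W + real m * (real p * (e / 3))"
    proof -
      have "\<eta> * (real m * ln E) = real m * (real p * (\<eta> * \<Lambda>))" by (simp add: E_def)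
      also have "... \<le> real m * (real p * (e / 3))" using \<eta>(2) by (intro mult_left_mono) auto
      finally show ?thesis using \<theta> by (intro add_mono mult_left_mono order.refl) auto
    qed
    finally have "(b - e) * (real m * real p) \<le> ent (itin (lab K) (Suc m * p)) + W" by (simp add: algebra_simps)
    \<comment> \<open>The itinerary is one block of length p longer than the time p m of the growth
      bound; that block is charged to the additive constant.\<close>
    moreover have "(b - e) * real p \<le> \<bar>b - e\<bar> * real p" by (intro mult_right_mono) auto
    ultimately show "(b - e) * real (k * p) - (\<bar>b - e\<bar> * real p + W) \<le> ent (itin (lab K) (k * p))"
      by (simp add: m algebra_simps)
  qed (use K in simp)
  then have "ereal (b - e) + ereal e \<le> metric_entropy \<mu> f + ereal e" by (rule add_right_mono)
  then show "ereal b \<le> metric_entropy \<mu> f + ereal e" by simp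
qed

end


section \<open>Limits of measures\<close>

lemma infdist_approx:
  assumes C: "closed C" "C \<noteq> {}"
  shows "(\<lambda>k. max 0 (1 - real k * infdist x C)) \<longlonglongrightarrow> indicator C x"
proof (cases "x \<in> C")
  case False
  have d: "infdist x C > 0" using False C by (metis in_closed_iff_infdist_zero infdist_nonneg less_eq_real_def)
  have "filterlim (\<lambda>k. infdist x C * real k) at_top sequentially"
    using d by (intro filterlim_tendsto_pos_mult_at_top[OF tendsto_const] filterlim_real_sequentially)
  then have "\<forall>\<^sub>F k in sequentially. 1 \<le> infdist x C * real k" unfolding filterlim_at_top by blast
  then have "\<forall>\<^sub>F k in sequentially. max 0 (1 - real k * infdist x C) = 0" by eventually_elim (simp add: mult.commute)
  then show ?thesis using False by (simp add: tendsto_eventually)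
qed simp

text \<open>Indicators of closed sets are limits of tent functions of the distance, and the closed
  sets are stable under intersection and generate the Borel sets.\<close>

lemma measure_eqI_continuous:
  fixes M N :: "'a::euclidean_space measure"
  assumes M: "prob_space M" "sets M = sets borel" and N: "prob_space N" "sets N = sets borel"
    and eq: "\<And>u. continuous_on UNIV u \<Longrightarrow> (\<And>x. 0 \<le> u x \<and> u x \<le> 1) \<Longrightarrow> (\<integral>x. u x \<partial>M) = (\<integral>x. (u x :: real) \<partial>N)"
  shows "M = N"
proof (rule measure_eqI_generator_eq[where E = "Collect closed" and \<Omega> = UNIV and A = "\<lambda>_. UNIV"])
  fix C :: "'a set" assume "C \<in> Collect closed"
  then have C: "closed C" by simp
  show "emeasure M C = emeasure N C"
  proof (cases "C = {}")
    case False
    define u where "u = (\<lambda>k x. max 0 (1 - real k * infdist x C))"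
    have ind: "(\<lambda>k. u k x) \<longlonglongrightarrow> indicator C x" for x unfolding u_def by (rule infdist_approx[OF C False])
    have uc: "continuous_on UNIV (u k)" for k unfolding u_def by (intro continuous_intros)
    have u01: "0 \<le> u k x \<and> u k x \<le> 1" for k x by (simp add: u_def infdist_nonneg)
    have lim: "(\<lambda>k. \<integral>x. u k x \<partial>Q) \<longlonglongrightarrow> measure Q C" if Q: "prob_space Q" "sets Q = sets borel" for Q
    proof -
      interpret prob_space Q by (rule Q)
      have um: "u k \<in> borel_measurable Q" for k using borel_measurable_continuous_onI[OF uc] Q(2) by (simp cong: measurable_cong_sets)
      have "(\<lambda>k. \<integral>x. u k x \<partial>Q) \<longlonglongrightarrow> (\<integral>x. indicator C x \<partial>Q)"
        using um u01 ind Q(2) C by (intro integral_dominated_convergence[where w = "\<lambda>_. 1"]) (auto intro!: borel_measurable_indicator)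
      then show ?thesis using Q(2) sets_eq_imp_space_eq[OF Q(2)] by simp
    qed
    have "measure M C = measure N C" using lim[OF M] lim[OF N] eq[OF uc u01] by (simp add: LIMSEQ_unique)
    then show ?thesis using M N by (simp add: prob_space_def finite_measure.emeasure_eq_measure)
  qed simp
next
  show "emeasure M UNIV \<noteq> \<infinity>" for i :: nat using M by (simp add: prob_space_def finite_measure.emeasure_finite)
qed (use M N in \<open>auto simp: Int_stable_def borel_eq_closed sets_measure_of\<close>)

lemma uniform_limit_compose_varying:
  assumes G: "uniform_limit B G g F" and g: "uniformly_continuous_on B g" and u: "uniform_limit A u v F"
    and B: "\<And>k x. x \<in> A \<Longrightarrow> u k x \<in> B" "\<And>x. x \<in> A \<Longrightarrow> v x \<in> B"
  shows "uniform_limit A (\<lambda>k x. G k (u k x)) (\<lambda>x. g (v x)) F"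
proof (rule uniform_limitI)
  fix e :: real assume e: "e > 0"
  obtain d where d: "d > 0" "\<And>x y. x \<in> B \<Longrightarrow> y \<in> B \<Longrightarrow> dist x y < d \<Longrightarrow> dist (g x) (g y) < e / 2"
    using g e unfolding uniformly_continuous_on_def by (metis half_gt_zero)
  show "\<forall>\<^sub>F k in F. \<forall>x\<in>A. dist (G k (u k x)) (g (v x)) < e"
    using uniform_limitD[OF u d(1)] uniform_limitD[OF G half_gt_zero[OF e]]
  proof eventually_elim
    case (elim k)
    show ?case
    proof
      fix x assume x: "x \<in> A"
      have "dist (g (u k x)) (g (v x)) < e / 2" using d(2) elim(1) x B by blast
      moreover have "dist (G k (u k x)) (g (u k x)) < e / 2" using elim(2) B(1) x by blast
      ultimately show "dist (G k (u k x)) (g (v x)) < e"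
        using dist_triangle_less_add[of "G k (u k x)" "g (u k x)" "e / 2" "g (v x)" "e / 2"] by (simp add: dist_commute)
    qed
  qed
qed

context one_dim_space begin

text \<open>Clamping to [0, L] makes the parametrisation a continuous map on the whole line, also
  for the interval. So weak convergence on the line passes to the space.\<close>

definition wrap :: "real \<Rightarrow> 'a" where "wrap t = q (max 0 (min L t))"

lemma wrap_pts: "wrap t \<in> pts"
proof -
  have "max 0 (min L t) \<in> {0..L}" using L by auto
  then show ?thesis unfolding wrap_def using q_pts S(3) by blast
qed

lemma wrap_cont: "continuous_on UNIV wrap"
  unfolding wrap_def
proof (rule continuous_on_compose2[OF continuous_on_subset[OF q_cont S(3)]])
  show "(\<lambda>t. max 0 (min L t)) ` UNIV \<subseteq> {0..L}" using L by auto
qed (intro continuous_intros)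

lemma wrap_meas: "wrap \<in> measurable borel (restrict_space borel pts)"
  using wrap_pts borel_measurable_continuous_onI[OF wrap_cont] by (intro measurable_restrict_space2) auto

end

context ac_system begin

lemma line_distr: "real_distribution line" "distr line (restrict_space borel pts) wrap = \<mu>"
proof -
  interpret line: finite_measure line by (rule line_finite)
  have "emeasure line (space line) = 1" using line_emeasure[of UNIV] dens_mass sets_eq_imp_space_eq[OF line_sets] by simp
  then show "real_distribution line"
    by (intro real_distribution.intro prob_spaceI real_distribution_axioms.intro) (auto simp: line_sets)
  show "distr line (restrict_space borel pts) wrap = \<mu>"
  proof (rule measure_eqI)
    fix A assume "A \<in> sets (distr line (restrict_space borel pts) wrap)"
    then have A: "A \<in> sets (restrict_space borel pts)" "A \<in> sets \<mu>" by (simp_all add: sets_mu)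
    have b: "wrap -` A \<in> sets borel" using measurable_sets[OF wrap_meas A(1)] by simp
    have w: "wrap \<in> measurable line (restrict_space borel pts)" using wrap_meas line_sets by (simp cong: measurable_cong_sets)
    have "emeasure (distr line (restrict_space borel pts) wrap) A = emeasure line (wrap -` A)"
      using emeasure_distr[OF w A(1)] sets_eq_imp_space_eq[OF line_sets] by simp
    also have "... = emeasure line {t\<in>{0..<L}. q t \<in> A}"
      unfolding line_emeasure[OF b] line_emeasure[OF q_vimage[OF A(2)]]
      by (intro nn_integral_cong) (auto simp: wrap_def split: split_indicator)
    also have "... = emeasure \<mu> A" by (rule line_q[OF A(2)])
    finally show "emeasure (distr line (restrict_space borel pts) wrap) A = emeasure \<mu> A" .
  qed (simp add: sets_mu)
qed

end

locale approx_system = one_dim_space I L red lab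
  for I :: "('a::euclidean_space) one_dim" and L red lab +
  fixes f :: "'a \<Rightarrow> 'a" and F :: "nat \<Rightarrow> 'a \<Rightarrow> 'a" and \<nu> :: "nat \<Rightarrow> 'a measure" and h :: real
  assumes f: "f \<in> smooth_maps I" and F: "\<And>k. F k \<in> smooth_nbhd I k (1 / real (Suc k)) f"
    and sys: "\<And>k. ac_system I L red lab (F k) (\<nu> k)" and h: "h > 0" "\<And>k. metric_entropy (\<nu> k) (F k) \<ge> ereal h"

text \<open>Helly's selection theorem on the parameter line: the transported measures all live on
  (-1, L], hence are tight. \<open>wrap\<close> carries the limit back to the space.\<close>

lemma (in approx_system) limit_measure:
  "\<exists>r \<mu>. strict_mono r \<and> prob_space \<mu> \<and> sets \<mu> = sets (restrict_space borel pts) \<and>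
     (\<forall>u::'a \<Rightarrow> real. continuous_on pts u \<longrightarrow> (\<lambda>k. \<integral>x. u x \<partial>\<nu> (r k)) \<longlonglongrightarrow> (\<integral>x. u x \<partial>\<mu>))"
proof -
  define ml where "ml = (\<lambda>k. ac_system.line I L (\<nu> k))"
  have ml: "real_distribution (ml k)" "distr (ml k) (restrict_space borel pts) wrap = \<nu> k" for k
    using ac_system.line_distr[OF sys[of k]] by (simp_all add: ml_def)
  have "measure (ml k) {-1<..L} = 1" for k
  proof -
    interpret s: ac_system I L red lab "F k" "\<nu> k" by (rule sys)
    have "emeasure s.line {-1<..L} = LI (\<lambda>t. ennreal (s.dens t))"
      by (subst s.line_emeasure) (auto intro!: nn_integral_cong split: split_indicator)
    then show ?thesis using s.dens_mass by (simp add: ml_def measure_def)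
  qed
  then have "tight ml" unfolding tight_def using ml(1) L
    by (intro conjI allI impI exI[of _ "-1::real"] exI[of _ L]) simp_all
  then obtain r M where r: "strict_mono (r :: nat \<Rightarrow> nat)" "real_distribution M" "weak_conv_m (ml \<circ> id \<circ> r) M"
    using tight_imp_convergent_subsubsequence[of ml id] by (auto simp: strict_mono_def)
  have r3: "weak_conv_m (\<lambda>k. ml (r k)) M" using r(3) by (simp add: comp_def)
  interpret M: real_distribution M by (rule r)
  define \<mu> where "\<mu> = distr M (restrict_space borel pts) wrap"
  have w: "wrap \<in> measurable Q (restrict_space borel pts)" if "sets Q = sets borel" for Q
    using wrap_meas that by (simp cong: measurable_cong_sets)
  have "(\<lambda>k. \<integral>x. u x \<partial>\<nu> (r k)) \<longlonglongrightarrow> (\<integral>x. u x \<partial>\<mu>)" if u: "continuous_on pts u" for u :: "'a \<Rightarrow> real"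
  proof -
    have uw: "continuous_on UNIV (\<lambda>t. u (wrap t))" by (rule continuous_on_compose2[OF u wrap_cont]) (use wrap_pts in auto)
    obtain B where B: "\<And>x. x \<in> pts \<Longrightarrow> norm (u x) \<le> B"
      using compact_imp_bounded[OF compact_continuous_image[OF u compact_pts]] by (auto simp: bounded_iff)
    have "(\<lambda>k. \<integral>t. u (wrap t) \<partial>ml (r k)) \<longlonglongrightarrow> (\<integral>t. u (wrap t) \<partial>M)"
      using uw B wrap_pts ml(1) r(2) r3
      by (intro weak_conv_imp_integral_bdd_continuous_conv[where B = B]) (auto simp: continuous_on_eq_continuous_at)
    moreover have "(\<integral>t. u (wrap t) \<partial>ml k) = (\<integral>x. u x \<partial>\<nu> k)" for k
      using integral_distr[OF w cont_meas[OF u], of "ml k"] ml[of k] by (simp add: real_distribution.events_eq_borel)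
    moreover have "(\<integral>t. u (wrap t) \<partial>M) = (\<integral>x. u x \<partial>\<mu>)"
      unfolding \<mu>_def using integral_distr[OF w cont_meas[OF u], of M] by simp
    ultimately show ?thesis by simp
  qed
  moreover have "prob_space \<mu>" unfolding \<mu>_def by (intro M.prob_space_distr w) simp
  ultimately show ?thesis using r(1) by (intro exI[of _ r] exI[of _ \<mu>]) (auto simp: \<mu>_def)
qed

section \<open>Properties of the limit measure\<close>

locale limit_system = approx_system I L red lab f F \<nu> h
  for I :: "('a::euclidean_space) one_dim" and L red lab f F \<nu> h +
  fixes \<mu> :: "'a measure"
  assumes prob_mu: "prob_space \<mu>" and sets_mu: "sets \<mu> = sets (restrict_space borel (points I))"
    and conv: "\<And>u::'a \<Rightarrow> real. continuous_on (points I) u \<Longrightarrow> (\<lambda>k. \<integral>x. u x \<partial>\<nu> k) \<longlonglongrightarrow> (\<integral>x. u x \<partial>\<mu>)"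

sublocale limit_system \<subseteq> prob_space \<mu> by (rule prob_mu)

context limit_system begin

lemma space_mu: "space \<mu> = pts" using sets_eq_imp_space_eq[OF sets_mu] by (simp add: space_restrict_space)

lemma meas_mu: "\<Phi> \<in> measurable (restrict_space borel pts) N \<longleftrightarrow> \<Phi> \<in> measurable \<mu> N"
  using measurable_cong_sets[OF sets_mu refl] by blast

lemma Fk: "F k \<in> smooth_maps I" "j \<le> k \<Longrightarrow> t \<in> dm \<Longrightarrow> dist (nth_deriv j I f t) (nth_deriv j I (F k) t) < 1 / real (Suc k)"
  using F[of k] by (auto simp: smooth_nbhd_def)

lemma uniform_limit_deriv:
  assumes "\<And>k t. t \<in> dm \<Longrightarrow> dist (G k (q t)) (g (q t)) \<le> dist (nth_deriv j I f t) (nth_deriv j I (F k) t)"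
  shows "uniform_limit pts G g sequentially"
proof (rule uniform_limitI)
  fix e :: real assume e: "e > 0"
  have "(\<lambda>k. 1 / real (Suc k)) \<longlonglongrightarrow> 0" using LIMSEQ_Suc[OF lim_1_over_n] by simp
  then have "\<forall>\<^sub>F k in sequentially. 1 / real (Suc k) < e" using e by (rule order_tendstoD)
  then show "\<forall>\<^sub>F k in sequentially. \<forall>x\<in>pts. dist (G k x) (g x) < e" using eventually_ge_at_top[of j]
  proof eventually_elim
    case (elim k)
    show ?case
    proof
      fix x assume "x \<in> pts"
      then obtain t where t: "t \<in> {0..L}" "x = q t" and td: "t \<in> dm" by (rule pts_obtain)
      show "dist (G k x) (g x) < e" using assms[OF td, of k] Fk(2)[OF elim(2) td] elim(1) t(2) by simp
    qed
  qed
qed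

lemma unif_abs_deriv: "uniform_limit pts (\<lambda>k. abs_deriv I (F k)) (abs_deriv I f) sequentially"
proof (rule uniform_limit_deriv)
  fix k t assume td: "t \<in> dm"
  show "dist (abs_deriv I (F k) (q t)) (abs_deriv I f (q t)) \<le> dist (nth_deriv 1 I f t) (nth_deriv 1 I (F k) t)"
    unfolding absd[OF Fk(1) td] absd[OF f td] by (metis dist_commute dist_norm dist_real_def norm_triangle_ineq3)
qed

lemma unif_F: "uniform_limit pts F f sequentially"
  by (rule uniform_limit_deriv[where j = 0]) (simp add: nth_deriv_0 dist_commute)

lemma unif_iter: "uniform_limit pts (\<lambda>k. F k ^^ i) (f ^^ i) sequentially"
proof (induction i)
  case (Suc i)
  have "continuous_on pts f" using fun_cont[OF f, of 1] by simp
  from uniform_limit_compose_varying[OF unif_F compact_uniformly_continuous[OF this compact_pts] Suc]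
  show ?case using fun_pts[OF f] fun_pts[OF Fk(1)] by simp
qed (simp add: uniform_limit_const)

lemma pts_bounded: "continuous_on pts (u :: 'a \<Rightarrow> real) \<Longrightarrow> bounded (u ` pts)"
  by (intro compact_imp_bounded compact_continuous_image compact_pts)

lemma unif_logp: "uniform_limit pts (\<lambda>k. logp I (F k) p) (logp I f p) sequentially"
proof -
  have step: "uniform_limit pts (\<lambda>k x. abs_deriv I (F k) ((F k ^^ i) x)) (\<lambda>x. abs_deriv I f ((f ^^ i) x)) sequentially" for i
    by (rule uniform_limit_compose_varying[OF unif_abs_deriv compact_uniformly_continuous[OF abs_deriv_cont[OF f] compact_pts] unif_iter])
      (use fun_pts[OF f] fun_pts[OF Fk(1)] in auto)
  have jc: "uniform_limit pts (\<lambda>k. jac I (F k) p) (jac I f p) sequentially"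
  proof (induction p)
    case (Suc p)
    have "bounded ((\<lambda>x. abs_deriv I f ((f ^^ p) x)) ` pts)"
      by (intro pts_bounded continuous_on_compose2[OF abs_deriv_cont[OF f] fun_cont[OF f]]) (use fun_pts[OF f] in auto)
    from uniform_lim_mult[OF Suc step[of p] pts_bounded[OF jac_cont[OF f]] this] show ?case by (simp add: jac_def)
  qed (simp add: jac_def uniform_limit_const)
  show ?thesis
  proof (rule uniform_limitI)
    fix e :: real assume "e > 0"
    from uniform_limitD[OF jc this] show "\<forall>\<^sub>F k in sequentially. \<forall>x\<in>pts. dist (logp I (F k) p x) (logp I f p x) < e"
    proof eventually_elim
      case (elim k)
      \<comment> \<open>The logarithm is 1-Lipschitz above 1, so the positive part passes to uniform
        limits even where the derivative vanishes.\<close>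
      have ln1: "\<bar>ln a - ln b\<bar> \<le> \<bar>a - b\<bar>" if "a \<ge> 1" "b \<ge> 1" for a b :: real
      proof -
        have *: "ln a - ln b \<le> a - b" if "1 \<le> b" "b \<le> a" for a b :: real
        proof -
          have "ln a - ln b = ln (a / b)" using that by (simp add: ln_div)
          also have "... \<le> a / b - 1" using that by (intro ln_le_minus_one) auto
          also have "... = (a - b) / b" using that by (simp add: field_simps)
          also have "... \<le> a - b" using that by (simp add: divide_le_eq mult_le_cancel_left1)
          finally show ?thesis .
        qed
        show ?thesis using *[of a b] *[of b a] that by (cases "a \<le> b") (auto simp: abs_if)
      qed
      show ?case
      proof
        fix x assume "x \<in> pts"
        then have "\<bar>jac I (F k) p x - jac I f p x\<bar> < e" using elim by (simp add: dist_real_def)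
        moreover have "\<bar>max 1 (jac I (F k) p x) - max 1 (jac I f p x)\<bar> \<le> \<bar>jac I (F k) p x - jac I f p x\<bar>" by linarith
        ultimately show "dist (logp I (F k) p x) (logp I f p x) < e"
          using ln1[of "max 1 (jac I (F k) p x)" "max 1 (jac I f p x)"] by (simp add: logp_def dist_real_def)
      qed
    qed
  qed
qed

lemma conv_uniform:
  fixes u :: "'a \<Rightarrow> real"
  assumes ul: "uniform_limit pts v u sequentially" and v: "\<And>k. continuous_on pts (v k)" and u: "continuous_on pts u"
  shows "(\<lambda>k. \<integral>x. v k x \<partial>\<nu> k) \<longlonglongrightarrow> (\<integral>x. u x \<partial>\<mu>)"
proof -
  have "(\<lambda>k. (\<integral>x. v k x \<partial>\<nu> k) - (\<integral>x. u x \<partial>\<nu> k)) \<longlonglongrightarrow> 0"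
  proof (rule tendstoI)
    fix e :: real assume e: "e > 0"
    from uniform_limitD[OF ul half_gt_zero[OF e]]
    show "\<forall>\<^sub>F k in sequentially. dist ((\<integral>x. v k x \<partial>\<nu> k) - (\<integral>x. u x \<partial>\<nu> k)) 0 < e"
    proof eventually_elim
      case (elim k)
      interpret s: ac_system I L red lab "F k" "\<nu> k" by (rule sys)
      have "\<bar>(\<integral>x. v k x \<partial>\<nu> k) - (\<integral>x. u x \<partial>\<nu> k)\<bar> = \<bar>\<integral>x. v k x - u x \<partial>\<nu> k\<bar>"
        using s.cont_int[OF v] s.cont_int[OF u] by simp
      also have "... \<le> (\<integral>x. \<bar>v k x - u x\<bar> \<partial>\<nu> k)" by (rule integral_abs_bound)
      also have "... \<le> (\<integral>x. e / 2 \<partial>\<nu> k)"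
        using elim s.cont_int[OF v] s.cont_int[OF u] by (intro integral_mono) (auto simp: s.space_mu dist_real_def less_imp_le)
      finally show ?case using e s.prob_space by (simp add: dist_real_def)
    qed
  qed
  from tendsto_add[OF this conv[OF u]] show ?thesis by simp
qed

lemma f_meas: "f \<in> measurable \<mu> \<mu>"
proof -
  have "f \<in> borel_measurable (restrict_space borel pts)" using fun_cont[OF f, of 1] cont_meas by simp
  then have "f \<in> measurable (restrict_space borel pts) (restrict_space borel pts)"
    using fun_pts[OF f, of _ 1] by (intro measurable_restrict_space2) (auto simp: space_restrict_space)
  then show ?thesis using sets_mu by (simp cong: measurable_cong_sets)
qed

text \<open>Measures are compared on the ambient Euclidean space, where
  \<open>measure_eqI_continuous\<close> applies, and the equality is then restricted. Since the maps
  converge uniformly, the test functions composed with them do as well.\<close>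

lemma mu_invariant: "distr \<mu> \<mu> f = \<mu>"
proof -
  have id: "(\<lambda>x. x) \<in> borel_measurable \<mu>" using cont_meas[of "\<lambda>x. x"] by (simp add: meas_mu)
  have fb: "f \<in> borel_measurable \<mu>" using fun_cont[OF f, of 1] cont_meas by (simp add: meas_mu)
  have "distr \<mu> borel f = distr \<mu> borel (\<lambda>x. x)"
  proof (rule measure_eqI_continuous)
    fix u :: "'a \<Rightarrow> real" assume u: "continuous_on UNIV u" "\<And>x. 0 \<le> u x \<and> u x \<le> 1"
    have ub: "u \<in> borel_measurable borel" by (rule borel_measurable_continuous_onI[OF u(1)])
    have uc: "continuous_on pts u" by (rule continuous_on_subset[OF u(1)]) simp
    have fc: "continuous_on pts g" if "g \<in> smooth_maps I" for g using fun_cont[OF that, of 1] by simp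
    have ufc: "continuous_on pts (\<lambda>x. u (g x))" if "g \<in> smooth_maps I" for g by (rule continuous_on_compose2[OF u(1) fc[OF that]]) simp
    have ul: "uniform_limit pts (\<lambda>k x. u (F k x)) (\<lambda>x. u (f x)) sequentially"
    proof (rule uniform_limit_compose_uniformly_continuous_on[OF unif_F])
      show "uniformly_continuous_on pts u" by (rule compact_uniformly_continuous[OF uc compact_pts])
      show "\<forall>\<^sub>F k in sequentially. \<forall>x\<in>pts. F k x \<in> pts" using fun_pts[OF Fk(1), where n = 1] by simp
      show "closed pts" using compact_pts by (rule compact_imp_closed)
    qed
    have "(\<lambda>k. \<integral>x. u (F k x) \<partial>\<nu> k) \<longlonglongrightarrow> (\<integral>x. u (f x) \<partial>\<mu>)" by (rule conv_uniform[OF ul ufc[OF Fk(1)] ufc[OF f]])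
    moreover have "(\<integral>x. u (F k x) \<partial>\<nu> k) = (\<integral>x. u x \<partial>\<nu> k)" for k
    proof -
      interpret s: ac_system I L red lab "F k" "\<nu> k" by (rule sys)
      have "u \<in> borel_measurable (\<nu> k)" using cont_meas[OF uc] by (simp add: s.meas_mu)
      from s.expectation_iter[OF this, of 1] show ?thesis by simp
    qed
    ultimately have "(\<integral>x. u (f x) \<partial>\<mu>) = (\<integral>x. u x \<partial>\<mu>)" using conv[OF uc] by (simp add: LIMSEQ_unique)
    then show "(\<integral>x. u x \<partial>distr \<mu> borel f) = (\<integral>x. u x \<partial>distr \<mu> borel (\<lambda>x. x))"
      using integral_distr[OF fb ub] integral_distr[OF id ub] by simp
  qed (simp_all add: prob_space_distr fb id)
  then have eq: "emeasure (distr \<mu> borel f) A = emeasure (distr \<mu> borel (\<lambda>x. x)) A" for A by simp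
  show ?thesis
  proof (rule measure_eqI)
    fix A assume "A \<in> sets (distr \<mu> \<mu> f)"
    then have A: "A \<in> sets \<mu>" by simp
    then have A': "A \<in> sets borel" "A \<subseteq> pts" using pts_borel by (auto simp: sets_mu sets_restrict_space_iff)
    have "emeasure (distr \<mu> \<mu> f) A = emeasure \<mu> (f -` A \<inter> space \<mu>)" by (rule emeasure_distr[OF f_meas A])
    also have "... = emeasure (distr \<mu> borel f) A" by (rule emeasure_distr[OF fb A'(1), symmetric])
    also have "... = emeasure \<mu> ((\<lambda>x. x) -` A \<inter> space \<mu>)" unfolding eq by (rule emeasure_distr[OF id A'(1)])
    also have "(\<lambda>x. x) -` A \<inter> space \<mu> = A" using A' by (auto simp: space_mu)
    finally show "emeasure (distr \<mu> \<mu> f) A = emeasure \<mu> A" .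
  qed simp
qed

text \<open>The index 0 is left out because its neighbourhood controls only values and no
  derivative.\<close>

lemma bounds: "\<exists>\<Lambda>\<ge>0. (lbd \<Lambda> f) \<and> (\<forall>k\<ge>1. lbd \<Lambda> (F k))"
proof -
  obtain B where B: "B \<ge> 1" "dbd 1 B f" using deriv_bound[OF f] by blast
  have "abs_deriv I f x \<le> exp (ln (B + 1)) \<and> (k \<ge> 1 \<longrightarrow> abs_deriv I (F k) x \<le> exp (ln (B + 1)))" if x: "x \<in> pts" for x k
  proof -
    obtain t where t: "t \<in> {0..L}" "x = q t" and td: "t \<in> dm" by (rule pts_obtain[OF x])
    have "norm (nth_deriv 1 I (F k) t) \<le> B + 1" if "k \<ge> 1"
    proof -
      have "norm (nth_deriv 1 I (F k) t) \<le> norm (nth_deriv 1 I f t) + dist (nth_deriv 1 I f t) (nth_deriv 1 I (F k) t)"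
        by (metis add.commute dist_norm norm_minus_commute norm_triangle_sub)
      also have "... \<le> B + 1 / real (Suc k)" using B(2) Fk(2)[OF that td] td by (intro add_mono) auto
      also have "... \<le> B + 1" by simp
      finally show ?thesis .
    qed
    moreover have "norm (nth_deriv 1 I f t) \<le> B" using B(2) td by auto
    ultimately show ?thesis using B(1) unfolding t(2) absd[OF f td] absd[OF Fk(1) td] by auto
  qed
  then show ?thesis using B(1) by (intro exI[of _ "ln (B + 1)"]) auto
qed

text \<open>C depends on n and p but not on \<open>\<kappa>\<close>; this order of the quantifiers
  lets \<open>\<kappa>\<close> concentrate on a null set afterwards. The derivatives up to order n +
  1 of \<open>F k\<close> are uniformly bounded for k > n, so one \<open>eps\<close> serves all
  these maps.\<close>

lemma entropy_limit_le:
  assumes \<Lambda>: "\<Lambda> \<ge> 0" "lbd \<Lambda> f" "\<forall>k\<ge>1. lbd \<Lambda> (F k)" and n: "n \<ge> 3" and p: "p > 0"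
  shows "\<exists>C. \<forall>\<kappa>. continuous_on pts \<kappa> \<longrightarrow> (\<forall>x\<in>pts. 0 \<le> \<kappa> x \<and> \<kappa> x \<le> 1) \<longrightarrow>
    h * real p \<le> ln (10 * C1 n * (2 * cc n) powr (2 / real n)) + 2 / real n * (real p * \<Lambda>) + C * integral {0..L} (\<lambda>t. \<kappa> (q t))
      + (\<integral>x. (1 - \<kappa> x) * logp I f p x \<partial>\<mu>)"
proof -
  obtain B where B: "B \<ge> 1" "dbd (Suc n) B f" using deriv_bound[OF f] by blast
  have B1: "B + 1 \<ge> 1" using B by simp
  obtain eps0 where eps0: "eps0 > 0" "\<And>g eps. g \<in> smooth_maps I \<Longrightarrow> (dbd (Suc n) (B + 1) g) \<Longrightarrow> (lbd \<Lambda> g) \<Longrightarrow>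
     0 < eps \<Longrightarrow> eps \<le> eps0 \<Longrightarrow> iter_map dm (fit g p) n (exp (real p * \<Lambda>)) eps"
    using iter_map_fit[OF B1 \<Lambda>(1) n, of p] by blast
  define eps where "eps = min eps0 (L / 2)"
  have eps: "0 < eps" "eps \<le> eps0" "2 * eps \<le> L" using eps0(1) L by (auto simp: eps_def)
  define E where "E = exp (real p * \<Lambda>)"
  define C where "C = ln E * (12 * E / eps)"
  define a where "a = ln (10 * C1 n * (2 * cc n) powr (2 / real n)) + 2 / real n * (real p * \<Lambda>)"
  have im: "iter_map dm (fit (F k) p) n E eps" if k: "k \<ge> Suc n" for k
    unfolding E_def
  proof (rule eps0(2)[OF Fk(1) _ _ eps(1,2)])
    show "lbd \<Lambda> (F k)" using \<Lambda>(3) k by simp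
    show "dbd (Suc n) (B + 1) (F k)"
    proof (intro allI impI ballI)
      fix j t assume j: "j \<le> Suc n" and t: "t \<in> dm"
      have "norm (nth_deriv j I (F k) t) \<le> norm (nth_deriv j I f t) + dist (nth_deriv j I f t) (nth_deriv j I (F k) t)"
        by (metis add.commute dist_norm norm_minus_commute norm_triangle_sub)
      also have "... \<le> B + 1 / real (Suc k)" using B(2) Fk(2)[of j k t] j k t by (intro add_mono) auto
      also have "... \<le> B + 1" by simp
      finally show "norm (nth_deriv j I (F k) t) \<le> B + 1" .
    qed
  qed
  have \<theta>: "ln (4 * (C1 n * (2 * cc n * E) powr (2 / real n)) + 6) \<le> a"
  proof -
    interpret iter_map dm "fit (F (Suc n)) p" n E eps by (rule im) simp
    \<comment> \<open>A pure multiple of \<theta>1, whose logarithm is affine in p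
      \<Lambda>.\<close>
    have "4 * \<theta>1 + 6 \<le> 10 * \<theta>1" using \<theta>1 by simp
    then have "ln (4 * \<theta>1 + 6) \<le> ln (10 * \<theta>1)" using \<theta>1 by (intro ln_mono) auto
    also have "10 * \<theta>1 = 10 * C1 n * (2 * cc n * exp (real p * \<Lambda>)) powr (2 / real n)" unfolding \<theta>1_def by (simp add: E_def)
    also have "ln ... = a" unfolding a_def using C1_ge1 cc_ge1[of n] n by (subst ln_mult_exp_powr) auto
    finally show ?thesis unfolding \<theta>1_def .
  qed
  have "h * real p \<le> a + C * integral {0..L} (\<lambda>t. \<kappa> (q t)) + (\<integral>x. (1 - \<kappa> x) * logp I f p x \<partial>\<mu>)"
    if \<kappa>: "continuous_on pts \<kappa>" "\<forall>x\<in>pts. 0 \<le> \<kappa> x \<and> \<kappa> x \<le> 1" for \<kappa>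
  proof -
    have c: "continuous_on pts (\<lambda>x. (1 - \<kappa> x) * logp I g p x)" if "g \<in> smooth_maps I" for g
      by (intro continuous_intros \<kappa>(1) logp_cont[OF that])
    have "uniform_limit pts (\<lambda>k x. (1 - \<kappa> x) * logp I (F k) p x) (\<lambda>x. (1 - \<kappa> x) * logp I f p x) sequentially"
      by (intro uniform_lim_mult unif_logp uniform_limit_const pts_bounded logp_cont[OF f] continuous_intros \<kappa>(1))
    from conv_uniform[OF this c[OF Fk(1)] c[OF f]]
    have lim: "(\<lambda>k. a + C * integral {0..L} (\<lambda>t. \<kappa> (q t)) + (\<integral>x. (1 - \<kappa> x) * logp I (F k) p x \<partial>\<nu> k))
       \<longlonglongrightarrow> a + C * integral {0..L} (\<lambda>t. \<kappa> (q t)) + (\<integral>x. (1 - \<kappa> x) * logp I f p x \<partial>\<mu>)"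
      by (intro tendsto_add tendsto_const)
    show ?thesis
    proof (rule LIMSEQ_le_const[OF lim], intro exI allI impI)
      fix k assume k: "Suc n \<le> k"
      interpret s: ac_system I L red lab "F k" "\<nu> k" by (rule sys)
      show "h * real p \<le> a + C * integral {0..L} (\<lambda>t. \<kappa> (q t)) + (\<integral>x. (1 - \<kappa> x) * logp I (F k) p x \<partial>\<nu> k)"
        using s.averaged_entropy[OF im[OF k] eps(3) h(2) p \<kappa>(1)] \<kappa>(2) \<theta> by (auto simp: C_def mult.assoc)
    qed
  qed
  then show ?thesis unfolding a_def by blast
qed

end


section \<open>The absolutely continuous part of the limit\<close>

text \<open>Exhaustion: a countable union of null sets attains the supremum of their measures, and a
  null set charging its complement would exceed it.\<close>

lemma maximal_null_set:
  assumes M: "prob_space M" and sets: "sets N = sets M"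
  shows "\<exists>Z\<in>null_sets N. \<forall>A\<in>null_sets N. measure M (A - Z) = 0"
proof -
  interpret prob_space M by (rule M)
  have sM: "A \<in> sets M" if "A \<in> null_sets N" for A using that sets by (auto simp: null_sets_def)
  define s where "s = (SUP A\<in>null_sets N. measure M A)"
  have bdd: "bdd_above (measure M ` null_sets N)" by (intro bdd_aboveI[of _ 1]) auto
  have "\<exists>A\<in>null_sets N. measure M A > s - 1 / real (Suc k)" for k
    using less_cSUP_iff[OF _ bdd, of "s - 1 / real (Suc k)"] by (auto simp: s_def)
  then obtain A where A: "\<And>k. A k \<in> null_sets N" "\<And>k. measure M (A k) > s - 1 / real (Suc k)" by metis
  define Z where "Z = (\<Union>k. A k)"
  have Z: "Z \<in> null_sets N" unfolding Z_def using A(1) by (rule null_sets_UN)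
  have "s \<le> measure M Z"
  proof (rule field_le_epsilon)
    fix e :: real assume "e > 0"
    then obtain k where "1 / real (Suc k) < e" by (metis nat_approx_posE)
    moreover have "measure M (A k) \<le> measure M Z" unfolding Z_def using sM[OF Z] by (intro finite_measure_mono) (auto simp: Z_def)
    ultimately show "s \<le> measure M Z + e" using A(2)[of k] by linarith
  qed
  moreover have "measure M (B \<union> Z) \<le> s" if "B \<in> null_sets N" for B
    unfolding s_def using that Z by (intro cSUP_upper bdd) auto
  moreover have "measure M (B \<union> Z) = measure M Z + measure M (B - Z)" if "B \<in> null_sets N" for B
    using finite_measure_Union[of Z "B - Z"] sM[OF Z] sM[OF that] by (simp add: Un_commute)
  ultimately have "measure M (B - Z) = 0" if "B \<in> null_sets N" for B
    using that measure_nonneg[of M "B - Z"] by (smt (verit))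
  then show ?thesis using Z by blast
qed

lemma sum_log_ereal:
  assumes "jac I f n x > 0"
  shows "(\<Sum>i<n. log_ereal (abs_deriv I f ((f ^^ i) x))) = ereal (ln (jac I f n x))"
  using assms
proof (induction n)
  case (Suc n)
  have "jac I f n x > 0" "abs_deriv I f ((f ^^ n) x) > 0"
    using Suc.prems jac_nonneg[of I f n x] by (auto simp: jac_def zero_less_mult_iff abs_deriv_def)
  moreover have "jac I f (Suc n) x = jac I f n x * abs_deriv I f ((f ^^ n) x)" by (simp add: jac_def)
  ultimately show ?case using Suc.IH by (simp add: log_ereal_def ln_mult)
qed (simp add: jac_def)

context one_dim_space begin

text \<open>Exponential growth at some rate 1 / (m + 1) along infinitely many times. The countable
  form makes the set measurable, and it mentions no logarithm of zero.\<close>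

definition expanding :: "('a \<Rightarrow> 'a) \<Rightarrow> 'a set" where
  "expanding f = {x\<in>pts. \<exists>m. \<forall>N. \<exists>n\<ge>N. jac I f n x > exp (real n / real (Suc m))}"

lemma lyapunov_expanding: "x \<in> expanding f \<Longrightarrow> lyapunov I f x > 0"
proof (rule ccontr)
  assume x: "x \<in> expanding f" and "\<not> lyapunov I f x > 0"
  then obtain m where m: "\<And>N. \<exists>n\<ge>N. jac I f n x > exp (real n / real (Suc m))" by (auto simp: expanding_def)
  have "lyapunov I f x < ereal (1 / real (Suc m))"
    using \<open>\<not> lyapunov I f x > 0\<close> le_less_trans[of _ 0 "ereal (1 / real (Suc m))"] by (simp add: not_less)
  then have "\<forall>\<^sub>F n in sequentially. ereal (1 / real n) * (\<Sum>i<n. log_ereal (abs_deriv I f ((f ^^ i) x))) < ereal (1 / real (Suc m))"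
    unfolding lyapunov_def by (rule Limsup_lessD)
  then obtain N where N: "\<And>n. n \<ge> N \<Longrightarrow> ereal (1 / real n) * (\<Sum>i<n. log_ereal (abs_deriv I f ((f ^^ i) x))) < ereal (1 / real (Suc m))"
    by (auto simp: eventually_sequentially)
  obtain n where n: "n \<ge> max 1 N" "jac I f n x > exp (real n / real (Suc m))" using m by blast
  have pos: "jac I f n x > 0" using n(2) exp_gt_zero less_trans by blast
  have "ln (jac I f n x) > real n / real (Suc m)" using n(2) pos by (metis exp_less_cancel_iff exp_ln)
  moreover have "1 / real n * ln (jac I f n x) < 1 / real (Suc m)" using N[of n] n(1) sum_log_ereal[OF pos] by simp
  ultimately show False using n(1) by (simp add: field_simps)
qed

lemma expanding_invariant:
  assumes f: "f \<in> smooth_maps I" and b: "\<Lambda> \<ge> 0" "lbd \<Lambda> f" and x: "x \<in> expanding f"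
  shows "f x \<in> expanding f"
proof -
  obtain m where m: "\<And>N. \<exists>n\<ge>N. jac I f n x > exp (real n / real (Suc m))" and xp: "x \<in> pts" using x by (auto simp: expanding_def)
  define M where "M = real (Suc m)"
  have M: "M > 0" by (simp add: M_def)
  have "\<exists>n\<ge>N. jac I f n (f x) > exp (real n / real (Suc (Suc (2 * m))))" for N
  proof -
    \<comment> \<open>The first step contributes a factor at most exp \<Lambda>, which for such n is
      at most half of the exponent. So the rate 1 / (m + 1) becomes 1 / (2 m + 2).\<close>
    obtain n where n: "n \<ge> Suc N + nat \<lceil>2 * M * \<Lambda>\<rceil>" "jac I f n x > exp (real n / M)" using m unfolding M_def by blast
    obtain k where k: "n = Suc k" using n(1) by (cases n) auto
    have "2 * M * \<Lambda> \<le> real k" using n(1) k by linarith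
    then have \<Lambda>k: "\<Lambda> \<le> real k / (2 * M)" using M by (simp add: field_simps)
    have "jac I f n x = jac I f 1 x * jac I f k (f x)" using jac_add[of I f 1 k x] by (simp add: k)
    also have "... \<le> exp \<Lambda> * jac I f k (f x)" using b xp by (intro mult_right_mono jac_nonneg) (auto simp: jac_def)
    finally have "exp (real k / M) < exp \<Lambda> * jac I f k (f x)"
      using n(2) M k by (smt (verit) divide_right_mono exp_le_cancel_iff of_nat_Suc)
    then have "exp (real k / M - \<Lambda>) < jac I f k (f x)" by (simp add: exp_diff field_simps)
    moreover have "real k / (2 * M) \<le> real k / M - \<Lambda>" using \<Lambda>k M by (simp add: field_simps)
    moreover have "real (Suc (Suc (2 * m))) = 2 * M" by (simp add: M_def)
    ultimately have "exp (real k / real (Suc (Suc (2 * m)))) < jac I f k (f x)" by (metis exp_le_cancel_iff order.strict_trans1)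
    then show ?thesis using n(1) k by (intro exI[of _ k]) auto
  qed
  moreover have "f x \<in> pts" using fun_pts[OF f xp, of 1] by simp
  ultimately show ?thesis unfolding expanding_def by blast
qed

lemma logp_not_expanding: "x \<in> pts \<Longrightarrow> x \<notin> expanding f \<Longrightarrow> (\<lambda>n. logp I f n x / real n) \<longlonglongrightarrow> 0"
proof (rule tendstoI)
  fix e :: real assume x: "x \<in> pts" "x \<notin> expanding f" and "e > 0"
  then obtain m where m: "1 / real (Suc m) < e" by (metis nat_approx_posE)
  obtain N where N: "\<And>n. n \<ge> N \<Longrightarrow> jac I f n x \<le> exp (real n / real (Suc m))" using x by (auto simp: expanding_def not_less)
  have "\<forall>\<^sub>F n in sequentially. n \<ge> max 1 N" by (rule eventually_ge_at_top)
  then show "\<forall>\<^sub>F n in sequentially. dist (logp I f n x / real n) 0 < e"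
  proof eventually_elim
    case (elim n)
    have "logp I f n x \<le> ln (exp (real n / real (Suc m)))" unfolding logp_def using N[of n] elim by (intro ln_mono) auto
    then have "logp I f n x / real n \<le> 1 / real (Suc m)" using elim by (simp add: field_simps)
    then show ?case using m logp_nonneg[of I f n x] by simp
  qed
qed

lemma null_preimage: "N \<in> null_sets (leb I) \<Longrightarrow> negligible {t\<in>{0..L}. q t \<in> N}"
proof -
  assume N: "N \<in> null_sets (leb I)"
  let ?T = "{t\<in>{0..<L}. q t \<in> N}"
  have Ns: "N \<in> sets (restrict_space borel pts)" using N leb_sets by (auto simp: null_sets_def)
  have T: "?T \<in> sets borel" by (rule q_vimage_borel[OF Ns])
  have "emeasure lborel ?T = (\<integral>\<^sup>+t. indicator ?T t \<partial>lborel)" using T by simp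
  also have "... = LI (\<lambda>t. indicator N (q t))" by (intro nn_integral_cong) (auto split: split_indicator)
  also have "... = integral\<^sup>N (leb I) (indicator N)" using Ns by (intro leb_nn[symmetric]) simp
  also have "... = 0" using N by (auto simp: null_sets_def)
  finally have "?T \<in> null_sets lebesgue" using T by (intro null_sets_completionI) (auto simp: null_sets_def)
  then have "negligible (?T \<union> {L})" by (intro negligible_Un) (auto simp: negligible_iff_null_sets[symmetric])
  then show ?thesis by (rule negligible_subset) auto
qed

text \<open>The lift is differentiable, and differentiable maps of the line send null sets to null
  sets.\<close>

lemma null_map: "f \<in> smooth_maps I \<Longrightarrow> N \<in> null_sets (leb I) \<Longrightarrow> \<exists>N'\<in>null_sets (leb I). f ` N \<subseteq> N'"
proof -
  assume f: "f \<in> smooth_maps I" and N: "N \<in> null_sets (leb I)"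
  let ?T = "{t\<in>{0..L}. q t \<in> N}"
  have T: "?T \<subseteq> dm" using S(3) by auto
  have "lft f 0 differentiable_on ?T"
    unfolding differentiable_on_def differentiable_def
    using dseqD[OF dseq_subset[OF lft_dseq[OF f] T], of _ 0] by (auto simp: has_vector_derivative_def)
  then have "negligible (lft f 0 ` ?T)" by (intro negligible_differentiable_image_negligible null_preimage[OF N]) auto
  moreover have "lft f 0 ` ?T \<subseteq> dm" using lft_into[OF f] T by blast
  ultimately obtain N' where N': "N' \<in> null_sets (leb I)" "q ` lft f 0 ` ?T \<subseteq> N'" using null_image by blast
  have "f ` N \<subseteq> N'"
  proof
    fix y assume "y \<in> f ` N"
    then obtain x where x: "x \<in> N" "y = f x" by blast
    have "x \<in> pts" using x(1) N leb_sets sets.sets_into_space[of N "leb I"] sets_eq_imp_space_eq[OF leb_sets] by (auto simp: null_sets_def space_restrict_space)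
    then obtain t where t: "t \<in> {0..L}" "x = q t" and td: "t \<in> dm" by (rule pts_obtain)
    have "y = q (lft f 0 t)" using lft[OF f td] x t by simp
    then show "y \<in> N'" using N'(2) t x(1) by auto
  qed
  then show ?thesis using N' by blast
qed

end

context limit_system begin

abbreviation (input) "JG A p \<equiv> (\<integral>x. indicator A x * logp I f p x \<partial>\<mu>)"

lemma sets_leb: "sets (leb I) = sets \<mu>" by (simp add: leb_sets sets_mu)

sublocale mp_system \<mu> f
  by (intro mp_system.intro mp_system_axioms.intro prob_mu f_meas mu_invariant)

lemma cont_mu: "continuous_on pts u \<Longrightarrow> (u :: 'a \<Rightarrow> real) \<in> borel_measurable \<mu>"
  using cont_meas meas_mu by blast

lemma logp_mu [measurable]: "logp I f p \<in> borel_measurable \<mu>" by (rule cont_mu[OF logp_cont[OF f]])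

lemma jac_mu [measurable]: "jac I f p \<in> borel_measurable \<mu>" by (rule cont_mu[OF jac_cont[OF f]])

lemma expanding_mu [measurable]: "expanding f \<in> sets \<mu>"
  unfolding expanding_def space_mu[symmetric] by measurable

text \<open>Up to measure 0 the set is contained in its preimage, and both have the same
  measure.\<close>

lemma invariant_mod_null:
  assumes A: "A \<in> sets \<mu>" and sub: "AE x in \<mu>. x \<in> A \<longrightarrow> f x \<in> A"
  shows "AE x in \<mu>. f x \<in> A \<longleftrightarrow> x \<in> A"
proof -
  let ?P = "f -` A \<inter> space \<mu>"
  have P: "?P \<in> sets \<mu>" using f_meas A by (rule measurable_sets)
  have eqm: "measure \<mu> ?P = measure \<mu> A" using measure_distr[OF f_meas A] mu_invariant by simp
  have "measure \<mu> (?P \<inter> A) = measure \<mu> A"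
    using sub A P sets.sets_into_space[OF A] by (intro finite_measure_eq_AE) auto
  then have "measure \<mu> (?P - A) = 0" using finite_measure_Diff'[OF P A] eqm by simp
  then have "AE x in \<mu>. x \<notin> ?P - A" using A P by (intro AE_not_in) (auto simp: null_sets_def emeasure_eq_measure)
  with sub AE_space show ?thesis by eventually_elim auto
qed

lemma AE_f_notin: "measure \<mu> A = 0 \<Longrightarrow> A \<in> sets \<mu> \<Longrightarrow> AE x in \<mu>. f x \<notin> A"
proof -
  assume A: "measure \<mu> A = 0" "A \<in> sets \<mu>"
  have "measure \<mu> (f -` A \<inter> space \<mu>) = 0" using measure_distr[OF f_meas A(2)] mu_invariant A(1) by simp
  then have "AE x in \<mu>. x \<notin> f -` A \<inter> space \<mu>"
    using measurable_sets[OF f_meas A(2)] by (intro AE_not_in) (auto simp: null_sets_def emeasure_eq_measure)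
  with AE_space show ?thesis by eventually_elim auto
qed

text \<open>f maps Z into a null set, which by maximality lies in Z up to \<mu>-measure 0; so Z is
  invariant modulo \<mu>. The point \<open>q 0\<close> is included so that compact subsets of Z can
  be taken nonempty, as distance functions require.\<close>

lemma null_part:
  "\<exists>Z\<in>null_sets (leb I). q 0 \<in> Z \<and> (\<forall>A\<in>null_sets (leb I). measure \<mu> (A - Z) = 0) \<and> (AE x in \<mu>. f x \<in> Z \<longleftrightarrow> x \<in> Z)"
proof -
  obtain Z0 where Z0: "Z0 \<in> null_sets (leb I)" "\<And>A. A \<in> null_sets (leb I) \<Longrightarrow> measure \<mu> (A - Z0) = 0"
    using maximal_null_set[OF prob_mu sets_leb] by blast
  have "{0} \<subseteq> dm" using S(3) L by auto
  from null_image[OF this] obtain W where W: "W \<in> null_sets (leb I)" "q 0 \<in> W" by auto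
  define Z where "Z = Z0 \<union> W"
  have Z: "Z \<in> null_sets (leb I)" "q 0 \<in> Z" using Z0 W by (auto simp: Z_def)
  have s: "A \<in> sets \<mu>" if "A \<in> null_sets (leb I)" for A using that sets_leb by (auto simp: null_sets_def)
  have max: "measure \<mu> (A - Z) = 0" if "A \<in> null_sets (leb I)" for A
  proof -
    have "measure \<mu> (A - Z) \<le> measure \<mu> (A - Z0)" using s[OF that] s[OF Z0(1)] by (intro finite_measure_mono) (auto simp: Z_def)
    then show ?thesis using Z0(2)[OF that] measure_nonneg[of \<mu> "A - Z"] by linarith
  qed
  obtain Z1 where Z1: "Z1 \<in> null_sets (leb I)" "f ` Z \<subseteq> Z1" using null_map[OF f Z(1)] by blast
  have "AE x in \<mu>. f x \<notin> Z1 - Z" using AE_f_notin[OF max[OF Z1(1)]] s Z Z1 by blast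
  then have "AE x in \<mu>. x \<in> Z \<longrightarrow> f x \<in> Z" by eventually_elim (use Z1 in auto)
  then show ?thesis using Z max invariant_mod_null[OF s[OF Z(1)]] by blast
qed

lemma inner_approx:
  assumes Z: "Z \<in> sets \<mu>" and e: "e > 0"
  shows "\<exists>K\<subseteq>Z. compact K \<and> measure \<mu> (Z - K) \<le> e"
proof (cases "measure \<mu> Z \<le> e")
  case False
  have id: "(\<lambda>x. x) \<in> borel_measurable \<mu>" using cont_meas[of "\<lambda>x. x"] by (simp add: meas_mu)
  define M where "M = distr \<mu> borel (\<lambda>x. x)"
  interpret M: prob_space M unfolding M_def by (rule prob_space_distr[OF id])
  have b: "A \<in> sets borel" "A \<subseteq> pts" if "A \<in> sets \<mu>" for A using that pts_borel by (auto simp: sets_mu sets_restrict_space_iff)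
  have M: "measure M A = measure \<mu> A" if "A \<in> sets \<mu>" for A
    using measure_distr[OF id b(1)[OF that]] b(2)[OF that] that by (simp add: M_def space_mu Int_absorb2)
  have "ennreal (measure \<mu> Z - e) < ennreal (measure \<mu> Z)" using False e by (simp add: ennreal_less_iff)
  also have "... = emeasure M Z" using M[OF Z] by (simp add: M.emeasure_eq_measure)
  also have "... = (SUP K \<in> {K. K \<subseteq> Z \<and> compact K}. emeasure M K)"
    by (rule inner_regular) (use M.emeasure_finite b(1)[OF Z] in \<open>simp_all add: M_def\<close>)
  finally obtain K where K: "K \<subseteq> Z" "compact K" "ennreal (measure \<mu> Z - e) < emeasure M K" by (auto simp: less_SUP_iff)
  have Ks: "K \<in> sets \<mu>" using K(1,2) b(2)[OF Z] pts_borel by (auto simp: sets_mu sets_restrict_space_iff borel_compact)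
  have "measure \<mu> Z - e < measure \<mu> K" using K(3) M[OF Ks] False by (simp add: M.emeasure_eq_measure ennreal_less_iff)
  then show ?thesis using K finite_measure_Diff[OF Z Ks K(1)] by (intro exI[of _ K]) auto
qed (use Z in \<open>intro exI[of _ "{}"], simp\<close>)

lemma logp_integrable: "integrable \<mu> (\<lambda>x. indicator A x * logp I f p x)" if "A \<in> sets \<mu>"
proof -
  obtain B where "\<And>x. x \<in> pts \<Longrightarrow> norm (logp I f p x) \<le> B" using pts_bounded[OF logp_cont[OF f], of p] unfolding bounded_iff by blast
  then show ?thesis using that
    by (intro integrable_const_bound[of _ "\<bar>B\<bar>"]) (force simp: space_mu split: split_indicator intro!: AE_I2)+
qed

text \<open>At fixed p, \<open>\<kappa>\<close> runs through tents around a compact K inside Z. The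
  Lebesgue term tends to 0, since K is null, while in the \<mu>-integral exactly K is removed. By
  inner regularity K can be almost all of Z.\<close>

lemma growth_off_null:
  assumes Z: "Z \<in> null_sets (leb I)" "q 0 \<in> Z" and \<Lambda>: "\<Lambda> \<ge> 0" "lbd \<Lambda> f" "\<forall>k\<ge>1. lbd \<Lambda> (F k)"
    and n: "n \<ge> 3" and p: "p > 0"
  shows "h * real p \<le> ln (10 * C1 n * (2 * cc n) powr (2 / real n)) + 2 / real n * (real p * \<Lambda>) + JG (pts - Z) p"
proof (rule field_le_epsilon)
  fix e :: real assume e: "e > 0"
  define a where "a = ln (10 * C1 n * (2 * cc n) powr (2 / real n)) + 2 / real n * (real p * \<Lambda>)"
  obtain C where C: "\<And>\<kappa>. continuous_on pts \<kappa> \<Longrightarrow> (\<forall>x\<in>pts. 0 \<le> \<kappa> x \<and> \<kappa> x \<le> 1) \<Longrightarrow>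
    h * real p \<le> a + C * integral {0..L} (\<lambda>t. \<kappa> (q t)) + (\<integral>x. (1 - \<kappa> x) * logp I f p x \<partial>\<mu>)"
    using entropy_limit_le[OF \<Lambda> n p] unfolding a_def by blast
  have Zs: "Z \<in> sets \<mu>" using Z(1) sets_leb by (auto simp: null_sets_def)
  have ptss: "pts \<in> sets \<mu>" using sets.top[of \<mu>] by (simp add: space_mu)
  \<comment> \<open>The \<mu>-measure that K may miss, so small that the bound p \<Lambda> on the
    logarithm makes the loss at most e. The + 1 covers \<Lambda> = 0.\<close>
  define d where "d = e / (real p * \<Lambda> + 1)"
  have d: "d > 0" "real p * \<Lambda> * d \<le> e" 
  proof -
    have D: "real p * \<Lambda> \<ge> 0" using \<Lambda>(1) by simp
    then show "d > 0" unfolding d_def using e by (intro divide_pos_pos) auto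
    have "d * (real p * \<Lambda> + 1) = e" unfolding d_def using D by simp
    with \<open>d > 0\<close> show "real p * \<Lambda> * d \<le> e" by (simp add: algebra_simps)
  qed
  obtain K0 where K0: "K0 \<subseteq> Z" "compact K0" "measure \<mu> (Z - K0) \<le> d" using inner_approx[OF Zs d(1)] by blast
  define K where "K = insert (q 0) K0"
  have Zp: "Z \<subseteq> pts" using sets.sets_into_space[OF Zs] by (simp add: space_mu)
  have K: "K \<subseteq> Z" "compact K" "K \<noteq> {}" "closed K" using K0 Z(2) by (auto simp: K_def intro: compact_imp_closed)
  have Ks: "K \<in> sets \<mu>" using K Zp pts_borel by (auto simp: sets_mu sets_restrict_space_iff borel_compact)
  have "measure \<mu> (Z - K) \<le> measure \<mu> (Z - K0)"
  proof (rule finite_measure_mono)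
    have "K0 \<in> sets \<mu>" using K0 Zp pts_borel by (auto simp: sets_mu sets_restrict_space_iff borel_compact)
    then show "Z - K0 \<in> sets \<mu>" using Zs by blast
  qed (auto simp: K_def)
  then have mK: "measure \<mu> (Z - K) \<le> d" using K0(3) by linarith
  define \<kappa> where "\<kappa> = (\<lambda>k x. max 0 (1 - real k * infdist x K))"
  have \<kappa>c: "continuous_on A (\<kappa> k)" for k A unfolding \<kappa>_def by (intro continuous_intros)
  have \<kappa>01: "0 \<le> \<kappa> k x" "\<kappa> k x \<le> 1" for k x by (auto simp: \<kappa>_def infdist_nonneg)
  have \<kappa>l: "(\<lambda>k. \<kappa> k x) \<longlonglongrightarrow> indicator K x" for x unfolding \<kappa>_def by (rule infdist_approx[OF K(4,3)])
  have "(\<lambda>k. integral {0..L} (\<lambda>t. \<kappa> k (q t))) \<longlonglongrightarrow> integral {0..L} (\<lambda>t. indicator K (q t))"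
  proof (rule dominated_convergence(2)[where h = "\<lambda>_. 1"])
    show "(\<lambda>t. \<kappa> k (q t)) integrable_on {0..L}" for k
      by (intro integrable_continuous_real continuous_on_compose2[OF \<kappa>c[of UNIV] continuous_on_subset[OF q_cont S(3)]]) auto
  qed (use \<kappa>01 \<kappa>l in auto)
  also have "integral {0..L} (\<lambda>t. indicator K (q t) :: real) = 0"
    by (rule integral_unique[OF has_integral_spike[OF null_preimage[OF Z(1)] _ has_integral_0]]) (use K(1) in \<open>auto simp: indicator_def\<close>)
  finally have l1: "(\<lambda>k. integral {0..L} (\<lambda>t. \<kappa> k (q t))) \<longlonglongrightarrow> 0" .
  have lb: "0 \<le> logp I f p x \<and> logp I f p x \<le> real p * \<Lambda>" if "x \<in> pts" for x
    using logp_nonneg logp_le[OF f _ \<Lambda>(1) that] \<Lambda>(2) by blast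
  have [measurable]: "\<kappa> k \<in> borel_measurable \<mu>" for k by (rule cont_mu[OF \<kappa>c])
  have l2: "(\<lambda>k. \<integral>x. (1 - \<kappa> k x) * logp I f p x \<partial>\<mu>) \<longlonglongrightarrow> (\<integral>x. (1 - indicator K x) * logp I f p x \<partial>\<mu>)"
  proof (rule integral_dominated_convergence[where w = "\<lambda>_. real p * \<Lambda>"])
    show "(\<lambda>x. (1 - indicator K x) * logp I f p x) \<in> borel_measurable \<mu>" using Ks by measurable
    show "AE x in \<mu>. (\<lambda>k. (1 - \<kappa> k x) * logp I f p x) \<longlonglongrightarrow> (1 - indicator K x) * logp I f p x"
      by (intro AE_I2 tendsto_intros \<kappa>l)
    show "AE x in \<mu>. norm ((1 - \<kappa> k x) * logp I f p x) \<le> real p * \<Lambda>" for k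
    proof (rule AE_I2)
      fix x assume "x \<in> space \<mu>"
      then show "norm ((1 - \<kappa> k x) * logp I f p x) \<le> real p * \<Lambda>"
        using lb[of x] \<kappa>01[of k x] mult_mono[of "1 - \<kappa> k x" 1 "logp I f p x" "real p * \<Lambda>"] by (simp add: space_mu abs_mult)
    qed
  qed measurable
  have "(\<lambda>k. a + C * integral {0..L} (\<lambda>t. \<kappa> k (q t)) + (\<integral>x. (1 - \<kappa> k x) * logp I f p x \<partial>\<mu>)) \<longlonglongrightarrow> a + C * 0 + (\<integral>x. (1 - indicator K x) * logp I f p x \<partial>\<mu>)"
    by (intro tendsto_intros l1 l2)
  from LIMSEQ_le_const[OF this] have 1: "h * real p \<le> a + C * 0 + (\<integral>x. (1 - indicator K x) * logp I f p x \<partial>\<mu>)"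
    using C[OF \<kappa>c] \<kappa>01 by blast
  have "(\<integral>x. (1 - indicator K x) * logp I f p x \<partial>\<mu>) = JG (pts - K) p"
    using K(1) Zp by (intro Bochner_Integration.integral_cong) (auto simp: space_mu split: split_indicator)
  also have "... \<le> (\<integral>x. indicator (pts - Z) x * logp I f p x + real p * \<Lambda> * indicator (Z - K) x \<partial>\<mu>)"
    using lb K Zs Ks ptss by (intro integral_mono Bochner_Integration.integrable_add logp_integrable) (auto simp: space_mu emeasure_eq_measure split: split_indicator)
  also have "... = JG (pts - Z) p + real p * \<Lambda> * measure \<mu> (Z - K)"
  proof -
    have "Z - K \<subseteq> space \<mu>" using Zp by (auto simp: space_mu)
    then show ?thesis using logp_integrable[of "pts - Z"] Zs Ks ptss by (subst Bochner_Integration.integral_add) (auto simp: emeasure_eq_measure Int_absorb2)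
  qed
  also have "real p * \<Lambda> * measure \<mu> (Z - K) \<le> e" using mult_left_mono[OF mK, of "real p * \<Lambda>"] \<Lambda>(1) d(2) by simp
  finally show "h * real p \<le> ln (10 * C1 n * (2 * cc n) powr (2 / real n)) + 2 / real n * (real p * \<Lambda>) + JG (pts - Z) p + e"
    using 1 by (simp add: a_def)
qed

end


section \<open>Construction of the SRB measure\<close>

context limit_system begin

text \<open>Outside \<open>expanding f\<close> the logarithm divided by p tends to 0 and is bounded
  by \<Lambda>, so dominated convergence makes its share small. The loss d is split evenly among
  this share, the constant D and the term with 2/n.\<close>

lemma growth_expanding:
  assumes Z: "Z \<in> null_sets (leb I)" "q 0 \<in> Z" and d: "d > 0"
  shows "\<exists>p0. \<forall>p\<ge>p0. (h - d) * real p \<le> JG (expanding f - Z) p"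
proof -
  obtain \<Lambda> where \<Lambda>: "\<Lambda> \<ge> 0" "lbd \<Lambda> f" "\<forall>k\<ge>1. lbd \<Lambda> (F k)" using bounds by blast
  have Zs: "Z \<in> sets \<mu>" using Z(1) sets_leb by (auto simp: null_sets_def)
  have ptss: "pts \<in> sets \<mu>" using sets.top[of \<mu>] by (simp add: space_mu)
  note X = expanding_mu
  have Xp: "expanding f \<subseteq> pts" by (auto simp: expanding_def)
  define n where "n = max 3 (nat \<lceil>6 * \<Lambda> / d\<rceil> + 1)"
  have n: "n \<ge> 3" by (simp add: n_def)
  have "6 * \<Lambda> / d \<le> real n" unfolding n_def by linarith
  then have n\<Lambda>: "2 / real n * \<Lambda> \<le> d / 3" using d n by (simp add: field_simps)
  define D where "D = ln (10 * C1 n * (2 * cc n) powr (2 / real n))"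
  have lb: "0 \<le> logp I f p x \<and> logp I f p x \<le> real p * \<Lambda>" if "x \<in> pts" for x p
    using logp_nonneg logp_le[OF f _ \<Lambda>(1) that] \<Lambda>(2) by blast
  have "(\<lambda>p. \<integral>x. indicator (pts - expanding f) x * (logp I f p x / real p) \<partial>\<mu>) \<longlonglongrightarrow> (\<integral>x. 0 \<partial>\<mu>)"
  proof (rule integral_dominated_convergence[where w = "\<lambda>_. \<Lambda>"])
    show "(\<lambda>x. indicator (pts - expanding f) x * (logp I f p x / real p)) \<in> borel_measurable \<mu>" for p using X ptss by measurable
    show "AE x in \<mu>. (\<lambda>p. indicator (pts - expanding f) x * (logp I f p x / real p)) \<longlonglongrightarrow> 0"
      using logp_not_expanding by (intro AE_I2) (auto simp: space_mu split: split_indicator)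
    show "AE x in \<mu>. norm (indicator (pts - expanding f) x * (logp I f p x / real p)) \<le> \<Lambda>" for p
      using lb \<Lambda>(1) by (intro AE_I2) (auto simp: space_mu divide_le_eq mult.commute split: split_indicator)
  qed auto
  then have "\<forall>\<^sub>F p in sequentially. (\<integral>x. indicator (pts - expanding f) x * (logp I f p x / real p) \<partial>\<mu>) < d / 3"
    using d by (intro order_tendstoD(2)) auto
  then obtain p1 where p1: "\<And>p. p \<ge> p1 \<Longrightarrow> (\<integral>x. indicator (pts - expanding f) x * (logp I f p x / real p) \<partial>\<mu>) < d / 3"
    by (auto simp: eventually_sequentially)
  have "(h - d) * real p \<le> JG (expanding f - Z) p" if p: "p \<ge> p1 + nat \<lceil>3 * \<bar>D\<bar> / d\<rceil> + 1" for p
  proof -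
    have p0: "p > 0" "p \<ge> p1" using p by auto
    have "3 * \<bar>D\<bar> / d \<le> real p" using p by linarith
    then have pD: "D \<le> real p * (d / 3)" using d by (simp add: field_simps)
    have off: "JG (pts - expanding f) p \<le> real p * (d / 3)"
    proof -
      have "(\<integral>x. indicator (pts - expanding f) x * (logp I f p x / real p) \<partial>\<mu>) = JG (pts - expanding f) p / real p" by simp
      then show ?thesis using p1[OF p0(2)] p0(1) by (simp add: field_simps)
    qed
    have "h * real p \<le> D + 2 / real n * (real p * \<Lambda>) + JG (pts - Z) p"
      unfolding D_def by (rule growth_off_null[OF Z \<Lambda> n p0(1)])
    also have "JG (pts - Z) p \<le> (\<integral>x. indicator (expanding f - Z) x * logp I f p x + indicator (pts - expanding f) x * logp I f p x \<partial>\<mu>)"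
      using lb Zs ptss X by (intro integral_mono Bochner_Integration.integrable_add logp_integrable) (auto simp: space_mu split: split_indicator)
    also have "... = JG (expanding f - Z) p + JG (pts - expanding f) p"
      using Zs ptss X by (intro Bochner_Integration.integral_add logp_integrable) auto
    also note off
    also have "2 / real n * (real p * \<Lambda>) = real p * (2 / real n * \<Lambda>)" by simp
    also note pD
    also have "real p * (2 / real n * \<Lambda>) \<le> real p * (d / 3)" using n\<Lambda> by (intro mult_left_mono) auto
    finally show ?thesis by (simp add: algebra_simps)
  qed
  then show ?thesis by blast
qed

lemma SRB_limit: "\<exists>\<nu>'. SRB I f \<nu>' \<and> metric_entropy \<nu>' f \<ge> ereal h"
proof -
  obtain \<Lambda> where \<Lambda>: "\<Lambda> \<ge> 0" "lbd \<Lambda> f" using bounds by blast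
  obtain Z where Z: "Z \<in> null_sets (leb I)" "q 0 \<in> Z" "\<And>A. A \<in> null_sets (leb I) \<Longrightarrow> measure \<mu> (A - Z) = 0" "AE x in \<mu>. f x \<in> Z \<longleftrightarrow> x \<in> Z"
    using null_part by blast
  have Zs: "Z \<in> sets \<mu>" using Z(1) sets_leb by (auto simp: null_sets_def)
  define G where "G = expanding f - Z"
  have G [measurable]: "G \<in> sets \<mu>" unfolding G_def using expanding_mu Zs by blast
  have AEG: "AE x in \<mu>. f x \<in> G \<longleftrightarrow> x \<in> G"
  proof -
    have "AE x in \<mu>. f x \<in> expanding f \<longleftrightarrow> x \<in> expanding f"
      using expanding_invariant[OF f \<Lambda>] by (intro invariant_mod_null[OF expanding_mu]) auto
    with Z(4) show ?thesis by eventually_elim (auto simp: G_def)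
  qed
  have lG: "JG G p \<le> real p * \<Lambda> * measure \<mu> G" for p
  proof -
    have "JG G p \<le> (\<integral>x. real p * \<Lambda> * indicator G x \<partial>\<mu>)"
      using logp_le[OF f _ \<Lambda>(1)] \<Lambda>(2) by (intro integral_mono logp_integrable G) (auto simp: space_mu emeasure_eq_measure split: split_indicator)
    then show ?thesis using sets.sets_into_space[OF G] by (simp add: Int_absorb2)
  qed
  have growth: "\<exists>p0. \<forall>p\<ge>p0. (h - d) * real p \<le> JG G p" if "d > 0" for d
    unfolding G_def by (rule growth_expanding[OF Z(1,2) that])
  \<comment> \<open>The integral over a null set is 0 and cannot grow at the rate h / 2; here h > 0
    enters.\<close>
  have mG: "measure \<mu> G > 0"
  proof (rule ccontr)
    assume "\<not> 0 < measure \<mu> G"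
    then have 0: "measure \<mu> G = 0" using measure_nonneg[of \<mu> G] by linarith
    obtain p0 where p0: "\<And>p. p \<ge> p0 \<Longrightarrow> (h - h / 2) * real p \<le> JG G p"
      using growth[of "h / 2"] h(1) by auto
    have "(h - h / 2) * real (Suc p0) \<le> 0" using order.trans[OF p0[of "Suc p0"] lG[of "Suc p0"]] 0 by simp
    then show False using h(1) by (simp add: mult_le_0_iff)
  qed
  have eG: "emeasure \<mu> G \<noteq> 0" "emeasure \<mu> G \<noteq> \<infinity>" using mG by (auto simp: emeasure_eq_measure)
  define \<nu>' where "\<nu>' = uniform_measure \<mu> G"
  have s': "sets \<nu>' = sets \<mu>" by (simp add: \<nu>'_def)
  have prob': "prob_space \<nu>'" unfolding \<nu>'_def by (rule prob_space_uniform_measure[OF eG])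
  have fm: "f \<in> measurable \<nu>' \<nu>'" using f_meas by (simp add: s' cong: measurable_cong_sets)
  have "distr \<nu>' \<nu>' f = \<nu>'"
  proof (rule measure_eqI)
    fix A assume "A \<in> sets (distr \<nu>' \<nu>' f)"
    then have A: "A \<in> sets \<mu>" "A \<in> sets \<nu>'" by (simp_all add: s')
    note P = measurable_sets[OF f_meas A(1)] and P2 = measurable_sets[OF f_meas sets.Int[OF G A(1)]]
    have "emeasure \<mu> (G \<inter> (f -` A \<inter> space \<mu>)) = emeasure \<mu> (f -` (G \<inter> A) \<inter> space \<mu>)"
      using AEG P P2 sets.sets_into_space[OF G] by (intro emeasure_eq_AE) auto
    also have "... = emeasure \<mu> (G \<inter> A)" using emeasure_distr[OF f_meas sets.Int[OF G A(1)]] mu_invariant by simp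
    finally have "emeasure \<mu> (G \<inter> (f -` A \<inter> space \<mu>)) = emeasure \<mu> (G \<inter> A)" .
    then show "emeasure (distr \<nu>' \<nu>' f) A = emeasure \<nu>' A"
      using emeasure_distr[OF fm A(2)] P A by (simp add: \<nu>'_def G)
  qed simp
  then have inv: "invariant_prob I f \<nu>'" using prob' fm by (simp add: invariant_prob_def s' sets_mu)
  have ac: "absolutely_continuous (leb I) \<nu>'"
    unfolding absolutely_continuous_def
  proof
    fix A assume A: "A \<in> null_sets (leb I)"
    then have As: "A \<in> sets \<mu>" using sets_leb by (auto simp: null_sets_def)
    \<comment> \<open>G avoids Z, and by maximality of Z a Lebesgue null set has no \<mu>-mass
      outside Z.\<close>
    have "measure \<mu> (G \<inter> A) \<le> measure \<mu> (A - Z)" using As Zs by (intro finite_measure_mono) (auto simp: G_def)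
    then have "emeasure \<mu> (G \<inter> A) = 0" using Z(3)[OF A] measure_nonneg[of \<mu> "G \<inter> A"] by (simp add: emeasure_eq_measure)
    then show "A \<in> null_sets \<nu>'" using As G by (simp add: null_sets_def s' \<nu>'_def)
  qed
  have "hyperbolic I f \<nu>'"
    unfolding hyperbolic_def \<nu>'_def using lyapunov_expanding by (intro AE_uniform_measureI G AE_I2) (auto simp: G_def)
  with inv ac have SRB: "SRB I f \<nu>'" by (simp add: SRB_def)
  interpret s: ac_system I L red lab f \<nu>'
    by (intro ac_system.intro ac_system_axioms.intro one_dim_space_axioms f inv ac)
  have ex: "s.expectation (logp I f p) = JG G p / measure \<mu> G" for p
  proof -
    have nn: "JG G p \<ge> 0" by (intro Bochner_Integration.integral_nonneg) (simp add: logp_nonneg)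
    have "ennreal (s.expectation (logp I f p)) = (\<integral>\<^sup>+x. ennreal (logp I f p x) \<partial>\<nu>')"
      using s.logp_int by (subst nn_integral_eq_integral) (auto simp: logp_nonneg)
    also have "... = (\<integral>\<^sup>+x. ennreal (logp I f p x) * indicator G x \<partial>\<mu>) / emeasure \<mu> G"
      unfolding \<nu>'_def using G by (intro nn_integral_uniform_measure) measurable
    also have "(\<integral>\<^sup>+x. ennreal (logp I f p x) * indicator G x \<partial>\<mu>) = (\<integral>\<^sup>+x. ennreal (indicator G x * logp I f p x) \<partial>\<mu>)"
      by (intro nn_integral_cong) (auto split: split_indicator)
    also have "... = ennreal (JG G p)"
      using logp_integrable[OF G] by (intro nn_integral_eq_integral) (auto simp: logp_nonneg)
    also have "... / emeasure \<mu> G = ennreal (JG G p / measure \<mu> G)"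
      using nn mG by (simp add: emeasure_eq_measure divide_ennreal)
    finally show ?thesis using nn mG by (subst (asm) ennreal_inj) (auto intro!: Bochner_Integration.integral_nonneg logp_nonneg)
  qed
  have "ereal (h - d) \<le> metric_entropy \<nu>' f" if d: "0 < d" "d < h" for d
  proof -
    obtain p0 where p0: "\<And>p. p \<ge> p0 \<Longrightarrow> (h - d) * real p \<le> JG G p" using growth[OF d(1)] by blast
    show ?thesis
    proof (rule s.entropy_ge_growth)
      fix p assume "p0 \<le> p"
      \<comment> \<open>Normalisation divides the integral by \<mu> G \<le> 1; as h - d > 0, the
        lower bound for the rate survives.\<close>
      have "(h - d) * real p * measure \<mu> G \<le> (h - d) * real p * 1" using d by (intro mult_left_mono) auto
      also have "... \<le> JG G p" using p0[OF \<open>p0 \<le> p\<close>] by simp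
      finally show "(h - d) * real p \<le> s.expectation (logp I f p)" unfolding ex using mG by (simp add: pos_le_divide_eq)
    qed
  qed note low = this
  have "ereal h \<le> metric_entropy \<nu>' f"
  proof (rule ereal_le_epsilon2)
    fix e :: real assume e: "e > 0"
    define d where "d = min e (h / 2)"
    have d: "0 < d" "d < h" "d \<le> e" using e h(1) by (auto simp: d_def)
    have "ereal (h - d) + ereal d \<le> metric_entropy \<nu>' f + ereal e"
      using d by (intro add_mono low) auto
    then show "ereal h \<le> metric_entropy \<nu>' f + ereal e" by simp
  qed
  then show ?thesis using SRB by blast
qed

end

lemma (in approx_system) SRB_limit: "\<exists>\<mu>. SRB I f \<mu> \<and> metric_entropy \<mu> f \<ge> ereal h"
proof -
  obtain r \<mu> where r: "strict_mono (r :: nat \<Rightarrow> nat)" and \<mu>: "prob_space \<mu>" "sets \<mu> = sets (restrict_space borel pts)"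
    "\<And>u::'a \<Rightarrow> real. continuous_on pts u \<Longrightarrow> (\<lambda>k. \<integral>x. u x \<partial>\<nu> (r k)) \<longlonglongrightarrow> (\<integral>x. u x \<partial>\<mu>)"
    using limit_measure by blast
  interpret limit_system I L red lab f "\<lambda>k. F (r k)" "\<lambda>k. \<nu> (r k)" h \<mu>
  proof (intro limit_system.intro approx_system.intro approx_system_axioms.intro limit_system_axioms.intro one_dim_space_axioms f sys h \<mu>)
    fix k
    have k: "k \<le> r k" by (rule seq_suble[OF r])
    \<comment> \<open>A subsequence lies in the prescribed shrinking neighbourhoods again, because r
      k \<ge> k and these neighbourhoods are nested.\<close>
    have "smooth_nbhd I (r k) (1 / real (Suc (r k))) f \<subseteq> smooth_nbhd I k (1 / real (Suc k)) f"
      using k by (intro smooth_nbhd_mono) (auto simp: frac_le)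
    then show "F (r k) \<in> smooth_nbhd I k (1 / real (Suc k)) f" using F by blast
  qed
  show ?thesis by (rule SRB_limit)
qed

text \<open>The neighbourhoods of order k and radius 1 / (k + 1) form a countable base at f. If the
  complement were not open at f, each of them would contain a map of the set, and the limit of their
  measures would put f itself into the set.\<close>

lemma (in one_dim_space) closedin_SRB_entropy:
  assumes h: "h > 0"
  shows "closedin (smooth_topology I) {f \<in> smooth_maps I. \<exists>\<mu>. SRB I f \<mu> \<and> metric_entropy \<mu> f \<ge> ereal h}" (is "closedin _ ?A")
proof -
  have "\<exists>k. \<exists>e>0. smooth_nbhd I k e f \<subseteq> smooth_maps I - ?A" if fA: "f \<in> smooth_maps I - ?A" for f
  proof (rule ccontr)
    assume neg: "\<not> ?thesis"
    have "\<exists>g \<mu>. g \<in> smooth_nbhd I k (1 / real (Suc k)) f \<and> SRB I g \<mu> \<and> metric_entropy \<mu> g \<ge> ereal h" for k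
    proof -
      have "1 / real (Suc k) > 0" by simp
      then have "\<not> smooth_nbhd I k (1 / real (Suc k)) f \<subseteq> smooth_maps I - ?A" using neg by blast
      then show ?thesis by (auto simp: smooth_nbhd_def)
    qed
    then obtain F \<nu> where F: "\<And>k. F k \<in> smooth_nbhd I k (1 / real (Suc k)) f" "\<And>k. SRB I (F k) (\<nu> k)" "\<And>k. metric_entropy (\<nu> k) (F k) \<ge> ereal h"
      by metis
    have "ac_system I L red lab (F k) (\<nu> k)" for k
      using F(1,2)[of k] by (intro ac_system.intro ac_system_axioms.intro one_dim_space_axioms) (auto simp: smooth_nbhd_def SRB_def)
    then interpret approx_system I L red lab f F \<nu> h
      using fA h F by (intro approx_system.intro approx_system_axioms.intro one_dim_space_axioms) auto
    show False using SRB_limit fA by blast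
  qed
  then have "openin (smooth_topology I) (smooth_maps I - ?A)" unfolding openin_smooth_topology by blast
  then show ?thesis by (auto simp: closedin_def)
qed

theorem corollary1p12:
  fixes h :: real
  assumes "h > 0"
  shows "closedin (smooth_topology unit_interval)
           {f \<in> smooth_maps unit_interval.
              \<exists>\<mu>. SRB unit_interval f \<mu> \<and> metric_entropy \<mu> f \<ge> ereal h} \<and>
         closedin (smooth_topology circle)
           {f \<in> smooth_maps circle.
              \<exists>\<mu>. SRB circle f \<mu> \<and> metric_entropy \<mu> f \<ge> ereal h}"
  using one_dim_space.closedin_SRB_entropy[OF one_dim_space_interval assms]
    one_dim_space.closedin_SRB_entropy[OF one_dim_space_circle assms] by blast


end
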